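(* Assume (a) and (b). Then: (i) for every $\eta>0$, $\lim_{t\to\infty}\mathbb P\big(|X_t-b_{\ell_t}|\le\eta\log t\big)=1$; (ii) for every $\delta>0$, $\lim_{t\to\infty}P\big(d_{TV}(\ell_t,\ \ell^{(\mathbf e)}_{t,\omega}+1)>\delta\big)=0$, where $d_{TV}$ is the total variation distance between the law of $\ell_t$ under $P_\omega$ and the law of $\ell^{(\mathbf e)}_{t,\omega}+1$ under $P^{(\mathbf e)}$ (both for fixed $\omega$).
   Context: Let $\omega=(\omega_i)_{i\in\mathbb Z}$ be i.i.d. random variables with values in $(0,1)$, with law $P$ and expectation $E$, and put $\rho_i=(1-\omega_i)/\omega_i$. Assumptions: (a) there is $\kappa\in(0,1)$ with $E[\rho_0^\kappa]=1$ and $E[\rho_0^\kappa\log^+\rho_0]<\infty$; (b) the law of $\log\rho_0$ is non-lattice. Given $\omega$, $(X_n)_{n\ge0}$ is the Markov chain on $\mathbb Z$ with $X_0=0$, $P_\omega(X_{n+1}=x+1\mid X_n=x)=\omega_x$, $P_\omega(X_{n+1}=x-1\mid X_n=x)=1-\omega_x$ (quenched law $P_\omega$); $\mathbb P$ is the annealed joint law of $(\omega,X)$. For real $s\ge0$, $X_s:=X_{\lfloor s\rfloor}$. Potential: $V(0)=0$, $V(x)=\sum_{i=1}^x\log\rho_i$ for $x\ge1$, $V(x)=-\sum_{i=x+1}^0\log\rho_i$ for $x\le-1$. Let $e_0=0$, $e_i=\inf\{k>e_{i-1}:V(k)\le V(e_{i-1})\}$ and $H_i=\max_{e_i\le k\le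 e_{i+1}}(V(k)-V(e_i))$ for $i\ge0$. For large $t$ put $h_t=\log t-\log\log t$ and $D_t=(1+\kappa)\log t$. Let $\sigma(1)=\inf\{i\ge0:H_i\ge h_t\}$, $\sigma(j)=\inf\{i>\sigma(j-1):H_i\ge h_t\}$ for $j\ge2$. For $j\ge1$: $b_j=e_{\sigma(j)}$, $a_j=\sup\{k\le b_j:V(k)-V(b_j)\ge D_t\}$, $\bar d_j=e_{\sigma(j)+1}$, $d_j=\inf\{k\ge\bar d_j:V(k)-V(\bar d_j)\le-D_t\}$. Hitting times: $\tau(x)=\inf\{n\ge1:X_n=x\}$; $\ell_t=\sup\{n\ge0:\tau(b_n)\le t\}$ with the convention $\tau(b_0)=0$. Weights: $W_k(\omega)=2\sum_{a_k\le m\le n,\ b_k\le n\le d_k}e^{V(n)-V(m)}$. Let $\mathbf e=(\mathbf e_i)_{i\ge1}$ be i.i.d. exponential random variables of parameter 1, independent of $X$, with law $P^{(\mathbf e)}$, and $\ell^{(\mathbf e)}_{t,\omega}=\sup\{i\ge0:\sum_{k=1}^iW_k(\omega)\mathbf e_k\le t\}$. *)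

theory Defs
  imports "HOL-Probability.Probability"
begin

definition rho :: "(int \<Rightarrow> real) \<Rightarrow> int \<Rightarrow> real" where
  "rho \<omega> i = (1 - \<omega> i) / \<omega> i"

definition V :: "(int \<Rightarrow> real) \<Rightarrow> int \<Rightarrow> real" where
  "V \<omega> x = (if 0 \<le> x then (\<Sum>i\<in>{1..x}. ln (rho \<omega> i))
             else - (\<Sum>i\<in>{x+1..0}. ln (rho \<omega> i)))"

fun e :: "(int \<Rightarrow> real) \<Rightarrow> nat \<Rightarrow> int" where
  "e \<omega> 0 = 0"
| "e \<omega> (Suc i) = Inf {k. e \<omega> i < k \<and> V \<omega> k \<le> V \<omega> (e \<omega> i)}"

definition H :: "(int \<Rightarrow> real) \<Rightarrow> nat \<Rightarrow> real" where
  "H \<omega> i = Max ((\<lambda>k. V \<omega> k - V \<omega> (e \<omega> i)) ` {e \<omega> i .. e \<omega> (Suc i)})"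

definition h :: "real \<Rightarrow> real" where
  "h t = ln t - ln (ln t)"

definition D :: "real \<Rightarrow> real \<Rightarrow> real" where
  "D \<kappa> t = (1 + \<kappa>) * ln t"

text \<open>sig \<omega> t j is the paper's sigma(j+1).\<close>
fun sig :: "(int \<Rightarrow> real) \<Rightarrow> real \<Rightarrow> nat \<Rightarrow> nat" where
  "sig \<omega> t 0 = (LEAST i. h t \<le> H \<omega> i)"
| "sig \<omega> t (Suc j) = (LEAST i. sig \<omega> t j < i \<and> h t \<le> H \<omega> i)"

text \<open>b_j for j \<ge> 1; b_0 is set to 0 (the starting point e_0 = 0).\<close>
definition b :: "(int \<Rightarrow> real) \<Rightarrow> real \<Rightarrow> nat \<Rightarrow> int" where
  "b \<omega> t j = (if j = 0 then 0 else e \<omega> (sig \<omega> t (j - 1)))"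

definition a :: "(int \<Rightarrow> real) \<Rightarrow> real \<Rightarrow> real \<Rightarrow> nat \<Rightarrow> int" where
  "a \<omega> \<kappa> t j = Sup {k. k \<le> b \<omega> t j \<and> V \<omega> k - V \<omega> (b \<omega> t j) \<ge> D \<kappa> t}"

definition dbar :: "(int \<Rightarrow> real) \<Rightarrow> real \<Rightarrow> nat \<Rightarrow> int" where
  "dbar \<omega> t j = e \<omega> (Suc (sig \<omega> t (j - 1)))"

definition d :: "(int \<Rightarrow> real) \<Rightarrow> real \<Rightarrow> real \<Rightarrow> nat \<Rightarrow> int" where
  "d \<omega> \<kappa> t j = Inf {k. dbar \<omega> t j \<le> k \<and> V \<omega> k - V \<omega> (dbar \<omega> t j) \<le> - D \<kappa> t}"

definition W :: "(int \<Rightarrow> real) \<Rightarrow> real \<Rightarrow> real \<Rightarrow> nat \<Rightarrow> real" where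
  "W \<omega> \<kappa> t k = 2 * (\<Sum>(m, n)\<in>{(m, n). a \<omega> \<kappa> t k \<le> m \<and> m \<le> n \<and> b \<omega> t k \<le> n \<and> n \<le> d \<omega> \<kappa> t k}.
                       exp (V \<omega> n - V \<omega> m))"

section \<open>Quenched walk (paths X_0..X_N as lists of length N+1)\<close>

fun walk :: "(int \<Rightarrow> real) \<Rightarrow> nat \<Rightarrow> int list pmf" where
  "walk \<omega> 0 = return_pmf [0]"
| "walk \<omega> (Suc n) = bind_pmf (walk \<omega> n)
     (\<lambda>p. map_pmf (\<lambda>up. p @ [if up then last p + 1 else last p - 1]) (bernoulli_pmf (\<omega> (last p))))"

text \<open>Number of steps considered at real time t: X_t = X_{floor t}.\<close>
definition steps :: "real \<Rightarrow> nat" where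
  "steps t = nat \<lfloor>t\<rfloor>"

text \<open>tau(x) \<le> t, with tau(x) = inf{n \<ge> 1 : X_n = x}.\<close>
definition hit_by :: "int list \<Rightarrow> real \<Rightarrow> int \<Rightarrow> bool" where
  "hit_by p t x = (\<exists>n. 1 \<le> n \<and> n \<le> steps t \<and> p ! n = x)"

text \<open>ell_t = sup{n \<ge> 0 : tau(b_n) \<le> t}, with tau(b_0) = 0.\<close>
definition ell :: "(int \<Rightarrow> real) \<Rightarrow> real \<Rightarrow> int list \<Rightarrow> nat" where
  "ell \<omega> t p = Sup {n. n = 0 \<or> hit_by p t (b \<omega> t n)}"

definition Exps :: "(nat \<Rightarrow> real) measure" where
  "Exps = (\<Pi>\<^sub>M i\<in>UNIV. density lborel (exponential_density 1))"

definition ellE :: "(int \<Rightarrow> real) \<Rightarrow> real \<Rightarrow> real \<Rightarrow> (nat \<Rightarrow> real) \<Rightarrow> nat" where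
  "ellE \<omega> \<kappa> t es = Sup {i. (\<Sum>k\<in>{1..i}. W \<omega> \<kappa> t k * es k) \<le> t}"

definition dTV :: "nat measure \<Rightarrow> nat measure \<Rightarrow> real" where
  "dTV M N = (SUP A. \<bar>measure M A - measure N A\<bar>)"

definition law_ell :: "(int \<Rightarrow> real) \<Rightarrow> real \<Rightarrow> nat measure" where
  "law_ell \<omega> t = measure_pmf (map_pmf (ell \<omega> t) (walk \<omega> (steps t)))"

definition law_ellE :: "(int \<Rightarrow> real) \<Rightarrow> real \<Rightarrow> real \<Rightarrow> nat measure" where
  "law_ellE \<omega> \<kappa> t = distr Exps (count_space UNIV) (\<lambda>es. ellE \<omega> \<kappa> t es + 1)"

definition Penv :: "real measure \<Rightarrow> (int \<Rightarrow> real) measure" where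
  "Penv \<mu> = (\<Pi>\<^sub>M i\<in>UNIV. \<mu>)"

end

theory Submission
  imports Defs "HOL-Real_Asymp.Real_Asymp"
begin

text \<open>
  Under the environment law \<open>exp (\<kappa> * V)\<close> is a martingale, and \<open>phi = E (\<rho>\<^sub>0 powr (\<kappa> / 2)) < 1\<close>. Optional stopping
  and a second moment bound show that from a given site the potential climbs by \<open>y\<close> with probability of exact
  order \<open>exp (- \<kappa> * y)\<close>, so at scale \<open>t powr \<kappa>\<close> there are a tight number of climbs of height \<open>ln t + O(1)\<close>, while
  two high climbs within distance \<open>O(ln t)\<close> and climbs along flat stretches have vanishing probability.

  In a good environment every deep valley is left at an almost exponential time. Reflect the walk at \<open>a\<^sub>k\<close>: the mean
  exit time is explicit, it hardly depends on the starting point, and the mean residual time decreases at each step by the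
  survival probability; this forces exponential decay, with the mean \<open>W\<^sub>k\<close>. Reversibility shows that before the exit the
  walk sits near \<open>b\<^sub>k\<close>. The time spent outside the deep valleys is \<open>o(t)\<close>.

  Hence \<open>\<ell>\<^sub>t = n\<close> holds, up to small probability, when the partial sums of the exit times straddle \<open>t\<close> at \<open>n\<close>, and the
  exit times may be replaced one by one by \<open>W\<^sub>k\<close> times exponential variables. The replacement costs little unless a partial sum
  falls into \<open>((1 - \<epsilon>) * t, t]\<close>; this is unlikely because some early valley already has an exponential time of mean of order \<open>t\<close>,
  whose density is bounded. So both laws of the theorem dominate one common sub-probability of mass close to one.
\<close>

subsection \<open>Independence in product measures\<close>

text \<open>An exit time is integer valued, so it is close to its exponential variable only in the
  uniform distance of tail functions, never in total variation. That distance adds up under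
  convolution, and the events deciding the value of \<open>ell\<close> are differences of tails;
  hence only laws of indices are compared in total variation. The window from
  \<open>(1 - \<epsilon>) * t\<close> to \<open>t\<close> has a second use: it is the room for the
  time spent between valleys, which is independent of the exit times and controlled only in mean.

  The lower bound for a climb needs the martingale not to overshoot its level by much in mean; the
  moment of \<open>\<rho> powr \<kappa>\<close> times its logarithm gives this. The half exponent
  trades height for length: weight \<open>\<kappa>\<close> on a stretch costs nothing per site,
  weight \<open>\<kappa> / 2\<close> gains a factor \<open>phi\<close> per site, so one exponential
  bound treats high climbs and long flat stretches together. The double logarithm subtracted in
  \<open>h\<close> makes shallow climbs contribute \<open>o(t)\<close> in total while the number of
  deep valleys stays below \<open>(ln t)\<^sup>2\<close>, a factor absorbed by the valley errors,
  which decay like powers of \<open>t\<close>.\<close>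

definition merge_on :: "'i set \<Rightarrow> ('i \<Rightarrow> 'a) \<Rightarrow> ('i \<Rightarrow> 'a) \<Rightarrow> 'i \<Rightarrow> 'a" where
  "merge_on A x y = (\<lambda>i. if i \<in> A then x i else y i)"

lemma measurable_merge_on [measurable]:
  "(\<lambda>p. merge_on A (fst p) (snd p)) \<in>
     (PiM UNIV (\<lambda>_. M) \<Otimes>\<^sub>M PiM UNIV (\<lambda>_. M)) \<rightarrow>\<^sub>M PiM UNIV (\<lambda>_. M)"
proof (rule measurable_PiM_single')
  fix i
  show "(\<lambda>p. merge_on A (fst p) (snd p) i) \<in> (PiM UNIV (\<lambda>_. M) \<Otimes>\<^sub>M PiM UNIV (\<lambda>_. M)) \<rightarrow>\<^sub>M M"
    unfolding merge_on_def by (cases "i \<in> A") simp_all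
qed (auto simp: space_PiM space_pair_measure merge_on_def PiE_def Pi_def)

text \<open>On a cylinder the product over \<open>J\<close> splits into the parts over
  \<open>J \<inter> A\<close> and \<open>J - A\<close>, so two independent samples spliced along
  \<open>A\<close> form a sample again. Independence of coordinates is used below in this form
  only.\<close>

lemma distr_merge_on:
  fixes M :: "'a measure" and A :: "'i set"
  assumes "prob_space M"
  defines "P \<equiv> PiM (UNIV :: 'i set) (\<lambda>_. M)"
  shows "distr (P \<Otimes>\<^sub>M P) P (\<lambda>p. merge_on A (fst p) (snd p)) = P"
proof -
  interpret M: prob_space M by fact
  interpret product_prob_space "\<lambda>_. M" "UNIV :: 'i set" ..
  interpret PP: prob_space P unfolding P_def by (rule prob_space_PiM) (rule assms(1))
  interpret P2: pair_prob_space P P ..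
  have m: "(\<lambda>p. merge_on A (fst p) (snd p)) \<in> (P \<Otimes>\<^sub>M P) \<rightarrow>\<^sub>M P"
    unfolding P_def by (rule measurable_merge_on)
  show ?thesis
    unfolding P_def
  proof (rule measure_eqI_PiM_infinite)
    fix X :: "'i \<Rightarrow> 'a set" and J :: "'i set"
    assume J: "finite J" "J \<subseteq> UNIV" "\<And>i. i \<in> J \<Longrightarrow> X i \<in> sets M"
    let ?S = "\<lambda>J. prod_emb UNIV (\<lambda>_. M) J (Pi\<^sub>E J X)"
    have sets: "?S J' \<in> sets P" if "J' \<subseteq> J" for J'
      unfolding P_def using that J by (intro sets_PiM_I) (auto intro: finite_subset)
    have pre: "(\<lambda>p. merge_on A (fst p) (snd p)) -` ?S J \<inter> space (P \<Otimes>\<^sub>M P) = ?S (J \<inter> A) \<times> ?S (J - A)"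
      by (auto simp: prod_emb_def space_pair_measure P_def space_PiM merge_on_def PiE_def Pi_def
          restrict_def extensional_def split: if_splits)
    have "emeasure (distr (P \<Otimes>\<^sub>M P) P (\<lambda>p. merge_on A (fst p) (snd p))) (?S J)
        = emeasure (P \<Otimes>\<^sub>M P) (?S (J \<inter> A) \<times> ?S (J - A))"
      using m sets[of J] by (simp add: emeasure_distr pre)
    also have "\<dots> = emeasure P (?S (J \<inter> A)) * emeasure P (?S (J - A))"
      by (intro PP.emeasure_pair_measure_Times sets) auto
    also have "\<dots> = (\<Prod>i\<in>J \<inter> A. emeasure M (X i)) * (\<Prod>i\<in>J - A. emeasure M (X i))"
      unfolding P_def using J by (subst (1 2) emeasure_PiM_emb) auto
    also have "\<dots> = (\<Prod>i\<in>J. emeasure M (X i))"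
      using J by (subst prod.union_disjoint[symmetric]) (auto intro!: prod.cong)
    also have "\<dots> = emeasure P (?S J)"
      unfolding P_def using J by (subst emeasure_PiM_emb) auto
    finally show "emeasure (distr (Pi\<^sub>M UNIV (\<lambda>_. M) \<Otimes>\<^sub>M Pi\<^sub>M UNIV (\<lambda>_. M)) (Pi\<^sub>M UNIV (\<lambda>_. M))
        (\<lambda>p. merge_on A (fst p) (snd p))) (?S J) = emeasure (Pi\<^sub>M UNIV (\<lambda>_. M)) (?S J)"
      unfolding P_def .
  next
    show "finite_measure (distr (Pi\<^sub>M UNIV (\<lambda>_. M) \<Otimes>\<^sub>M Pi\<^sub>M UNIV (\<lambda>_. M)) (Pi\<^sub>M UNIV (\<lambda>_. M))
        (\<lambda>p. merge_on A (fst p) (snd p)))"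
      using P2.finite_measure_distr[OF m] unfolding P_def .
  qed simp_all
qed

lemma nn_integral_merge_on:
  fixes M :: "'a measure" and A :: "'i set"
  assumes M: "prob_space M"
  defines "P \<equiv> PiM (UNIV :: 'i set) (\<lambda>_. M)"
  assumes F: "F \<in> borel_measurable P"
  shows "(\<integral>\<^sup>+x. F x \<partial>P) = (\<integral>\<^sup>+x. \<integral>\<^sup>+y. F (merge_on A x y) \<partial>P \<partial>P)"
proof -
  interpret PP: prob_space P unfolding P_def by (rule prob_space_PiM) (rule assms(1))
  have m [measurable]: "(\<lambda>p. merge_on A (fst p) (snd p)) \<in> (P \<Otimes>\<^sub>M P) \<rightarrow>\<^sub>M P"
    unfolding P_def by (rule measurable_merge_on)
  have "(\<integral>\<^sup>+x. F x \<partial>P) = (\<integral>\<^sup>+x. F x \<partial>distr (P \<Otimes>\<^sub>M P) P (\<lambda>p. merge_on A (fst p) (snd p)))"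
    unfolding P_def by (subst distr_merge_on[OF M]) simp
  also have "\<dots> = (\<integral>\<^sup>+p. F (merge_on A (fst p) (snd p)) \<partial>(P \<Otimes>\<^sub>M P))"
    using F by (subst nn_integral_distr) (auto simp: m)
  also have "\<dots> = (\<integral>\<^sup>+x. \<integral>\<^sup>+y. F (merge_on A x y) \<partial>P \<partial>P)"
    using measurable_compose[OF m F] by (subst PP.nn_integral_fst[symmetric]) simp_all
  finally show ?thesis .
qed

text \<open>Stands in for measurability with respect to the coordinates in \<open>A\<close>; Borel
  measurability is stated separately.\<close>

definition depends_on :: "'i set \<Rightarrow> (('i \<Rightarrow> 'a) \<Rightarrow> 'b) \<Rightarrow> bool" where
  "depends_on A F \<longleftrightarrow> (\<forall>x y. (\<forall>i\<in>A. x i = y i) \<longrightarrow> F x = F y)"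

lemma depends_onI: "(\<And>x y. (\<And>i. i \<in> A \<Longrightarrow> x i = y i) \<Longrightarrow> F x = F y) \<Longrightarrow> depends_on A F"
  unfolding depends_on_def by blast

lemma depends_onD: "depends_on A F \<Longrightarrow> (\<And>i. i \<in> A \<Longrightarrow> x i = y i) \<Longrightarrow> F x = F y"
  unfolding depends_on_def by blast

text \<open>After the splice \<open>F\<close> sees only the first sample and \<open>G\<close> only
  the second, so the double integral factorizes.\<close>

lemma nn_integral_mult_depends_on:
  fixes M :: "'a measure" and A B :: "'i set" and F G :: "('i \<Rightarrow> 'a) \<Rightarrow> ennreal"
  assumes M: "prob_space M"
  defines "P \<equiv> PiM (UNIV :: 'i set) (\<lambda>_. M)"
  assumes F [measurable]: "F \<in> borel_measurable P" and G [measurable]: "G \<in> borel_measurable P"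
    and dF: "depends_on A F" and dG: "depends_on B G" and disj: "A \<inter> B = {}"
  shows "(\<integral>\<^sup>+x. F x * G x \<partial>P) = (\<integral>\<^sup>+x. F x \<partial>P) * (\<integral>\<^sup>+x. G x \<partial>P)"
proof -
  have "(\<integral>\<^sup>+x. F x * G x \<partial>P) = (\<integral>\<^sup>+x. \<integral>\<^sup>+y. F (merge_on A x y) * G (merge_on A x y) \<partial>P \<partial>P)"
    unfolding P_def by (rule nn_integral_merge_on[OF M]) (use F G in \<open>simp add: P_def\<close>)
  also have "\<dots> = (\<integral>\<^sup>+x. \<integral>\<^sup>+y. F x * G y \<partial>P \<partial>P)"
  proof (intro nn_integral_cong)
    fix x y
    have "F (merge_on A x y) = F x" by (rule depends_onD[OF dF]) (simp add: merge_on_def)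
    moreover have "G (merge_on A x y) = G y"
      by (rule depends_onD[OF dG]) (use disj in \<open>auto simp: merge_on_def\<close>)
    ultimately show "F (merge_on A x y) * G (merge_on A x y) = F x * G y" by simp
  qed
  also have "\<dots> = (\<integral>\<^sup>+x. F x \<partial>P) * (\<integral>\<^sup>+x. G x \<partial>P)"
    by (simp add: nn_integral_cmult nn_integral_multc)
  finally show ?thesis .
qed

subsection \<open>Exponential moments of the potential\<close>

definition xi :: "real \<Rightarrow> real" where
  "xi x = ln ((1 - x) / x)"

text \<open>A one-sided sum, free of the case distinction at 0 in \<open>V\<close>;
  \<open>V_diff\<close> connects the two.\<close>

definition inc :: "(int \<Rightarrow> real) \<Rightarrow> int \<Rightarrow> int \<Rightarrow> real" where
  "inc \<omega> x y = (\<Sum>i\<in>{x<..y}. xi (\<omega> i))"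

lemma inc_add: "x \<le> y \<Longrightarrow> y \<le> z \<Longrightarrow> inc \<omega> x y + inc \<omega> y z = inc \<omega> x z"
  unfolding inc_def by (subst sum.union_disjoint[symmetric]) (auto intro!: sum.cong)

lemma inc_self [simp]: "inc \<omega> x x = 0"
  by (simp add: inc_def)

lemma V_inc: "V \<omega> x = (if 0 \<le> x then inc \<omega> 0 x else - inc \<omega> x 0)"
proof -
  have "{1..x} = {0<..x}" "{x+1..0} = {x<..0}" by auto
  then show ?thesis by (simp add: V_def inc_def xi_def rho_def)
qed

lemma V_diff: "x \<le> y \<Longrightarrow> V \<omega> y - V \<omega> x = inc \<omega> x y"
  using inc_add[of 0 x y \<omega>] inc_add[of x y 0 \<omega>] inc_add[of x 0 y \<omega>]
  by (auto simp: V_inc)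

lemma xi_measurable [measurable]: "xi \<in> borel_measurable borel"
  unfolding xi_def[abs_def] by measurable

lemma depends_on_inc: "{x<..y} \<subseteq> A \<Longrightarrow> depends_on A (\<lambda>\<omega>. inc \<omega> x y)"
  by (rule depends_onI) (auto simp: inc_def intro!: sum.cong)

locale rwre_env =
  fixes \<mu> :: "real measure" and \<kappa> :: real
  assumes prob_mu: "prob_space \<mu>" and sets_mu: "sets \<mu> = sets borel"
    and unit_mu: "AE x in \<mu>. 0 < x \<and> x < 1"
    and kappa_pos: "0 < \<kappa>" and kappa_less: "\<kappa> < 1"
    and int_kappa: "integrable \<mu> (\<lambda>x. ((1 - x) / x) powr \<kappa>)"
    and moment_kappa: "(\<integral>x. ((1 - x) / x) powr \<kappa> \<partial>\<mu>) = 1"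
    and int_log: "integrable \<mu> (\<lambda>x. ((1 - x) / x) powr \<kappa> * max 0 (ln ((1 - x) / x)))"
    and nonlattice: "\<not> (\<exists>c l. 0 < l \<and> (AE x in \<mu>. \<exists>k::int. ln ((1 - x) / x) = c + l * of_int k))"
begin

abbreviation "P \<equiv> Penv \<mu>"

sublocale mu: prob_space \<mu> by (rule prob_mu)

lemma space_mu [simp]: "space \<mu> = UNIV"
  using sets_eq_imp_space_eq[OF sets_mu] by simp

lemma space_P [simp]: "space P = UNIV"
  by (simp add: Penv_def space_PiM PiE_def)

sublocale P: prob_space P
  unfolding Penv_def by (rule prob_space_PiM) (rule prob_mu)

lemma borel_mu: "borel_measurable \<mu> = borel_measurable (borel :: real measure)"
  by (rule measurable_cong_sets) (simp_all add: sets_mu)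

lemma component_measurable [measurable]: "(\<lambda>\<omega>. \<omega> i) \<in> borel_measurable P"
proof -
  have "(\<lambda>\<omega>. \<omega> i) \<in> P \<rightarrow>\<^sub>M \<mu>" unfolding Penv_def by (rule measurable_component_singleton) simp
  then show ?thesis by (simp add: measurable_cong_sets[OF refl sets_mu])
qed

lemma inc_measurable [measurable]: "(\<lambda>\<omega>. inc \<omega> x y) \<in> borel_measurable P"
  unfolding inc_def by measurable

definition mom :: "real \<Rightarrow> ennreal" where
  "mom s = (\<integral>\<^sup>+x. ennreal (exp (s * xi x)) \<partial>\<mu>)"

lemma xi_mu [measurable]: "xi \<in> borel_measurable \<mu>"
  by (simp add: borel_mu)

lemma exp_xi_powr: "AE x in \<mu>. exp (s * xi x) = ((1 - x) / x) powr s"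
  using unit_mu by eventually_elim (simp add: xi_def powr_def)

lemma int_exp: "integrable \<mu> (\<lambda>x. exp (\<kappa> * xi x))"
proof (rule integrable_cong_AE_imp[OF int_kappa])
  show "AE x in \<mu>. ((1 - x) / x) powr \<kappa> = exp (\<kappa> * xi x)"
    using exp_xi_powr[of \<kappa>] by eventually_elim simp
qed simp

lemma integral_exp: "(\<integral>x. exp (\<kappa> * xi x) \<partial>\<mu>) = 1"
proof -
  have "(\<integral>x. exp (\<kappa> * xi x) \<partial>\<mu>) = (\<integral>x. ((1 - x) / x) powr \<kappa> \<partial>\<mu>)"
    by (rule integral_cong_AE) (simp_all add: borel_mu exp_xi_powr)
  then show ?thesis by (simp add: moment_kappa)
qed

lemma mom_kappa [simp]: "mom \<kappa> = 1"
  unfolding mom_def by (subst nn_integral_eq_integral[OF int_exp]) (simp_all add: integral_exp)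

definition phi :: real where
  "phi = (\<integral>x. exp (\<kappa> / 2 * xi x) \<partial>\<mu>)"

lemma int_exp_half: "integrable \<mu> (\<lambda>x. exp (\<kappa> / 2 * xi x))"
proof (rule Bochner_Integration.integrable_bound)
  show "integrable \<mu> (\<lambda>x. 1 + exp (\<kappa> * xi x))" using int_exp by simp
  have "exp (\<kappa> / 2 * z) \<le> 1 + exp (\<kappa> * z)" for z
  proof -
    have "exp (\<kappa> * z) = (exp (\<kappa> / 2 * z))\<^sup>2" by (simp add: power2_eq_square exp_add[symmetric])
    moreover have "0 \<le> (exp (\<kappa> / 2 * z) - 1)\<^sup>2" "0 < exp (\<kappa> / 2 * z)" by simp_all
    ultimately show ?thesis by (simp only: power2_diff power_one mult_1_right)
  qed
  then show "AE x in \<mu>. norm (exp (\<kappa> / 2 * xi x)) \<le> norm (1 + exp (\<kappa> * xi x))"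
    by (auto simp: add_nonneg_nonneg)
qed simp

lemma mom_half: "mom (\<kappa> / 2) = ennreal phi"
  unfolding mom_def phi_def by (subst nn_integral_eq_integral[OF int_exp_half]) simp_all

lemma phi_nonneg: "0 \<le> phi"
  unfolding phi_def by (rule Bochner_Integration.integral_nonneg) simp

text \<open>Strictness in Cauchy-Schwarz: the square of \<open>exp (\<kappa> / 2 * xi x) - 1\<close>
  has mean \<open>2 - 2 * phi\<close>, which vanishes only if \<open>xi\<close> is almost surely 0,
  and a constant law is lattice.\<close>

lemma phi_less: "phi < 1"
proof -
  let ?f = "\<lambda>x. (exp (\<kappa> / 2 * xi x) - 1)\<^sup>2"
  have sq: "?f x = exp (\<kappa> * xi x) - 2 * exp (\<kappa> / 2 * xi x) + 1" for x
    by (simp add: power2_eq_square algebra_simps exp_add[symmetric])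
  have int: "integrable \<mu> ?f" unfolding sq using int_exp int_exp_half by auto
  have val: "(\<integral>x. ?f x \<partial>\<mu>) = 2 - 2 * phi"
    unfolding sq using int_exp int_exp_half mu.prob_space by (simp add: integral_exp phi_def)
  have "(\<integral>x. ?f x \<partial>\<mu>) \<noteq> 0"
  proof
    assume "(\<integral>x. ?f x \<partial>\<mu>) = 0"
    then have "AE x in \<mu>. ?f x = 0" using integral_nonneg_eq_0_iff_AE[OF int] by simp
    then have "AE x in \<mu>. \<exists>k::int. ln ((1 - x) / x) = 0 + 1 * of_int k"
      by eventually_elim (use kappa_pos in \<open>auto simp: xi_def intro!: exI[of _ 0]\<close>)
    then have "\<exists>c l. 0 < l \<and> (AE x in \<mu>. \<exists>k::int. ln ((1 - x) / x) = c + l * of_int k)"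
      by (intro exI[of _ 0] exI[of _ 1]) simp
    then show False using nonlattice by contradiction
  qed
  moreover have "(\<integral>x. ?f x \<partial>\<mu>) \<ge> 0" by (rule Bochner_Integration.integral_nonneg) simp
  ultimately show ?thesis unfolding val by simp
qed

lemma phi_pos: "0 < phi"
proof (rule ccontr)
  assume "\<not> 0 < phi"
  then have "phi = 0" using phi_nonneg by simp
  then have "AE x in \<mu>. exp (\<kappa> / 2 * xi x) = 0"
    unfolding phi_def using integral_nonneg_eq_0_iff_AE[OF int_exp_half] by simp
  then show False by simp
qed

lemma nn_integral_component: "f \<in> borel_measurable borel \<Longrightarrow> (\<integral>\<^sup>+\<omega>. f (\<omega> i) \<partial>P) = (\<integral>\<^sup>+x. f x \<partial>\<mu>)"
proof -
  interpret PP: product_prob_space "\<lambda>_. \<mu>" "UNIV :: int set" ..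
  assume f: "f \<in> borel_measurable borel"
  have "distr P \<mu> (\<lambda>\<omega>. \<omega> i) = \<mu>" unfolding Penv_def by (rule PP.PiM_component) simp
  moreover have "(\<lambda>\<omega>. \<omega> i) \<in> P \<rightarrow>\<^sub>M \<mu>" unfolding Penv_def by (rule measurable_component_singleton) simp
  ultimately show ?thesis using f nn_integral_distr[of "\<lambda>\<omega>. \<omega> i" P \<mu> f] by (simp add: borel_mu)
qed

lemma nn_integral_indep:
  assumes "F \<in> borel_measurable P" "G \<in> borel_measurable P" "depends_on A F" "depends_on B G" "A \<inter> B = {}"
  shows "(\<integral>\<^sup>+\<omega>. F \<omega> * G \<omega> \<partial>P) = (\<integral>\<^sup>+\<omega>. F \<omega> \<partial>P) * (\<integral>\<^sup>+\<omega>. G \<omega> \<partial>P)"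
  unfolding Penv_def by (rule nn_integral_mult_depends_on[OF prob_mu, where A=A and B=B])
    (use assms in \<open>simp_all add: Penv_def\<close>)

lemma nn_integral_exp_sum:
  assumes "finite I"
  shows "(\<integral>\<^sup>+\<omega>. ennreal (exp (\<Sum>i\<in>I. s i * xi (\<omega> i))) \<partial>P) = (\<Prod>i\<in>I. mom (s i))"
  using assms
proof (induction I)
  case empty
  then show ?case by (simp add: P.emeasure_space_1[simplified])
next
  case (insert j I)
  have "(\<integral>\<^sup>+\<omega>. ennreal (exp (\<Sum>i\<in>insert j I. s i * xi (\<omega> i))) \<partial>P)
     = (\<integral>\<^sup>+\<omega>. ennreal (exp (s j * xi (\<omega> j))) * ennreal (exp (\<Sum>i\<in>I. s i * xi (\<omega> i))) \<partial>P)"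
    using insert by (simp add: exp_add ennreal_mult)
  also have "\<dots> = (\<integral>\<^sup>+\<omega>. ennreal (exp (s j * xi (\<omega> j))) \<partial>P) * (\<integral>\<^sup>+\<omega>. ennreal (exp (\<Sum>i\<in>I. s i * xi (\<omega> i))) \<partial>P)"
    using insert(2) by (intro nn_integral_indep[of _ _ "{j}" I])
      (auto intro!: depends_onI arg_cong[of _ _ exp] arg_cong[of _ _ ennreal] sum.cong)
  also have "(\<integral>\<^sup>+\<omega>. ennreal (exp (s j * xi (\<omega> j))) \<partial>P) = mom (s j)"
    unfolding mom_def by (rule nn_integral_component[of "\<lambda>x. ennreal (exp (s j * xi x))"]) measurable
  finally show ?case using insert by simp
qed

lemma nn_integral_exp_inc: "(\<integral>\<^sup>+\<omega>. ennreal (exp (s * inc \<omega> x y)) \<partial>P) = mom s ^ nat (y - x)"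
proof -
  have "(\<integral>\<^sup>+\<omega>. ennreal (exp (s * inc \<omega> x y)) \<partial>P) = (\<Prod>i\<in>{x<..y}. mom s)"
    unfolding inc_def sum_distrib_left by (rule nn_integral_exp_sum) simp
  then show ?thesis by simp
qed

lemma nn_integral_step:
  assumes "F \<in> borel_measurable P" "depends_on A F" "A \<inter> {y<..z} = {}"
  shows "(\<integral>\<^sup>+\<omega>. F \<omega> * ennreal (exp (s * inc \<omega> y z)) \<partial>P) = (\<integral>\<^sup>+\<omega>. F \<omega> \<partial>P) * mom s ^ nat (z - y)"
proof -
  have "depends_on {y<..z} (\<lambda>\<omega>. ennreal (exp (s * inc \<omega> y z)))"
    using depends_on_inc[of y z "{y<..z}"] unfolding depends_on_def by auto
  then have "(\<integral>\<^sup>+\<omega>. F \<omega> * ennreal (exp (s * inc \<omega> y z)) \<partial>P)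
      = (\<integral>\<^sup>+\<omega>. F \<omega> \<partial>P) * (\<integral>\<^sup>+\<omega>. ennreal (exp (s * inc \<omega> y z)) \<partial>P)"
    using assms by (intro nn_integral_indep) auto
  then show ?thesis by (simp add: nn_integral_exp_inc)
qed

text \<open>Exponential Markov inequality with two weights. Sites of \<open>I\<close> carry weight
  \<open>\<kappa>\<close> and cost no factor because \<open>mom \<kappa> = 1\<close>; each site of
  \<open>J\<close> carries weight \<open>\<kappa> / 2\<close> and gains a factor
  \<open>phi\<close>.\<close>

lemma chernoff:
  assumes fin: "finite I" "finite J" "I \<inter> J = {}" and [measurable]: "Measurable.pred P E"
    and le: "\<And>\<omega>. E \<omega> \<Longrightarrow> c \<le> \<kappa> * (\<Sum>i\<in>I. xi (\<omega> i)) + \<kappa> / 2 * (\<Sum>i\<in>J. xi (\<omega> i))"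
  shows "measure P {\<omega>. E \<omega>} \<le> exp (- c) * phi ^ card J"
proof -
  define s where "s i = (if i \<in> I then \<kappa> else \<kappa> / 2)" for i
  have sum: "(\<Sum>i\<in>I \<union> J. s i * xi (\<omega> i)) = \<kappa> * (\<Sum>i\<in>I. xi (\<omega> i)) + \<kappa> / 2 * (\<Sum>i\<in>J. xi (\<omega> i))" for \<omega>
  proof -
    have "(\<Sum>i\<in>J. s i * xi (\<omega> i)) = (\<Sum>i\<in>J. \<kappa> / 2 * xi (\<omega> i))"
      using fin(3) by (intro sum.cong) (auto simp: s_def)
    then show ?thesis using fin by (simp add: sum.union_disjoint sum_distrib_left s_def)
  qed
  have E: "{\<omega>. E \<omega>} \<in> sets P" using predE[OF assms(4)] by simp
  have "emeasure P {\<omega>. E \<omega>} = (\<integral>\<^sup>+\<omega>. indicator {\<omega>. E \<omega>} \<omega> \<partial>P)" using E by simp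
  also have "\<dots> \<le> (\<integral>\<^sup>+\<omega>. ennreal (exp (- c)) * ennreal (exp (\<Sum>i\<in>I \<union> J. s i * xi (\<omega> i))) \<partial>P)"
  proof (rule nn_integral_mono)
    fix \<omega>
    have "1 \<le> exp (- c) * exp (\<Sum>i\<in>I \<union> J. s i * xi (\<omega> i))" if "E \<omega>"
      using le[OF that] by (simp add: sum exp_add[symmetric])
    then show "indicator {\<omega>. E \<omega>} \<omega> \<le> ennreal (exp (- c)) * ennreal (exp (\<Sum>i\<in>I \<union> J. s i * xi (\<omega> i)))"
      by (cases "E \<omega>") (simp_all add: ennreal_mult[symmetric] ennreal_ge_1)
  qed
  also have "\<dots> = ennreal (exp (- c)) * (\<Prod>i\<in>I \<union> J. mom (s i))"
    using fin by (simp add: nn_integral_cmult nn_integral_exp_sum)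
  also have "(\<Prod>i\<in>I \<union> J. mom (s i)) = (\<Prod>i\<in>J. ennreal phi)"
  proof -
    have "(\<Prod>i\<in>J. mom (s i)) = (\<Prod>i\<in>J. ennreal phi)"
      using fin(3) by (intro prod.cong) (auto simp: s_def mom_half)
    then show ?thesis using fin by (simp add: prod.union_disjoint s_def)
  qed
  finally show ?thesis using phi_nonneg
    by (simp add: P.emeasure_eq_measure ennreal_power ennreal_mult[symmetric] ennreal_le_iff)
qed

text \<open>The martingale property on an event decided by time \<open>y\<close>: the later
  increment is independent of it and has tilted mean one.\<close>

lemma stop_step:
  assumes [measurable]: "Measurable.pred P Q" and "depends_on {x<..y} Q" "y \<le> z" "x \<le> y"
  shows "(\<integral>\<^sup>+\<omega>. (if Q \<omega> then ennreal (exp (\<kappa> * inc \<omega> x z)) else 0) \<partial>P)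
       = (\<integral>\<^sup>+\<omega>. (if Q \<omega> then ennreal (exp (\<kappa> * inc \<omega> x y)) else 0) \<partial>P)"
proof -
  have dep: "depends_on {x<..y} (\<lambda>\<omega>. if Q \<omega> then ennreal (exp (\<kappa> * inc \<omega> x y)) else 0)"
  proof (rule depends_onI)
    fix \<omega> \<omega>' :: "int \<Rightarrow> real" assume eq: "\<And>i. i \<in> {x<..y} \<Longrightarrow> \<omega> i = \<omega>' i"
    have "Q \<omega> = Q \<omega>'" "inc \<omega> x y = inc \<omega>' x y"
      using depends_onD[OF assms(2) eq] depends_onD[OF depends_on_inc[of x y "{x<..y}"] eq] by auto
    then show "(if Q \<omega> then ennreal (exp (\<kappa> * inc \<omega> x y)) else 0) =
        (if Q \<omega>' then ennreal (exp (\<kappa> * inc \<omega>' x y)) else 0)" by simp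
  qed
  have "(\<integral>\<^sup>+\<omega>. (if Q \<omega> then ennreal (exp (\<kappa> * inc \<omega> x z)) else 0) \<partial>P)
      = (\<integral>\<^sup>+\<omega>. (if Q \<omega> then ennreal (exp (\<kappa> * inc \<omega> x y)) else 0) * ennreal (exp (\<kappa> * inc \<omega> y z)) \<partial>P)"
    using assms(3,4) by (intro nn_integral_cong)
      (auto simp: inc_add[symmetric, of x y z] exp_add ennreal_mult distrib_left)
  also have "\<dots> = (\<integral>\<^sup>+\<omega>. (if Q \<omega> then ennreal (exp (\<kappa> * inc \<omega> x y)) else 0) \<partial>P) * mom \<kappa> ^ nat (z - y)"
    by (rule nn_integral_step[OF _ dep]) auto
  finally show ?thesis by simp
qed

text \<open>\<open>Q j\<close> reads as stopping at time \<open>j\<close>. The mass stopped up to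
  time \<open>n\<close> and the mass still running add up to one for every finite \<open>n\<close>,
  so no limit and no integrability of a stopping time is involved.\<close>

lemma optional_stopping:
  assumes meas [measurable]: "\<And>j. Measurable.pred P (Q j)"
    and dep: "\<And>j. depends_on {x<..x + int j} (Q j)"
    and disj: "\<And>i j \<omega>. Q i \<omega> \<Longrightarrow> Q j \<omega> \<Longrightarrow> i = j"
  shows "(\<Sum>j\<le>n. \<integral>\<^sup>+\<omega>. (if Q j \<omega> then ennreal (exp (\<kappa> * inc \<omega> x (x + int j))) else 0) \<partial>P)
       + (\<integral>\<^sup>+\<omega>. (if \<forall>j\<le>n. \<not> Q j \<omega> then ennreal (exp (\<kappa> * inc \<omega> x (x + int n))) else 0) \<partial>P) = 1"
proof -
  let ?e = "\<lambda>\<omega>. ennreal (exp (\<kappa> * inc \<omega> x (x + int n)))"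
  have "(\<Sum>j\<le>n. \<integral>\<^sup>+\<omega>. (if Q j \<omega> then ennreal (exp (\<kappa> * inc \<omega> x (x + int j))) else 0) \<partial>P)
      = (\<Sum>j\<le>n. \<integral>\<^sup>+\<omega>. (if Q j \<omega> then ?e \<omega> else 0) \<partial>P)"
    by (intro sum.cong refl stop_step[symmetric] dep) auto
  also have "\<dots> = (\<integral>\<^sup>+\<omega>. (\<Sum>j\<le>n. if Q j \<omega> then ?e \<omega> else 0) \<partial>P)"
    by (rule nn_integral_sum[symmetric]) measurable
  also have "\<dots> + (\<integral>\<^sup>+\<omega>. (if \<forall>j\<le>n. \<not> Q j \<omega> then ?e \<omega> else 0) \<partial>P)
      = (\<integral>\<^sup>+\<omega>. (\<Sum>j\<le>n. if Q j \<omega> then ?e \<omega> else 0) + (if \<forall>j\<le>n. \<not> Q j \<omega> then ?e \<omega> else 0) \<partial>P)"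
    by (rule nn_integral_add[symmetric]) measurable
  also have "\<dots> = (\<integral>\<^sup>+\<omega>. ?e \<omega> \<partial>P)"
  proof (rule nn_integral_cong)
    fix \<omega>
    show "(\<Sum>j\<le>n. if Q j \<omega> then ?e \<omega> else 0) + (if \<forall>j\<le>n. \<not> Q j \<omega> then ?e \<omega> else 0) = ?e \<omega>"
    proof (cases "\<exists>j\<le>n. Q j \<omega>")
      case True
      then obtain j where j: "j \<le> n" "Q j \<omega>" by blast
      have "(\<Sum>i\<le>n. if Q i \<omega> then ?e \<omega> else 0) = (\<Sum>i\<le>n. if i = j then ?e \<omega> else 0)"
        using disj j(2) by (intro sum.cong) auto
      then show ?thesis using j True by auto
    qed auto
  qed
  also have "\<dots> = 1" by (simp add: nn_integral_exp_inc)
  finally show ?thesis .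
qed

end

subsection \<open>Climbs of the potential\<close>

lemma geometric_sum_inj_le:
  fixes r :: real
  assumes "finite I" "inj_on f I" "0 \<le> r" "r < 1"
  shows "(\<Sum>j\<in>I. r ^ f j) \<le> 1 / (1 - r)"
proof -
  have "(\<Sum>j\<in>I. r ^ f j) = (\<Sum>k\<in>f ` I. r ^ k)"
    using assms by (simp add: sum.reindex)
  also have "\<dots> \<le> (\<Sum>k. r ^ k)"
    using assms by (intro sum_le_suminf summable_geometric) auto
  also have "\<dots> = 1 / (1 - r)" using assms by (intro suminf_geometric) auto
  finally show ?thesis .
qed

lemma exists_nat_ceiling_minus_one:
  fixes z :: real
  assumes "0 < z"
  shows "\<exists>k::nat. real k < z \<and> z \<le> real k + 1"
proof (intro exI conjI)
  have "1 \<le> \<lceil>z\<rceil>" using assms by linarith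
  then have "real (nat (\<lceil>z\<rceil> - 1)) = of_int \<lceil>z\<rceil> - 1" by simp
  then show "real (nat (\<lceil>z\<rceil> - 1)) < z" "z \<le> real (nat (\<lceil>z\<rceil> - 1)) + 1" by linarith+
qed

lemma ennreal_term_le_suminf: "(f k :: ennreal) \<le> (\<Sum>k. f k)"
  using sum_le_suminf[of f "{k}"] by simp

text \<open>Staying strictly above the starting level serves the second moment bound: a rise from
  \<open>k\<close> that lasts beyond \<open>l\<close> forces the potential at \<open>l\<close> to
  lie above its value at \<open>k\<close>, which has probability at most
  \<open>phi ^ (l - k)\<close>.\<close>

definition rise :: "(int \<Rightarrow> real) \<Rightarrow> int \<Rightarrow> real \<Rightarrow> nat \<Rightarrow> bool" where
  "rise \<omega> x y n \<longleftrightarrow> (\<exists>j\<in>{1..n}. y \<le> inc \<omega> x (x + int j) \<and> (\<forall>i\<in>{1..j}. 0 < inc \<omega> x (x + int i)))"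

lemma inc_cong:
  assumes "\<And>i. i \<in> {x<..x + int j} \<Longrightarrow> \<omega> i = \<omega>' i" "i \<le> j"
  shows "inc \<omega> x (x + int i) = inc \<omega>' x (x + int i)"
  unfolding inc_def using assms by (intro sum.cong) auto

lemma inc_Suc: "inc \<omega> x (x + int (Suc j)) = inc \<omega> x (x + int j) + xi (\<omega> (x + int j + 1))"
proof -
  have "{x + int j<..x + int (Suc j)} = {x + int j + 1}" by auto
  then have "inc \<omega> (x + int j) (x + int (Suc j)) = xi (\<omega> (x + int j + 1))" by (simp add: inc_def)
  then show ?thesis using inc_add[of x "x + int j" "x + int (Suc j)" \<omega>] by simp
qed

lemma depends_on_rise: "depends_on {x<..x + int n} (\<lambda>\<omega>. rise \<omega> x y n)"
proof (rule depends_onI)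
  fix \<omega> \<omega>' :: "int \<Rightarrow> real" assume eq: "\<And>i. i \<in> {x<..x + int n} \<Longrightarrow> \<omega> i = \<omega>' i"
  have "inc \<omega> x (x + int i) = inc \<omega>' x (x + int i)" if "i \<le> n" for i
    using inc_cong[of x n \<omega> \<omega>' i] eq that by blast
  then show "rise \<omega> x y n = rise \<omega>' x y n"
    unfolding rise_def by (intro bex_cong refl conj_cong ball_cong) auto
qed

section \<open>Upper bounds for climbs\<close>

context rwre_env
begin

lemma rise_measurable [measurable]: "Measurable.pred P (\<lambda>\<omega>. rise \<omega> x y n)"
  unfolding rise_def by measurable

lemma optional_stopping_le:
  assumes "\<And>j. Measurable.pred P (Q j)"
    and "\<And>j. depends_on {x<..x + int j} (Q j)"
    and "\<And>i j \<omega>. Q i \<omega> \<Longrightarrow> Q j \<omega> \<Longrightarrow> i = j"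
  shows "(\<Sum>j\<le>n. \<integral>\<^sup>+\<omega>. (if Q j \<omega> then ennreal (exp (\<kappa> * inc \<omega> x (x + int j))) else 0) \<partial>P) \<le> 1"
  by (rule order_trans[OF _ eq_refl[OF optional_stopping[OF assms, where n=n]]]) (auto intro: add_increasing2)

lemma measure_inc_ge: "measure P {\<omega>. z \<le> inc \<omega> x (x + int j)} \<le> exp (- (\<kappa> / 2 * z)) * phi ^ j"
  using chernoff[of "{}" "{x<..x + int j}" "\<lambda>\<omega>. z \<le> inc \<omega> x (x + int j)" "\<kappa> / 2 * z"] kappa_pos
  by (simp add: inc_def)

lemma maximal_inequality:
  "measure P {\<omega>. \<exists>j\<le>n. y \<le> inc \<omega> x (x + int j)} \<le> exp (- (\<kappa> * y))"
proof -
  define Q where "Q j \<omega> \<longleftrightarrow> y \<le> inc \<omega> x (x + int j) \<and> (\<forall>i<j. inc \<omega> x (x + int i) < y)" for j \<omega>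
  have [measurable]: "Measurable.pred P (Q j)" for j unfolding Q_def by measurable
  have dep: "depends_on {x<..x + int j} (Q j)" for j
  proof (rule depends_onI)
    fix \<omega> \<omega>' :: "int \<Rightarrow> real" assume eq: "\<And>i. i \<in> {x<..x + int j} \<Longrightarrow> \<omega> i = \<omega>' i"
    have "inc \<omega> x (x + int i) = inc \<omega>' x (x + int i)" if "i \<le> j" for i
      using inc_cong[of x j \<omega> \<omega>' i] eq that by blast
    then show "Q j \<omega> = Q j \<omega>'" unfolding Q_def by auto
  qed
  have disj: "i = j" if "Q i \<omega>" "Q j \<omega>" for i j \<omega>
    using that unfolding Q_def by (metis linorder_neqE_nat not_le)
  let ?A = "{\<omega>. \<exists>j\<le>n. y \<le> inc \<omega> x (x + int j)}"
  have A: "?A \<in> sets P"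
  proof -
    have "Measurable.pred P (\<lambda>\<omega>. \<exists>j\<le>n. y \<le> inc \<omega> x (x + int j))" by measurable
    from predE[OF this] show ?thesis by simp
  qed
  have "ennreal (exp (\<kappa> * y)) * emeasure P ?A = (\<integral>\<^sup>+\<omega>. ennreal (exp (\<kappa> * y)) * indicator ?A \<omega> \<partial>P)"
    using A by (simp add: nn_integral_cmult)
  also have "\<dots> \<le> (\<integral>\<^sup>+\<omega>. (\<Sum>j\<le>n. if Q j \<omega> then ennreal (exp (\<kappa> * inc \<omega> x (x + int j))) else 0) \<partial>P)"
  proof (rule nn_integral_mono)
    fix \<omega>
    show "ennreal (exp (\<kappa> * y)) * indicator ?A \<omega>
        \<le> (\<Sum>j\<le>n. if Q j \<omega> then ennreal (exp (\<kappa> * inc \<omega> x (x + int j))) else 0)"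
    proof (cases "\<omega> \<in> ?A")
      case True
      define j where "j = (LEAST j. y \<le> inc \<omega> x (x + int j))"
      from True obtain j' where j': "j' \<le> n" "y \<le> inc \<omega> x (x + int j')" by blast
      have Qj: "Q j \<omega>" unfolding Q_def j_def
        using LeastI[of "\<lambda>j. y \<le> inc \<omega> x (x + int j)", OF j'(2)] not_less_Least by (auto simp: not_le[symmetric])
      have jn: "j \<le> n" using Least_le[of "\<lambda>j. y \<le> inc \<omega> x (x + int j)", OF j'(2)] j'(1) unfolding j_def by simp
      have "ennreal (exp (\<kappa> * y)) \<le> (if Q j \<omega> then ennreal (exp (\<kappa> * inc \<omega> x (x + int j))) else 0)"
        using Qj kappa_pos by (auto simp: Q_def intro!: ennreal_leI)
      also have "\<dots> \<le> (\<Sum>j\<le>n. if Q j \<omega> then ennreal (exp (\<kappa> * inc \<omega> x (x + int j))) else 0)"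
        using jn by (intro member_le_sum) auto
      finally show ?thesis using True by simp
    qed simp
  qed
  also have "\<dots> = (\<Sum>j\<le>n. \<integral>\<^sup>+\<omega>. (if Q j \<omega> then ennreal (exp (\<kappa> * inc \<omega> x (x + int j))) else 0) \<partial>P)"
    by (rule nn_integral_sum) measurable
  also have "\<dots> \<le> 1" by (rule optional_stopping_le) (use dep disj in auto)
  finally have "exp (\<kappa> * y) * measure P ?A \<le> 1"
    by (simp add: P.emeasure_eq_measure ennreal_mult[symmetric] ennreal_le_1)
  then show ?thesis by (simp add: exp_minus field_simps)
qed

definition C0 :: real where "C0 = exp (\<kappa> / 2) / (1 - phi)"

lemma C0_pos: "0 < C0"
  using phi_less by (simp add: C0_def)

text \<open>The tilted occupation time of a unit interval is bounded uniformly in its position.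
  Decompose at the first visit: the masses of first visits sum to at most one by optional stopping.
  A later visit needs a further increment at most 1, so half of the exponent can be given away for
  \<open>exp (\<kappa> / 2)\<close>, and the remaining half has mean
  \<open>phi ^ (j - i)\<close>.\<close>

lemma renewal_bound:
  "(\<Sum>j\<le>n. \<integral>\<^sup>+\<omega>. (if y \<le> inc \<omega> x (x + int j) \<and> inc \<omega> x (x + int j) < y + 1
       then ennreal (exp (\<kappa> * inc \<omega> x (x + int j))) else 0) \<partial>P) \<le> ennreal C0"
proof -
  define I where "I j \<omega> \<longleftrightarrow> y \<le> inc \<omega> x (x + int j) \<and> inc \<omega> x (x + int j) < y + 1" for j \<omega>
  define Q where "Q j \<omega> \<longleftrightarrow> I j \<omega> \<and> (\<forall>i<j. \<not> I i \<omega>)" for j \<omega>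
  define q where "q j \<omega> = (if Q j \<omega> then ennreal (exp (\<kappa> * inc \<omega> x (x + int j))) else 0)" for j \<omega>
  have [measurable]: "Measurable.pred P (I j)" "Measurable.pred P (Q j)" for j unfolding Q_def I_def by measurable
  have [measurable]: "q j \<in> borel_measurable P" for j unfolding q_def by measurable
  have Idep: "I i \<omega> = I i \<omega>' \<and> inc \<omega> x (x + int i) = inc \<omega>' x (x + int i)"
    if "\<And>i. i \<in> {x<..x + int j} \<Longrightarrow> \<omega> i = \<omega>' i" "i \<le> j" for i j \<omega> \<omega>'
    using inc_cong[of x j \<omega> \<omega>' i] that unfolding I_def by auto
  have dep: "depends_on {x<..x + int j} (Q j)" for j
  proof (rule depends_onI)
    fix \<omega> \<omega>' :: "int \<Rightarrow> real" assume eq: "\<And>i. i \<in> {x<..x + int j} \<Longrightarrow> \<omega> i = \<omega>' i"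
    show "Q j \<omega> = Q j \<omega>'" unfolding Q_def using Idep[of j \<omega> \<omega>'] eq by auto
  qed
  have depq: "depends_on {x<..x + int j} (q j)" for j
  proof (rule depends_onI)
    fix \<omega> \<omega>' :: "int \<Rightarrow> real" assume eq: "\<And>i. i \<in> {x<..x + int j} \<Longrightarrow> \<omega> i = \<omega>' i"
    show "q j \<omega> = q j \<omega>'" unfolding q_def using depends_onD[OF dep eq] Idep[of j \<omega> \<omega>' j] eq by auto
  qed
  have disj: "i = j" if "Q i \<omega>" "Q j \<omega>" for i j \<omega>
    using that unfolding Q_def by (metis linorder_neqE_nat)
  have one: "(\<integral>\<^sup>+\<omega>. (if I j \<omega> then ennreal (exp (\<kappa> * inc \<omega> x (x + int j))) else 0) \<partial>P)
     \<le> (\<Sum>i\<le>j. (\<integral>\<^sup>+\<omega>. q i \<omega> \<partial>P) * ennreal (exp (\<kappa> / 2) * phi ^ (j - i)))" for j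
  proof -
    have "(\<integral>\<^sup>+\<omega>. (if I j \<omega> then ennreal (exp (\<kappa> * inc \<omega> x (x + int j))) else 0) \<partial>P)
       \<le> (\<integral>\<^sup>+\<omega>. (\<Sum>i\<le>j. ennreal (exp (\<kappa> / 2)) * (q i \<omega> * ennreal (exp (\<kappa> / 2 * inc \<omega> (x + int i) (x + int j))))) \<partial>P)"
    proof (rule nn_integral_mono)
      fix \<omega>
      show "(if I j \<omega> then ennreal (exp (\<kappa> * inc \<omega> x (x + int j))) else 0)
        \<le> (\<Sum>i\<le>j. ennreal (exp (\<kappa> / 2)) * (q i \<omega> * ennreal (exp (\<kappa> / 2 * inc \<omega> (x + int i) (x + int j)))))"
      proof (cases "I j \<omega>")
        case True
        define i where "i = (LEAST i. I i \<omega>)"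
        have ij: "i \<le> j" unfolding i_def by (rule Least_le) (rule True)
        have Qi: "Q i \<omega>" unfolding Q_def i_def using LeastI[of "\<lambda>i. I i \<omega>", OF True] not_less_Least by auto
        have add: "inc \<omega> x (x + int j) = inc \<omega> x (x + int i) + inc \<omega> (x + int i) (x + int j)"
          using ij by (intro inc_add[symmetric]) auto
        have "inc \<omega> (x + int i) (x + int j) \<le> 1"
          using add True Qi unfolding Q_def I_def by linarith
        then have "\<kappa> / 2 * inc \<omega> (x + int i) (x + int j) \<le> \<kappa> / 2"
          using kappa_pos by (simp add: mult_left_le)
        then have "\<kappa> * inc \<omega> x (x + int j) \<le> \<kappa> / 2 + (\<kappa> * inc \<omega> x (x + int i) + \<kappa> / 2 * inc \<omega> (x + int i) (x + int j))"
          unfolding add by (simp add: algebra_simps)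
        then have "exp (\<kappa> * inc \<omega> x (x + int j))
            \<le> exp (\<kappa> / 2) * (exp (\<kappa> * inc \<omega> x (x + int i)) * exp (\<kappa> / 2 * inc \<omega> (x + int i) (x + int j)))"
          by (simp only: exp_add[symmetric] exp_le_cancel_iff)
        then have "ennreal (exp (\<kappa> * inc \<omega> x (x + int j)))
            \<le> ennreal (exp (\<kappa> / 2)) * (q i \<omega> * ennreal (exp (\<kappa> / 2 * inc \<omega> (x + int i) (x + int j))))"
          using Qi by (simp add: q_def ennreal_mult[symmetric] ennreal_leI)
        also have "\<dots> \<le> (\<Sum>i\<le>j. ennreal (exp (\<kappa> / 2)) * (q i \<omega> * ennreal (exp (\<kappa> / 2 * inc \<omega> (x + int i) (x + int j)))))"
          using ij by (intro member_le_sum) auto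
        finally show ?thesis using True by simp
      qed simp
    qed
    also have "\<dots> = (\<Sum>i\<le>j. ennreal (exp (\<kappa> / 2)) * (\<integral>\<^sup>+\<omega>. q i \<omega> * ennreal (exp (\<kappa> / 2 * inc \<omega> (x + int i) (x + int j))) \<partial>P))"
      by (simp add: nn_integral_sum nn_integral_cmult)
    also have "\<dots> = (\<Sum>i\<le>j. (\<integral>\<^sup>+\<omega>. q i \<omega> \<partial>P) * ennreal (exp (\<kappa> / 2) * phi ^ (j - i)))"
    proof (intro sum.cong refl)
      fix i assume "i \<in> {..j}"
      have "(\<integral>\<^sup>+\<omega>. q i \<omega> * ennreal (exp (\<kappa> / 2 * inc \<omega> (x + int i) (x + int j))) \<partial>P)
          = (\<integral>\<^sup>+\<omega>. q i \<omega> \<partial>P) * mom (\<kappa> / 2) ^ nat (x + int j - (x + int i))"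
        by (rule nn_integral_step[OF _ depq]) auto
      also have "nat (x + int j - (x + int i)) = j - i" by simp
      finally show "ennreal (exp (\<kappa> / 2)) * (\<integral>\<^sup>+\<omega>. q i \<omega> * ennreal (exp (\<kappa> / 2 * inc \<omega> (x + int i) (x + int j))) \<partial>P)
          = (\<integral>\<^sup>+\<omega>. q i \<omega> \<partial>P) * ennreal (exp (\<kappa> / 2) * phi ^ (j - i))"
        using phi_nonneg by (simp add: mom_half ennreal_power ennreal_mult ac_simps)
    qed
    finally show ?thesis .
  qed
  have "(\<Sum>j\<le>n. \<integral>\<^sup>+\<omega>. (if I j \<omega> then ennreal (exp (\<kappa> * inc \<omega> x (x + int j))) else 0) \<partial>P)
    \<le> (\<Sum>j\<le>n. \<Sum>i\<le>j. (\<integral>\<^sup>+\<omega>. q i \<omega> \<partial>P) * ennreal (exp (\<kappa> / 2) * phi ^ (j - i)))"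
    by (intro sum_mono one)
  also have "\<dots> = (\<Sum>j\<le>n. \<Sum>i\<le>n. if i \<le> j then (\<integral>\<^sup>+\<omega>. q i \<omega> \<partial>P) * ennreal (exp (\<kappa> / 2) * phi ^ (j - i)) else 0)"
    by (intro sum.cong refl sum.mono_neutral_cong_left) auto
  also have "\<dots> = (\<Sum>i\<le>n. \<Sum>j\<le>n. if i \<le> j then (\<integral>\<^sup>+\<omega>. q i \<omega> \<partial>P) * ennreal (exp (\<kappa> / 2) * phi ^ (j - i)) else 0)"
    by (rule sum.swap)
  also have "\<dots> \<le> (\<Sum>i\<le>n. (\<integral>\<^sup>+\<omega>. q i \<omega> \<partial>P) * ennreal C0)"
  proof (rule sum_mono)
    fix i assume "i \<in> {..n}"
    have "(\<Sum>j\<le>n. if i \<le> j then (\<integral>\<^sup>+\<omega>. q i \<omega> \<partial>P) * ennreal (exp (\<kappa> / 2) * phi ^ (j - i)) else 0)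
      = (\<integral>\<^sup>+\<omega>. q i \<omega> \<partial>P) * (\<Sum>j\<in>{i..n}. ennreal (exp (\<kappa> / 2) * phi ^ (j - i)))"
      unfolding sum_distrib_left by (intro sum.mono_neutral_cong_right) auto
    also have "(\<Sum>j\<in>{i..n}. ennreal (exp (\<kappa> / 2) * phi ^ (j - i))) = ennreal (exp (\<kappa> / 2) * (\<Sum>j\<in>{i..n}. phi ^ (j - i)))"
      using phi_nonneg by (simp add: sum_ennreal sum_distrib_left)
    also have "\<dots> \<le> ennreal (exp (\<kappa> / 2) * (1 / (1 - phi)))"
      using phi_nonneg phi_less by (intro ennreal_leI mult_left_mono geometric_sum_inj_le) (auto simp: inj_on_def)
    finally show "(\<Sum>j\<le>n. if i \<le> j then (\<integral>\<^sup>+\<omega>. q i \<omega> \<partial>P) * ennreal (exp (\<kappa> / 2) * phi ^ (j - i)) else 0)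
       \<le> (\<integral>\<^sup>+\<omega>. q i \<omega> \<partial>P) * ennreal C0" by (simp add: C0_def mult_left_mono)
  qed
  also have "\<dots> = (\<Sum>i\<le>n. (\<integral>\<^sup>+\<omega>. q i \<omega> \<partial>P)) * ennreal C0" by (simp add: sum_distrib_right)
  also have "\<dots> \<le> 1 * ennreal C0"
    unfolding q_def by (intro mult_right_mono optional_stopping_le) (use dep disj in auto)
  finally show ?thesis by (simp add: I_def)
qed

definition C3 :: real where "C3 = C0 / (1 - exp (- (1 - \<kappa>)))"

lemma C3_pos: "0 < C3"
  using C0_pos kappa_less by (simp add: C3_def)

text \<open>Cut the range below \<open>y\<close> into unit bands. In the band at depth
  \<open>k\<close> the full exponential is at most \<open>exp ((1 - \<kappa>) * (y - k))\<close>
  times the tilted one, whose sum \<open>renewal_bound\<close> controls; the bands sum geometrically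
  because \<open>\<kappa> < 1\<close>.\<close>

lemma truncated_exponential_sum:
  "(\<Sum>j\<le>n. \<integral>\<^sup>+\<omega>. (if inc \<omega> x (x + int j) < y then ennreal (exp (inc \<omega> x (x + int j))) else 0) \<partial>P)
     \<le> ennreal (C3 * exp ((1 - \<kappa>) * y))"
proof -
  let ?S = "\<lambda>\<omega> j. inc \<omega> x (x + int j)"
  define c where "c k = ennreal (exp ((1 - \<kappa>) * (y - real k)))" for k :: nat
  define g where "g j k \<omega> = (if y - real k - 1 \<le> ?S \<omega> j \<and> ?S \<omega> j < y - real k - 1 + 1 then ennreal (exp (\<kappa> * ?S \<omega> j)) else 0)" for j k \<omega>
  have [measurable]: "g j k \<in> borel_measurable P" for j k unfolding g_def by measurable
  have "(\<Sum>j\<le>n. \<integral>\<^sup>+\<omega>. (if ?S \<omega> j < y then ennreal (exp (?S \<omega> j)) else 0) \<partial>P)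
      \<le> (\<Sum>j\<le>n. \<integral>\<^sup>+\<omega>. (\<Sum>k. c k * g j k \<omega>) \<partial>P)"
  proof (intro sum_mono nn_integral_mono)
    fix j \<omega>
    show "(if ?S \<omega> j < y then ennreal (exp (?S \<omega> j)) else 0) \<le> (\<Sum>k. c k * g j k \<omega>)"
    proof (cases "?S \<omega> j < y")
      case True
      then obtain k :: nat where k: "real k < y - ?S \<omega> j" "y - ?S \<omega> j \<le> real k + 1"
        using exists_nat_ceiling_minus_one[of "y - ?S \<omega> j"] by auto
      have "?S \<omega> j = (1 - \<kappa>) * ?S \<omega> j + \<kappa> * ?S \<omega> j" by (simp add: algebra_simps)
      also have "\<dots> \<le> (1 - \<kappa>) * (y - real k) + \<kappa> * ?S \<omega> j"
        using k kappa_less by (intro add_right_mono mult_left_mono) auto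
      finally have "exp (?S \<omega> j) \<le> exp ((1 - \<kappa>) * (y - real k)) * exp (\<kappa> * ?S \<omega> j)"
        by (simp only: exp_add[symmetric] exp_le_cancel_iff)
      then have "ennreal (exp (?S \<omega> j)) \<le> c k * g j k \<omega>"
        using k by (simp add: c_def g_def ennreal_mult[symmetric] ennreal_leI)
      also have "\<dots> \<le> (\<Sum>k. c k * g j k \<omega>)" by (rule ennreal_term_le_suminf)
      finally show ?thesis using True by simp
    qed simp
  qed
  also have "\<dots> = (\<Sum>j\<le>n. \<Sum>k. c k * (\<integral>\<^sup>+\<omega>. g j k \<omega> \<partial>P))"
    by (simp add: nn_integral_suminf nn_integral_cmult)
  also have "\<dots> = (\<Sum>k. \<Sum>j\<le>n. c k * (\<integral>\<^sup>+\<omega>. g j k \<omega> \<partial>P))"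
    by (rule suminf_sum[symmetric]) simp
  also have "\<dots> \<le> (\<Sum>k. c k * ennreal C0)"
    unfolding sum_distrib_left[symmetric] g_def
    by (intro suminf_le summableI mult_left_mono renewal_bound) auto
  also have "\<dots> = (\<Sum>k. ennreal ((C0 * exp ((1 - \<kappa>) * y)) * exp (- (1 - \<kappa>)) ^ k))"
  proof (intro arg_cong[of _ _ suminf] ext)
    fix k :: nat
    have "exp ((1 - \<kappa>) * (y - real k)) = exp ((1 - \<kappa>) * y) * exp (- (1 - \<kappa>)) ^ k"
      by (simp add: exp_of_nat_mult[symmetric] exp_add[symmetric] algebra_simps)
    then show "c k * ennreal C0 = ennreal ((C0 * exp ((1 - \<kappa>) * y)) * exp (- (1 - \<kappa>)) ^ k)"
      using C0_pos by (simp add: c_def ennreal_mult[symmetric] ac_simps)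
  qed
  also have "\<dots> = ennreal ((C0 * exp ((1 - \<kappa>) * y)) * (1 / (1 - exp (- (1 - \<kappa>)))))"
    using C0_pos kappa_less by (intro suminf_ennreal_eq sums_mult geometric_sums) auto
  also have "\<dots> = ennreal (C3 * exp ((1 - \<kappa>) * y))" by (simp add: C3_def)
  finally show ?thesis .
qed

end

lemma depends_on_mono: "depends_on A F \<Longrightarrow> A \<subseteq> B \<Longrightarrow> depends_on B F"
  unfolding depends_on_def by blast

section \<open>Lower bound for the probability of a climb\<close>

context rwre_env
begin

text \<open>Exchanging sum and integral turns the left side into a tilted mean of the number of
  \<open>k\<close> with \<open>B + k \<le> xi\<close>, which is at most \<open>xi + 1\<close> and
  lives on \<open>B \<le> xi\<close>. The logarithmic moment makes this integrable, so it vanishes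
  as \<open>B\<close> grows.\<close>

lemma overshoot_tail:
  assumes "0 < \<epsilon>"
  shows "\<exists>B\<ge>0. (\<Sum>k. \<integral>\<^sup>+x. (if B + real k \<le> xi x then ennreal (exp (\<kappa> * xi x)) else 0) \<partial>\<mu>) \<le> ennreal \<epsilon>"
proof -
  define F where "F x = exp (\<kappa> * xi x) * (max 0 (xi x) + 1)" for x
  have Fm [measurable]: "F \<in> borel_measurable \<mu>" unfolding F_def by measurable
  have "integrable \<mu> (\<lambda>x. exp (\<kappa> * xi x) * max 0 (xi x))"
  proof (rule integrable_cong_AE_imp[OF int_log])
    show "AE x in \<mu>. ((1 - x) / x) powr \<kappa> * max 0 (ln ((1 - x) / x)) = exp (\<kappa> * xi x) * max 0 (xi x)"
      using exp_xi_powr[of \<kappa>] by eventually_elim (simp add: xi_def)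
  qed simp
  then have F: "integrable \<mu> F" unfolding F_def distrib_left using int_exp by simp
  have F0: "0 \<le> F x" for x unfolding F_def by (intro mult_nonneg_nonneg) auto
  have "(\<lambda>n. \<integral>x. (if real n \<le> xi x then F x else 0) \<partial>\<mu>) \<longlonglongrightarrow> (\<integral>x. 0 \<partial>\<mu>)"
  proof (rule integral_dominated_convergence[OF _ _ F])
    show "AE x in \<mu>. (\<lambda>n. if real n \<le> xi x then F x else 0) \<longlonglongrightarrow> 0"
    proof (rule AE_I2)
      fix x
      have "eventually (\<lambda>n. xi x < real n) sequentially"
        using filterlim_real_sequentially by (simp add: filterlim_at_top_dense)
      then show "(\<lambda>n. if real n \<le> xi x then F x else 0) \<longlonglongrightarrow> 0"
        by (intro tendsto_eventually) (erule eventually_mono, simp)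
    qed
    show "\<And>i. AE x in \<mu>. norm (if real i \<le> xi x then F x else 0) \<le> F x" using F0 by auto
  qed simp_all
  then have "eventually (\<lambda>n. (\<integral>x. (if real n \<le> xi x then F x else 0) \<partial>\<mu>) < \<epsilon>) sequentially"
    using assms by (intro order_tendstoD) auto
  then obtain n :: nat where n: "(\<integral>x. (if real n \<le> xi x then F x else 0) \<partial>\<mu>) < \<epsilon>"
    by (auto simp: eventually_sequentially)
  have int: "integrable \<mu> (\<lambda>x. if real n \<le> xi x then F x else 0)"
    by (rule Bochner_Integration.integrable_bound[OF F]) (use F0 in auto)
  have "(\<Sum>k. \<integral>\<^sup>+x. (if real n + real k \<le> xi x then ennreal (exp (\<kappa> * xi x)) else 0) \<partial>\<mu>)
      = (\<integral>\<^sup>+x. (\<Sum>k. if real n + real k \<le> xi x then ennreal (exp (\<kappa> * xi x)) else 0) \<partial>\<mu>)"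
    by (rule nn_integral_suminf[symmetric]) measurable
  also have "\<dots> \<le> (\<integral>\<^sup>+x. ennreal (if real n \<le> xi x then F x else 0) \<partial>\<mu>)"
  proof (rule nn_integral_mono)
    fix x
    show "(\<Sum>k. if real n + real k \<le> xi x then ennreal (exp (\<kappa> * xi x)) else 0)
       \<le> ennreal (if real n \<le> xi x then F x else 0)"
    proof (cases "real n \<le> xi x")
      case True
      define m where "m = nat \<lfloor>xi x - real n\<rfloor>"
      have m: "real m \<le> xi x - real n" unfolding m_def using True by simp
      have out: "(if real n + real k \<le> xi x then ennreal (exp (\<kappa> * xi x)) else 0) = 0" if "k \<notin> {..m}" for k
      proof -
        have "m < k" using that by simp
        then have "\<lfloor>xi x - real n\<rfloor> < int k" unfolding m_def using True by (simp add: nat_less_iff)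
        then have "\<not> real n + real k \<le> xi x" by linarith
        then show ?thesis by simp
      qed
      have "(\<Sum>k. if real n + real k \<le> xi x then ennreal (exp (\<kappa> * xi x)) else 0)
         = (\<Sum>k\<le>m. if real n + real k \<le> xi x then ennreal (exp (\<kappa> * xi x)) else 0)"
        by (rule suminf_finite) (use out in auto)
      also have "\<dots> \<le> (\<Sum>k\<le>m. ennreal (exp (\<kappa> * xi x)))" by (intro sum_mono) auto
      also have "\<dots> = ennreal (real (Suc m) * exp (\<kappa> * xi x))"
        by (simp add: ennreal_of_nat_eq_real_of_nat ennreal_mult)
      also have "\<dots> \<le> ennreal (F x)"
        unfolding F_def using m by (intro ennreal_leI) (simp add: mult.commute mult_left_mono)
      finally show ?thesis using True by simp
    next
      case False
      then have "\<not> real n + real k \<le> xi x" for k by linarith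
      then show ?thesis by simp
    qed
  qed
  also have "\<dots> = ennreal (\<integral>x. (if real n \<le> xi x then F x else 0) \<partial>\<mu>)"
    using F0 by (intro nn_integral_eq_integral[OF int]) auto
  also have "\<dots> \<le> ennreal \<epsilon>" using n by (intro ennreal_leI) simp
  finally show ?thesis by (intro exI[of _ "real n"]) simp
qed

text \<open>Bounds the tilted mass with which a walk leaves the interval downwards: a first step
  that is not positive stops at once with value \<open>exp (\<kappa> * xi x)\<close>, and any later
  exit at or below 0 has value at most 1. Equality with 1 would force nonnegative increments and
  contradict \<open>phi_less\<close>.\<close>

lemma down_mass:
  "\<exists>c0>0. c0 \<le> 1 \<and> (\<integral>\<^sup>+x. ennreal (if xi x \<le> 0 then exp (\<kappa> * xi x) else 1) \<partial>\<mu>) \<le> ennreal (1 - c0)"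
proof -
  let ?f = "\<lambda>x. if xi x \<le> 0 then exp (\<kappa> * xi x) else 1"
  have f: "0 \<le> ?f x" "?f x \<le> 1" for x using kappa_pos by (auto simp: mult_nonneg_nonpos)
  have int: "integrable \<mu> ?f" by (rule mu.integrable_const_bound[of _ 1]) (use f in auto)
  have "(\<integral>x. 1 - ?f x \<partial>\<mu>) = 1 - (\<integral>x. ?f x \<partial>\<mu>)"
    using int mu.prob_space by simp
  moreover have "(\<integral>x. 1 - ?f x \<partial>\<mu>) \<ge> 0" by (rule Bochner_Integration.integral_nonneg) (use f in auto)
  moreover have "(\<integral>x. 1 - ?f x \<partial>\<mu>) \<noteq> 0"
  proof
    assume "(\<integral>x. 1 - ?f x \<partial>\<mu>) = 0"
    then have "AE x in \<mu>. 1 - ?f x = 0"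
      using f int by (subst (asm) integral_nonneg_eq_0_iff_AE) auto
    then have "AE x in \<mu>. 1 \<le> exp (\<kappa> / 2 * xi x)"
      by eventually_elim (use kappa_pos in \<open>auto split: if_splits\<close>)
    then have "(\<integral>x. 1 \<partial>\<mu>) \<le> (\<integral>x. exp (\<kappa> / 2 * xi x) \<partial>\<mu>)"
      by (intro integral_mono_AE int_exp_half) auto
    then show False using phi_less mu.prob_space by (simp add: phi_def)
  qed
  moreover have "0 \<le> (\<integral>x. ?f x \<partial>\<mu>)" by (rule Bochner_Integration.integral_nonneg) (use f in auto)
  moreover have "(\<integral>\<^sup>+x. ennreal (?f x) \<partial>\<mu>) = ennreal (\<integral>x. ?f x \<partial>\<mu>)"
    using f by (intro nn_integral_eq_integral[OF int]) auto
  ultimately show ?thesis by (intro exI[of _ "1 - (\<integral>x. ?f x \<partial>\<mu>)"]) auto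
qed

text \<open>Stop on leaving the interval from 0 to \<open>y\<close>. Of the total mass 1, at most
  \<open>1 - c0\<close> leaves downwards, \<open>c0 / 4\<close> overshoots \<open>y\<close> by more
  than \<open>B\<close>, and \<open>c0 / 4\<close> is still inside at time \<open>n\<close>. The
  remaining \<open>c0 / 2\<close> leaves upwards with value below
  \<open>exp (\<kappa> * (y + B))\<close>, which bounds the probability from below.\<close>

lemma rise_prob_lower:
  "\<exists>c>0. \<exists>C2>0. \<forall>y>0. \<forall>n x. C2 * (y + 1) \<le> real n \<longrightarrow> c * exp (- (\<kappa> * y)) \<le> measure P {\<omega>. rise \<omega> x y n}"
proof -
  obtain c0 where c0: "0 < c0" "c0 \<le> 1"
    and down: "(\<integral>\<^sup>+x. ennreal (if xi x \<le> 0 then exp (\<kappa> * xi x) else 1) \<partial>\<mu>) \<le> ennreal (1 - c0)"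
    using down_mass by blast
  obtain B where B: "0 \<le> B" and
    over: "(\<Sum>k. \<integral>\<^sup>+x. (if B + real k \<le> xi x then ennreal (exp (\<kappa> * xi x)) else 0) \<partial>\<mu>) \<le> ennreal (c0 / (4 * C0))"
    using overshoot_tail[of "c0 / (4 * C0)"] c0 C0_pos by auto
  define lam where "lam = - ln phi"
  have lam: "0 < lam" "phi = exp (- lam)" unfolding lam_def using phi_pos phi_less by auto
  \<comment> \<open>Chosen so that \<open>exp (\<kappa> / 2 * y) * phi ^ n\<close>, the bound for
    the mass still inside, is at most \<open>c0 / 4\<close> once \<open>n\<close> reaches
    \<open>C2 * (y + 1)\<close>.\<close>
  define C2 where "C2 = (\<kappa> / 2 + ln (4 / c0)) / lam + 1"
  have l4: "0 < ln (4 / c0)" using c0 by (intro ln_gt_zero) auto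
  have C2: "0 < C2" unfolding C2_def using l4 kappa_pos lam by (intro add_nonneg_pos divide_nonneg_pos) auto
  show ?thesis
  proof (intro exI conjI allI impI)
    show "0 < c0 / 2 * exp (- (\<kappa> * B))" "0 < C2" using c0 C2 by auto
    fix y :: real and n :: nat and x :: int
    assume y: "0 < y" and n: "C2 * (y + 1) \<le> real n"
    let ?S = "\<lambda>\<omega> j. inc \<omega> x (x + int j)"
    define Q where "Q j \<omega> \<longleftrightarrow> 1 \<le> j \<and> \<not> (0 < ?S \<omega> j \<and> ?S \<omega> j < y) \<and> (\<forall>i\<in>{1..<j}. 0 < ?S \<omega> i \<and> ?S \<omega> i < y)" for j \<omega>
    have [measurable]: "Measurable.pred P (Q j)" for j unfolding Q_def by measurable
    have dep: "depends_on {x<..x + int j} (Q j)" for j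
    proof (rule depends_onI)
      fix \<omega> \<omega>' :: "int \<Rightarrow> real" assume eq: "\<And>i. i \<in> {x<..x + int j} \<Longrightarrow> \<omega> i = \<omega>' i"
      have "?S \<omega> i = ?S \<omega>' i" if "i \<le> j" for i
        using inc_cong[of x j \<omega> \<omega>' i] eq that by blast
      then show "Q j \<omega> = Q j \<omega>'" unfolding Q_def by auto
    qed
    have disj: "i = j" if "Q i \<omega>" "Q j \<omega>" for i j \<omega>
    proof (rule ccontr)
      assume "i \<noteq> j"
      then consider "i < j" | "j < i" by linarith
      then show False using that unfolding Q_def by cases auto
    qed
    define Dn where "Dn j \<omega> = (if Q j \<omega> \<and> ?S \<omega> j \<le> 0 then ennreal (exp (\<kappa> * ?S \<omega> j)) else 0)" for j \<omega>
    define Up where "Up j \<omega> = (if Q j \<omega> \<and> y \<le> ?S \<omega> j \<and> ?S \<omega> j < y + B then ennreal (exp (\<kappa> * ?S \<omega> j)) else 0)" for j \<omega>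
    define Ov where "Ov j \<omega> = (if Q j \<omega> \<and> y + B \<le> ?S \<omega> j then ennreal (exp (\<kappa> * ?S \<omega> j)) else 0)" for j \<omega>
    have [measurable]: "Dn j \<in> borel_measurable P" "Up j \<in> borel_measurable P" "Ov j \<in> borel_measurable P" for j
      unfolding Dn_def Up_def Ov_def by measurable
    have at_most_one: "(\<Sum>j\<le>n. ff j) \<le> z" if "\<And>j. \<not> Q j \<omega> \<Longrightarrow> ff j = 0" "\<And>j. j \<le> n \<Longrightarrow> Q j \<omega> \<Longrightarrow> ff j \<le> z"
      for ff \<omega> and z :: ennreal
    proof (cases "\<exists>j\<le>n. Q j \<omega>")
      case True
      then obtain j where j: "j \<le> n" "Q j \<omega>" by blast
      have "(\<Sum>i\<le>n. ff i) = (\<Sum>i\<in>{j}. ff i)"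
        using j disj that(1) by (intro sum.mono_neutral_right) auto
      then show ?thesis using that(2)[OF j] by simp
    next
      case False
      then have "(\<Sum>i\<le>n. ff i) = 0" using that(1) by (intro sum.neutral) auto
      then show ?thesis by simp
    qed
    have "(\<integral>\<^sup>+\<omega>. (if Q j \<omega> then ennreal (exp (\<kappa> * ?S \<omega> j)) else 0) \<partial>P)
        \<le> (\<integral>\<^sup>+\<omega>. Dn j \<omega> \<partial>P) + (\<integral>\<^sup>+\<omega>. Up j \<omega> \<partial>P) + (\<integral>\<^sup>+\<omega>. Ov j \<omega> \<partial>P)" for j
    proof -
      have "(\<integral>\<^sup>+\<omega>. (if Q j \<omega> then ennreal (exp (\<kappa> * ?S \<omega> j)) else 0) \<partial>P)
        \<le> (\<integral>\<^sup>+\<omega>. Dn j \<omega> + Up j \<omega> + Ov j \<omega> \<partial>P)"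
      proof (rule nn_integral_mono)
        fix \<omega>
        have "?S \<omega> j \<le> 0 \<or> y \<le> ?S \<omega> j" if "Q j \<omega>" using that by (auto simp: Q_def)
        then show "(if Q j \<omega> then ennreal (exp (\<kappa> * ?S \<omega> j)) else 0) \<le> Dn j \<omega> + Up j \<omega> + Ov j \<omega>"
          by (auto simp: Dn_def Up_def Ov_def not_le not_less)
      qed
      also have "\<dots> = (\<integral>\<^sup>+\<omega>. Dn j \<omega> \<partial>P) + (\<integral>\<^sup>+\<omega>. Up j \<omega> \<partial>P) + (\<integral>\<^sup>+\<omega>. Ov j \<omega> \<partial>P)"
        by (simp add: nn_integral_add)
      finally show ?thesis .
    qed
    then have split: "(\<Sum>j\<le>n. \<integral>\<^sup>+\<omega>. (if Q j \<omega> then ennreal (exp (\<kappa> * ?S \<omega> j)) else 0) \<partial>P)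
      \<le> (\<Sum>j\<le>n. \<integral>\<^sup>+\<omega>. Dn j \<omega> \<partial>P) + (\<Sum>j\<le>n. \<integral>\<^sup>+\<omega>. Up j \<omega> \<partial>P) + (\<Sum>j\<le>n. \<integral>\<^sup>+\<omega>. Ov j \<omega> \<partial>P)"
      by (simp add: sum.distrib[symmetric] sum_mono)
    have D: "(\<Sum>j\<le>n. \<integral>\<^sup>+\<omega>. Dn j \<omega> \<partial>P) \<le> ennreal (1 - c0)"
    proof -
      let ?f = "\<lambda>z. ennreal (if xi z \<le> 0 then exp (\<kappa> * xi z) else 1)"
      have "(\<Sum>j\<le>n. \<integral>\<^sup>+\<omega>. Dn j \<omega> \<partial>P) = (\<integral>\<^sup>+\<omega>. (\<Sum>j\<le>n. Dn j \<omega>) \<partial>P)"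
        by (rule nn_integral_sum[symmetric]) measurable
      also have "\<dots> \<le> (\<integral>\<^sup>+\<omega>. ?f (\<omega> (x + 1)) \<partial>P)"
      proof (rule nn_integral_mono)
        fix \<omega>
        have S1: "?S \<omega> 1 = xi (\<omega> (x + 1))" using inc_Suc[of \<omega> x 0] by simp
        show "(\<Sum>j\<le>n. Dn j \<omega>) \<le> ?f (\<omega> (x + 1))"
        proof (rule at_most_one[of \<omega>])
          fix j assume "Q j \<omega>"
          show "Dn j \<omega> \<le> ?f (\<omega> (x + 1))"
          proof (cases "xi (\<omega> (x + 1)) \<le> 0")
            case True
            then have "Q 1 \<omega>" unfolding Q_def S1 by auto
            then have "j = 1" using disj \<open>Q j \<omega>\<close> by blast
            then show ?thesis using True S1 by (simp add: Dn_def)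
          next
            case False
            then show ?thesis using kappa_pos by (auto simp: Dn_def mult_nonneg_nonpos intro!: ennreal_leI[of _ 1, simplified])
          qed
        qed (simp add: Dn_def)
      qed
      also have "\<dots> = (\<integral>\<^sup>+z. ?f z \<partial>\<mu>)" by (rule nn_integral_component) measurable
      finally show ?thesis using down by (rule order_trans)
    qed
    have U: "(\<Sum>j\<le>n. \<integral>\<^sup>+\<omega>. Up j \<omega> \<partial>P) \<le> ennreal (exp (\<kappa> * (y + B)) * measure P {\<omega>. rise \<omega> x y n})"
    proof -
      have R: "{\<omega>. rise \<omega> x y n} \<in> sets P" using predE[OF rise_measurable] by simp
      have "(\<Sum>j\<le>n. \<integral>\<^sup>+\<omega>. Up j \<omega> \<partial>P) = (\<integral>\<^sup>+\<omega>. (\<Sum>j\<le>n. Up j \<omega>) \<partial>P)"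
        by (rule nn_integral_sum[symmetric]) measurable
      also have "\<dots> \<le> (\<integral>\<^sup>+\<omega>. ennreal (exp (\<kappa> * (y + B))) * indicator {\<omega>. rise \<omega> x y n} \<omega> \<partial>P)"
      proof (rule nn_integral_mono, rule at_most_one)
        fix \<omega> j assume j: "j \<le> n" "Q j \<omega>"
        show "Up j \<omega> \<le> ennreal (exp (\<kappa> * (y + B))) * indicator {\<omega>. rise \<omega> x y n} \<omega>"
        proof (cases "y \<le> ?S \<omega> j \<and> ?S \<omega> j < y + B")
          case True
          have "0 < ?S \<omega> i" if "i \<in> {1..j}" for i
            using that j(2) True y by (cases "i = j") (auto simp: Q_def)
          then have "rise \<omega> x y n" unfolding rise_def using j True by (auto simp: Q_def)
          then show ?thesis using True kappa_pos by (auto simp: Up_def intro!: ennreal_leI)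
        qed (auto simp: Up_def)
      qed (simp add: Up_def)
      also have "\<dots> = ennreal (exp (\<kappa> * (y + B)) * measure P {\<omega>. rise \<omega> x y n})"
        using R by (simp add: nn_integral_cmult P.emeasure_eq_measure ennreal_mult)
      finally show ?thesis .
    qed
    have O: "(\<Sum>j\<le>n. \<integral>\<^sup>+\<omega>. Ov j \<omega> \<partial>P) \<le> ennreal (c0 / 4)"
    proof -
      \<comment> \<open>Sort by the unit band below \<open>y\<close> from which the last jump
        starts. From depth at least \<open>k\<close> the jump must exceed \<open>B + k\<close>,
        independently of the past; summing over the time \<open>i\<close> leaves a factor
        \<open>C0\<close> for each band.\<close>
      define g where "g i k \<omega> = (if y - real k - 1 \<le> ?S \<omega> i \<and> ?S \<omega> i < y - real k - 1 + 1 then ennreal (exp (\<kappa> * ?S \<omega> i)) else 0)" for i \<omega> and k :: nat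
      define r where "r k z = (if B + real k \<le> xi z then ennreal (exp (\<kappa> * xi z)) else 0)" for z and k :: nat
      have [measurable]: "g i k \<in> borel_measurable P" "r k \<in> borel_measurable borel" for i k unfolding g_def r_def by measurable
      have O0: "Ov 0 = (\<lambda>_. 0)" by (simp add: Ov_def Q_def fun_eq_iff)
      have "(\<integral>\<^sup>+\<omega>. Ov (Suc i) \<omega> \<partial>P) \<le> (\<Sum>k. (\<integral>\<^sup>+\<omega>. g i k \<omega> \<partial>P) * (\<integral>\<^sup>+z. r k z \<partial>\<mu>))" for i
      proof -
        have "(\<integral>\<^sup>+\<omega>. Ov (Suc i) \<omega> \<partial>P) \<le> (\<integral>\<^sup>+\<omega>. (\<Sum>k. g i k \<omega> * r k (\<omega> (x + int i + 1))) \<partial>P)"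
        proof (rule nn_integral_mono)
          fix \<omega>
          show "Ov (Suc i) \<omega> \<le> (\<Sum>k. g i k \<omega> * r k (\<omega> (x + int i + 1)))"
          proof (cases "Q (Suc i) \<omega> \<and> y + B \<le> ?S \<omega> (Suc i)")
            case True
            have Si: "?S \<omega> i < y"
            proof (cases "i = 0")
              case False
              then have "i \<in> {1..<Suc i}" by simp
              then show ?thesis using True unfolding Q_def by blast
            qed (use y in simp)
            then obtain k :: nat where k: "real k < y - ?S \<omega> i" "y - ?S \<omega> i \<le> real k + 1"
              using exists_nat_ceiling_minus_one[of "y - ?S \<omega> i"] by auto
            have eq: "?S \<omega> (Suc i) = ?S \<omega> i + xi (\<omega> (x + int i + 1))" by (rule inc_Suc)
            then have "B + real k \<le> xi (\<omega> (x + int i + 1))" using True k by linarith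
            then have "Ov (Suc i) \<omega> = g i k \<omega> * r k (\<omega> (x + int i + 1))"
              using True k unfolding Ov_def g_def r_def eq by (simp add: ennreal_mult[symmetric] exp_add[symmetric] distrib_left)
            also have "\<dots> \<le> (\<Sum>k. g i k \<omega> * r k (\<omega> (x + int i + 1)))" by (rule ennreal_term_le_suminf)
            finally show ?thesis .
          next
            case False then show ?thesis by (auto simp: Ov_def)
          qed
        qed
        also have "\<dots> = (\<Sum>k. \<integral>\<^sup>+\<omega>. g i k \<omega> * r k (\<omega> (x + int i + 1)) \<partial>P)"
          by (rule nn_integral_suminf) measurable
        also have "\<dots> = (\<Sum>k. (\<integral>\<^sup>+\<omega>. g i k \<omega> \<partial>P) * (\<integral>\<^sup>+z. r k z \<partial>\<mu>))"
        proof (intro arg_cong[of _ _ suminf] ext)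
          fix k
          have dg: "depends_on {x<..x + int i} (g i k)"
          proof (rule depends_onI)
            fix \<omega> \<omega>' :: "int \<Rightarrow> real" assume eq: "\<And>l. l \<in> {x<..x + int i} \<Longrightarrow> \<omega> l = \<omega>' l"
            show "g i k \<omega> = g i k \<omega>'" unfolding g_def using inc_cong[of x i \<omega> \<omega>' i] eq by simp
          qed
          have "(\<integral>\<^sup>+\<omega>. g i k \<omega> * r k (\<omega> (x + int i + 1)) \<partial>P)
              = (\<integral>\<^sup>+\<omega>. g i k \<omega> \<partial>P) * (\<integral>\<^sup>+\<omega>. r k (\<omega> (x + int i + 1)) \<partial>P)"
            by (rule nn_integral_indep[OF _ _ dg, of _ "{x + int i + 1}"]) (auto intro!: depends_onI)
          then show "(\<integral>\<^sup>+\<omega>. g i k \<omega> * r k (\<omega> (x + int i + 1)) \<partial>P) = (\<integral>\<^sup>+\<omega>. g i k \<omega> \<partial>P) * (\<integral>\<^sup>+z. r k z \<partial>\<mu>)"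
            by (simp add: nn_integral_component)
        qed
        finally show ?thesis .
      qed
      then have step: "(\<Sum>i\<le>n. \<integral>\<^sup>+\<omega>. Ov (Suc i) \<omega> \<partial>P) \<le> (\<Sum>i\<le>n. \<Sum>k. (\<integral>\<^sup>+\<omega>. g i k \<omega> \<partial>P) * (\<integral>\<^sup>+z. r k z \<partial>\<mu>))"
        by (intro sum_mono)
      have "(\<Sum>j\<le>n. \<integral>\<^sup>+\<omega>. Ov j \<omega> \<partial>P) \<le> (\<Sum>j\<le>Suc n. \<integral>\<^sup>+\<omega>. Ov j \<omega> \<partial>P)" by (rule sum_mono2) auto
      also have "\<dots> = (\<Sum>i\<le>n. \<integral>\<^sup>+\<omega>. Ov (Suc i) \<omega> \<partial>P)" by (subst sum.atMost_Suc_shift) (simp add: O0)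
      also note step
      also have "(\<Sum>i\<le>n. \<Sum>k. (\<integral>\<^sup>+\<omega>. g i k \<omega> \<partial>P) * (\<integral>\<^sup>+z. r k z \<partial>\<mu>))
          = (\<Sum>k. \<Sum>i\<le>n. (\<integral>\<^sup>+\<omega>. g i k \<omega> \<partial>P) * (\<integral>\<^sup>+z. r k z \<partial>\<mu>))"
        by (rule suminf_sum[symmetric]) simp
      also have "\<dots> \<le> (\<Sum>k. ennreal C0 * (\<integral>\<^sup>+z. r k z \<partial>\<mu>))"
        unfolding sum_distrib_right[symmetric] g_def
        by (intro suminf_le summableI mult_right_mono renewal_bound) auto
      also have "\<dots> = ennreal C0 * (\<Sum>k. \<integral>\<^sup>+z. r k z \<partial>\<mu>)" by simp
      also have "\<dots> \<le> ennreal C0 * ennreal (c0 / (4 * C0))"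
        using over unfolding r_def by (intro mult_left_mono) auto
      also have "\<dots> = ennreal (c0 / 4)" using C0_pos c0 by (simp add: ennreal_mult[symmetric])
      finally show ?thesis .
    qed
    \<comment> \<open>Not having left means lying below \<open>y\<close> at time \<open>n\<close>,
      so half of the exponent is at most \<open>\<kappa> / 2 * y\<close> and the other half decays
      like \<open>phi ^ n\<close>.\<close>
    have E: "(\<integral>\<^sup>+\<omega>. (if \<forall>j\<le>n. \<not> Q j \<omega> then ennreal (exp (\<kappa> * ?S \<omega> n)) else 0) \<partial>P) \<le> ennreal (c0 / 4)"
    proof -
      have n1: "1 \<le> n"
      proof -
        have "0 < C2 * (y + 1)" using C2 y by simp
        then show ?thesis using n by (cases n) auto
      qed
      have "(\<integral>\<^sup>+\<omega>. (if \<forall>j\<le>n. \<not> Q j \<omega> then ennreal (exp (\<kappa> * ?S \<omega> n)) else 0) \<partial>P)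
        \<le> (\<integral>\<^sup>+\<omega>. ennreal (exp (\<kappa> / 2 * y)) * ennreal (exp (\<kappa> / 2 * ?S \<omega> n)) \<partial>P)"
      proof (rule nn_integral_mono)
        fix \<omega>
        show "(if \<forall>j\<le>n. \<not> Q j \<omega> then ennreal (exp (\<kappa> * ?S \<omega> n)) else 0)
            \<le> ennreal (exp (\<kappa> / 2 * y)) * ennreal (exp (\<kappa> / 2 * ?S \<omega> n))"
        proof (cases "\<forall>j\<le>n. \<not> Q j \<omega>")
          case True
          have "0 < ?S \<omega> i \<and> ?S \<omega> i < y" if "i \<in> {1..n}" for i
            using that
          proof (induction i rule: less_induct)
            case (less i)
            then have "\<forall>k\<in>{1..<i}. 0 < ?S \<omega> k \<and> ?S \<omega> k < y" by auto
            moreover have "\<not> Q i \<omega>" using True less(2) by auto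
            moreover have "1 \<le> i" using less(2) by simp
            ultimately show ?case by (simp add: Q_def)
          qed
          then have "?S \<omega> n < y" using n1 by auto
          then have "\<kappa> / 2 * ?S \<omega> n \<le> \<kappa> / 2 * y" using kappa_pos by (intro mult_left_mono) auto
          then have "\<kappa> * ?S \<omega> n \<le> \<kappa> / 2 * y + \<kappa> / 2 * ?S \<omega> n" by simp
          then have "exp (\<kappa> * ?S \<omega> n) \<le> exp (\<kappa> / 2 * y) * exp (\<kappa> / 2 * ?S \<omega> n)"
            by (simp only: exp_add[symmetric] exp_le_cancel_iff)
          then show ?thesis using True by (simp add: ennreal_mult[symmetric] ennreal_leI)
        qed auto
      qed
      also have "\<dots> = ennreal (exp (\<kappa> / 2 * y)) * mom (\<kappa> / 2) ^ n"
        using nn_integral_exp_inc[of "\<kappa> / 2" x "x + int n"] by (simp add: nn_integral_cmult)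
      also have "\<dots> = ennreal (exp (\<kappa> / 2 * y) * phi ^ n)"
        using phi_nonneg by (simp add: mom_half ennreal_power ennreal_mult)
      also have "\<dots> \<le> ennreal (c0 / 4)"
      proof (rule ennreal_leI)
        have "lam * (C2 * (y + 1)) = (\<kappa> / 2 + ln (4 / c0)) * (y + 1) + lam * (y + 1)"
          unfolding C2_def using lam by (simp add: field_simps)
        moreover have "\<kappa> / 2 * y + ln (4 / c0) \<le> (\<kappa> / 2 + ln (4 / c0)) * (y + 1)"
          using mult_nonneg_nonneg[of "ln (4 / c0)" y] l4 y kappa_pos
          by (simp only: distrib_left distrib_right mult_1_right) linarith
        moreover have "lam * (C2 * (y + 1)) \<le> lam * real n" using n lam by simp
        moreover have "0 \<le> lam * (y + 1)" using lam y by simp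
        ultimately have "\<kappa> / 2 * y + - (lam * real n) \<le> - ln (4 / c0)" by linarith
        moreover have "- ln (4 / c0) = ln (c0 / 4)" using c0 by (simp add: ln_div)
        ultimately have "exp (\<kappa> / 2 * y) * exp (- (lam * real n)) \<le> exp (ln (c0 / 4))"
          by (simp only: exp_add[symmetric] exp_le_cancel_iff)
        moreover have "phi ^ n = exp (- (lam * real n))"
          unfolding lam(2) by (simp add: exp_of_nat_mult[symmetric] mult.commute)
        ultimately show "exp (\<kappa> / 2 * y) * phi ^ n \<le> c0 / 4" using c0 by simp
      qed
      finally show ?thesis .
    qed
    define m where "m = exp (\<kappa> * (y + B)) * measure P {\<omega>. rise \<omega> x y n}"
    have m0: "0 \<le> m" unfolding m_def by simp
    define p1 p2 where "p1 = 1 - c0" and "p2 = c0 / 4"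
    have p: "0 \<le> p1" "0 \<le> p2" using c0 by (auto simp: p1_def p2_def)
    have "1 = (\<Sum>j\<le>n. \<integral>\<^sup>+\<omega>. (if Q j \<omega> then ennreal (exp (\<kappa> * ?S \<omega> j)) else 0) \<partial>P)
       + (\<integral>\<^sup>+\<omega>. (if \<forall>j\<le>n. \<not> Q j \<omega> then ennreal (exp (\<kappa> * ?S \<omega> n)) else 0) \<partial>P)"
      by (rule optional_stopping[symmetric]) (use dep disj in auto)
    also have "\<dots> \<le> (ennreal p1 + ennreal m + ennreal p2) + ennreal p2"
      unfolding p1_def p2_def by (intro add_mono E order_trans[OF split] D U[folded m_def] O)
    also have "\<dots> = ennreal (p1 + m + p2 + p2)" using p m0 by (simp only: ennreal_plus add_nonneg_nonneg)
    finally have "ennreal 1 \<le> ennreal (p1 + m + p2 + p2)" by simp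
    then have "1 \<le> p1 + m + p2 + p2" using p m0 by (subst (asm) ennreal_le_iff) auto
    then have "c0 / 2 \<le> m" by (simp add: p1_def p2_def)
    then have "c0 / 2 * exp (- (\<kappa> * (y + B))) \<le> m * exp (- (\<kappa> * (y + B)))" by (intro mult_right_mono) auto
    also have "\<dots> = measure P {\<omega>. rise \<omega> x y n}" unfolding m_def by (simp add: exp_minus)
    finally have "c0 / 2 * exp (- (\<kappa> * (y + B))) \<le> measure P {\<omega>. rise \<omega> x y n}" .
    then show "c0 / 2 * exp (- (\<kappa> * B)) * exp (- (\<kappa> * y)) \<le> measure P {\<omega>. rise \<omega> x y n}"
    proof -
      have "exp (- (\<kappa> * (y + B))) = exp (- (\<kappa> * B)) * exp (- (\<kappa> * y))"
        by (simp add: exp_add[symmetric] algebra_simps)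
      then show ?thesis using \<open>c0 / 2 * exp (- (\<kappa> * (y + B))) \<le> measure P {\<omega>. rise \<omega> x y n}\<close>
        by (simp add: mult.assoc)
    qed
  qed
qed

lemma measure_indep:
  assumes "Measurable.pred P E" "Measurable.pred P F" "depends_on A E" "depends_on B F" "A \<inter> B = {}"
  shows "measure P {\<omega>. E \<omega> \<and> F \<omega>} = measure P {\<omega>. E \<omega>} * measure P {\<omega>. F \<omega>}"
proof -
  have sets: "{\<omega>. E \<omega>} \<in> sets P" "{\<omega>. F \<omega>} \<in> sets P" using predE[OF assms(1)] predE[OF assms(2)] by simp_all
  then have sets2: "{\<omega>. E \<omega> \<and> F \<omega>} \<in> sets P" by (simp add: Collect_conj_eq sets.Int)
  have "emeasure P {\<omega>. E \<omega> \<and> F \<omega>} = (\<integral>\<^sup>+\<omega>. indicator {\<omega>. E \<omega>} \<omega> * indicator {\<omega>. F \<omega>} \<omega> \<partial>P)"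
    using sets2 by (simp add: nn_integral_indicator[symmetric] Collect_conj_eq indicator_inter_arith)
  also have "\<dots> = (\<integral>\<^sup>+\<omega>. indicator {\<omega>. E \<omega>} \<omega> \<partial>P) * (\<integral>\<^sup>+\<omega>. indicator {\<omega>. F \<omega>} \<omega> \<partial>P)"
  proof (rule nn_integral_indep[OF _ _ _ _ assms(5)])
    show "depends_on A (\<lambda>\<omega>. indicator {\<omega>. E \<omega>} \<omega> :: ennreal)" "depends_on B (\<lambda>\<omega>. indicator {\<omega>. F \<omega>} \<omega> :: ennreal)"
      using assms(3,4) unfolding depends_on_def indicator_def by auto
  qed (use sets in auto)
  finally show ?thesis using sets sets2 by (simp add: P.emeasure_eq_measure ennreal_mult[symmetric])
qed

text \<open>Second moment method. The number \<open>Z\<close> of sites at which a rise starts has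
  mean \<open>m \<ge> N * q\<close>, and correlations decay geometrically, so its variance is at
  most \<open>C * m\<close> and Chebyshev gives \<open>C / m\<close> for
  \<open>Z = 0\<close>.\<close>

lemma no_rise_prob:
  assumes q: "\<And>k. k < N \<Longrightarrow> q \<le> measure P {\<omega>. rise \<omega> (x + int k) y n}" and "0 < q" "0 < N"
  shows "measure P {\<omega>. \<forall>k<N. \<not> rise \<omega> (x + int k) y n} \<le> (4 / (1 - phi)) / (real N * q)"
proof -
  define A where "A k = {\<omega>. rise \<omega> (x + int k) y n}" for k
  have A [measurable]: "A k \<in> sets P" for k unfolding A_def using predE[OF rise_measurable] by simp
  define pk where "pk k = measure P (A k)" for k
  define m where "m = (\<Sum>k<N. pk k)"
  have pk0: "0 \<le> pk k" for k by (simp add: pk_def)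
  have m: "real N * q \<le> m"
  proof -
    have "(\<Sum>k<N. q) \<le> m" unfolding m_def pk_def A_def by (intro sum_mono q) auto
    then show ?thesis by simp
  qed
  have mpos: "0 < m" using m assms(2,3) by (smt (verit) mult_pos_pos of_nat_0_less_iff)
  \<comment> \<open>Either the rise from \<open>k\<close> is complete by \<open>l\<close>, and then
    it is independent of the rise from \<open>l\<close>, or the potential at \<open>l\<close> has
    not fallen below its value at \<open>k\<close>. Both alternatives depend only on sites up to
    \<open>l\<close>.\<close>
  have lt: "measure P (A k \<inter> A l) \<le> pk k * pk l + phi ^ (l - k) * pk l" if "k < l" for k l
  proof -
    define E where "E \<omega> = rise \<omega> (x + int k) y (min n (l - k))" for \<omega>
    define G where "G \<omega> \<longleftrightarrow> 0 \<le> inc \<omega> (x + int k) (x + int k + int (l - k))" for \<omega>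
    have pE [measurable]: "Measurable.pred P E" and pG [measurable]: "Measurable.pred P G" unfolding E_def G_def by measurable
    have xl: "x + int l = x + int k + int (l - k)" using that by simp
    have sub: "A k \<inter> A l \<subseteq> {\<omega>. E \<omega> \<and> rise \<omega> (x + int l) y n} \<union> {\<omega>. G \<omega> \<and> rise \<omega> (x + int l) y n}"
    proof
      fix \<omega> assume w: "\<omega> \<in> A k \<inter> A l"
      then obtain j where j: "j \<in> {1..n}" "y \<le> inc \<omega> (x + int k) (x + int k + int j)"
        "\<forall>i\<in>{1..j}. 0 < inc \<omega> (x + int k) (x + int k + int i)"
        unfolding A_def rise_def by auto
      show "\<omega> \<in> {\<omega>. E \<omega> \<and> rise \<omega> (x + int l) y n} \<union> {\<omega>. G \<omega> \<and> rise \<omega> (x + int l) y n}"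
      proof (cases "j \<le> l - k")
        case True
        then have "E \<omega>" unfolding E_def rise_def using j by (intro bexI[of _ j]) auto
        then show ?thesis using w by (auto simp: A_def)
      next
        case False
        then have "G \<omega>" unfolding G_def using j(3)[rule_format, of "l - k"] that by (intro less_imp_le) auto
        then show ?thesis using w by (auto simp: A_def)
      qed
    qed
    have dE: "depends_on {x + int k<..x + int l} E"
      unfolding E_def by (rule depends_on_mono[OF depends_on_rise]) (use that in auto)
    have dG: "depends_on {x + int k<..x + int l} G"
    proof (rule depends_onI)
      fix \<omega> \<omega>' :: "int \<Rightarrow> real" assume eq: "\<And>i. i \<in> {x + int k<..x + int l} \<Longrightarrow> \<omega> i = \<omega>' i"
      have "inc \<omega> (x + int k) (x + int l) = inc \<omega>' (x + int k) (x + int l)"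
        by (rule depends_onD[OF depends_on_inc[OF order_refl] eq])
      then show "G \<omega> = G \<omega>'" unfolding G_def xl by simp
    qed
    have disj: "{x + int k<..x + int l} \<inter> {x + int l<..x + int l + int n} = {}" by auto
    have sE: "{\<omega>. E \<omega>} \<in> sets P" "{\<omega>. G \<omega>} \<in> sets P" using predE[OF pE] predE[OF pG] by simp_all
    have "measure P (A k \<inter> A l) \<le> measure P ({\<omega>. E \<omega> \<and> rise \<omega> (x + int l) y n} \<union> {\<omega>. G \<omega> \<and> rise \<omega> (x + int l) y n})"
      using sE A[of l] by (intro P.finite_measure_mono[OF sub] sets.Un) (auto simp: Collect_conj_eq A_def)
    also have "\<dots> \<le> measure P {\<omega>. E \<omega> \<and> rise \<omega> (x + int l) y n} + measure P {\<omega>. G \<omega> \<and> rise \<omega> (x + int l) y n}"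
      using sE A[of l] by (intro measure_Un_le) (auto simp: Collect_conj_eq A_def)
    also have "\<dots> = measure P {\<omega>. E \<omega>} * pk l + measure P {\<omega>. G \<omega>} * pk l"
      by (simp add: measure_indep[OF _ _ dE depends_on_rise disj] measure_indep[OF _ _ dG depends_on_rise disj] pk_def A_def)
    also have "\<dots> \<le> pk k * pk l + phi ^ (l - k) * pk l"
    proof (intro add_mono mult_right_mono pk0)
      have "{\<omega>. E \<omega>} \<subseteq> A k" unfolding E_def A_def rise_def by (auto; force)
      then show "measure P {\<omega>. E \<omega>} \<le> pk k" unfolding pk_def by (intro P.finite_measure_mono A)
      show "measure P {\<omega>. G \<omega>} \<le> phi ^ (l - k)"
        using measure_inc_ge[of 0 "x + int k" "l - k"] unfolding G_def by simp
    qed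
    finally show ?thesis .
  qed
  \<comment> \<open>With truncated subtraction the exponent is the distance between \<open>k\<close>
    and \<open>l\<close>.\<close>
  let ?r = "\<lambda>k l. phi ^ ((k - l) + (l - k))"
  have pair: "measure P (A k \<inter> A l) \<le> pk k * pk l + ?r k l * (pk k + pk l)" for k l
  proof -
    consider "k < l" | "l < k" | "k = l" by linarith
    then show ?thesis
    proof cases
      case 1
      have "phi ^ (l - k) * pk l \<le> ?r k l * (pk k + pk l)"
        using 1 phi_nonneg pk0[of k] by (simp add: mult_left_mono)
      then show ?thesis using lt[OF 1] by linarith
    next
      case 2
      have "phi ^ (k - l) * pk k \<le> ?r k l * (pk k + pk l)"
        using 2 phi_nonneg pk0[of l] by (simp add: mult_left_mono)
      then show ?thesis using lt[OF 2] by (simp add: Int_commute mult.commute)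
    next
      case 3
      then show ?thesis using pk0[of k] by (simp add: pk_def)
    qed
  qed
  have rsum: "(\<Sum>l<N. ?r k l) \<le> 2 / (1 - phi)" for k
  proof -
    have "(\<Sum>l<N. ?r k l) \<le> (\<Sum>l\<in>{..k}. ?r k l) + (\<Sum>l\<in>{k..k+N}. ?r k l)"
    proof -
      have "(\<Sum>l<N. ?r k l) \<le> (\<Sum>l\<in>{..k} \<union> {k..k+N}. ?r k l)"
        using phi_nonneg by (intro sum_mono2) auto
      also have "\<dots> \<le> (\<Sum>l\<in>{..k}. ?r k l) + (\<Sum>l\<in>{k..k+N}. ?r k l)"
        using phi_nonneg by (subst sum_Un) (auto intro!: sum_nonneg)
      finally show ?thesis .
    qed
    also have "(\<Sum>l\<in>{..k}. ?r k l) = (\<Sum>l\<in>{..k}. phi ^ (k - l))" by (intro sum.cong) auto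
    also have "\<dots> \<le> 1 / (1 - phi)" using phi_nonneg phi_less by (intro geometric_sum_inj_le) (auto simp: inj_on_def)
    also have "(\<Sum>l\<in>{k..k+N}. ?r k l) = (\<Sum>l\<in>{k..k+N}. phi ^ (l - k))" by (intro sum.cong) auto
    also have "\<dots> \<le> 1 / (1 - phi)" using phi_nonneg phi_less by (intro geometric_sum_inj_le) (auto simp: inj_on_def)
    finally show ?thesis by simp
  qed
  define C where "C = 4 / (1 - phi)"
  have second: "(\<Sum>k<N. \<Sum>l<N. measure P (A k \<inter> A l)) \<le> m\<^sup>2 + C * m"
  proof -
    have "(\<Sum>k<N. \<Sum>l<N. measure P (A k \<inter> A l)) \<le> (\<Sum>k<N. \<Sum>l<N. pk k * pk l + ?r k l * (pk k + pk l))"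
      by (intro sum_mono pair)
    also have "\<dots> = m\<^sup>2 + ((\<Sum>k<N. \<Sum>l<N. ?r k l * pk k) + (\<Sum>k<N. \<Sum>l<N. ?r k l * pk l))"
      by (simp add: m_def power2_eq_square sum_product sum.distrib distrib_left)
    also have "(\<Sum>k<N. \<Sum>l<N. ?r k l * pk l) = (\<Sum>l<N. \<Sum>k<N. ?r l k * pk l)"
      by (subst sum.swap) (simp add: add.commute)
    also have "(\<Sum>k<N. \<Sum>l<N. ?r k l * pk k) + (\<Sum>l<N. \<Sum>k<N. ?r l k * pk l) = 2 * (\<Sum>k<N. (\<Sum>l<N. ?r k l) * pk k)"
      by (simp add: sum_distrib_right)
    also have "\<dots> \<le> 2 * (\<Sum>k<N. 2 / (1 - phi) * pk k)"
      by (intro mult_left_mono sum_mono mult_right_mono rsum pk0) auto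
    also have "\<dots> = C * m" by (simp add: C_def m_def sum_distrib_left)
    finally show ?thesis by simp
  qed
  define Z where "Z \<omega> = (\<Sum>k<N. indicator (A k) \<omega> :: real)" for \<omega>
  have intA: "integrable P (\<lambda>\<omega>. indicator (A k \<inter> A l) \<omega> :: real)" for k l
    by (intro P.integrable_const_bound[of _ 1]) auto
  have intA1: "integrable P (\<lambda>\<omega>. indicator (A k) \<omega> :: real)" for k
    by (intro P.integrable_const_bound[of _ 1]) auto
  have Z2: "(Z \<omega> - m)\<^sup>2 = (\<Sum>k<N. \<Sum>l<N. indicator (A k \<inter> A l) \<omega>) - 2 * m * (\<Sum>k<N. indicator (A k) \<omega>) + m\<^sup>2" for \<omega>
  proof -
    have "(Z \<omega>)\<^sup>2 = (\<Sum>k<N. \<Sum>l<N. indicator (A k \<inter> A l) \<omega>)"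
      by (simp only: Z_def power2_eq_square sum_product indicator_inter_arith)
    then show ?thesis unfolding power2_diff Z_def[symmetric] by simp
  qed
  have intZ: "integrable P (\<lambda>\<omega>. (Z \<omega> - m)\<^sup>2)" unfolding Z2 using intA intA1 by auto
  have EZ: "(\<integral>\<omega>. (Z \<omega> - m)\<^sup>2 \<partial>P) \<le> C * m"
  proof -
    have "(\<integral>\<omega>. (Z \<omega> - m)\<^sup>2 \<partial>P) = (\<Sum>k<N. \<Sum>l<N. measure P (A k \<inter> A l)) - 2 * m * (\<Sum>k<N. measure P (A k)) + m\<^sup>2"
      unfolding Z2 using intA intA1 P.prob_space by simp
    also have "\<dots> = (\<Sum>k<N. \<Sum>l<N. measure P (A k \<inter> A l)) - m\<^sup>2"
      by (simp add: pk_def[symmetric] m_def[symmetric] power2_eq_square)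
    finally show ?thesis using second by simp
  qed
  let ?B = "{\<omega>. \<forall>k<N. \<not> rise \<omega> (x + int k) y n}"
  have Beq: "?B = space P - (\<Union>k<N. A k)" by (auto simp: A_def)
  have B [measurable]: "?B \<in> sets P" unfolding Beq by (intro sets.Diff sets.top sets.finite_UN) auto
  have "measure P ?B * m\<^sup>2 = (\<integral>\<omega>. indicator ?B \<omega> * m\<^sup>2 \<partial>P)" by simp
  also have "\<dots> \<le> (\<integral>\<omega>. (Z \<omega> - m)\<^sup>2 \<partial>P)"
  proof (rule integral_mono[OF _ intZ])
    show "integrable P (\<lambda>\<omega>. indicator ?B \<omega> * m\<^sup>2)"
      by (intro integrable_mult_left P.integrable_const_bound[of _ 1]) auto
    fix \<omega>
    have "Z \<omega> = 0" if "\<omega> \<in> ?B" unfolding Z_def using that by (intro sum.neutral) (auto simp: A_def)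
    then show "indicator ?B \<omega> * m\<^sup>2 \<le> (Z \<omega> - m)\<^sup>2" by (cases "\<omega> \<in> ?B") auto
  qed
  finally have "measure P ?B * m\<^sup>2 \<le> C * m" using EZ by linarith
  then have "measure P ?B * m \<le> C" using mpos by (simp add: power2_eq_square mult.assoc[symmetric])
  then have "measure P ?B \<le> C / m" using mpos by (simp add: field_simps)
  also have "\<dots> \<le> C / (real N * q)"
    using m assms(2,3) phi_less by (intro divide_left_mono) (auto simp: C_def mpos)
  finally show ?thesis by (simp add: C_def)
qed

section \<open>Almost sure properties of the potential\<close>

lemma AE_not_if_measure_small:
  assumes "\<And>N::nat. {\<omega>. E N \<omega>} \<in> sets P" "(\<lambda>N. measure P {\<omega>. E N \<omega>}) \<longlonglongrightarrow> 0"
  shows "AE \<omega> in P. \<exists>N. \<not> E N \<omega>"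
proof -
  let ?A = "\<Inter>N. {\<omega>. E N \<omega>}"
  have A: "?A \<in> sets P" using assms(1) by (intro sets.countable_INT) auto
  have "measure P ?A \<le> measure P {\<omega>. E N \<omega>}" for N by (intro P.finite_measure_mono assms(1)) auto
  then have "measure P ?A \<le> 0" using assms(2) by (intro LIMSEQ_le_const[of _ _ "measure P ?A"]) auto
  then have "measure P ?A = 0" by (meson antisym measure_nonneg)
  then have "?A \<in> null_sets P" using A by (auto simp: null_sets_def P.emeasure_eq_measure)
  then show ?thesis by (rule AE_I') auto
qed

text \<open>Makes all ladder epochs \<open>e\<close> finite, so that the \<open>Inf\<close> defining
  them is attained.\<close>

lemma AE_descend: "AE \<omega> in P. \<forall>x. \<exists>y>x. inc \<omega> x y \<le> 0"
  unfolding AE_all_countable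
proof
  fix x :: int
  have "AE \<omega> in P. \<exists>N. \<not> (0 < inc \<omega> x (x + int (Suc N)))"
  proof (rule AE_not_if_measure_small)
    show "{\<omega>. 0 < inc \<omega> x (x + int (Suc N))} \<in> sets P" for N
    proof -
      have "Measurable.pred P (\<lambda>\<omega>. 0 < inc \<omega> x (x + int (Suc N)))" by measurable
      from predE[OF this] show ?thesis by simp
    qed
    have le: "measure P {\<omega>. 0 < inc \<omega> x (x + int (Suc N))} \<le> phi ^ Suc N" for N
    proof -
      have "Measurable.pred P (\<lambda>\<omega>. 0 \<le> inc \<omega> x (x + int (Suc N)))" by measurable
      from predE[OF this] have "{\<omega>. 0 \<le> inc \<omega> x (x + int (Suc N))} \<in> sets P" by simp
      then have "measure P {\<omega>. 0 < inc \<omega> x (x + int (Suc N))} \<le> measure P {\<omega>. 0 \<le> inc \<omega> x (x + int (Suc N))}"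
        by (intro P.finite_measure_mono) auto
      also have "\<dots> \<le> phi ^ Suc N" using measure_inc_ge[of 0 x "Suc N"] by simp
      finally show ?thesis .
    qed
    have lim: "(\<lambda>N. phi ^ Suc N) \<longlonglongrightarrow> 0" using phi_nonneg phi_less by (intro LIMSEQ_Suc LIMSEQ_realpow_zero) auto
    show "(\<lambda>N. measure P {\<omega>. 0 < inc \<omega> x (x + int (Suc N))}) \<longlonglongrightarrow> 0"
      by (rule tendsto_sandwich[OF _ _ tendsto_const lim]) (use le in auto)
  qed
  then show "AE \<omega> in P. \<exists>y>x. inc \<omega> x y \<le> 0"
  proof eventually_elim
    case (elim \<omega>)
    then obtain N where "\<not> 0 < inc \<omega> x (x + int (Suc N))" by blast
    then show ?case by (intro exI[of _ "x + int (Suc N)"]) auto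
  qed
qed

text \<open>Makes every \<open>LEAST\<close> in \<open>sig\<close> meaningful: excursions of any
  height occur arbitrarily far to the right.\<close>

lemma AE_rise: "AE \<omega> in P. \<forall>x. \<forall>y::nat. \<exists>m\<ge>x. \<exists>n>m. real y \<le> inc \<omega> m n"
  unfolding AE_all_countable
proof (intro allI)
  fix x :: int and y :: nat
  obtain c C2 where c: "0 < c" and low: "\<And>z n x. 0 < z \<Longrightarrow> C2 * (z + 1) \<le> real n \<Longrightarrow> c * exp (- (\<kappa> * z)) \<le> measure P {\<omega>. rise \<omega> x z n}"
    using rise_prob_lower by blast
  \<comment> \<open>The added 1 only makes the height positive.\<close>
  define z where "z = real y + 1"
  define n where "n = nat \<lceil>C2 * (z + 1)\<rceil>"
  define q where "q = c * exp (- (\<kappa> * z))"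
  have z: "0 < z" by (simp add: z_def)
  have q: "0 < q" "\<And>x. q \<le> measure P {\<omega>. rise \<omega> x z n}"
    unfolding q_def using c by (auto intro!: low z simp: n_def real_nat_ceiling_ge)
  have "AE \<omega> in P. \<exists>N. \<not> (\<forall>k<Suc N. \<not> rise \<omega> (x + int k) z n)"
  proof (rule AE_not_if_measure_small)
    show "{\<omega>. \<forall>k<Suc N. \<not> rise \<omega> (x + int k) z n} \<in> sets P" for N
    proof -
      have "Measurable.pred P (\<lambda>\<omega>. \<forall>k<Suc N. \<not> rise \<omega> (x + int k) z n)" by measurable
      from predE[OF this] show ?thesis by simp
    qed
    have le: "measure P {\<omega>. \<forall>k<Suc N. \<not> rise \<omega> (x + int k) z n} \<le> (4 / (1 - phi) / q) * inverse (real (Suc N))" for N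
      using no_rise_prob[of "Suc N" q x z n] q by (simp add: field_simps)
    have lim: "(\<lambda>N. (4 / (1 - phi) / q) * inverse (real (Suc N))) \<longlonglongrightarrow> 0"
      by (rule tendsto_mult_right_zero[OF LIMSEQ_inverse_real_of_nat])
    show "(\<lambda>N. measure P {\<omega>. \<forall>k<Suc N. \<not> rise \<omega> (x + int k) z n}) \<longlonglongrightarrow> 0"
      by (rule tendsto_sandwich[OF _ _ tendsto_const lim]) (use le in auto)
  qed
  then show "AE \<omega> in P. \<exists>m\<ge>x. \<exists>n>m. real y \<le> inc \<omega> m n"
  proof eventually_elim
    case (elim \<omega>)
    then obtain k where "rise \<omega> (x + int k) z n" by blast
    then obtain j where "1 \<le> j" "z \<le> inc \<omega> (x + int k) (x + int k + int j)" by (auto simp: rise_def)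
    then show ?case by (intro exI[of _ "x + int k"] conjI exI[of _ "x + int k + int j"]) (auto simp: z_def)
  qed
qed

end

subsection \<open>The quenched walk\<close>

definition stp :: "(int \<Rightarrow> real) \<Rightarrow> (int \<Rightarrow> real) \<Rightarrow> int \<Rightarrow> real" where
  "stp \<omega> f x = \<omega> x * f (x + 1) + (1 - \<omega> x) * f (x - 1)"

text \<open>The bounds are closed because the reflected environment below takes the value 1.\<close>

definition ellip :: "(int \<Rightarrow> real) \<Rightarrow> bool" where
  "ellip \<omega> \<longleftrightarrow> (\<forall>x. 0 \<le> \<omega> x \<and> \<omega> x \<le> 1)"

lemma stp_mono: "ellip \<omega> \<Longrightarrow> f (x + 1) \<le> g (x + 1) \<Longrightarrow> f (x - 1) \<le> g (x - 1) \<Longrightarrow> stp \<omega> f x \<le> stp \<omega> g x"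
  unfolding stp_def ellip_def by (intro add_mono mult_left_mono) auto

lemma stp_const [simp]: "stp \<omega> (\<lambda>_. c) x = c"
  by (simp add: stp_def algebra_simps)

text \<open>\<open>ev \<omega> y f n x\<close> is the expectation of \<open>f (X\<^sub>n)\<close> on the event that the walk started at \<open>x\<close>
  has stayed below \<open>y\<close> up to time \<open>n\<close>.\<close>

fun ev :: "(int \<Rightarrow> real) \<Rightarrow> int \<Rightarrow> (int \<Rightarrow> real) \<Rightarrow> nat \<Rightarrow> int \<Rightarrow> real" where
  "ev \<omega> y f 0 x = (if x < y then f x else 0)"
| "ev \<omega> y f (Suc n) x = (if x < y then stp \<omega> (ev \<omega> y f n) x else 0)"

abbreviation sv :: "(int \<Rightarrow> real) \<Rightarrow> int \<Rightarrow> nat \<Rightarrow> int \<Rightarrow> real" where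
  "sv \<omega> y n x \<equiv> ev \<omega> y (\<lambda>_. 1) n x"

abbreviation ker :: "(int \<Rightarrow> real) \<Rightarrow> int \<Rightarrow> nat \<Rightarrow> int \<Rightarrow> int \<Rightarrow> real" where
  "ker \<omega> y n x z \<equiv> ev \<omega> y (\<lambda>x. if x = z then 1 else 0) n x"

lemma ev_ge: "y \<le> x \<Longrightarrow> ev \<omega> y f n x = 0"
  by (cases n) auto

lemma ev_mono:
  assumes "ellip \<omega>" "\<And>x. x < y \<Longrightarrow> f x \<le> g x"
  shows "ev \<omega> y f n x \<le> ev \<omega> y g n x"
  using assms(2) by (induction n arbitrary: x) (auto intro!: stp_mono assms(1))

lemma ev_nonneg:
  assumes "ellip \<omega>" "\<And>x. x < y \<Longrightarrow> 0 \<le> f x"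
  shows "0 \<le> ev \<omega> y f n x"
  using ev_mono[OF assms(1), of y "\<lambda>_. 0" f n x] assms(2)
proof -
  have "ev \<omega> y (\<lambda>_. 0) n x = 0" by (induction n arbitrary: x) (auto simp: stp_def)
  then show ?thesis using ev_mono[OF assms(1), of y "\<lambda>_. 0" f n x] assms(2) by simp
qed

lemma ev_add: "ev \<omega> y (\<lambda>x. f x + g x) n x = ev \<omega> y f n x + ev \<omega> y g n x"
  by (induction n arbitrary: x) (auto simp: stp_def algebra_simps)

lemma ev_cmult: "ev \<omega> y (\<lambda>x. c * f x) n x = c * ev \<omega> y f n x"
  by (induction n arbitrary: x) (auto simp: stp_def algebra_simps)

lemma ev_sum: "finite I \<Longrightarrow> ev \<omega> y (\<lambda>x. \<Sum>i\<in>I. f i x) n x = (\<Sum>i\<in>I. ev \<omega> y (f i) n x)"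
proof (induction I rule: finite_induct)
  case empty
  have "ev \<omega> y (\<lambda>_. 0) n x = 0" by (induction n arbitrary: x) (auto simp: stp_def)
  then show ?case by simp
next
  case (insert i I)
  then show ?case by (simp add: ev_add)
qed

text \<open>A maximum principle, by induction on time: superharmonicity propagates the bound off
  \<open>R\<close>, and on \<open>R\<close> it is given.\<close>

lemma ev_le_superharmonic:
  assumes el: "ellip \<omega>" and f: "\<And>x. x < y \<Longrightarrow> f x \<le> u x" and u0: "\<And>x. 0 \<le> u x"
    and sup: "\<And>x. x < y \<Longrightarrow> x \<notin> R \<Longrightarrow> stp \<omega> u x \<le> u x"
    and R: "\<And>x n. x \<in> R \<Longrightarrow> ev \<omega> y f n x \<le> u x"
  shows "ev \<omega> y f n x \<le> u x"
proof (induction n arbitrary: x)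
  case 0
  then show ?case using f u0 by auto
next
  case (Suc n)
  show ?case
  proof (cases "x < y \<and> x \<notin> R")
    case True
    then have "ev \<omega> y f (Suc n) x \<le> stp \<omega> u x" using Suc by (simp add: stp_mono[OF el])
    then show ?thesis using sup[of x] True by simp
  next
    case False
    then show ?thesis using R[of x "Suc n"] u0 by auto
  qed
qed

lemma ev_le_one:
  assumes "ellip \<omega>" "\<And>x. f x \<le> 1"
  shows "ev \<omega> y f n x \<le> 1"
  by (rule ev_le_superharmonic[OF assms(1), where u = "\<lambda>_. 1" and R = "{}"]) (use assms in auto)

lemma ker_ge: "y \<le> z \<Longrightarrow> ker \<omega> y n x z = 0"
  by (induction n arbitrary: x) (auto simp: stp_def)

text \<open>The recursion of \<open>ev\<close> conditions on the first step, this one on the last;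
  unfolding at both ends commutes.\<close>

lemma ker_forward:
  "z < y \<Longrightarrow> ker \<omega> y (Suc n) x z = ker \<omega> y n x (z - 1) * \<omega> (z - 1) + ker \<omega> y n x (z + 1) * (1 - \<omega> (z + 1))"
proof (induction n arbitrary: x)
  case 0
  then show ?case by (auto simp: stp_def)
next
  case (Suc n)
  show ?case
  proof (cases "x < y")
    case True
    have "ker \<omega> y (Suc (Suc n)) x z = \<omega> x * ker \<omega> y (Suc n) (x + 1) z + (1 - \<omega> x) * ker \<omega> y (Suc n) (x - 1) z"
      using True by (simp add: stp_def)
    also have "\<dots> = ker \<omega> y (Suc n) x (z - 1) * \<omega> (z - 1) + ker \<omega> y (Suc n) x (z + 1) * (1 - \<omega> (z + 1))"
      using True unfolding Suc.IH[OF Suc.prems] by (simp add: stp_def algebra_simps)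
    finally show ?thesis .
  qed simp
qed

text \<open>Here \<open>c x\<close> is the conductance of the edge from \<open>x\<close> to
  \<open>x + 1\<close> and \<open>w\<close> the reversible measure. Expanding the left side by the
  first step and the right side by the last step, detailed balance matches the terms.\<close>

lemma ker_reversible:
  assumes "\<And>x. w x * \<omega> x = c x" "\<And>x. w x * (1 - \<omega> x) = c (x - 1)"
  shows "w x * ker \<omega> y n x z = w z * ker \<omega> y n z x"
proof (induction n arbitrary: x z)
  case 0
  then show ?case by auto
next
  case (Suc n)
  show ?case
  proof (cases "x < y")
    case True
    have "w x * ker \<omega> y (Suc n) x z = c x * ker \<omega> y n (x + 1) z + c (x - 1) * ker \<omega> y n (x - 1) z"
      using True assms(1)[of x] assms(2)[of x] by (simp add: stp_def distrib_left mult.assoc[symmetric])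
    also have "c x = w (x + 1) * (1 - \<omega> (x + 1))" using assms(2)[of "x + 1"] by simp
    also have "c (x - 1) = w (x - 1) * \<omega> (x - 1)" using assms(1)[of "x - 1"] by simp
    also have "w (x + 1) * (1 - \<omega> (x + 1)) * ker \<omega> y n (x + 1) z + w (x - 1) * \<omega> (x - 1) * ker \<omega> y n (x - 1) z
       = (1 - \<omega> (x + 1)) * (w (x + 1) * ker \<omega> y n (x + 1) z) + \<omega> (x - 1) * (w (x - 1) * ker \<omega> y n (x - 1) z)"
      by (simp add: algebra_simps)
    also have "\<dots> = w z * (ker \<omega> y n z (x - 1) * \<omega> (x - 1) + ker \<omega> y n z (x + 1) * (1 - \<omega> (x + 1)))"
      unfolding Suc by (simp add: algebra_simps)
    finally show ?thesis using ker_forward[OF True, of \<omega> n z] by simp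
  next
    case False
    then show ?thesis by (simp add: ev_ge ker_ge del: ev.simps)
  qed
qed

subsection \<open>Path events\<close>

text \<open>Grows the path from the front and from any starting point, so that conditioning on the
  first step is the recursion itself; \<open>walk\<close> grows at the end.\<close>

fun paths :: "(int \<Rightarrow> real) \<Rightarrow> nat \<Rightarrow> int \<Rightarrow> int list pmf" where
  "paths \<omega> 0 x = return_pmf [x]"
| "paths \<omega> (Suc n) x = bind_pmf (bernoulli_pmf (\<omega> x))
     (\<lambda>up. map_pmf (Cons x) (paths \<omega> n (if up then x + 1 else x - 1)))"

lemma paths_nonempty: "p \<in> set_pmf (paths \<omega> n x) \<Longrightarrow> p \<noteq> []"
  by (cases n) (auto simp: set_bind_pmf)

lemma length_paths: "p \<in> set_pmf (paths \<omega> n x) \<Longrightarrow> length p = Suc n"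
  by (induction n arbitrary: x p) (auto simp: set_bind_pmf)

lemma paths_append:
  "paths \<omega> (Suc n) x = bind_pmf (paths \<omega> n x)
     (\<lambda>p. map_pmf (\<lambda>up. p @ [if up then last p + 1 else last p - 1]) (bernoulli_pmf (\<omega> (last p))))"
proof (induction n arbitrary: x)
  case 0
  show ?case by (simp add: map_pmf_def bind_return_pmf cong: if_cong)
next
  case (Suc n)
  have "paths \<omega> (Suc (Suc n)) x = bind_pmf (bernoulli_pmf (\<omega> x))
     (\<lambda>up. map_pmf (Cons x) (paths \<omega> (Suc n) (if up then x + 1 else x - 1)))" by simp
  also have "\<dots> = bind_pmf (bernoulli_pmf (\<omega> x)) (\<lambda>up. bind_pmf (paths \<omega> n (if up then x + 1 else x - 1))
     (\<lambda>p. map_pmf (\<lambda>up. x # (p @ [if up then last p + 1 else last p - 1])) (bernoulli_pmf (\<omega> (last p)))))"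
    unfolding Suc by (simp add: map_bind_pmf pmf.map_comp o_def)
  also have "\<dots> = bind_pmf (bernoulli_pmf (\<omega> x)) (\<lambda>up. bind_pmf (paths \<omega> n (if up then x + 1 else x - 1))
     (\<lambda>p. map_pmf (\<lambda>up. (x # p) @ [if up then last (x # p) + 1 else last (x # p) - 1]) (bernoulli_pmf (\<omega> (last (x # p))))))"
    by (intro bind_pmf_cong refl) (auto dest: paths_nonempty cong: if_cong)
  also have "\<dots> = bind_pmf (paths \<omega> (Suc n) x)
     (\<lambda>p. map_pmf (\<lambda>up. p @ [if up then last p + 1 else last p - 1]) (bernoulli_pmf (\<omega> (last p))))"
    by (simp add: bind_assoc_pmf bind_map_pmf)
  finally show ?case .
qed

lemma walk_eq_paths: "walk \<omega> n = paths \<omega> n 0"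
proof (induction n)
  case (Suc n)
  then show ?case unfolding paths_append by simp
qed simp

abbreviation pr :: "(int \<Rightarrow> real) \<Rightarrow> nat \<Rightarrow> int \<Rightarrow> (int list \<Rightarrow> bool) \<Rightarrow> real" where
  "pr \<omega> n x E \<equiv> measure_pmf.prob (paths \<omega> n x) {p. E p}"

lemma pr_0: "pr \<omega> 0 x E = (if E [x] then 1 else 0)"
  by (simp add: indicator_def)

lemma prob_bind_bernoulli:
  assumes "0 \<le> q" "q \<le> 1"
  shows "measure_pmf.prob (bind_pmf (bernoulli_pmf q) f) A
     = q * measure_pmf.prob (f True) A + (1 - q) * measure_pmf.prob (f False) A"
proof -
  have "ennreal (measure_pmf.prob (bind_pmf (bernoulli_pmf q) f) A) = emeasure (measure_pmf (bind_pmf (bernoulli_pmf q) f)) A"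
    by (simp add: measure_pmf.emeasure_eq_measure)
  also have "\<dots> = (\<integral>\<^sup>+up. emeasure (measure_pmf (f up)) A \<partial>measure_pmf (bernoulli_pmf q))"
    by (rule emeasure_bind_pmf)
  also have "\<dots> = ennreal (q * measure_pmf.prob (f True) A + (1 - q) * measure_pmf.prob (f False) A)"
    using assms by (simp add: nn_integral_bernoulli_pmf measure_pmf.emeasure_eq_measure ennreal_mult[symmetric] mult.commute ennreal_plus[symmetric] del: ennreal_plus)
  finally show ?thesis using assms by (subst (asm) ennreal_inj) (auto intro!: add_nonneg_nonneg mult_nonneg_nonneg)
qed

lemma pr_Suc:
  assumes "ellip \<omega>"
  shows "pr \<omega> (Suc n) x E = stp \<omega> (\<lambda>x'. pr \<omega> n x' (\<lambda>p. E (x # p))) x"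
  using assms unfolding ellip_def
  by (simp add: prob_bind_bernoulli stp_def vimage_def)

lemma pr_below:
  assumes el: "ellip \<omega>"
  shows "pr \<omega> n x (\<lambda>p. (\<forall>z\<in>set p. z < y) \<and> f (last p)) = ev \<omega> y (\<lambda>z. if f z then 1 else 0) n x"
proof (induction n arbitrary: x)
  case 0
  show ?case unfolding pr_0 by simp
next
  case (Suc n)
  have 1: "pr \<omega> n x' (\<lambda>p. (\<forall>z\<in>set (x # p). z < y) \<and> f (last (x # p)))
      = (if x < y then pr \<omega> n x' (\<lambda>p. (\<forall>z\<in>set p. z < y) \<and> f (last p)) else 0)" for x'
  proof -
    have "pr \<omega> n x' (\<lambda>p. (\<forall>z\<in>set (x # p). z < y) \<and> f (last (x # p)))
       = pr \<omega> n x' (\<lambda>p. x < y \<and> (\<forall>z\<in>set p. z < y) \<and> f (last p))"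
      by (intro measure_pmf.finite_measure_eq_AE) (auto simp: AE_measure_pmf_iff dest: paths_nonempty)
    then show ?thesis by auto
  qed
  show ?case unfolding pr_Suc[OF el] 1 Suc by (simp add: stp_def)
qed

lemma pr_all_below:
  assumes el: "ellip \<omega>"
  shows "pr \<omega> n x (\<lambda>p. \<forall>z\<in>set p. z < y) = sv \<omega> y n x"
  using pr_below[OF el, of n x y "\<lambda>_. True"] by simp

text \<open>A nearest-neighbour path started at or below \<open>\<beta>\<close> avoids
  \<open>\<beta>\<close> exactly when it stays below it, so the event is a difference of two
  survival events.\<close>

lemma pr_hit_below:
  assumes el: "ellip \<omega>" and "x \<le> \<beta>" "\<beta> < y"
  shows "pr \<omega> n x (\<lambda>p. \<beta> \<in> set p \<and> (\<forall>z\<in>set p. z < y)) = sv \<omega> y n x - sv \<omega> \<beta> n x"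
  using assms(2)
proof (induction n arbitrary: x)
  case 0
  then show ?case using assms(3) unfolding pr_0 by auto
next
  case (Suc n)
  show ?case
  proof (cases "x = \<beta>")
    case True
    have "pr \<omega> (Suc n) x (\<lambda>p. \<beta> \<in> set p \<and> (\<forall>z\<in>set p. z < y)) = pr \<omega> (Suc n) x (\<lambda>p. \<forall>z\<in>set p. z < y)"
      unfolding pr_Suc[OF el] using True by simp
    then show ?thesis using True by (simp add: pr_all_below[OF el] ev_ge del: paths.simps)
  next
    case False
    then have "x < \<beta>" using Suc by simp
    then have "(\<lambda>p. \<beta> \<in> set (x # p) \<and> (\<forall>z\<in>set (x # p). z < y)) = (\<lambda>p. \<beta> \<in> set p \<and> (\<forall>z\<in>set p. z < y))"
      using assms(3) by auto
    then have "pr \<omega> (Suc n) x (\<lambda>p. \<beta> \<in> set p \<and> (\<forall>z\<in>set p. z < y))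
       = stp \<omega> (\<lambda>x'. pr \<omega> n x' (\<lambda>p. \<beta> \<in> set p \<and> (\<forall>z\<in>set p. z < y))) x"
      unfolding pr_Suc[OF el] by simp
    also have "\<dots> = stp \<omega> (\<lambda>x'. sv \<omega> y n x' - sv \<omega> \<beta> n x') x"
      unfolding stp_def using Suc.IH[of "x + 1"] Suc.IH[of "x - 1"] \<open>x < \<beta>\<close> by simp
    finally show ?thesis using \<open>x < \<beta>\<close> assms(3) by (simp add: stp_def algebra_simps del: paths.simps)
  qed
qed

text \<open>Markov property at the first visit to \<open>\<beta>\<close>: what remains is a path
  from \<open>\<beta>\<close> of some length \<open>u \<le> n\<close>, and the bound holds for all
  of these.\<close>

lemma pr_hit_last_le:
  assumes el: "ellip \<omega>" and B0: "0 \<le> B0"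
    and le: "\<And>u. u \<le> n \<Longrightarrow> pr \<omega> u \<beta> (\<lambda>p. (\<forall>z\<in>set p. z < y) \<and> f (last p)) \<le> B0"
  shows "pr \<omega> n x (\<lambda>p. \<beta> \<in> set p \<and> (\<forall>z\<in>set p. z < y) \<and> f (last p)) \<le> B0"
  using le
proof (induction n arbitrary: x)
  case 0
  show ?case
  proof (cases "x = \<beta>")
    case True
    then show ?thesis using 0[of 0] unfolding pr_0 by simp
  next
    case False
    then show ?thesis using B0 unfolding pr_0 by simp
  qed
next
  case (Suc n)
  show ?case
  proof (cases "x = \<beta>")
    case True
    have "pr \<omega> (Suc n) x (\<lambda>p. \<beta> \<in> set p \<and> (\<forall>z\<in>set p. z < y) \<and> f (last p))
       \<le> pr \<omega> (Suc n) x (\<lambda>p. (\<forall>z\<in>set p. z < y) \<and> f (last p))"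
      by (intro measure_pmf.finite_measure_mono) auto
    also have "\<dots> \<le> B0" using Suc.prems[of "Suc n"] True by simp
    finally show ?thesis .
  next
    case False
    have le': "pr \<omega> n x' (\<lambda>p. \<beta> \<in> set (x # p) \<and> (\<forall>z\<in>set (x # p). z < y) \<and> f (last (x # p))) \<le> B0" for x'
    proof -
      have "pr \<omega> n x' (\<lambda>p. \<beta> \<in> set (x # p) \<and> (\<forall>z\<in>set (x # p). z < y) \<and> f (last (x # p)))
         \<le> pr \<omega> n x' (\<lambda>p. \<beta> \<in> set p \<and> (\<forall>z\<in>set p. z < y) \<and> f (last p))"
        by (intro measure_pmf.finite_measure_mono_AE) (use False in \<open>auto simp: AE_measure_pmf_iff dest: paths_nonempty\<close>)
      also have "\<dots> \<le> B0" by (rule Suc.IH) (use Suc.prems in auto)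
      finally show ?thesis .
    qed
    have "stp \<omega> (\<lambda>x'. pr \<omega> n x' (\<lambda>p. \<beta> \<in> set (x # p) \<and> (\<forall>z\<in>set (x # p). z < y) \<and> f (last (x # p)))) x \<le> stp \<omega> (\<lambda>_. B0) x"
      by (intro stp_mono[OF el] le')
    then show ?thesis unfolding pr_Suc[OF el] by simp
  qed
qed

subsection \<open>Hitting times\<close>

text \<open>\<open>hit \<omega> c x y\<close> is the law of \<open>min (\<tau>(x\<rightarrow>y)) c\<close> for the walk started at \<open>x \<le> y\<close>.\<close>

fun hit :: "(int \<Rightarrow> real) \<Rightarrow> nat \<Rightarrow> int \<Rightarrow> int \<Rightarrow> nat pmf" where
  "hit \<omega> 0 x y = return_pmf 0"
| "hit \<omega> (Suc c) x y = (if y \<le> x then return_pmf 0 else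
     bind_pmf (bernoulli_pmf (\<omega> x)) (\<lambda>up. map_pmf Suc (hit \<omega> c (if up then x + 1 else x - 1) y)))"

lemma hit_ge: "y \<le> x \<Longrightarrow> hit \<omega> c x y = return_pmf 0"
  by (cases c) auto

lemma set_hit: "set_pmf (hit \<omega> c x y) \<subseteq> {..c}"
proof (induction c arbitrary: x)
  case (Suc c)
  then show ?case by (auto simp: set_bind_pmf; blast)
qed simp

lemma finite_set_hit [simp]: "finite (set_pmf (hit \<omega> c x y))"
  using set_hit by (rule finite_subset) simp

lemma hit_survival:
  assumes el: "ellip \<omega>" and "s < c"
  shows "measure_pmf.prob (hit \<omega> c x y) {k. s < k} = sv \<omega> y s x"
  using assms(2)
proof (induction c arbitrary: s x)
  case (Suc c)
  show ?case
  proof (cases "y \<le> x")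
    case True
    then show ?thesis by (simp add: ev_ge hit_ge del: hit.simps)
  next
    case False
    have "measure_pmf.prob (hit \<omega> (Suc c) x y) {k. s < k}
      = stp \<omega> (\<lambda>x'. measure_pmf.prob (hit \<omega> c x' y) {k. s < Suc k}) x"
      using False el unfolding ellip_def by (simp add: prob_bind_bernoulli stp_def vimage_def)
    also have "\<dots> = sv \<omega> y s x"
    proof (cases s)
      case 0
      then show ?thesis using False by simp
    next
      case (Suc s')
      then show ?thesis using False Suc.IH Suc.prems by (simp add: stp_def)
    qed
    finally show ?thesis .
  qed
qed simp

text \<open>Strong Markov property at \<open>y\<close> for capped passage times: after
  \<open>k\<close> steps the second passage has only the budget \<open>c - k\<close> left.\<close>

lemma hit_concat_aux:
  assumes "x \<le> y" "y \<le> z"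
  shows "hit \<omega> c x z = bind_pmf (hit \<omega> c x y) (\<lambda>k. map_pmf ((+) k) (hit \<omega> (c - k) y z))"
  using assms(1)
proof (induction c arbitrary: x)
  case 0
  then show ?case by (simp add: bind_return_pmf)
next
  case (Suc c)
  show ?case
  proof (cases "x = y")
    case True
    have "(+) (0::nat) = (\<lambda>k. k)" by (simp add: fun_eq_iff)
    then show ?thesis using True by (simp add: hit_ge bind_return_pmf pmf.map_ident del: hit.simps)
  next
    case False
    then have xy: "x < y" using Suc.prems by simp
    have "hit \<omega> (Suc c) x z = bind_pmf (bernoulli_pmf (\<omega> x)) (\<lambda>up. map_pmf Suc (hit \<omega> c (if up then x + 1 else x - 1) z))"
      using xy assms(2) by simp
    also have "\<dots> = bind_pmf (bernoulli_pmf (\<omega> x)) (\<lambda>up. map_pmf Suc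
        (bind_pmf (hit \<omega> c (if up then x + 1 else x - 1) y) (\<lambda>k. map_pmf ((+) k) (hit \<omega> (c - k) y z))))"
    proof (intro bind_pmf_cong refl arg_cong[of _ _ "map_pmf Suc"])
      fix up
      show "hit \<omega> c (if up then x + 1 else x - 1) z =
        bind_pmf (hit \<omega> c (if up then x + 1 else x - 1) y) (\<lambda>k. map_pmf ((+) k) (hit \<omega> (c - k) y z))"
        by (rule Suc.IH) (use xy in auto)
    qed
    also have "\<dots> = bind_pmf (hit \<omega> (Suc c) x y) (\<lambda>k. map_pmf ((+) k) (hit \<omega> (Suc c - k) y z))"
    proof -
      have "(+) (Suc k) = (\<lambda>j. Suc (k + j))" for k by (simp add: fun_eq_iff)
      then show ?thesis using xy by (simp add: bind_assoc_pmf bind_map_pmf map_bind_pmf pmf.map_comp o_def)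
    qed
    finally show ?thesis .
  qed
qed

lemma hit_truncate: "c' \<le> c \<Longrightarrow> hit \<omega> c' x y = map_pmf (min c') (hit \<omega> c x y)"
proof (induction c arbitrary: c' x)
  case 0
  then show ?case by simp
next
  case (Suc c)
  show ?case
  proof (cases c')
    case 0
    then show ?thesis by (simp add: map_pmf_const)
  next
    case (Suc c'')
    have "hit \<omega> c'' x' y = map_pmf (min c'') (hit \<omega> c x' y)" for x'
      by (rule Suc.IH) (use Suc Suc.prems in auto)
    then show ?thesis using Suc by (simp add: map_bind_pmf pmf.map_comp o_def)
  qed
qed

text \<open>A cap on the sum hides the cap on its second term, so the budget \<open>c - k\<close>,
  which depends on the first passage, may be raised to \<open>c\<close>; then the two passage times
  form an independent pair.\<close>

lemma hit_concat:
  assumes "x \<le> y" "y \<le> z"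
  shows "hit \<omega> c x z = map_pmf (\<lambda>(i, j). min c (i + j)) (pair_pmf (hit \<omega> c x y) (hit \<omega> c y z))"
proof -
  have "hit \<omega> c x z = bind_pmf (hit \<omega> c x y) (\<lambda>k. map_pmf ((+) k) (hit \<omega> (c - k) y z))"
    by (rule hit_concat_aux[OF assms])
  also have "\<dots> = bind_pmf (hit \<omega> c x y) (\<lambda>k. map_pmf (\<lambda>j. min c (k + j)) (hit \<omega> c y z))"
  proof (intro bind_pmf_cong refl)
    fix k assume "k \<in> set_pmf (hit \<omega> c x y)"
    then have "k \<le> c" using set_hit by blast
    then have "(+) k \<circ> min (c - k) = (\<lambda>j. min c (k + j))" by (auto simp: fun_eq_iff min_def)
    then show "map_pmf ((+) k) (hit \<omega> (c - k) y z) = map_pmf (\<lambda>j. min c (k + j)) (hit \<omega> c y z)"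
      by (simp add: hit_truncate[of "c - k" c] pmf.map_comp)
  qed
  also have "\<dots> = map_pmf (\<lambda>(i, j). min c (i + j)) (pair_pmf (hit \<omega> c x y) (hit \<omega> c y z))"
    by (simp add: pair_pmf_def map_bind_pmf map_pmf_def[symmetric] map_return_pmf pmf.map_comp o_def)
  finally show ?thesis .
qed

text \<open>A supersolution of the mean passage time equation dominates. It is needed only above
  \<open>lo\<close>, since a walk starting at \<open>lo + c\<close> or higher is stopped by the cap
  before any step from \<open>lo\<close> is taken.\<close>

lemma expectation_hit_le:
  assumes el: "ellip \<omega>" and m0: "\<And>x. 0 \<le> m x"
    and sup: "\<And>x. lo < x \<Longrightarrow> x < y \<Longrightarrow> 1 + stp \<omega> m x \<le> m x"
  shows "lo + int c \<le> x \<Longrightarrow> measure_pmf.expectation (hit \<omega> c x y) real \<le> m x"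
proof (induction c arbitrary: x)
  case 0
  then show ?case using m0 by simp
next
  case (Suc c)
  show ?case
  proof (cases "y \<le> x")
    case True
    then show ?thesis using m0 by (simp add: hit_ge del: hit.simps)
  next
    case False
    have E1: "measure_pmf.expectation (map_pmf Suc (hit \<omega> c x' y)) real = 1 + measure_pmf.expectation (hit \<omega> c x' y) real" for x'
      by (simp add: integrable_measure_pmf_finite)
    have "measure_pmf.expectation (hit \<omega> (Suc c) x y) real
      = (\<Sum>up\<in>UNIV. pmf (bernoulli_pmf (\<omega> x)) up *\<^sub>R
          measure_pmf.expectation (map_pmf Suc (hit \<omega> c (if up then x + 1 else x - 1) y)) real)"
      unfolding hit.simps using False by (simp only: if_False) (rule pmf_expectation_bind, auto)
    also have "\<dots> = 1 + stp \<omega> (\<lambda>x'. measure_pmf.expectation (hit \<omega> c x' y) real) x"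
      using el unfolding ellip_def E1 by (simp add: UNIV_bool stp_def algebra_simps)
    also have "\<dots> \<le> 1 + stp \<omega> m x"
      using Suc.prems by (intro add_left_mono stp_mono[OF el] Suc.IH) auto
    also have "\<dots> \<le> m x" using Suc.prems False by (intro sup) auto
    finally show ?thesis .
  qed
qed

subsection \<open>Exit probabilities and mean exit times\<close>

definition sellip :: "(int \<Rightarrow> real) \<Rightarrow> bool" where
  "sellip \<omega> \<longleftrightarrow> (\<forall>x. 0 < \<omega> x \<and> \<omega> x < 1)"

lemma sellip_imp_ellip: "sellip \<omega> \<Longrightarrow> ellip \<omega>"
  unfolding sellip_def ellip_def by (auto intro: less_imp_le)

text \<open>The one relation behind both explicit structures of the walk: \<open>exp V\<close> gives
  the increments of the scale function, and \<open>exp (- V)\<close> the edge conductances.\<close>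

lemma exp_V_step:
  assumes "sellip \<omega>"
  shows "\<omega> x * exp (V \<omega> x) = (1 - \<omega> x) * exp (V \<omega> (x - 1))"
proof -
  have w: "0 < \<omega> x" "\<omega> x < 1" using assms by (auto simp: sellip_def)
  have "{x - 1<..x} = {x}" by auto
  then have "V \<omega> x - V \<omega> (x - 1) = ln ((1 - \<omega> x) / \<omega> x)"
    using V_diff[of "x - 1" x \<omega>] by (simp add: inc_def xi_def)
  then have "V \<omega> x = V \<omega> (x - 1) + ln ((1 - \<omega> x) / \<omega> x)" by simp
  then have "exp (V \<omega> x) = exp (V \<omega> (x - 1)) * ((1 - \<omega> x) / \<omega> x)" using w by (simp add: exp_add)
  then show ?thesis using w by simp
qed

lemma conductance:
  assumes "sellip \<omega>"
  shows "(exp (- V \<omega> x) + exp (- V \<omega> (x - 1))) * \<omega> x = exp (- V \<omega> x)"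
    and "(exp (- V \<omega> x) + exp (- V \<omega> (x - 1))) * (1 - \<omega> x) = exp (- V \<omega> (x - 1))"
proof -
  have "exp (- V \<omega> (x - 1)) * \<omega> x = exp (- V \<omega> x) * (1 - \<omega> x)"
    using exp_V_step[OF assms, of x] by (simp add: exp_minus field_simps)
  then show "(exp (- V \<omega> x) + exp (- V \<omega> (x - 1))) * \<omega> x = exp (- V \<omega> x)"
    "(exp (- V \<omega> x) + exp (- V \<omega> (x - 1))) * (1 - \<omega> x) = exp (- V \<omega> (x - 1))"
    by (simp_all add: algebra_simps)
qed

text \<open>\<open>hm \<omega> lo hi x\<close> is the probability that the walk started at \<open>x \<le> hi\<close> visits \<open>{..lo}\<close> before \<open>hi + 1\<close>.\<close>

definition hm :: "(int \<Rightarrow> real) \<Rightarrow> int \<Rightarrow> int \<Rightarrow> int \<Rightarrow> real" where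
  "hm \<omega> lo hi x = (if x \<le> lo then 1 else (\<Sum>z\<in>{x..hi}. exp (V \<omega> z)) / (\<Sum>z\<in>{lo..hi}. exp (V \<omega> z)))"

lemma hm_nonneg: "0 \<le> hm \<omega> lo hi x"
  by (auto simp: hm_def intro!: divide_nonneg_nonneg sum_nonneg)

lemma hm_le_one: "hm \<omega> lo hi x \<le> 1"
proof -
  have "(\<Sum>z\<in>{x..hi}. exp (V \<omega> z)) \<le> (\<Sum>z\<in>{lo..hi}. exp (V \<omega> z))" if "lo < x"
    using that by (intro sum_mono2) auto
  moreover have "0 \<le> (\<Sum>z\<in>{lo..hi}. exp (V \<omega> z))" by (intro sum_nonneg) auto
  ultimately show ?thesis by (auto simp: hm_def divide_le_eq_1)
qed

lemma hm_eq: "lo \<le> x \<Longrightarrow> lo \<le> hi \<Longrightarrow> hm \<omega> lo hi x = (\<Sum>z\<in>{x..hi}. exp (V \<omega> z)) / (\<Sum>z\<in>{lo..hi}. exp (V \<omega> z))"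
proof (cases "x = lo")
  case True
  assume "lo \<le> hi"
  then have "0 < (\<Sum>z\<in>{lo..hi}. exp (V \<omega> z))" by (intro sum_pos) auto
  then show ?thesis using True by (simp add: hm_def)
qed (simp add: hm_def)

lemma hm_harmonic:
  assumes "sellip \<omega>" "lo < x" "x \<le> hi"
  shows "stp \<omega> (hm \<omega> lo hi) x = hm \<omega> lo hi x"
proof -
  define Z where "Z = (\<Sum>z\<in>{lo..hi}. exp (V \<omega> z))"
  define T where "T = (\<Sum>z\<in>{x+1..hi}. exp (V \<omega> z))"
  have "{x..hi} = insert x {x+1..hi}" using assms by auto
  then have T1: "(\<Sum>z\<in>{x..hi}. exp (V \<omega> z)) = exp (V \<omega> x) + T" by (simp add: T_def)
  have "{x-1..hi} = insert (x-1) {x..hi}" using assms by auto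
  then have T2: "(\<Sum>z\<in>{x-1..hi}. exp (V \<omega> z)) = exp (V \<omega> (x-1)) + (exp (V \<omega> x) + T)" using T1 by simp
  have "stp \<omega> (hm \<omega> lo hi) x = (\<omega> x * T + (1 - \<omega> x) * (exp (V \<omega> (x-1)) + (exp (V \<omega> x) + T))) / Z"
    using assms by (simp add: stp_def hm_eq T1 T2 T_def[symmetric] Z_def[symmetric] times_divide_eq_right add_divide_distrib[symmetric])
  also have "\<omega> x * T + (1 - \<omega> x) * (exp (V \<omega> (x-1)) + (exp (V \<omega> x) + T)) = exp (V \<omega> x) + T"
    using exp_V_step[OF assms(1), of x] by (simp add: algebra_simps)
  finally show ?thesis using assms by (simp add: hm_eq T1 Z_def)
qed

lemma hm_superharmonic:
  assumes "sellip \<omega>" "x \<le> hi"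
  shows "stp \<omega> (hm \<omega> lo hi) x \<le> hm \<omega> lo hi x"
proof (cases "lo < x")
  case True
  then show ?thesis using hm_harmonic assms by simp
next
  case False
  have "stp \<omega> (hm \<omega> lo hi) x \<le> stp \<omega> (\<lambda>_. 1) x"
    by (intro stp_mono sellip_imp_ellip assms hm_le_one)
  then show ?thesis using False by (simp add: hm_def)
qed

text \<open>\<open>mean \<omega> lo y x\<close> is the mean passage time from \<open>x\<close> to \<open>y\<close> of the walk reflected at \<open>lo\<close>.\<close>

definition Asum :: "(int \<Rightarrow> real) \<Rightarrow> int \<Rightarrow> int \<Rightarrow> real" where
  "Asum \<omega> lo n = (\<Sum>m\<in>{lo..n}. exp (V \<omega> n - V \<omega> m))"

definition mean :: "(int \<Rightarrow> real) \<Rightarrow> int \<Rightarrow> int \<Rightarrow> int \<Rightarrow> real" where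
  "mean \<omega> lo y x = (\<Sum>n\<in>{x..<y}. 2 * Asum \<omega> lo n - 1)"

lemma Asum_nonneg: "0 \<le> Asum \<omega> lo n"
  unfolding Asum_def by (intro sum_nonneg) auto

lemma Asum_ge: "lo \<le> m \<Longrightarrow> m \<le> n \<Longrightarrow> exp (V \<omega> n - V \<omega> m) \<le> Asum \<omega> lo n"
  unfolding Asum_def by (intro member_le_sum) auto

lemma Asum_ge_one: "lo \<le> n \<Longrightarrow> 1 \<le> Asum \<omega> lo n"
  using Asum_ge[of lo n n \<omega>] by simp

text \<open>With \<open>T n = 2 * Asum \<omega> lo n - 1\<close>, the mean time to cross from
  \<open>n\<close> to \<open>n + 1\<close> for the reflected walk, this is the first-step equation
  \<open>\<omega> x * T x = 1 + (1 - \<omega> x) * T (x - 1)\<close>.\<close>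

lemma Asum_rec:
  assumes "sellip \<omega>" "lo < x"
  shows "\<omega> x * Asum \<omega> lo x = \<omega> x + (1 - \<omega> x) * Asum \<omega> lo (x - 1)"
proof -
  have "{lo..x} = insert x {lo..x - 1}" using assms by auto
  then have "Asum \<omega> lo x = 1 + (\<Sum>m\<in>{lo..x-1}. exp (V \<omega> x - V \<omega> m))" by (simp add: Asum_def)
  moreover have "\<omega> x * (\<Sum>m\<in>{lo..x-1}. exp (V \<omega> x - V \<omega> m)) = (1 - \<omega> x) * Asum \<omega> lo (x - 1)"
    unfolding Asum_def sum_distrib_left
  proof (intro sum.cong refl)
    fix m
    have "\<omega> x * exp (V \<omega> x) * exp (- V \<omega> m) = (1 - \<omega> x) * exp (V \<omega> (x - 1)) * exp (- V \<omega> m)"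
      by (simp add: exp_V_step[OF assms(1)])
    then show "\<omega> x * exp (V \<omega> x - V \<omega> m) = (1 - \<omega> x) * exp (V \<omega> (x - 1) - V \<omega> m)"
      by (simp add: exp_diff exp_minus field_simps)
  qed
  ultimately show ?thesis by (simp add: distrib_left)
qed

lemma mean_step: "x < y \<Longrightarrow> mean \<omega> lo y x = (2 * Asum \<omega> lo x - 1) + mean \<omega> lo y (x + 1)"
proof -
  assume "x < y"
  then have "{x..<y} = insert x {x+1..<y}" by auto
  then show ?thesis by (simp add: mean_def)
qed

lemma mean_ge_zero: "lo \<le> x \<Longrightarrow> 0 \<le> mean \<omega> lo y x"
  unfolding mean_def
proof (rule sum_nonneg)
  fix n assume "lo \<le> x" "n \<in> {x..<y}"
  then show "0 \<le> 2 * Asum \<omega> lo n - 1" using Asum_ge_one[of lo n \<omega>] by simp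
qed

lemma mean_rec:
  assumes "sellip \<omega>" "lo < x" "x < y"
  shows "1 + stp \<omega> (mean \<omega> lo y) x = mean \<omega> lo y x"
proof -
  have 1: "mean \<omega> lo y (x + 1) = mean \<omega> lo y x - (2 * Asum \<omega> lo x - 1)" using mean_step[of x y \<omega> lo] assms by simp
  have 2: "mean \<omega> lo y (x - 1) = mean \<omega> lo y x + (2 * Asum \<omega> lo (x - 1) - 1)" using mean_step[of "x - 1" y \<omega> lo] assms by simp
  show ?thesis using Asum_rec[OF assms(1,2)] unfolding stp_def 1 2 by (simp add: algebra_simps)
qed

lemma mean_antimono:
  assumes "lo \<le> x" "x \<le> x'"
  shows "mean \<omega> lo y x' \<le> mean \<omega> lo y x"
  unfolding mean_def
proof (rule sum_mono2)
  fix n assume "n \<in> {x..<y} - {x'..<y}"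
  then show "0 \<le> 2 * Asum \<omega> lo n - 1" using Asum_ge_one[of lo n \<omega>] assms by auto
qed (use assms in auto)

text \<open>Expected passage times dominate the harmonic measure because the weights
  \<open>exp (- V n) * (2 * Asum n - 1)\<close> increase with \<open>n\<close>.\<close>

lemma mean_ge_hm:
  assumes "lo \<le> bb" "bb \<le> z" "z \<le> hi"
  shows "mean \<omega> lo (hi + 1) bb * hm \<omega> bb hi z \<le> mean \<omega> lo (hi + 1) z"
proof -
  define k where "k n = exp (- V \<omega> n) * (2 * Asum \<omega> lo n - 1)" for n
  have keq: "k n = (\<Sum>m\<in>{lo..n}. exp (- V \<omega> m)) + (\<Sum>m\<in>{lo..<n}. exp (- V \<omega> m))" if "lo \<le> n" for n
  proof -
    have "exp (- V \<omega> n) * Asum \<omega> lo n = (\<Sum>m\<in>{lo..n}. exp (- V \<omega> m))"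
      unfolding Asum_def sum_distrib_left by (intro sum.cong refl) (simp add: exp_add[symmetric])
    moreover have "{lo..n} = insert n {lo..<n}" using that by auto
    ultimately show ?thesis by (simp add: k_def algebra_simps)
  qed
  have kmono: "k n \<le> k n'" if "lo \<le> n" "n \<le> n'" for n n'
    using that by (simp add: keq) (intro add_mono sum_mono2; auto)
  have w: "2 * Asum \<omega> lo n - 1 = exp (V \<omega> n) * k n" for n by (simp add: k_def exp_minus)
  define A where "A = (\<Sum>n\<in>{bb..<z}. exp (V \<omega> n))"
  define B where "B = (\<Sum>n\<in>{z..hi}. exp (V \<omega> n))"
  have AB: "0 \<le> A" "0 < B" unfolding A_def B_def using assms by (auto intro!: sum_nonneg sum_pos)
  have un: "{bb..hi} = {bb..<z} \<union> {z..hi}" "{bb..<hi+1} = {bb..<z} \<union> {z..<hi+1}" using assms by auto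
  have Z: "(\<Sum>n\<in>{bb..hi}. exp (V \<omega> n)) = A + B" unfolding un(1) A_def B_def by (subst sum.union_disjoint) auto
  define P1 where "P1 = (\<Sum>n\<in>{bb..<z}. exp (V \<omega> n) * k n)"
  define P2 where "P2 = mean \<omega> lo (hi + 1) z"
  have M: "mean \<omega> lo (hi + 1) bb = P1 + P2"
    unfolding mean_def P1_def P2_def un(2) w by (subst sum.union_disjoint) auto
  have "P1 \<le> (\<Sum>n\<in>{bb..<z}. exp (V \<omega> n) * k z)"
    unfolding P1_def using assms by (intro sum_mono mult_left_mono kmono) auto
  then have 1: "P1 \<le> A * k z" by (simp add: A_def sum_distrib_right)
  have "{z..<hi+1} = {z..hi}" by auto
  then have "P2 = (\<Sum>n\<in>{z..hi}. exp (V \<omega> n) * k n)" by (simp add: P2_def mean_def w)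
  also have "\<dots> \<ge> (\<Sum>n\<in>{z..hi}. exp (V \<omega> n) * k z)"
    using assms by (intro sum_mono mult_left_mono kmono) auto
  finally have 2: "B * k z \<le> P2" by (simp add: B_def sum_distrib_right)
  have "P1 * B \<le> (A * k z) * B" using 1 AB by (intro mult_right_mono) auto
  also have "\<dots> = A * (B * k z)" by simp
  also have "\<dots> \<le> A * P2" using 2 AB by (intro mult_left_mono) auto
  finally have "(P1 + P2) * B \<le> P2 * (A + B)" by (simp add: algebra_simps)
  then have "(P1 + P2) * (B / (A + B)) \<le> P2" using AB by (simp add: field_simps)
  then show ?thesis unfolding M P2_def[symmetric] using assms by (simp add: hm_eq Z B_def)
qed

text \<open>Reverse time: being at \<open>k\<close> when started from \<open>bb\<close> becomes
  being at \<open>bb\<close> when started from \<open>k\<close>, and the latter is at most any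
  nonnegative superharmonic \<open>u\<close> with value 1 at \<open>bb\<close>, such as the
  probability of reaching \<open>bb\<close> before the exit.\<close>

lemma reversible_bound:
  assumes el: "ellip \<omega>" and rev: "\<And>x. w x * \<omega> x = c x" "\<And>x. w x * (1 - \<omega> x) = c (x - 1)"
    and pos: "exp (- v0) \<le> w bb" and wk: "0 \<le> w k"
    and u: "\<And>x. 0 \<le> u x" "u bb = 1" "\<And>x. x < y \<Longrightarrow> stp \<omega> u x \<le> u x"
  shows "ker \<omega> y n bb k \<le> exp v0 * w k * u k"
proof -
  have kb: "ker \<omega> y n k bb \<le> u k"
    by (rule ev_le_superharmonic[OF el, where R = "{}"]) (use u in auto)
  have k0: "0 \<le> ker \<omega> y n bb k" by (rule ev_nonneg[OF el]) auto
  have "exp (- v0) * ker \<omega> y n bb k \<le> w bb * ker \<omega> y n bb k" using pos k0 by (rule mult_right_mono)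
  also have "\<dots> = w k * ker \<omega> y n k bb" by (rule ker_reversible[of w \<omega> c]) (rule rev)+
  also have "\<dots> \<le> w k * u k" using kb wk by (rule mult_left_mono)
  finally have "exp v0 * (exp (- v0) * ker \<omega> y n bb k) \<le> exp v0 * (w k * u k)" by (rule mult_left_mono) simp
  then show ?thesis by (simp add: mult.assoc[symmetric] exp_add[symmetric])
qed

lemma ker_bound:
  assumes "sellip \<omega>" "bb \<le> hi"
  shows "ker \<omega> (hi + 1) n bb k \<le> exp (V \<omega> bb) * (exp (- V \<omega> k) + exp (- V \<omega> (k - 1))) * hm \<omega> bb hi k"
  by (rule reversible_bound[where c = "\<lambda>x. exp (- V \<omega> x)"])
    (use assms conductance[OF assms(1)] in \<open>auto simp: sellip_imp_ellip hm_nonneg hm_superharmonic mult.commute intro: hm_def[THEN trans]\<close>)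

definition reflect :: "(int \<Rightarrow> real) \<Rightarrow> int \<Rightarrow> int \<Rightarrow> real" where
  "reflect \<omega> aa x = (if x = aa then 1 else \<omega> x)"

lemma ellip_reflect: "sellip \<omega> \<Longrightarrow> ellip (reflect \<omega> aa)"
  unfolding sellip_def ellip_def reflect_def by (auto intro: less_imp_le)

lemma stp_reflect: "x \<noteq> aa \<Longrightarrow> stp (reflect \<omega> aa) f x = stp \<omega> f x" "stp (reflect \<omega> aa) f aa = f (aa + 1)"
  by (simp_all add: stp_def reflect_def)

lemma ker_bound_reflect:
  assumes s: "sellip \<omega>" and "aa \<le> bb" "bb \<le> hi" "bb < k"
  shows "ker (reflect \<omega> aa) (hi + 1) n bb k \<le> exp (V \<omega> bb) * (exp (- V \<omega> k) + exp (- V \<omega> (k - 1))) * hm \<omega> bb hi k"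
proof -
  \<comment> \<open>Cutting the edges to the left of \<open>aa\<close> preserves detailed balance:
    the reflected walk is reversible for the remaining conductances. Since \<open>k\<close> lies to
    the right of \<open>bb\<close>, its weight is unchanged.\<close>
  define c where "c x = (if aa \<le> x then exp (- V \<omega> x) else 0)" for x
  define w where "w x = c x + c (x - 1)" for x
  have rev: "w x * (reflect \<omega> aa) x = c x" "w x * (1 - (reflect \<omega> aa) x) = c (x - 1)" for x
    using conductance[OF s, of x] by (cases "x = aa"; cases "x < aa"; simp add: w_def c_def reflect_def)+
  have "ker (reflect \<omega> aa) (hi + 1) n bb k \<le> exp (V \<omega> bb) * w k * hm \<omega> bb hi k"
  proof (rule reversible_bound[where w=w and c=c, OF ellip_reflect[OF s] rev])
    show "exp (- V \<omega> bb) \<le> w bb" "0 \<le> w k" using assms by (auto simp: w_def c_def)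
    show "hm \<omega> bb hi bb = 1" by (simp add: hm_def)
    fix x assume "x < hi + 1"
    show "stp (reflect \<omega> aa) (hm \<omega> bb hi) x \<le> hm \<omega> bb hi x"
    proof (cases "x = aa")
      case True
      have "hm \<omega> bb hi aa = 1" using assms by (simp add: hm_def)
      then show ?thesis using True by (simp add: stp_reflect hm_le_one)
    next
      case False
      then show ?thesis using hm_superharmonic[OF s] \<open>x < hi + 1\<close> by (simp add: stp_reflect)
    qed
  qed (rule hm_nonneg)
  then show ?thesis using assms by (simp add: w_def c_def)
qed

text \<open>The two walks agree until one reaches \<open>{..aa}\<close>. Instead of a coupling, the
  difference of survival probabilities is propagated as a function that the harmonic
  \<open>hm\<close> dominates.\<close>

lemma reflect_diff:
  assumes s: "sellip \<omega>"
  shows "\<bar>sv \<omega> (hi + 1) n x - sv (reflect \<omega> aa) (hi + 1) n x\<bar> \<le> hm \<omega> aa hi x"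
proof (induction n arbitrary: x)
  case 0
  then show ?case by (simp add: hm_nonneg)
next
  case (Suc n)
  have b: "0 \<le> sv \<omega> (hi + 1) (Suc n) x" "sv \<omega> (hi + 1) (Suc n) x \<le> 1"
      "0 \<le> sv (reflect \<omega> aa) (hi + 1) (Suc n) x" "sv (reflect \<omega> aa) (hi + 1) (Suc n) x \<le> 1"
    using ev_nonneg[OF sellip_imp_ellip[OF s]] ev_le_one[OF sellip_imp_ellip[OF s]]
      ev_nonneg[OF ellip_reflect[OF s]] ev_le_one[OF ellip_reflect[OF s]] by (simp_all del: ev.simps)
  consider "x \<le> aa" | "aa < x" "x \<le> hi" | "hi < x" by linarith
  then show ?case
  proof cases
    case 1
    then have "hm \<omega> aa hi x = 1" by (simp add: hm_def)
    then show ?thesis using b by linarith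
  next
    case 2
    have w: "0 \<le> \<omega> x" "0 \<le> 1 - \<omega> x" using s by (auto simp: sellip_def intro: less_imp_le)
    have "\<bar>sv \<omega> (hi + 1) (Suc n) x - sv (reflect \<omega> aa) (hi + 1) (Suc n) x\<bar>
      = \<bar>\<omega> x * (sv \<omega> (hi + 1) n (x + 1) - sv (reflect \<omega> aa) (hi + 1) n (x + 1))
       + (1 - \<omega> x) * (sv \<omega> (hi + 1) n (x - 1) - sv (reflect \<omega> aa) (hi + 1) n (x - 1))\<bar>"
      using 2 by (simp add: stp_def reflect_def algebra_simps)
    also have "\<dots> \<le> \<omega> x * hm \<omega> aa hi (x + 1) + (1 - \<omega> x) * hm \<omega> aa hi (x - 1)"
      by (rule order_trans[OF abs_triangle_ineq]) (use w Suc in \<open>auto simp: abs_mult intro!: add_mono mult_left_mono\<close>)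
    also have "\<dots> = hm \<omega> aa hi x" using hm_harmonic[OF s 2] by (simp add: stp_def)
    finally show ?thesis .
  next
    case 3
    then show ?thesis by (simp add: hm_nonneg)
  qed
qed

lemma exp_neg_lipschitz: "0 \<le> p \<Longrightarrow> p \<le> q \<Longrightarrow> exp (- p) - exp (- q) \<le> q - (p::real)"
proof -
  assume "0 \<le> p" "p \<le> q"
  have "exp (- p) * (1 - exp (- (q - p))) \<le> 1 * (q - p)"
  proof (rule mult_mono)
    show "1 - exp (- (q - p)) \<le> q - p" using exp_ge_add_one_self[of "- (q - p)"] by linarith
  qed (use \<open>0 \<le> p\<close> \<open>p \<le> q\<close> in auto)
  then show ?thesis by (simp add: right_diff_distrib exp_add[symmetric])
qed

text \<open>\<open>F\<close> is a survival probability and \<open>G\<close> the mean residual time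
  on survival. The two comparisons squeeze \<open>F\<close> between \<open>G / (M + r)\<close> and
  \<open>G / M + \<epsilon>\<close>, so \<open>G\<close> decreases nearly by the factor
  \<open>1 - 1 / M\<close> per step. The shift \<open>w\<close> allows a slightly different mean in
  the exponential.\<close>

lemma near_memoryless:
  fixes F G :: "nat \<Rightarrow> real"
  assumes M: "2 \<le> M" and r: "0 \<le> r" and w: "0 \<le> w" and eps: "0 \<le> \<epsilon>"
    and G0: "G 0 = M" and GS: "\<And>n. G (Suc n) = G n - F n"
    and up: "\<And>n. F n \<le> G n / M + \<epsilon>" and lowr: "\<And>n. G n \<le> (M + r) * F n"
  shows "\<bar>F n - exp (- (real n / (M + w)))\<bar> \<le> \<epsilon> + r / M + \<epsilon> * real n / M + real n * (r + 2 + w) / M\<^sup>2"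
proof -
  have Mp: "0 < M" "0 < M + r" "0 < M + w" using M r w by auto
  have Gup: "G n \<le> M * (1 - 1 / (M + r)) ^ n" for n
  proof (induction n)
    case (Suc n)
    have "G n / (M + r) \<le> F n" using lowr[of n] Mp by (simp add: field_simps)
    then have "G (Suc n) \<le> G n - G n / (M + r)" by (simp add: GS)
    also have "\<dots> = G n * (1 - 1 / (M + r))" by (simp add: algebra_simps)
    also have "\<dots> \<le> M * (1 - 1 / (M + r)) ^ n * (1 - 1 / (M + r))"
      using Suc M r by (intro mult_right_mono) (auto simp: divide_le_eq_1)
    finally show ?case by (simp add: mult.commute mult.left_commute)
  qed (simp add: G0)
  have Glow: "M * (1 - 1 / M) ^ n - \<epsilon> * real n \<le> G n" for n
  proof (induction n)
    case (Suc n)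
    define c where "c = 1 - 1 / M"
    have c: "0 \<le> c" "c \<le> 1" using M by (auto simp: c_def divide_le_eq_1)
    have "M * c ^ Suc n - \<epsilon> * real n \<le> (M * c ^ n - \<epsilon> * real n) * c"
      using c eps mult_left_le[of c "\<epsilon> * real n"] by (simp add: algebra_simps)
    also have "\<dots> \<le> G n * c" using Suc c by (intro mult_right_mono) (auto simp: c_def)
    also have "\<dots> = G n - G n / M" by (simp add: c_def algebra_simps)
    also have "\<dots> \<le> G (Suc n) + \<epsilon>" using up[of n] by (simp add: GS)
    finally show ?case unfolding c_def by (simp add: algebra_simps del: power_Suc)
  qed (simp add: G0)
  have M2: "0 < M\<^sup>2" using Mp by simp
  have upper: "F n \<le> exp (- (real n / (M + w))) + \<epsilon> + real n * r / M\<^sup>2"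
  proof -
    have "(1 - 1 / (M + r)) ^ n \<le> exp (- (1 / (M + r))) ^ n"
      using exp_ge_add_one_self[of "- (1 / (M + r))"] M r by (intro power_mono) (auto simp: divide_le_eq_1)
    also have "\<dots> = exp (- (real n / (M + r)))" by (simp add: exp_of_nat_mult[symmetric])
    finally have "F n \<le> exp (- (real n / (M + r))) + \<epsilon>"
      using up[of n] Gup[of n] Mp by (smt (verit) divide_right_mono mult_left_mono nonzero_mult_div_cancel_left)
    moreover have "exp (- (real n / (M + r))) \<le> exp (- (real n / (M + w))) + real n * r / M\<^sup>2"
    proof (cases "w \<le> r")
      case True
      have "real n / (M + r) \<le> real n / (M + w)" using True Mp by (intro divide_left_mono) auto
      then have "exp (- (real n / (M + r))) - exp (- (real n / (M + w))) \<le> real n / (M + w) - real n / (M + r)"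
        using Mp by (intro exp_neg_lipschitz) auto
      also have "\<dots> = real n * (r - w) / ((M + w) * (M + r))" using Mp by (simp add: field_simps)
      also have "\<dots> \<le> real n * r / M\<^sup>2"
        using M2 w r Mp True unfolding power2_eq_square by (intro frac_le mult_left_mono mult_mono) auto
      finally show ?thesis by simp
    next
      case False
      have "real n / (M + w) \<le> real n / (M + r)" using False Mp by (intro divide_left_mono) auto
      then have "exp (- (real n / (M + r))) \<le> exp (- (real n / (M + w)))" by simp
      moreover have "0 \<le> real n * r / M\<^sup>2" using r by simp
      ultimately show ?thesis by linarith
    qed
    ultimately show ?thesis by linarith
  qed
  have lower: "exp (- (real n / (M + w))) - r / M - \<epsilon> * real n / M - real n * 2 / M\<^sup>2 - real n * w / M\<^sup>2 \<le> F n"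
  proof -
    define A where "A = (1 - 1 / M) ^ n"
    have A: "0 \<le> A" "A \<le> 1" unfolding A_def using M by (auto intro!: power_le_one simp: divide_le_eq_1)
    have "(M * A - \<epsilon> * real n) / (M + r) \<le> F n"
      using Glow[of n] lowr[of n] Mp unfolding A_def by (simp add: divide_le_eq mult.commute)
    moreover have "A - r / M - \<epsilon> * real n / M \<le> (M * A - \<epsilon> * real n) / (M + r)"
    proof -
      have "A - M * A / (M + r) = r * A / (M + r)" using Mp by (simp add: field_simps)
      also have "\<dots> \<le> r * 1 / M" using A r Mp by (intro frac_le mult_left_mono) auto
      finally have "A - r / M \<le> M * A / (M + r)" by simp
      moreover have "\<epsilon> * real n / (M + r) \<le> \<epsilon> * real n / M" using eps r Mp by (intro frac_le) auto
      ultimately show ?thesis by (simp add: diff_divide_distrib)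
    qed
    \<comment> \<open>The second-order bound for \<open>ln (1 - 1 / M)\<close> costs
      \<open>2 / M\<^sup>2\<close> per step, whence the 2 in the final estimate.\<close>
    moreover have "exp (- (real n / M)) - real n * 2 / M\<^sup>2 \<le> A"
    proof -
      have x: "0 \<le> 1 / M" "1 / M \<le> 1 / 2" "0 < 1 - 1 / M" using M by (auto simp: field_simps)
      have "- (1 / M) - 2 * (1 / M)\<^sup>2 \<le> ln (1 - 1 / M)" using x by (intro ln_one_minus_pos_lower_bound) auto
      then have "exp (- (1 / M + 2 * (1 / M)\<^sup>2)) \<le> 1 - 1 / M" using x by (simp add: ln_ge_iff)
      then have "exp (- (1 / M + 2 * (1 / M)\<^sup>2)) ^ n \<le> A" unfolding A_def by (intro power_mono) auto
      moreover have "exp (- (1 / M + 2 * (1 / M)\<^sup>2)) ^ n = exp (- (real n / M + real n * 2 / M\<^sup>2))"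
        by (simp add: exp_of_nat_mult[symmetric] power_divide algebra_simps)
      moreover have "exp (- (real n / M)) - exp (- (real n / M + real n * 2 / M\<^sup>2)) \<le> (real n / M + real n * 2 / M\<^sup>2) - real n / M"
        using Mp by (intro exp_neg_lipschitz) auto
      ultimately show ?thesis by linarith
    qed
    moreover have "exp (- (real n / (M + w))) - exp (- (real n / M)) \<le> real n * w / M\<^sup>2"
    proof -
      have "real n / (M + w) \<le> real n / M" using Mp w by (intro divide_left_mono) auto
      then have "exp (- (real n / (M + w))) - exp (- (real n / M)) \<le> real n / M - real n / (M + w)"
        using Mp by (intro exp_neg_lipschitz) auto
      also have "\<dots> = real n * w / (M * (M + w))" using Mp by (simp add: field_simps)
      also have "\<dots> \<le> real n * w / M\<^sup>2" using Mp w unfolding power2_eq_square by (intro frac_le mult_left_mono) auto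
      finally show ?thesis .
    qed
    ultimately show ?thesis by linarith
  qed
  have nn: "0 \<le> r / M" "0 \<le> \<epsilon> * real n / M" "0 \<le> real n * 2 / M\<^sup>2" "0 \<le> real n * w / M\<^sup>2" "0 \<le> real n * r / M\<^sup>2"
    using r eps w Mp by auto
  have "real n * (r + 2 + w) / M\<^sup>2 = real n * r / M\<^sup>2 + real n * 2 / M\<^sup>2 + real n * w / M\<^sup>2"
    by (simp add: distrib_left add_divide_distrib)
  then show ?thesis using upper lower nn eps by (intro abs_leI) linarith+
qed

subsection \<open>Leaving a single valley\<close>

text \<open>A valley with bottom \<open>bb\<close>, left wall \<open>aa\<close>, peak \<open>cc\<close> and exit at \<open>hi + 1\<close>; away from the climb
  from \<open>bb\<close> to \<open>cc\<close> the potential varies in the wrong direction by at most \<open>U\<close>.\<close>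

locale valley =
  fixes \<omega> :: "int \<Rightarrow> real" and aa bb cc hi :: int and L U hh DD HH :: real
  assumes s: "sellip \<omega>" and ord: "aa \<le> bb" "bb \<le> cc" "cc \<le> hi"
    and L: "real_of_int (hi - aa + 1) \<le> L" and U: "0 \<le> U"
    and drop: "\<And>z k. bb \<le> z \<Longrightarrow> z \<le> k \<Longrightarrow> k \<le> cc \<Longrightarrow> V \<omega> z - V \<omega> k \<le> U"
    and rise_r: "\<And>k z. cc \<le> k \<Longrightarrow> k \<le> z \<Longrightarrow> z \<le> hi \<Longrightarrow> V \<omega> z - V \<omega> k \<le> U"
    and rise_l: "\<And>m n. aa \<le> m \<Longrightarrow> m \<le> n \<Longrightarrow> n < bb \<Longrightarrow> V \<omega> n - V \<omega> m \<le> U"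
    and hh: "hh \<le> V \<omega> cc - V \<omega> bb" "ln 2 \<le> hh"
    and walls: "DD \<le> V \<omega> aa - V \<omega> bb" "\<And>z. bb \<le> z \<Longrightarrow> z \<le> hi \<Longrightarrow> V \<omega> z - V \<omega> bb \<le> HH"
begin

lemma L_pos: "1 \<le> L"
  using L ord by simp

lemma card_le: "X \<subseteq> {aa..hi} \<Longrightarrow> real (card X) \<le> L"
proof -
  assume "X \<subseteq> {aa..hi}"
  then have "card X \<le> card {aa..hi}" by (intro card_mono) auto
  then have "real (card X) \<le> real_of_int (hi - aa + 1)" using ord by simp
  then show ?thesis using L by linarith
qed

lemma sum_le_card: "X \<subseteq> {aa..hi} \<Longrightarrow> 0 \<le> C \<Longrightarrow> (\<And>x. x \<in> X \<Longrightarrow> f x \<le> C) \<Longrightarrow> (\<Sum>x\<in>X. f x) \<le> L * (C :: real)"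
proof -
  assume X: "X \<subseteq> {aa..hi}" "0 \<le> C" "\<And>x. x \<in> X \<Longrightarrow> f x \<le> C"
  have "(\<Sum>x\<in>X. f x) \<le> real (card X) * C" using sum_bounded_above[of X f C] X by simp
  also have "\<dots> \<le> L * C" using card_le[OF X(1)] X(2) by (rule mult_right_mono)
  finally show ?thesis .
qed

text \<open>The reversible weight at \<open>k\<close>, relative to \<open>bb\<close>, times the
  share of the scale carried by \<open>X\<close>. If the potential on \<open>X\<close> exceeds that
  at \<open>k\<close> by at most \<open>U\<close>, this is small, because the full scale contains
  the peak term \<open>exp (V \<omega> cc)\<close>.\<close>

lemma crossing_weight:
  assumes X: "X \<subseteq> {bb..hi}" and X2: "\<And>z. z \<in> X \<Longrightarrow> V \<omega> z - V \<omega> k \<le> U" "\<And>z. z \<in> X \<Longrightarrow> V \<omega> z - V \<omega> (k - 1) \<le> U"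
  shows "exp (V \<omega> bb) * (exp (- V \<omega> k) + exp (- V \<omega> (k - 1))) * ((\<Sum>z\<in>X. exp (V \<omega> z)) / (\<Sum>z\<in>{bb..hi}. exp (V \<omega> z)))
     \<le> 2 * L * exp (U - hh)"
proof -
  define Z where "Z = (\<Sum>z\<in>{bb..hi}. exp (V \<omega> z))"
  have Z: "exp (V \<omega> cc) \<le> Z" unfolding Z_def using ord by (intro member_le_sum) auto
  have Z0: "0 < Z" using Z exp_gt_zero less_le_trans by blast
  have X': "X \<subseteq> {aa..hi}" using X ord by auto
  have 1: "exp (- V \<omega> k) * (\<Sum>z\<in>X. exp (V \<omega> z)) \<le> L * exp U"
    unfolding sum_distrib_left using X2(1) by (intro sum_le_card[OF X']) (auto simp: exp_add[symmetric])
  have 2: "exp (- V \<omega> (k - 1)) * (\<Sum>z\<in>X. exp (V \<omega> z)) \<le> L * exp U"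
    unfolding sum_distrib_left using X2(2) by (intro sum_le_card[OF X']) (auto simp: exp_add[symmetric])
  have "exp (V \<omega> bb) * (exp (- V \<omega> k) + exp (- V \<omega> (k - 1))) * ((\<Sum>z\<in>X. exp (V \<omega> z)) / Z)
     = (exp (V \<omega> bb) / Z) * (exp (- V \<omega> k) * (\<Sum>z\<in>X. exp (V \<omega> z)) + exp (- V \<omega> (k - 1)) * (\<Sum>z\<in>X. exp (V \<omega> z)))"
    by (simp add: distrib_left distrib_right add_divide_distrib mult.assoc)
  also have "\<dots> \<le> (exp (V \<omega> bb) / Z) * (L * exp U + L * exp U)"
    using 1 2 Z0 by (intro mult_left_mono add_mono) auto
  also have "\<dots> \<le> (exp (V \<omega> bb) / exp (V \<omega> cc)) * (L * exp U + L * exp U)"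
    using Z Z0 L_pos by (intro mult_right_mono divide_left_mono) auto
  also have "\<dots> = exp (V \<omega> bb - V \<omega> cc) * (2 * L * exp U)" by (simp add: exp_diff)
  also have "\<dots> \<le> exp (- hh) * (2 * L * exp U)" using hh L_pos by (intro mult_right_mono) auto
  also have "\<dots> = 2 * L * exp (U - hh)" by (simp add: exp_diff exp_minus field_simps)
  finally show ?thesis unfolding Z_def .
qed

text \<open>Beyond the peak the site \<open>k\<close> itself is rarely occupied. Before the peak,
  \<open>hm_compl_weight\<close> shows instead that being at \<open>k\<close> and then leaving
  without a return to \<open>bb\<close> is rare.\<close>

lemma hm_weight:
  assumes "cc < k" "k \<le> hi"
  shows "exp (V \<omega> bb) * (exp (- V \<omega> k) + exp (- V \<omega> (k - 1))) * hm \<omega> bb hi k \<le> 2 * L * exp (U - hh)"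
proof -
  have "hm \<omega> bb hi k = (\<Sum>z\<in>{k..hi}. exp (V \<omega> z)) / (\<Sum>z\<in>{bb..hi}. exp (V \<omega> z))"
    using assms ord by (intro hm_eq) auto
  then show ?thesis
    by (simp only:) (rule crossing_weight, use rise_r assms ord in auto)
qed

lemma hm_compl_weight:
  assumes "bb < k" "k \<le> cc"
  shows "exp (V \<omega> bb) * (exp (- V \<omega> k) + exp (- V \<omega> (k - 1))) * (1 - hm \<omega> bb hi k) \<le> 2 * L * exp (U - hh)"
proof -
  have un: "{bb..hi} = {bb..<k} \<union> {k..hi}" using assms ord by auto
  have "0 < (\<Sum>z\<in>{bb..hi}. exp (V \<omega> z))" using ord by (intro sum_pos) auto
  moreover have "(\<Sum>z\<in>{bb..hi}. exp (V \<omega> z)) = (\<Sum>z\<in>{bb..<k}. exp (V \<omega> z)) + (\<Sum>z\<in>{k..hi}. exp (V \<omega> z))"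
    unfolding un by (subst sum.union_disjoint) auto
  ultimately have "1 - hm \<omega> bb hi k = (\<Sum>z\<in>{bb..<k}. exp (V \<omega> z)) / (\<Sum>z\<in>{bb..hi}. exp (V \<omega> z))"
    using assms ord by (simp add: hm_eq field_simps)
  then show ?thesis
    by (simp only:) (rule crossing_weight, use drop assms ord in auto)
qed

text \<open>The left wall rises above everything met on the way to the exit, so the scale to the
  right of \<open>bb\<close> is negligible against the term at \<open>aa\<close>.\<close>

lemma hm_exit: "hm \<omega> aa hi bb \<le> L * exp (HH - DD)"
proof -
  have "exp (V \<omega> aa) \<le> (\<Sum>z\<in>{aa..hi}. exp (V \<omega> z))" using ord by (intro member_le_sum) auto
  moreover have "(\<Sum>z\<in>{bb..hi}. exp (V \<omega> z)) \<le> L * exp (V \<omega> bb + HH)"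
    using walls(2) ord by (intro sum_le_card) (auto simp: algebra_simps)
  ultimately have "(\<Sum>z\<in>{bb..hi}. exp (V \<omega> z)) / (\<Sum>z\<in>{aa..hi}. exp (V \<omega> z)) \<le> L * exp (V \<omega> bb + HH) / exp (V \<omega> aa)"
    using L_pos by (intro frac_le) auto
  also have "\<dots> = L * exp (V \<omega> bb + HH - V \<omega> aa)" by (simp add: exp_diff)
  also have "\<dots> \<le> L * exp (HH - DD)" using walls(1) L_pos by (intro mult_left_mono) auto
  finally show ?thesis using ord by (simp add: hm_eq)
qed

definition W0 :: real where "W0 = 2 * (\<Sum>n\<in>{bb..hi}. Asum \<omega> aa n)"

text \<open>\<open>W0\<close> exceeds the mean exit time by the number of sites, through the
  \<open>- 1\<close> in \<open>2 * Asum - 1\<close>; this number is the shift \<open>w\<close> in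
  \<open>near_memoryless\<close>.\<close>

lemma mean_eq: "mean \<omega> aa (hi + 1) bb + real_of_int (hi - bb + 1) = W0"
proof -
  have "{bb..<hi+1} = {bb..hi}" by auto
  then show ?thesis using ord by (simp add: mean_def W0_def sum_subtractf sum_distrib_left)
qed

lemma mean_ge: "exp hh \<le> mean \<omega> aa (hi + 1) bb"
proof -
  have "1 \<le> exp hh" using hh(2) by (smt (verit) exp_ge_zero exp_ln exp_le_cancel_iff)
  then have "exp hh \<le> 2 * exp hh - 1" by simp
  also have "\<dots> \<le> 2 * exp (V \<omega> cc - V \<omega> bb) - 1" using hh by simp
  also have "\<dots> \<le> 2 * Asum \<omega> aa cc - 1" using Asum_ge[of aa bb cc \<omega>] ord by simp
  also have "\<dots> \<le> mean \<omega> aa (hi + 1) bb"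
    unfolding mean_def
  proof (rule member_le_sum)
    fix n assume "n \<in> {bb..<hi+1} - {cc}"
    then show "0 \<le> 2 * Asum \<omega> aa n - 1" using Asum_ge_one[of aa n \<omega>] ord by simp
  qed (use ord in auto)
  finally show ?thesis .
qed

lemma mean_left: "mean \<omega> aa (hi + 1) aa \<le> mean \<omega> aa (hi + 1) bb + 2 * L\<^sup>2 * exp U"
proof -
  have un: "{aa..<hi+1} = {aa..<bb} \<union> {bb..<hi+1}" using ord by auto
  have "mean \<omega> aa (hi + 1) aa = (\<Sum>n\<in>{aa..<bb}. 2 * Asum \<omega> aa n - 1) + mean \<omega> aa (hi + 1) bb"
    unfolding mean_def un by (subst sum.union_disjoint) auto
  moreover have "(\<Sum>n\<in>{aa..<bb}. 2 * Asum \<omega> aa n - 1) \<le> L * (2 * (L * exp U))"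
  proof (rule sum_le_card)
    show "{aa..<bb} \<subseteq> {aa..hi}" using ord by auto
    show "0 \<le> 2 * (L * exp U)" using L_pos by simp
    fix n assume n: "n \<in> {aa..<bb}"
    have "Asum \<omega> aa n \<le> L * exp U" unfolding Asum_def
      using n ord rise_l by (intro sum_le_card) auto
    then show "2 * Asum \<omega> aa n - 1 \<le> 2 * (L * exp U)" by simp
  qed
  ultimately show ?thesis by (simp add: power2_eq_square)
qed

text \<open>The first error term undoes the reflection, the second collects
  \<open>\<epsilon>\<close> and \<open>r / M\<close>, and the third is the quadratic error of
  \<open>near_memoryless\<close>; all use \<open>exp hh \<le> M\<close>.\<close>

theorem exit_time_exponential:
  assumes n: "real n \<le> T"
  shows "\<bar>sv \<omega> (hi + 1) n bb - exp (- (real n / W0))\<bar>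
     \<le> L * exp (HH - DD) + 2 * L\<^sup>2 * exp (U - hh) * (2 + T * exp (- hh)) + T * exp (- 2 * hh) * (2 * L\<^sup>2 * exp U + 2 + L)"
proof -
  define y where "y = hi + 1"
  define \<omega>' where "\<omega>' = reflect \<omega> aa"
  define M where "M = mean \<omega> aa y bb"
  \<comment> \<open>Frozen to the left of \<open>aa\<close>, where the reflected walk started inside
    the valley never goes.\<close>
  define mt where "mt z = mean \<omega> aa y (max aa z)" for z
  define r where "r = 2 * L\<^sup>2 * exp U"
  define ep where "ep = 2 * L\<^sup>2 * exp (U - hh)"
  define w where "w = real_of_int (hi - bb + 1)"
  define F where "F n = sv \<omega>' y n bb" for n
  define G where "G n = ev \<omega>' y mt n bb" for n
  have el: "ellip \<omega>'" unfolding \<omega>'_def by (rule ellip_reflect[OF s])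
  have Me: "exp hh \<le> M" unfolding M_def y_def by (rule mean_ge)
  have e2: "2 \<le> exp hh" using hh(2) by (metis exp_le_cancel_iff exp_ln zero_less_numeral)
  have M2: "2 \<le> M" using Me e2 by simp
  have r0: "0 \<le> r" and ep0: "0 \<le> ep" and w0: "0 \<le> w" unfolding r_def ep_def w_def using ord by auto
  have mean_y: "mean \<omega> aa y y = 0" by (simp add: mean_def)
  \<comment> \<open>Each step reduces the mean residual time by exactly one on survival, since
    \<open>mean\<close> solves the passage equation inside and the reflected equation at
    \<open>aa\<close>.\<close>
  have GS': "ev \<omega>' y mt (Suc n) x = ev \<omega>' y mt n x - sv \<omega>' y n x" if "aa \<le> x" for n x
    using that
  proof (induction n arbitrary: x)
    case 0
    show ?case
    proof (cases "x < y")
      case True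
      have e0: "ev \<omega>' y mt 0 z = mean \<omega> aa y z" if "aa \<le> z" "z \<le> y" for z
        using that mean_y by (cases "z = y") (auto simp: mt_def)
      have "stp \<omega>' (ev \<omega>' y mt 0) x = mean \<omega> aa y x - 1"
      proof (cases "x = aa")
        case xa: True
        have "Asum \<omega> aa aa = 1" by (simp add: Asum_def)
        then show ?thesis using mean_step[of aa y \<omega> aa] e0[of "aa + 1"] True xa
          by (simp add: \<omega>'_def stp_reflect del: ev.simps)
      next
        case False
        then have xa: "aa < x" using 0 by simp
        have "stp \<omega>' (ev \<omega>' y mt 0) x = stp \<omega> (mean \<omega> aa y) x"
          using xa True e0[of "x + 1"] e0[of "x - 1"] by (simp add: \<omega>'_def stp_def reflect_def del: ev.simps)
        then show ?thesis using mean_rec[OF s xa True] by simp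
      qed
      then show ?thesis using True e0[of x] 0 by simp
    qed simp
  next
    case (Suc n)
    show ?case
    proof (cases "x < y")
      case True
      have "ev \<omega>' y mt (Suc (Suc n)) x = stp \<omega>' (ev \<omega>' y mt (Suc n)) x" using True by simp
      also have "\<dots> = stp \<omega>' (\<lambda>z. ev \<omega>' y mt n z - sv \<omega>' y n z) x"
      proof (cases "x = aa")
        case xa: True
        then show ?thesis using Suc.IH[of "aa + 1"] by (simp add: \<omega>'_def stp_reflect del: ev.simps)
      next
        case False
        then show ?thesis using Suc.IH[of "x + 1"] Suc.IH[of "x - 1"] Suc.prems by (simp add: stp_def del: ev.simps)
      qed
      also have "\<dots> = ev \<omega>' y mt (Suc n) x - sv \<omega>' y (Suc n) x"
        using True by (simp add: stp_def algebra_simps)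
      finally show ?thesis .
    qed simp
  qed
  have G0: "G 0 = M" using ord by (simp add: G_def M_def mt_def y_def)
  have GS: "G (Suc n) = G n - F n" for n unfolding G_def F_def by (rule GS') (rule ord)
  have lowr: "G n \<le> (M + r) * F n" for n
  proof -
    have "G n \<le> ev \<omega>' y (\<lambda>z. (M + r) * 1) n bb" unfolding G_def
    proof (rule ev_mono[OF el])
      fix z assume "z < y"
      have "mt z \<le> mean \<omega> aa y aa" unfolding mt_def by (rule mean_antimono) auto
      then show "mt z \<le> (M + r) * 1" using mean_left unfolding M_def r_def y_def by simp
    qed
    then show ?thesis unfolding ev_cmult F_def .
  qed
  \<comment> \<open>The chance to survive until \<open>n\<close> at a site from which the walk then
    leaves without returning to \<open>bb\<close>, summed over the sites to the right of
    \<open>bb\<close>.\<close>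
  have err: "ev \<omega>' y (\<lambda>z. 1 - hm \<omega> bb hi z) n bb \<le> ep" for n
  proof -
    let ?X = "{bb<..hi}"
    have "ev \<omega>' y (\<lambda>z. 1 - hm \<omega> bb hi z) n bb
        \<le> ev \<omega>' y (\<lambda>z. \<Sum>k\<in>?X. (1 - hm \<omega> bb hi k) * (if z = k then 1 else 0)) n bb"
    proof (rule ev_mono[OF el])
      fix z assume z: "z < y"
      show "1 - hm \<omega> bb hi z \<le> (\<Sum>k\<in>?X. (1 - hm \<omega> bb hi k) * (if z = k then 1 else 0))"
      proof (cases "z \<le> bb")
        case True
        then show ?thesis by (simp add: hm_def)
      next
        case False
        have "(\<Sum>k\<in>?X. (1 - hm \<omega> bb hi k) * (if z = k then 1 else 0)) = (\<Sum>k\<in>?X. if z = k then 1 - hm \<omega> bb hi k else 0)"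
          by (intro sum.cong) auto
        then show ?thesis using z False by (simp add: y_def)
      qed
    qed
    also have "\<dots> = (\<Sum>k\<in>?X. (1 - hm \<omega> bb hi k) * ker \<omega>' y n bb k)"
      by (simp add: ev_sum ev_cmult)
    also have "\<dots> \<le> L * (2 * L * exp (U - hh))"
    proof (rule sum_le_card)
      show "?X \<subseteq> {aa..hi}" using ord by auto
      show "0 \<le> 2 * L * exp (U - hh)" using L_pos by simp
      fix k assume k: "k \<in> ?X"
      let ?p = "exp (V \<omega> bb) * (exp (- V \<omega> k) + exp (- V \<omega> (k - 1)))"
      have p0: "0 \<le> ?p" by (intro mult_nonneg_nonneg add_nonneg_nonneg) auto
      have h1: "0 \<le> 1 - hm \<omega> bb hi k" "0 \<le> hm \<omega> bb hi k" using hm_le_one hm_nonneg by auto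
      have "(1 - hm \<omega> bb hi k) * ker \<omega>' y n bb k \<le> (1 - hm \<omega> bb hi k) * (?p * hm \<omega> bb hi k)"
        unfolding \<omega>'_def y_def using k ord by (intro mult_left_mono ker_bound_reflect s h1) auto
      also have "\<dots> \<le> 2 * L * exp (U - hh)"
      proof (cases "k \<le> cc")
        case True
        have "(1 - hm \<omega> bb hi k) * (?p * hm \<omega> bb hi k) = (?p * (1 - hm \<omega> bb hi k)) * hm \<omega> bb hi k" by simp
        also have "\<dots> \<le> (?p * (1 - hm \<omega> bb hi k)) * 1" using p0 h1 hm_le_one by (intro mult_left_mono) auto
        also have "\<dots> \<le> 2 * L * exp (U - hh)" using hm_compl_weight[of k] True k by simp
        finally show ?thesis .
      next
        case False
        have "(1 - hm \<omega> bb hi k) * (?p * hm \<omega> bb hi k) \<le> 1 * (?p * hm \<omega> bb hi k)"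
          using p0 h1 by (intro mult_right_mono) auto
        also have "\<dots> \<le> 2 * L * exp (U - hh)" using hm_weight[of k] False k by simp
        finally show ?thesis .
      qed
      finally show "(1 - hm \<omega> bb hi k) * ker \<omega>' y n bb k \<le> 2 * L * exp (U - hh)" .
    qed
    finally show ?thesis by (simp add: ep_def power2_eq_square mult.assoc mult.left_commute)
  qed
  \<comment> \<open>From \<open>z\<close> the mean residual time is at least \<open>M\<close> times
    the chance to return to \<open>bb\<close>; by \<open>err\<close> this chance is nearly one for a
    surviving walk.\<close>
  have up: "F n \<le> G n / M + ep" for n
  proof -
    have "M * ev \<omega>' y (hm \<omega> bb hi) n bb \<le> G n"
      unfolding G_def ev_cmult[symmetric]
    proof (rule ev_mono[OF el])
      fix z assume z: "z < y"
      show "M * hm \<omega> bb hi z \<le> mt z"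
      proof (cases "z \<le> bb")
        case True
        have "M \<le> mt z" unfolding M_def mt_def using True ord by (intro mean_antimono) auto
        then show ?thesis using True by (simp add: hm_def)
      next
        case False
        then have "mt z = mean \<omega> aa y z" using ord by (simp add: mt_def)
        then show ?thesis using mean_ge_hm[of aa bb z hi \<omega>] False z ord by (simp add: M_def y_def)
      qed
    qed
    then have "ev \<omega>' y (hm \<omega> bb hi) n bb \<le> G n / M" using M2 by (simp add: field_simps)
    moreover have "F n = ev \<omega>' y (hm \<omega> bb hi) n bb + ev \<omega>' y (\<lambda>z. 1 - hm \<omega> bb hi z) n bb"
      unfolding F_def ev_add[symmetric] by simp
    ultimately show ?thesis using err[of n] by linarith
  qed
  have "\<bar>F n - exp (- (real n / (M + w)))\<bar> \<le> ep + r / M + ep * real n / M + real n * (r + 2 + w) / M\<^sup>2"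
    by (rule near_memoryless[OF M2 r0 w0 ep0 G0 GS up lowr])
  also have "M + w = W0" unfolding M_def w_def y_def by (rule mean_eq)
  finally have 1: "\<bar>F n - exp (- (real n / W0))\<bar> \<le> ep + r / M + ep * real n / M + real n * (r + 2 + w) / M\<^sup>2" .
  have wL: "w \<le> L" using L ord by (simp add: w_def)
  have T0: "0 \<le> T" using n by (smt (verit) of_nat_0_le_iff)
  have "r / M \<le> r / exp hh" using Me r0 by (intro divide_left_mono) (auto simp: M2 intro!: mult_pos_pos less_le_trans[OF exp_gt_zero Me])
  also have "\<dots> = ep" by (simp add: r_def ep_def exp_diff)
  finally have 2: "r / M \<le> ep" .
  have 3: "ep * real n / M \<le> ep * T * exp (- hh)"
  proof -
    have "ep * real n / M \<le> ep * T / exp hh" using ep0 n T0 Me by (intro frac_le mult_left_mono) auto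
    then show ?thesis by (simp add: exp_minus field_simps)
  qed
  have 4: "real n * (r + 2 + w) / M\<^sup>2 \<le> T * exp (- 2 * hh) * (r + 2 + L)"
  proof -
    have "real n * (r + 2 + w) / M\<^sup>2 \<le> T * (r + 2 + L) / (exp hh)\<^sup>2"
      using n T0 r0 w0 wL Me by (intro frac_le mult_mono power_mono) auto
    also have "(exp hh)\<^sup>2 = exp (2 * hh)" by (simp add: exp_double)
    finally show ?thesis by (simp add: exp_minus field_simps)
  qed
  have 5: "\<bar>sv \<omega> y n bb - F n\<bar> \<le> L * exp (HH - DD)"
    unfolding F_def \<omega>'_def y_def using reflect_diff[OF s, of hi n bb aa] hm_exit by linarith
  have "ep + ep + ep * T * exp (- hh) = ep * (2 + T * exp (- hh))" by (simp add: algebra_simps)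
  then show ?thesis using 1 2 3 4 5 unfolding ep_def[symmetric] r_def[symmetric] y_def[symmetric] by linarith
qed

text \<open>Sum the kernel bound over the far sites: left of \<open>aa\<close> use the exit
  estimate, beyond the peak \<open>hm_weight\<close>, and otherwise the reversible weight. The
  latter involves \<open>V\<close> at \<open>k\<close> and \<open>k - 1\<close>, so
  \<open>far\<close> reaches one site below \<open>aa\<close> and starts at distance
  \<open>R - 1\<close>.\<close>

theorem localization:
  assumes far: "\<And>k. aa - 1 \<le> k \<Longrightarrow> k \<le> cc \<Longrightarrow> R - 1 \<le> \<bar>real_of_int (k - bb)\<bar> \<Longrightarrow> c1 \<le> V \<omega> k - V \<omega> bb"
  shows "pr \<omega> n bb (\<lambda>p. (\<forall>z\<in>set p. z < hi + 1) \<and> \<not> \<bar>real_of_int (last p - bb)\<bar> \<le> R)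
     \<le> L * exp (HH - DD) + L * (2 * L * exp (U - hh) + 2 * exp (- c1))"
proof -
  define y where "y = hi + 1"
  have el: "ellip \<omega>" by (rule sellip_imp_ellip[OF s])
  let ?bad = "\<lambda>z. \<not> \<bar>real_of_int (z - bb)\<bar> \<le> R"
  let ?X = "{k \<in> {aa..hi}. ?bad k}"
  have finX: "finite ?X" by (rule finite_subset[of _ "{aa..hi}"]) auto
  have "pr \<omega> n bb (\<lambda>p. (\<forall>z\<in>set p. z < y) \<and> ?bad (last p)) = ev \<omega> y (\<lambda>z. if ?bad z then 1 else 0) n bb"
    by (rule pr_below[OF el])
  also have "\<dots> \<le> ev \<omega> y (\<lambda>z. (if z < aa then 1 else 0) + (\<Sum>k\<in>?X. if z = k then 1 else 0)) n bb"
  proof (rule ev_mono[OF el])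
    fix z assume z: "z < y"
    show "(if ?bad z then 1 else (0::real)) \<le> (if z < aa then 1 else 0) + (\<Sum>k\<in>?X. if z = k then 1 else 0)"
    proof -
      from finX have "(\<Sum>k\<in>?X. if z = k then 1 else (0::real)) = (if z \<in> ?X then 1 else 0)" by (rule sum.delta')
      then show ?thesis using z by (auto simp: y_def)
    qed
  qed
  also have "\<dots> = ev \<omega> y (\<lambda>z. if z < aa then 1 else 0) n bb + (\<Sum>k\<in>?X. ker \<omega> y n bb k)"
    by (simp only: ev_add ev_sum[OF finX])
  also have "\<dots> \<le> L * exp (HH - DD) + L * (2 * L * exp (U - hh) + 2 * exp (- c1))"
  proof (rule add_mono)
    have "ev \<omega> y (\<lambda>z. if z < aa then 1 else 0) n bb \<le> hm \<omega> aa hi bb"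
      by (rule ev_le_superharmonic[OF el, where R = "{}"])
        (auto simp: hm_nonneg hm_superharmonic[OF s] y_def, simp add: hm_def)
    then show "ev \<omega> y (\<lambda>z. if z < aa then 1 else 0) n bb \<le> L * exp (HH - DD)" using hm_exit by simp
    show "(\<Sum>k\<in>?X. ker \<omega> y n bb k) \<le> L * (2 * L * exp (U - hh) + 2 * exp (- c1))"
    proof (rule sum_le_card)
      show "?X \<subseteq> {aa..hi}" by auto
      show "0 \<le> 2 * L * exp (U - hh) + 2 * exp (- c1)" using L_pos by simp
      fix k assume k: "k \<in> ?X"
      let ?p = "exp (V \<omega> bb) * (exp (- V \<omega> k) + exp (- V \<omega> (k - 1)))"
      have p0: "0 \<le> ?p" by (intro mult_nonneg_nonneg add_nonneg_nonneg) auto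
      have kb: "ker \<omega> y n bb k \<le> ?p * hm \<omega> bb hi k"
        unfolding y_def using ord by (intro ker_bound s) auto
      show "ker \<omega> y n bb k \<le> 2 * L * exp (U - hh) + 2 * exp (- c1)"
      proof (cases "cc < k")
        case True
        then have "?p * hm \<omega> bb hi k \<le> 2 * L * exp (U - hh)" using hm_weight[of k] k by simp
        moreover have "0 \<le> 2 * exp (- c1)" by simp
        ultimately show ?thesis using kb by linarith
      next
        case False
        have "c1 \<le> V \<omega> k - V \<omega> bb" using False k by (intro far) auto
        moreover have "c1 \<le> V \<omega> (k - 1) - V \<omega> bb" using False k by (intro far) auto
        ultimately have "exp (- (V \<omega> k - V \<omega> bb)) + exp (- (V \<omega> (k - 1) - V \<omega> bb)) \<le> exp (- c1) + exp (- c1)"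
          by (intro add_mono) auto
        moreover have "?p = exp (- (V \<omega> k - V \<omega> bb)) + exp (- (V \<omega> (k - 1) - V \<omega> bb))"
          by (simp add: distrib_left exp_add[symmetric])
        moreover have "?p * hm \<omega> bb hi k \<le> ?p * 1" using p0 hm_le_one by (intro mult_left_mono) auto
        moreover have "0 \<le> 2 * L * exp (U - hh)" using L_pos by simp
        ultimately show ?thesis using kb by linarith
      qed
    qed
  qed
  finally show ?thesis unfolding y_def .
qed

end

subsection \<open>Weighted sums of exponential variables\<close>

abbreviation Ex1 :: "real measure" where
  "Ex1 \<equiv> density lborel (exponential_density 1)"

lemma prob_Ex1: "prob_space Ex1"
  by (rule prob_space_exponential_density) simp

lemma prob_Exps: "prob_space Exps"
  unfolding Exps_def by (rule prob_space_PiM) (rule prob_Ex1)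

interpretation Exps: prob_space Exps
  by (rule prob_Exps)

lemma sets_Ex1: "sets Ex1 = sets borel"
  by simp

lemma Exps_component: "(\<lambda>es. es k) \<in> borel_measurable Exps"
proof -
  have "(\<lambda>es. es k) \<in> Exps \<rightarrow>\<^sub>M Ex1" unfolding Exps_def by (rule measurable_component_singleton) simp
  then show ?thesis by (simp add: measurable_cong_sets[OF refl sets_Ex1])
qed

lemma Exps_cmult_component: "(\<lambda>es. c * es k) \<in> borel_measurable Exps"
  by (intro borel_measurable_times borel_measurable_const Exps_component)

lemma space_Exps [simp]: "space Exps = UNIV"
  by (simp add: Exps_def space_PiM PiE_def)

lemma Exps_distributed: "distributed Exps lborel (\<lambda>es. es k) (exponential_density 1)"
proof -
  interpret PP: product_prob_space "\<lambda>_. Ex1" "UNIV :: nat set"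
    by (intro product_prob_spaceI prob_Ex1)
  have "distr Exps Ex1 (\<lambda>es. es k) = Ex1" unfolding Exps_def by (rule PP.PiM_component) simp
  moreover have "distr Exps Ex1 (\<lambda>es. es k) = distr Exps lborel (\<lambda>es. es k)"
    by (rule distr_cong_AE) (auto simp: sets_Ex1 Exps_component)
  ultimately show ?thesis by (auto simp: distributed_def exponential_density_nonneg Exps_component)
qed

lemma Exps_nonneg: "AE es in Exps. \<forall>k. 0 \<le> es k"
  unfolding AE_all_countable
proof
  fix k
  have "measure Exps {es \<in> space Exps. es k \<le> 0} = 1 - exp (- 0 * 1)"
    by (rule Exps.exponential_distributedD_le[OF Exps_distributed]) auto
  then have "measure Exps {es. es k \<le> 0} = 0" by simp
  moreover have "{es. es k \<le> 0} \<in> sets Exps"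
  proof -
    have "{es \<in> space Exps. es k \<le> 0} \<in> sets Exps" by (intro borel_measurable_le Exps_component borel_measurable_const)
    then show ?thesis by simp
  qed
  ultimately have "{es. es k \<le> 0} \<in> null_sets Exps" by (auto simp: null_sets_def Exps.emeasure_eq_measure)
  then show "AE es in Exps. 0 \<le> es k" by (rule AE_I') auto
qed

lemma Exps_tail: "0 < c \<Longrightarrow> 0 \<le> x \<Longrightarrow> measure Exps {es. x < c * es k} = exp (- (x / c))"
proof -
  assume c: "0 < c" "0 \<le> x"
  have "measure Exps {es \<in> space Exps. x / c < es k} = exp (- (x / c) * 1)"
    by (rule Exps.exponential_distributedD_gt[OF Exps_distributed]) (use c in auto)
  moreover have "{es \<in> space Exps. x / c < es k} = {es. x < c * es k}" using c by (auto simp: field_simps)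
  ultimately show ?thesis by simp
qed

lemma Exps_measure_le: "emeasure Exps A \<le> ennreal x \<Longrightarrow> 0 \<le> x \<Longrightarrow> measure Exps A \<le> x"
  by (simp add: Exps.emeasure_eq_measure ennreal_le_iff)

lemma Exps_integral: "integrable Exps (\<lambda>es. es k)" "(\<integral>es. es k \<partial>Exps) = 1"
proof -
  show "(\<integral>es. es k \<partial>Exps) = 1"
    using Exps.exponential_distributed_expectation[OF zero_less_one Exps_distributed[of k]] by simp
  then show "integrable Exps (\<lambda>es. es k)" by (metis not_integrable_integral_eq zero_neq_one)
qed

lemma nn_integral_Exps_component: "f \<in> borel_measurable borel \<Longrightarrow> (\<integral>\<^sup>+es. f (es k) \<partial>Exps) = (\<integral>\<^sup>+x. f x \<partial>Ex1)"
proof -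
  assume f: "f \<in> borel_measurable borel"
  have "distr Exps lborel (\<lambda>es. es k) = Ex1" using Exps_distributed[of k] by (simp add: distributed_def)
  then show ?thesis using nn_integral_distr[of "\<lambda>es. es k" Exps lborel f] f by (simp add: Exps_component)
qed

lemma Exps_merge:
  "F \<in> borel_measurable Exps \<Longrightarrow> (\<integral>\<^sup>+x. F x \<partial>Exps) = (\<integral>\<^sup>+x. \<integral>\<^sup>+y. F (merge_on A x y) \<partial>Exps \<partial>Exps)"
  unfolding Exps_def by (rule nn_integral_merge_on[OF prob_Ex1])

lemma Ex1_interval: "0 < c \<Longrightarrow> (\<integral>\<^sup>+x. indicator {x. l < c * x \<and> c * x \<le> u} x \<partial>Ex1) \<le> ennreal ((u - l) / c)"
proof -
  assume c: "0 < c"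
  have eq: "{x. l < c * x \<and> c * x \<le> u} = {l / c<..u / c}" using c by (auto simp: field_simps)
  have "(\<integral>\<^sup>+x. indicator {x. l < c * x \<and> c * x \<le> u} x \<partial>Ex1)
      = (\<integral>\<^sup>+x. ennreal (exponential_density 1 x) * indicator {l / c<..u / c} x \<partial>lborel)"
    unfolding eq by (subst nn_integral_density) (auto simp: exponential_density_nonneg)
  also have "\<dots> \<le> (\<integral>\<^sup>+x. indicator {l / c<..u / c} x \<partial>lborel)"
  proof (rule nn_integral_mono)
    fix x :: real
    have "exponential_density 1 x \<le> 1" by (simp add: exponential_density_def)
    then show "ennreal (exponential_density 1 x) * indicator {l / c<..u / c} x \<le> indicator {l / c<..u / c} x"
      by (auto simp: indicator_def ennreal_le_1)
  qed
  also have "\<dots> = emeasure lborel {l / c<..u / c}" by simp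
  also have "\<dots> \<le> ennreal ((u - l) / c)"
    by (cases "l / c \<le> u / c") (auto simp: diff_divide_distrib)
  finally show ?thesis .
qed

text \<open>Conditioning on all other coordinates, the density of \<open>es k0\<close> is bounded by one.\<close>

lemma Exps_window:
  fixes f g :: "(nat \<Rightarrow> real) \<Rightarrow> real"
  assumes f [measurable]: "f \<in> borel_measurable Exps" and g [measurable]: "g \<in> borel_measurable Exps"
    and dep: "depends_on (- {k0}) f" "depends_on (- {k0}) g" and c: "0 < c"
  shows "emeasure Exps {es. f es < c * es k0 \<and> c * es k0 \<le> g es} \<le> (\<integral>\<^sup>+es. ennreal ((g es - f es) / c) \<partial>Exps)"
proof -
  let ?A = "{es. f es < c * es k0 \<and> c * es k0 \<le> g es}"
  have "{es \<in> space Exps. f es < c * es k0} \<in> sets Exps" "{es \<in> space Exps. c * es k0 \<le> g es} \<in> sets Exps"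
    by (intro borel_measurable_less borel_measurable_le f g Exps_cmult_component)+
  then have A: "?A \<in> sets Exps" by (simp add: Collect_conj_eq sets.Int)
  have "emeasure Exps ?A = (\<integral>\<^sup>+es. indicator ?A es \<partial>Exps)" using A by simp
  also have "\<dots> = (\<integral>\<^sup>+x. \<integral>\<^sup>+y. indicator ?A (merge_on (- {k0}) x y) \<partial>Exps \<partial>Exps)"
    using A by (intro Exps_merge) auto
  also have "\<dots> = (\<integral>\<^sup>+x. \<integral>\<^sup>+y. indicator {z. f x < c * z \<and> c * z \<le> g x} (y k0) \<partial>Exps \<partial>Exps)"
  proof (intro nn_integral_cong)
    fix x y :: "nat \<Rightarrow> real"
    have "f (merge_on (- {k0}) x y) = f x" "g (merge_on (- {k0}) x y) = g x"
      by (intro depends_onD[OF dep(1)] depends_onD[OF dep(2)]; simp add: merge_on_def)+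
    then show "indicator ?A (merge_on (- {k0}) x y) = (indicator {z. f x < c * z \<and> c * z \<le> g x} (y k0) :: ennreal)"
      by (auto simp: indicator_def merge_on_def)
  qed
  also have "\<dots> \<le> (\<integral>\<^sup>+x. ennreal ((g x - f x) / c) \<partial>Exps)"
  proof (rule nn_integral_mono)
    fix x
    have "(\<integral>\<^sup>+y. indicator {z. f x < c * z \<and> c * z \<le> g x} (y k0) \<partial>Exps)
        = (\<integral>\<^sup>+z. indicator {z. f x < c * z \<and> c * z \<le> g x} z \<partial>Ex1)"
      by (rule nn_integral_Exps_component) measurable
    also have "\<dots> \<le> ennreal ((g x - f x) / c)" by (rule Ex1_interval[OF c])
    finally show "(\<integral>\<^sup>+y. indicator {z. f x < c * z \<and> c * z \<le> g x} (y k0) \<partial>Exps) \<le> ennreal ((g x - f x) / c)" .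
  qed
  finally show ?thesis .
qed

definition ws :: "(nat \<Rightarrow> real) \<Rightarrow> nat \<Rightarrow> (nat \<Rightarrow> real) \<Rightarrow> real" where
  "ws w n es = (\<Sum>k\<in>{1..n}. w k * es k)"

lemma ws_measurable [measurable]: "ws w n \<in> borel_measurable Exps"
  unfolding ws_def by (intro borel_measurable_sum Exps_cmult_component)

lemma ws_0 [simp]: "ws w 0 es = 0"
  by (simp add: ws_def)

lemma ws_Suc: "ws w (Suc n) es = ws w n es + w (Suc n) * es (Suc n)"
  by (simp add: ws_def)

lemma ws_mono:
  assumes "\<forall>k. 0 \<le> es k" "\<And>k. 0 \<le> w k" "m \<le> n"
  shows "ws w m es \<le> ws w n es"
  unfolding ws_def using assms by (intro sum_mono2) auto

lemma ws_split: "k0 \<in> {1..n} \<Longrightarrow> ws w n es = (\<Sum>k\<in>{1..n} - {k0}. w k * es k) + w k0 * es k0"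
  unfolding ws_def by (subst sum.remove[of _ k0]) auto

lemma depends_on_comp2:
  fixes F :: "('i \<Rightarrow> 'a) \<Rightarrow> 'b" and G :: "('i \<Rightarrow> 'a) \<Rightarrow> 'c"
  assumes "depends_on A F" "depends_on A G"
  shows "depends_on A (\<lambda>x. q (F x) (G x))"
proof (rule depends_onI)
  fix x y :: "'i \<Rightarrow> 'a" assume eq: "\<And>i. i \<in> A \<Longrightarrow> x i = y i"
  have "F x = F y" by (rule depends_onD[OF assms(1) eq])
  moreover have "G x = G y" by (rule depends_onD[OF assms(2) eq])
  ultimately show "q (F x) (G x) = q (F y) (G y)" by simp
qed

lemma depends_on_ws_rest: "depends_on (- {k0}) (\<lambda>es. \<Sum>k\<in>{1..n} - {k0}. w k * es k :: real)"
  by (rule depends_onI) (auto intro!: sum.cong)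

lemma sets_Exps_pred: "Measurable.pred Exps Q \<Longrightarrow> {es. Q es} \<in> sets Exps"
  by (drule predE) simp

text \<open>Given all other coordinates, entering the window at step \<open>n\<close> confines
  \<open>w k0 * es k0\<close> to an interval of length \<open>min (w n * es n) (u - l)\<close>, and
  the density of \<open>es k0\<close> is at most one. The first bound is meant for large
  \<open>w n\<close>, the second for small ones, which are summed.\<close>

lemma ws_enter_window:
  assumes w: "\<And>k. 0 \<le> w k" "0 < w k0" and k0: "1 \<le> k0" "k0 < n" and "l \<le> u"
  shows "measure Exps {es. ws w (n - 1) es \<le> l \<and> l < ws w n es \<and> ws w n es \<le> u}
     \<le> min ((u - l) / w k0) (w n / w k0)"
proof -
  define R where "R n es = (\<Sum>k\<in>{1..n} - {k0}. w k * es k)" for n and es :: "nat \<Rightarrow> real"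
  have [measurable]: "R n \<in> borel_measurable Exps" for n unfolding R_def by (intro borel_measurable_sum Exps_cmult_component)
  have dR: "depends_on (- {k0}) (R m)" for m unfolding R_def by (rule depends_on_ws_rest)
  have eq: "ws w m es = R m es + w k0 * es k0" if "k0 \<le> m" for m es
    unfolding R_def using that k0 by (intro ws_split) auto
  let ?f = "\<lambda>es. l - R n es" and ?g = "\<lambda>es. min (l - R (n - 1) es) (u - R n es)"
  have Rn: "R n es - R (n - 1) es = w n * es n" for es
  proof -
    have "{1..n} - {k0} = insert n ({1..n - 1} - {k0})" using k0 by auto
    moreover have "n \<notin> {1..n - 1} - {k0}" using k0 by auto
    ultimately show ?thesis by (simp add: R_def)
  qed
  have set: "{es. ws w (n - 1) es \<le> l \<and> l < ws w n es \<and> ws w n es \<le> u} = {es. ?f es < w k0 * es k0 \<and> w k0 * es k0 \<le> ?g es}"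
    using eq[of n] eq[of "n - 1"] k0 by (auto simp: algebra_simps)
  have "emeasure Exps {es. ?f es < w k0 * es k0 \<and> w k0 * es k0 \<le> ?g es} \<le> (\<integral>\<^sup>+es. ennreal ((?g es - ?f es) / w k0) \<partial>Exps)"
  proof (rule Exps_window)
    show "depends_on (- {k0}) ?f" by (rule depends_on_comp2[OF dR dR, of "\<lambda>p _. l - p"])
    show "depends_on (- {k0}) ?g" by (rule depends_on_comp2[OF dR dR])
  qed (use w in auto)
  also have "\<dots> = (\<integral>\<^sup>+es. ennreal (min (w n * es n) (u - l) / w k0) \<partial>Exps)"
    by (intro nn_integral_cong arg_cong[of _ _ ennreal] arg_cong2[of _ _ _ _ "(/)"] refl)
      (use Rn in \<open>auto simp: min_def algebra_simps\<close>)
  finally have le: "emeasure Exps {es. ws w (n - 1) es \<le> l \<and> l < ws w n es \<and> ws w n es \<le> u}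
    \<le> (\<integral>\<^sup>+es. ennreal (min (w n * es n) (u - l) / w k0) \<partial>Exps)" unfolding set .
  have "(\<integral>\<^sup>+es. ennreal (min (w n * es n) (u - l) / w k0) \<partial>Exps) \<le> (\<integral>\<^sup>+es. ennreal ((u - l) / w k0) \<partial>Exps)"
    using w by (intro nn_integral_mono ennreal_leI divide_right_mono) auto
  also have "\<dots> = ennreal ((u - l) / w k0)" using Exps.emeasure_space_1 by simp
  finally have 1: "measure Exps {es. ws w (n - 1) es \<le> l \<and> l < ws w n es \<and> ws w n es \<le> u} \<le> (u - l) / w k0"
    using w \<open>l \<le> u\<close> by (intro Exps_measure_le order_trans[OF le]) auto
  have int: "integrable Exps (\<lambda>es. w n * es n / w k0)" using Exps_integral(1)[of n] by simp
  have "(\<integral>\<^sup>+es. ennreal (min (w n * es n) (u - l) / w k0) \<partial>Exps) \<le> (\<integral>\<^sup>+es. ennreal (w n * es n / w k0) \<partial>Exps)"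
    using w by (intro nn_integral_mono ennreal_leI divide_right_mono) auto
  also have "\<dots> = ennreal (\<integral>es. w n * es n / w k0 \<partial>Exps)"
  proof (rule nn_integral_eq_integral[OF int])
    show "AE es in Exps. 0 \<le> w n * es n / w k0" using Exps_nonneg by eventually_elim (use w in auto)
  qed
  also have "(\<integral>es. w n * es n / w k0 \<partial>Exps) = w n / w k0" using Exps_integral[of n] by simp
  finally have 2: "measure Exps {es. ws w (n - 1) es \<le> l \<and> l < ws w n es \<and> ws w n es \<le> u} \<le> w n / w k0"
    using w by (intro Exps_measure_le order_trans[OF le]) (auto intro: less_imp_le)
  show ?thesis using 1 2 by simp
qed

lemma ws_in_window:
  assumes w: "0 < w k0" and k0: "1 \<le> k0" and "l \<le> u"
  shows "measure Exps {es. l < ws w k0 es \<and> ws w k0 es \<le> u} \<le> (u - l) / w k0"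
proof -
  define R where "R es = (\<Sum>k\<in>{1..k0} - {k0}. w k * es k)" for es :: "nat \<Rightarrow> real"
  have [measurable]: "R \<in> borel_measurable Exps" unfolding R_def by (intro borel_measurable_sum Exps_cmult_component)
  have dR: "depends_on (- {k0}) R" unfolding R_def by (rule depends_on_ws_rest)
  have eq: "ws w k0 es = R es + w k0 * es k0" for es
    unfolding R_def using k0 by (intro ws_split) auto
  have set: "{es. l < ws w k0 es \<and> ws w k0 es \<le> u} = {es. l - R es < w k0 * es k0 \<and> w k0 * es k0 \<le> u - R es}"
    by (auto simp: eq algebra_simps)
  have "emeasure Exps {es. l < ws w k0 es \<and> ws w k0 es \<le> u} \<le> (\<integral>\<^sup>+es. ennreal (((u - R es) - (l - R es)) / w k0) \<partial>Exps)"
    unfolding set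
  proof (rule Exps_window)
    show "depends_on (- {k0}) (\<lambda>es. l - R es)" by (rule depends_on_comp2[OF dR dR, of "\<lambda>p _. l - p"])
    show "depends_on (- {k0}) (\<lambda>es. u - R es)" by (rule depends_on_comp2[OF dR dR, of "\<lambda>p _. u - p"])
  qed (use w in auto)
  also have "\<dots> = ennreal ((u - l) / w k0)" using Exps.emeasure_space_1 by simp
  finally show ?thesis using w \<open>l \<le> u\<close> by (intro Exps_measure_le) auto
qed

text \<open>Let \<open>n\<close> be the first index with a partial sum above \<open>l\<close>.
  Either the sum jumps over the whole window at \<open>n\<close>, or one of four bad things happens:
  the sum up to \<open>K\<close> stays below \<open>u\<close>, \<open>l\<close> is passed before
  \<open>k0\<close>, or a step lands in the window at \<open>k0\<close> or at a later index below
  \<open>K\<close>. The factor \<open>m + 1\<close> counts \<open>k0\<close> and the indices in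
  \<open>Lg\<close>.\<close>

lemma window_sum:
  assumes w: "\<And>k. 0 \<le> w k" and k0: "1 \<le> k0" "k0 \<le> K" "0 < w k0" and wK: "0 < w K"
    and l: "0 < l" "l \<le> u" and Lg: "finite Lg" "real (card Lg) \<le> m"
  shows "1 - u / w K - (\<Sum>k\<in>{1..<k0}. w k) / l - ((m + 1) * (u - l) + (\<Sum>k\<in>{1..K} - Lg. w k)) / w k0
     \<le> (\<Sum>n\<in>{1..K}. measure Exps {es. ws w (n - 1) es \<le> l \<and> u < ws w n es})"
proof -
  let ?G = "\<lambda>n. {es. ws w (n - 1) es \<le> l \<and> u < ws w n es}"
  let ?E = "\<lambda>n. {es. ws w (n - 1) es \<le> l \<and> l < ws w n es \<and> ws w n es \<le> u}"
  let ?A = "{es. ws w K es \<le> u}" and ?B = "{es. l < ws w (k0 - 1) es}" and ?C = "{es. l < ws w k0 es \<and> ws w k0 es \<le> u}"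
  have ms: "?G n \<in> sets Exps" "?E n \<in> sets Exps" "?A \<in> sets Exps" "?B \<in> sets Exps" "?C \<in> sets Exps" for n
    by (rule sets_Exps_pred, measurable)+
  have K1: "1 \<le> K" using k0 by simp
  let ?U = "(\<Union>n\<in>{1..K}. ?G n) \<union> (?A \<union> (?B \<union> (?C \<union> (\<Union>n\<in>{k0<..<K}. ?E n))))"
  have "AE es in Exps. es \<in> ?U"
    using Exps_nonneg
  proof eventually_elim
    case (elim es)
    show ?case
    proof (rule ccontr)
      assume no: "es \<notin> ?U"
      define n where "n = (LEAST n. l < ws w n es)"
      have KK: "u < ws w K es" using no by auto
      then have lK: "l < ws w K es" using l by simp
      have n: "l < ws w n es" unfolding n_def by (rule LeastI[of _ K]) (rule lK)
      have nK: "n \<le> K" unfolding n_def by (rule Least_le) (rule lK)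
      have n0: "n \<noteq> 0"
      proof
        assume "n = 0"
        with n l show False by simp
      qed
      then have before: "ws w (n - 1) es \<le> l" using not_less_Least[of "n - 1" "\<lambda>n. l < ws w n es"] unfolding n_def by auto
      have "k0 \<le> n"
      proof (rule ccontr)
        assume "\<not> k0 \<le> n"
        then have "ws w n es \<le> ws w (k0 - 1) es" using elim w by (intro ws_mono) auto
        then show False using n no by auto
      qed
      then consider "n = K" | "n = k0" "n < K" | "k0 < n" "n < K" using nK by linarith
      then show False
      proof cases
        case 1
        then have "es \<in> ?G K" using before KK by simp
        then show False using no K1 by auto
      next
        case 2
        then have "u < ws w n es" using no n by auto
        then have "es \<in> ?G n" using before by simp
        then show False using no n0 nK by auto
      next
        case 3
        then have "es \<notin> ?E n" using no by auto
        then have "es \<in> ?G n" using before n by auto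
        then show False using no n0 nK by auto
      qed
    qed
  qed
  moreover have U: "?U \<in> sets Exps" by (intro sets.Un sets.finite_UN ms) auto
  ultimately have "1 = measure Exps ?U" using Exps.prob_eq_1[OF U] by simp
  also have "\<dots> \<le> measure Exps (\<Union>n\<in>{1..K}. ?G n) + (measure Exps ?A + (measure Exps ?B + (measure Exps ?C + measure Exps (\<Union>n\<in>{k0<..<K}. ?E n))))"
    by (intro order_trans[OF measure_Un_le] add_mono order_refl sets.Un sets.finite_UN ms) auto
  also have "\<dots> \<le> (\<Sum>n\<in>{1..K}. measure Exps (?G n)) + (u / w K + ((\<Sum>k\<in>{1..<k0}. w k) / l + ((u - l) / w k0 + (\<Sum>n\<in>{k0<..<K}. measure Exps (?E n)))))"
  proof (intro add_mono)
    show "measure Exps (\<Union>n\<in>{1..K}. ?G n) \<le> (\<Sum>n\<in>{1..K}. measure Exps (?G n))"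
      by (rule measure_UNION_le) (simp_all only: ms finite_atLeastAtMost finite_greaterThanLessThan)
    show "measure Exps (\<Union>n\<in>{k0<..<K}. ?E n) \<le> (\<Sum>n\<in>{k0<..<K}. measure Exps (?E n))"
      by (rule measure_UNION_le) (simp_all only: ms finite_atLeastAtMost finite_greaterThanLessThan)
    show "measure Exps ?C \<le> (u - l) / w k0" using k0 l by (intro ws_in_window) auto
    \<comment> \<open>The sum dominates its last term, and one exponential variable of mean
      \<open>w K\<close> stays below \<open>u\<close> with probability at most
      \<open>u / w K\<close>.\<close>
    show "measure Exps ?A \<le> u / w K"
    proof -
      have "AE es in Exps. es \<in> ?A \<longrightarrow> es \<in> {es. - 1 < ws w K es \<and> ws w K es \<le> u} \<inter> ?A \<and> w K * es K \<le> u"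
        using Exps_nonneg
      proof eventually_elim
        case (elim es)
        have "0 \<le> ws w K es" unfolding ws_def using elim w by (intro sum_nonneg) auto
        moreover have "w K * es K \<le> ws w K es" unfolding ws_def using elim w K1 by (intro member_le_sum) auto
        ultimately show ?case by auto
      qed
      then have AE: "AE es in Exps. es \<in> ?A \<longrightarrow> es \<in> {es. w K * es K \<le> u}" by eventually_elim auto
      have "{es \<in> space Exps. w K * es K \<le> u} \<in> sets Exps" by (intro borel_measurable_le Exps_cmult_component borel_measurable_const)
      then have m: "{es. w K * es K \<le> u} \<in> sets Exps" by simp
      have "measure Exps ?A \<le> measure Exps {es. w K * es K \<le> u}"
        by (rule Exps.finite_measure_mono_AE[OF AE m])
      also have "\<dots> = 1 - measure Exps {es. u < w K * es K}"
      proof -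
        have "{es. w K * es K \<le> u} = space Exps - {es. u < w K * es K}" by auto
        moreover have "{es \<in> space Exps. u < w K * es K} \<in> sets Exps"
          by (intro borel_measurable_less Exps_cmult_component borel_measurable_const)
        ultimately show ?thesis using Exps.prob_compl by simp
      qed
      also have "\<dots> = 1 - exp (- (u / w K))" using wK l by (simp add: Exps_tail)
      also have "\<dots> \<le> u / w K" using exp_ge_add_one_self[of "- (u / w K)"] by simp
      finally show ?thesis .
    qed
    show "measure Exps ?B \<le> (\<Sum>k\<in>{1..<k0}. w k) / l"
    proof -
      have eq: "{1..k0 - 1} = {1..<k0}" using k0 by auto
      have int: "integrable Exps (ws w (k0 - 1))" unfolding ws_def using Exps_integral(1) by auto
      have E: "(\<integral>es. ws w (k0 - 1) es \<partial>Exps) = (\<Sum>k\<in>{1..<k0}. w k)"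
        unfolding ws_def eq using Exps_integral by simp
      have "measure Exps ?B \<le> measure Exps {es \<in> space Exps. l \<le> ws w (k0 - 1) es}"
      proof (intro Exps.finite_measure_mono)
        have "{es. l \<le> ws w (k0 - 1) es} \<in> sets Exps" by (rule sets_Exps_pred) measurable
        then show "{es \<in> space Exps. l \<le> ws w (k0 - 1) es} \<in> sets Exps" by simp
      qed auto
      also have "\<dots> \<le> (\<integral>es. ws w (k0 - 1) es \<partial>Exps) / l"
      proof (rule integral_Markov_inequality_measure[OF int])
        show "AE es in Exps. 0 \<le> ws w (k0 - 1) es"
          using Exps_nonneg by eventually_elim (use w in \<open>auto simp: ws_def intro!: sum_nonneg\<close>)
      qed (use l in auto)
      finally show ?thesis unfolding E .
    qed
  qed
  finally have main: "1 \<le> (\<Sum>n\<in>{1..K}. measure Exps (?G n)) + (u / w K + ((\<Sum>k\<in>{1..<k0}. w k) / l + ((u - l) / w k0 + (\<Sum>n\<in>{k0<..<K}. measure Exps (?E n)))))" .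
  have tail: "(\<Sum>n\<in>{k0<..<K}. measure Exps (?E n)) \<le> (m * (u - l) + (\<Sum>k\<in>{1..K} - Lg. w k)) / w k0"
  proof -
    have "(\<Sum>n\<in>{k0<..<K}. measure Exps (?E n)) \<le> (\<Sum>n\<in>{k0<..<K}. if n \<in> Lg then (u - l) / w k0 else w n / w k0)"
    proof (rule sum_mono)
      fix n assume "n \<in> {k0<..<K}"
      then have "measure Exps (?E n) \<le> min ((u - l) / w k0) (w n / w k0)"
        using w k0 l by (intro ws_enter_window) auto
      then show "measure Exps (?E n) \<le> (if n \<in> Lg then (u - l) / w k0 else w n / w k0)" by auto
    qed
    also have "\<dots> = (\<Sum>n\<in>{k0<..<K} \<inter> Lg. (u - l) / w k0) + (\<Sum>n\<in>{k0<..<K} - Lg. w n / w k0)"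
      by (subst sum.If_cases) (auto simp: Diff_eq Collect_neg_eq)
    finally have 1: "(\<Sum>n\<in>{k0<..<K}. measure Exps (?E n)) \<le> (\<Sum>n\<in>{k0<..<K} \<inter> Lg. (u - l) / w k0) + (\<Sum>n\<in>{k0<..<K} - Lg. w n / w k0)" .
    have 2: "(\<Sum>n\<in>{k0<..<K} \<inter> Lg. (u - l) / w k0) \<le> m * ((u - l) / w k0)"
    proof -
      have "real (card ({k0<..<K} \<inter> Lg)) \<le> m" using Lg card_mono[of Lg "{k0<..<K} \<inter> Lg"] by auto
      then show ?thesis using l k0 by (simp only: sum_constant) (intro mult_right_mono, auto)
    qed
    have 3: "(\<Sum>n\<in>{k0<..<K} - Lg. w n / w k0) \<le> (\<Sum>n\<in>{1..K} - Lg. w n / w k0)"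
      using w k0 by (intro sum_mono2) auto
    have "(m * (u - l) + (\<Sum>k\<in>{1..K} - Lg. w k)) / w k0 = m * ((u - l) / w k0) + (\<Sum>n\<in>{1..K} - Lg. w n / w k0)"
      by (simp only: add_divide_distrib sum_divide_distrib times_divide_eq_right)
    then show ?thesis using 1 2 3 by linarith
  qed
  have "((m + 1) * (u - l) + (\<Sum>k\<in>{1..K} - Lg. w k)) / w k0 = (u - l) / w k0 + (m * (u - l) + (\<Sum>k\<in>{1..K} - Lg. w k)) / w k0"
    by (simp only: add_divide_distrib[symmetric]) (simp add: algebra_simps)
  then show ?thesis using main tail by linarith
qed

subsection \<open>Comparison of passage times with exponential sums\<close>

definition pmf_add :: "nat pmf \<Rightarrow> nat pmf \<Rightarrow> nat pmf" where
  "pmf_add p q = map_pmf (\<lambda>(i, j). i + j) (pair_pmf p q)"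

lemma pmf_add_bind: "pmf_add p q = bind_pmf p (\<lambda>i. map_pmf ((+) i) q)"
  by (simp add: pmf_add_def pair_pmf_def map_pmf_def bind_assoc_pmf bind_return_pmf)

lemma pmf_add_commute: "pmf_add p q = pmf_add q p"
proof -
  have "pmf_add p q = map_pmf (\<lambda>(i, j). i + j) (map_pmf (\<lambda>(x, y). (y, x)) (pair_pmf q p))"
    unfolding pmf_add_def by (subst pair_commute_pmf) simp
  also have "\<dots> = pmf_add q p" unfolding pmf_add_def by (simp add: pmf.map_comp o_def case_prod_unfold add.commute)
  finally show ?thesis .
qed

lemma pmf_add_assoc: "pmf_add (pmf_add p q) r = pmf_add p (pmf_add q r)"
  unfolding pmf_add_bind by (simp add: bind_assoc_pmf bind_map_pmf map_bind_pmf pmf.map_comp o_def add.assoc)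
    (simp add: map_pmf_def bind_return_pmf bind_assoc_pmf add.assoc)

lemma pmf_add_middle: "pmf_add (pmf_add (pmf_add p q) r) g = pmf_add (pmf_add p r) (pmf_add q g)"
  by (metis pmf_add_assoc pmf_add_commute)

text \<open>Lets intermediate caps be dropped, so that a whole chain of passage times carries a
  single cap outside.\<close>

lemma trunc_pmf_add_trunc: "map_pmf (min c) (pmf_add (map_pmf (min c) p) q) = map_pmf (min c) (pmf_add p q)"
proof -
  have eq: "min c (min c i + j) = min c (i + j)" for i j :: nat by auto
  show ?thesis unfolding pmf_add_bind by (simp add: bind_map_pmf map_bind_pmf pmf.map_comp o_def eq)
qed

lemma hit_pmf_add: "x \<le> y \<Longrightarrow> y \<le> z \<Longrightarrow> hit \<omega> c x z = map_pmf (min c) (pmf_add (hit \<omega> c x y) (hit \<omega> c y z))"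
  by (subst hit_concat) (simp_all add: pmf_add_def pmf.map_comp o_def case_prod_unfold)

lemma finite_set_pmf_add: "finite (set_pmf p) \<Longrightarrow> finite (set_pmf q) \<Longrightarrow> finite (set_pmf (pmf_add p q))"
  by (simp add: pmf_add_def)

lemma prob_bind_pmf:
  "measure_pmf.prob (bind_pmf p f) A = measure_pmf.expectation p (\<lambda>i. measure_pmf.prob (f i) A)"
proof -
  have "ennreal (measure_pmf.prob (bind_pmf p f) A) = (\<integral>\<^sup>+i. ennreal (measure_pmf.prob (f i) A) \<partial>measure_pmf p)"
    using emeasure_bind_pmf[of p f A] by (simp add: measure_pmf.emeasure_eq_measure)
  also have "\<dots> = ennreal (measure_pmf.expectation p (\<lambda>i. measure_pmf.prob (f i) A))"
    by (intro nn_integral_eq_integral measure_pmf.integrable_const_bound[of _ 1]) auto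
  finally show ?thesis by (simp add: ennreal_inj integral_nonneg_AE)
qed

lemma prob_pmf_add: "measure_pmf.prob (pmf_add p q) A = measure_pmf.expectation p (\<lambda>i. measure_pmf.prob q {j. i + j \<in> A})"
  unfolding pmf_add_bind prob_bind_pmf by (simp add: vimage_def)

lemma expectation_pmf_add:
  assumes "finite (set_pmf p)" "finite (set_pmf q)"
  shows "measure_pmf.expectation (pmf_add p q) real = measure_pmf.expectation p real + measure_pmf.expectation q real"
proof -
  have 1: "measure_pmf.expectation (pmf_add p q) real = measure_pmf.expectation (pair_pmf p q) (\<lambda>x. real (fst x) + real (snd x))"
    unfolding pmf_add_def by (simp add: case_prod_unfold)
  have "\<dots> = measure_pmf.expectation (pair_pmf p q) (\<lambda>x. real (fst x)) + measure_pmf.expectation (pair_pmf p q) (\<lambda>x. real (snd x))"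
    using assms by (intro Bochner_Integration.integral_add integrable_measure_pmf_finite) auto
  also have "measure_pmf.expectation (pair_pmf p q) (\<lambda>x. real (fst x)) = measure_pmf.expectation (map_pmf fst (pair_pmf p q)) real" by simp
  also have "measure_pmf.expectation (pair_pmf p q) (\<lambda>x. real (snd x)) = measure_pmf.expectation (map_pmf snd (pair_pmf p q)) real" by simp
  finally show ?thesis using 1 by (simp add: map_fst_pair_pmf map_snd_pair_pmf)
qed

lemma expectation_diff_le:
  assumes "\<And>i. \<bar>f i - g i\<bar> \<le> (\<delta>::real)" "finite (set_pmf p)"
  shows "\<bar>measure_pmf.expectation p f - measure_pmf.expectation p g\<bar> \<le> \<delta>"
proof -
  have int: "integrable p f" "integrable p g" "integrable p (\<lambda>i. f i - g i)"
    using assms(2) by (auto intro!: integrable_measure_pmf_finite)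
  have "\<bar>measure_pmf.expectation p f - measure_pmf.expectation p g\<bar> = \<bar>measure_pmf.expectation p (\<lambda>i. f i - g i)\<bar>"
    using int by simp
  also have "\<dots> \<le> measure_pmf.expectation p (\<lambda>i. \<bar>f i - g i\<bar>)" by (rule integral_abs_bound)
  also have "\<dots> \<le> measure_pmf.expectation p (\<lambda>i. \<delta>)"
    using assms by (intro integral_mono integrable_measure_pmf_finite) auto
  finally show ?thesis by simp
qed

lemma Exps_integral_diff_le:
  assumes "AE x in Exps. \<bar>f x - g x\<bar> \<le> (\<delta>::real)" "integrable Exps f" "integrable Exps g"
  shows "\<bar>(\<integral>x. f x \<partial>Exps) - (\<integral>x. g x \<partial>Exps)\<bar> \<le> \<delta>"
proof -
  have "\<bar>(\<integral>x. f x \<partial>Exps) - (\<integral>x. g x \<partial>Exps)\<bar> = \<bar>\<integral>x. f x - g x \<partial>Exps\<bar>" using assms by simp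
  also have "\<dots> \<le> (\<integral>x. \<bar>f x - g x\<bar> \<partial>Exps)" by (rule integral_abs_bound)
  also have "\<dots> \<le> (\<integral>x. \<delta> \<partial>Exps)" using assms by (intro integral_mono_AE) auto
  finally show ?thesis using Exps.prob_space by simp
qed

lemma pmf_Exps_fubini:
  assumes fin: "finite (set_pmf p)" and sets: "\<And>i. {x. Q i (x k)} \<in> sets Exps"
  shows "measure_pmf.expectation p (\<lambda>i. measure Exps {x. Q i (x k)}) = (\<integral>x. measure_pmf.prob p {i. Q i (x k)} \<partial>Exps)"
proof -
  have int: "integrable Exps (\<lambda>x. indicator {x. Q i (x k)} x :: real)" for i
    using sets[of i] by (intro Exps.integrable_const_bound[of _ 1]) auto
  have "measure_pmf.prob p {i. Q i z} = (\<Sum>i\<in>set_pmf p. indicator {i. Q i z} i * pmf p i)" for z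
  proof -
    have "measure_pmf.prob p {i. Q i z} = measure_pmf.expectation p (indicator {i. Q i z})" by simp
    also have "\<dots> = (\<Sum>i\<in>set_pmf p. indicator {i. Q i z} i * pmf p i)"
      using fin by (intro integral_measure_pmf_real) auto
    finally show ?thesis .
  qed
  then have "(\<integral>x. measure_pmf.prob p {i. Q i (x k)} \<partial>Exps) = (\<integral>x. (\<Sum>i\<in>set_pmf p. indicator {x. Q i (x k)} x * pmf p i) \<partial>Exps)"
    by (simp add: indicator_def)
  also have "\<dots> = (\<Sum>i\<in>set_pmf p. measure Exps {x. Q i (x k)} * pmf p i)"
    using int sets by (subst Bochner_Integration.integral_sum) auto
  also have "\<dots> = measure_pmf.expectation p (\<lambda>i. measure Exps {x. Q i (x k)})"
    using fin by (intro integral_measure_pmf_real[symmetric]) auto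
  finally show ?thesis by simp
qed

text \<open>\<open>tB\<close> is the tail of the exponential sums and \<open>tA\<close> that of
  integer laws. Being monotone, tails are Borel functions, and the straddling events are expressed
  by them alone in \<open>tB_between\<close> and \<open>tA_between\<close>.\<close>

definition tB :: "(nat \<Rightarrow> real) \<Rightarrow> nat \<Rightarrow> real \<Rightarrow> real" where
  "tB w n r = measure Exps {es. r < ws w n es}"

definition tA :: "nat pmf \<Rightarrow> real \<Rightarrow> real" where
  "tA p r = measure_pmf.prob p {i. r < real i}"

lemma antimono_borel:
  fixes f :: "real \<Rightarrow> real"
  assumes "\<And>x y. x \<le> y \<Longrightarrow> f y \<le> f x"
  shows "f \<in> borel_measurable borel"
proof -
  have "mono (\<lambda>x. - f x)" using assms by (intro monoI) simp
  then have "(\<lambda>x. - f x) \<in> borel_measurable borel" by (rule borel_measurable_mono)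
  then show ?thesis by simp
qed

lemma ws_sets: "{es. r < ws w n es} \<in> sets Exps"
  by (rule sets_Exps_pred) measurable

lemma tB_antimono: "x \<le> y \<Longrightarrow> tB w n y \<le> tB w n x"
  unfolding tB_def by (intro Exps.finite_measure_mono ws_sets) auto

lemma tA_antimono: "x \<le> y \<Longrightarrow> tA p y \<le> tA p x"
  unfolding tA_def by (intro measure_pmf.finite_measure_mono) auto

lemma tB_le_1: "0 \<le> tB w n r" "tB w n r \<le> 1" by (simp_all add: tB_def)
lemma tA_le_1: "0 \<le> tA p r" "tA p r \<le> 1" by (simp_all add: tA_def)

lemma tB_between: "measure Exps {es. ws w n es \<le> l \<and> r < ws w n es} = max 0 (tB w n r - tB w n l)"
proof (cases "r \<le> l")
  case True
  have "{es. ws w n es \<le> l \<and> r < ws w n es} = {es. r < ws w n es} - {es. l < ws w n es}" by auto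
  moreover have "measure Exps ({es. r < ws w n es} - {es. l < ws w n es}) = tB w n r - tB w n l"
    unfolding tB_def using True by (intro Exps.finite_measure_Diff ws_sets) auto
  ultimately show ?thesis using tB_antimono[OF True, of w n] by simp
next
  case False
  then have "{es. ws w n es \<le> l \<and> r < ws w n es} = {}" by auto
  then have "measure Exps {es. ws w n es \<le> l \<and> r < ws w n es} = 0" by (metis measure_empty)
  then show ?thesis using tB_antimono[of l r w n] False by simp
qed

lemma tA_between: "measure_pmf.prob p {i. real i \<le> l \<and> r < real i} = max 0 (tA p r - tA p l)"
proof (cases "r \<le> l")
  case True
  have "{i. real i \<le> l \<and> r < real i} = {i. r < real i} - {i. l < real i}" by auto
  moreover have "measure_pmf.prob p ({i. r < real i} - {i. l < real i}) = tA p r - tA p l"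
    unfolding tA_def using True by (intro measure_pmf.finite_measure_Diff) auto
  ultimately show ?thesis using tA_antimono[OF True, of p] by simp
next
  case False
  then have "{i. real i \<le> l \<and> r < real i} = {}" by auto
  then have "measure_pmf.prob p {i. real i \<le> l \<and> r < real i} = 0" by (metis measure_empty)
  then show ?thesis using tA_antimono[of l r p] False by simp
qed

lemma Exps_comp_integrable:
  fixes f :: "real \<Rightarrow> real"
  assumes "f \<in> borel_measurable borel" "\<And>r. 0 \<le> f r" "\<And>r. f r \<le> 1"
  shows "integrable Exps (\<lambda>x. f (s - c * x k))"
proof (rule Exps.integrable_const_bound[of _ 1])
  have "(\<lambda>x. s - c * x k) \<in> borel_measurable Exps"
    by (intro borel_measurable_diff borel_measurable_const Exps_cmult_component)
  from measurable_compose[OF this assms(1)] show "(\<lambda>x. f (s - c * x k)) \<in> borel_measurable Exps" .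
qed (use assms in auto)

text \<open>The partial sum of order \<open>n\<close> ignores the coordinate \<open>Suc n\<close>:
  splice that coordinate off and integrate over the others first.\<close>

lemma ws_conv:
  assumes Q: "{es. Q (ws w n es) (es (Suc n))} \<in> sets Exps"
    and f: "\<And>z. measure Exps {y. Q (ws w n y) z} = f (s - c * z)"
    and meas: "f \<in> borel_measurable borel" "\<And>r. 0 \<le> f r" "\<And>r. f r \<le> 1"
    and Qs: "\<And>z. {y. Q (ws w n y) z} \<in> sets Exps"
  shows "measure Exps {es. Q (ws w n es) (es (Suc n))} = (\<integral>x. f (s - c * x (Suc n)) \<partial>Exps)"
proof -
  let ?A = "{es. Q (ws w n es) (es (Suc n))}"
  have "ennreal (measure Exps ?A) = (\<integral>\<^sup>+x. indicator ?A x \<partial>Exps)" using Q by (simp add: Exps.emeasure_eq_measure)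
  also have "\<dots> = (\<integral>\<^sup>+x. \<integral>\<^sup>+y. indicator ?A (merge_on {Suc n} x y) \<partial>Exps \<partial>Exps)"
    using Q by (intro Exps_merge) auto
  also have "\<dots> = (\<integral>\<^sup>+x. \<integral>\<^sup>+y. indicator {y. Q (ws w n y) (x (Suc n))} y \<partial>Exps \<partial>Exps)"
  proof (intro nn_integral_cong)
    fix x y :: "nat \<Rightarrow> real"
    have "ws w n (merge_on {Suc n} x y) = ws w n y" unfolding ws_def merge_on_def by (intro sum.cong) auto
    then show "indicator ?A (merge_on {Suc n} x y) = (indicator {y. Q (ws w n y) (x (Suc n))} y :: ennreal)"
      by (simp add: indicator_def merge_on_def)
  qed
  also have "\<dots> = (\<integral>\<^sup>+x. ennreal (f (s - c * x (Suc n))) \<partial>Exps)"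
    using Qs by (simp add: Exps.emeasure_eq_measure f)
  also have "\<dots> = ennreal (\<integral>x. f (s - c * x (Suc n)) \<partial>Exps)"
    using meas by (intro nn_integral_eq_integral Exps_comp_integrable) auto
  finally show ?thesis using meas by (simp add: ennreal_inj integral_nonneg_AE)
qed

lemma Exps_pred_lin: "{x. r - c * x k < l} \<in> sets Exps" "{x. l < c * x k} \<in> sets Exps"
proof -
  have "{x \<in> space Exps. r - c * x k < l} \<in> sets Exps" "{x \<in> space Exps. l < c * x k} \<in> sets Exps"
    by (intro borel_measurable_less borel_measurable_diff borel_measurable_const Exps_cmult_component)+
  then show "{x. r - c * x k < l} \<in> sets Exps" "{x. l < c * x k} \<in> sets Exps" by simp_all
qed

lemma ws_Suc_sets: "{es. ws w n es \<le> l \<and> u < ws w n es + c * es k} \<in> sets Exps"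
  "{es. u < ws w n es + c * es k} \<in> sets Exps"
proof -
  have "{es \<in> space Exps. u < ws w n es + c * es k} \<in> sets Exps"
    by (intro borel_measurable_less borel_measurable_add borel_measurable_const Exps_cmult_component ws_measurable)
  then show 1: "{es. u < ws w n es + c * es k} \<in> sets Exps" by simp
  have "{es \<in> space Exps. ws w n es \<le> l} \<in> sets Exps"
    by (intro borel_measurable_le borel_measurable_const ws_measurable)
  then have "{es. ws w n es \<le> l} \<in> sets Exps" by simp
  from sets.Int[OF this 1] show "{es. ws w n es \<le> l \<and> u < ws w n es + c * es k} \<in> sets Exps" by (simp add: Collect_conj_eq)
qed

lemma ws_between_sets: "{y. ws w n y \<le> l \<and> r < ws w n y} \<in> sets Exps"
  by (rule sets_Exps_pred) measurable

lemma tB_Suc: "tB w (Suc n) s = (\<integral>x. tB w n (s - w (Suc n) * x (Suc n)) \<partial>Exps)"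
proof -
  have "measure Exps {es. s < ws w n es + w (Suc n) * es (Suc n)} = (\<integral>x. tB w n (s - w (Suc n) * x (Suc n)) \<partial>Exps)"
  proof (rule ws_conv[where Q = "\<lambda>y z. s < y + w (Suc n) * z"])
    show "measure Exps {y. s < ws w n y + w (Suc n) * z} = tB w n (s - w (Suc n) * z)" for z
      unfolding tB_def by (rule arg_cong[of _ _ "measure Exps"]) auto
    show "{y. s < ws w n y + w (Suc n) * z} \<in> sets Exps" for z
    proof -
      have "{y. s < ws w n y + w (Suc n) * z} = {y. s - w (Suc n) * z < ws w n y}" by auto
      then show ?thesis using ws_sets by simp
    qed
  qed (auto intro!: antimono_borel tB_antimono simp: tB_le_1 ws_Suc_sets)
  then show ?thesis by (simp add: tB_def ws_Suc)
qed

lemma ws_cross_eq: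
  "measure Exps {es. ws w n es \<le> l \<and> u < ws w (Suc n) es}
     = (\<integral>x. max 0 (tB w n (u - w (Suc n) * x (Suc n)) - tB w n l) \<partial>Exps)"
proof -
  have "measure Exps {es. ws w n es \<le> l \<and> u < ws w n es + w (Suc n) * es (Suc n)}
     = (\<integral>x. max 0 (tB w n (u - w (Suc n) * x (Suc n)) - tB w n l) \<partial>Exps)"
  proof (rule ws_conv[where Q = "\<lambda>y z. y \<le> l \<and> u < y + w (Suc n) * z" and f = "\<lambda>r. max 0 (tB w n r - tB w n l)"])
    have eq: "{y. ws w n y \<le> l \<and> u < ws w n y + w (Suc n) * z} = {y. ws w n y \<le> l \<and> u - w (Suc n) * z < ws w n y}" for z by auto
    show "measure Exps {y. ws w n y \<le> l \<and> u < ws w n y + w (Suc n) * z} = max 0 (tB w n (u - w (Suc n) * z) - tB w n l)" for z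
      unfolding eq by (rule tB_between)
    show "{y. ws w n y \<le> l \<and> u < ws w n y + w (Suc n) * z} \<in> sets Exps" for z
      unfolding eq by (rule ws_between_sets)
    show "(\<lambda>r. max 0 (tB w n r - tB w n l)) \<in> borel_measurable borel"
      by (intro antimono_borel max.mono order_refl diff_mono tB_antimono)
    show "max 0 (tB w n r - tB w n l) \<le> 1" for r using tB_le_1[of w n r] tB_le_1[of w n l] by auto
  qed (auto simp: ws_Suc_sets)
  then show ?thesis by (simp add: ws_Suc)
qed

text \<open>A chain of valleys with bottoms \<open>\<beta>\<close> and exits
  \<open>dd k + 1\<close>. In \<open>approx\<close> the summand \<open>1 / w k\<close> pays for
  passing from integer to real times.\<close>

locale passage =
  fixes \<omega> :: "int \<Rightarrow> real" and t :: real and \<beta> dd :: "nat \<Rightarrow> int" and w :: "nat \<Rightarrow> real" and K :: nat and \<delta> :: real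
  assumes el: "ellip \<omega>" and t0: "0 \<le> t"
    and beta_pos: "0 < \<beta> 1"
    and beta_le: "\<And>k. k \<in> {1..K} \<Longrightarrow> \<beta> k \<le> dd k"
    and dd_less: "\<And>k. k \<in> {1..<K} \<Longrightarrow> dd k < \<beta> (Suc k)"
    and w_pos: "\<And>k. k \<in> {1..K} \<Longrightarrow> 0 < w k"
    and delta0: "0 \<le> \<delta>"
    and approx: "\<And>k n. k \<in> {1..K} \<Longrightarrow> real n \<le> t \<Longrightarrow> \<bar>sv \<omega> (dd k + 1) n (\<beta> k) - exp (- (real n / w k))\<bar> + 1 / w k \<le> \<delta>"
begin

definition T :: nat where "T = nat \<lfloor>t\<rfloor>"
text \<open>One more than the horizon, so that capping does not affect the event of exceeding
  \<open>T\<close>.\<close>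

definition c :: nat where "c = Suc T"

lemma T: "real T \<le> t" "t < real T + 1"
  unfolding T_def using t0 by linarith+

definition tau :: "nat \<Rightarrow> nat pmf" where "tau k = hit \<omega> c (\<beta> k) (dd k + 1)"

text \<open>The time spent in the first \<open>n\<close> valleys; \<open>Gap\<close> collects the
  initial stretch and the passages between consecutive valleys. Kept as separate laws, they can be
  treated as independent.\<close>

fun Th :: "nat \<Rightarrow> nat pmf" where
  "Th 0 = return_pmf 0"
| "Th (Suc n) = pmf_add (Th n) (tau (Suc n))"

fun Gap :: "nat \<Rightarrow> nat pmf" where
  "Gap 0 = hit \<omega> c 0 (\<beta> 1)"
| "Gap (Suc n) = pmf_add (Gap n) (hit \<omega> c (dd (Suc n) + 1) (\<beta> (Suc (Suc n))))"

lemma finite_tau: "finite (set_pmf (tau k))"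
  by (simp add: tau_def)

lemma finite_Th: "finite (set_pmf (Th n))"
  by (induction n) (auto simp: finite_set_pmf_add finite_tau)

lemma finite_Gap: "finite (set_pmf (Gap n))"
  by (induction n) (auto simp: finite_set_pmf_add)

lemma beta_ge: "k \<in> {1..K} \<Longrightarrow> 0 < \<beta> k"
proof (induction k)
  case (Suc k)
  show ?case
  proof (cases "k = 0")
    case False
    then have "0 < \<beta> k" "\<beta> k \<le> dd k" "dd k < \<beta> (Suc k)" using Suc beta_le dd_less by auto
    then show ?thesis by linarith
  qed (use beta_pos in simp)
qed simp

text \<open>The passage to the next bottom alternates valley times and gap times; commutativity of
  convolution regroups them into one valley part and one gap part under a single cap.\<close>

lemma hit_beta: "n < K \<Longrightarrow> hit \<omega> c 0 (\<beta> (Suc n)) = map_pmf (min c) (pmf_add (Th n) (Gap n))"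
proof (induction n)
  case 0
  have "pmf_add (return_pmf 0) p = p" for p
    unfolding pmf_add_bind by (simp add: bind_return_pmf) (simp add: pmf.map_ident[unfolded id_def] plus_nat.add_0[abs_def])
  moreover have "map_pmf (min c) (hit \<omega> c 0 (\<beta> 1)) = hit \<omega> c 0 (\<beta> 1)"
    using hit_truncate[of c c \<omega> 0 "\<beta> 1"] by simp
  ultimately show ?case by simp
next
  case (Suc n)
  have b: "0 < \<beta> (Suc n)" "\<beta> (Suc n) \<le> dd (Suc n)" "dd (Suc n) < \<beta> (Suc (Suc n))"
    using Suc.prems beta_ge beta_le dd_less by auto
  let ?g = "hit \<omega> c (dd (Suc n) + 1) (\<beta> (Suc (Suc n)))"
  have "hit \<omega> c 0 (\<beta> (Suc (Suc n))) = map_pmf (min c) (pmf_add (hit \<omega> c 0 (dd (Suc n) + 1)) ?g)"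
    using b by (intro hit_pmf_add) auto
  also have "hit \<omega> c 0 (dd (Suc n) + 1) = map_pmf (min c) (pmf_add (hit \<omega> c 0 (\<beta> (Suc n))) (tau (Suc n)))"
    unfolding tau_def using b by (intro hit_pmf_add) auto
  also have "hit \<omega> c 0 (\<beta> (Suc n)) = map_pmf (min c) (pmf_add (Th n) (Gap n))" using Suc by simp
  finally show ?case by (simp add: trunc_pmf_add_trunc pmf_add_middle)
qed

lemma hit_dd:
  assumes "n < K"
  shows "hit \<omega> c 0 (dd (Suc n) + 1) = map_pmf (min c) (pmf_add (pmf_add (Th n) (Gap n)) (tau (Suc n)))"
proof -
  have b: "0 < \<beta> (Suc n)" "\<beta> (Suc n) \<le> dd (Suc n)" using assms beta_ge beta_le by auto
  have "hit \<omega> c 0 (dd (Suc n) + 1) = map_pmf (min c) (pmf_add (hit \<omega> c 0 (\<beta> (Suc n))) (tau (Suc n)))"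
    unfolding tau_def using b by (intro hit_pmf_add) auto
  then show ?thesis by (simp add: hit_beta[OF assms] trunc_pmf_add_trunc)
qed

definition ex :: "nat \<Rightarrow> real \<Rightarrow> real" where
  "ex k r = measure Exps {x. r < w k * x k}"

lemma tau_approx:
  assumes k: "k \<in> {1..K}" and r: "r \<le> t"
  shows "\<bar>tA (tau k) r - ex k r\<bar> \<le> \<delta>"
proof (cases "r < 0")
  case True
  have "tA (tau k) r = 1" unfolding tA_def
  proof -
    have "{i::nat. r < real i} = UNIV" using True by auto
    then show "measure_pmf.prob (tau k) {i. r < real i} = 1" by simp
  qed
  moreover have "ex k r = 1" unfolding ex_def
  proof (subst Exps.prob_eq_1)
    show "AE x in Exps. x \<in> {x. r < w k * x k}" using Exps_nonneg
      by eventually_elim (use True w_pos[OF k] in \<open>auto intro: less_le_trans[OF True]\<close>)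
  qed (rule Exps_pred_lin)
  ultimately show ?thesis using delta0 by simp
next
  case False
  define n where "n = nat \<lfloor>r\<rfloor>"
  have n: "real n \<le> r" "r < real n + 1" unfolding n_def using False by linarith+
  have nT: "n < c" using n r T unfolding c_def by linarith
  have "{i::nat. r < real i} = {i. n < i}" using n by (auto simp: less_eq_real_def) 
  then have "tA (tau k) r = sv \<omega> (dd k + 1) n (\<beta> k)"
    unfolding tA_def tau_def using hit_survival[OF el nT] by simp
  moreover have "ex k r = exp (- (r / w k))" unfolding ex_def using False w_pos[OF k] by (intro Exps_tail) auto
  moreover have "\<bar>exp (- (real n / w k)) - exp (- (r / w k))\<bar> \<le> 1 / w k"
  proof -
    have le: "real n / w k \<le> r / w k" using n w_pos[OF k] by (intro divide_right_mono) auto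
    have "exp (- (real n / w k)) - exp (- (r / w k)) \<le> r / w k - real n / w k"
      using w_pos[OF k] le by (intro exp_neg_lipschitz) auto
    also have "\<dots> = (r - real n) / w k" by (simp add: diff_divide_distrib)
    also have "\<dots> \<le> 1 / w k" using n w_pos[OF k] by (intro divide_right_mono) auto
    finally show ?thesis using le by simp
  qed
  moreover have "\<bar>sv \<omega> (dd k + 1) n (\<beta> k) - exp (- (real n / w k))\<bar> + 1 / w k \<le> \<delta>"
    using approx[OF k, of n] n r by simp
  ultimately show ?thesis by linarith
qed

text \<open>One summand is replaced at a time: the last exit time costs \<open>\<delta>\<close>, and
  then the induction hypothesis applies for each value of the exponential variable that replaced
  it.\<close>

lemma kolmogorov: "n \<le> K \<Longrightarrow> s \<le> t \<Longrightarrow> \<bar>tA (Th n) s - tB w n s\<bar> \<le> real n * \<delta>"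
proof (induction n arbitrary: s)
  case 0
  have "tA (Th 0) s = tB w 0 s"
    using Exps.prob_space by (cases "s < 0") (simp_all add: tA_def tB_def)
  then show ?case by simp
next
  case (Suc n)
  let ?w = "w (Suc n)"
  have kK: "Suc n \<in> {1..K}" using Suc by simp
  have "tA (Th (Suc n)) s = measure_pmf.expectation (Th n) (\<lambda>i. tA (tau (Suc n)) (s - real i))"
    unfolding tA_def Th.simps prob_pmf_add
    by (intro arg_cong[of _ _ "measure_pmf.expectation (Th n)"] ext arg_cong[of _ _ "measure_pmf.prob (tau (Suc n))"]) auto
  moreover have "\<bar>measure_pmf.expectation (Th n) (\<lambda>i. tA (tau (Suc n)) (s - real i)) - measure_pmf.expectation (Th n) (\<lambda>i. ex (Suc n) (s - real i))\<bar> \<le> \<delta>"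
    using Suc.prems by (intro expectation_diff_le finite_Th tau_approx kK) auto
  \<comment> \<open>Exchange the order of integration, so that the tail falls on the earlier sum,
    shifted by the last exponential variable.\<close>
  moreover have "measure_pmf.expectation (Th n) (\<lambda>i. ex (Suc n) (s - real i)) = (\<integral>x. tA (Th n) (s - ?w * x (Suc n)) \<partial>Exps)"
  proof -
    have "measure_pmf.expectation (Th n) (\<lambda>i. ex (Suc n) (s - real i)) = (\<integral>x. measure_pmf.prob (Th n) {i. s - real i < ?w * x (Suc n)} \<partial>Exps)"
      unfolding ex_def by (intro pmf_Exps_fubini[where Q = "\<lambda>i z. s - real i < ?w * z"] finite_Th Exps_pred_lin)
    also have "\<dots> = (\<integral>x. tA (Th n) (s - ?w * x (Suc n)) \<partial>Exps)"
      unfolding tA_def by (intro Bochner_Integration.integral_cong refl arg_cong[of _ _ "measure_pmf.prob (Th n)"]) auto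
    finally show ?thesis .
  qed
  moreover have "\<bar>(\<integral>x. tA (Th n) (s - ?w * x (Suc n)) \<partial>Exps) - (\<integral>x. tB w n (s - ?w * x (Suc n)) \<partial>Exps)\<bar> \<le> real n * \<delta>"
  proof (rule Exps_integral_diff_le)
    show "AE x in Exps. \<bar>tA (Th n) (s - ?w * x (Suc n)) - tB w n (s - ?w * x (Suc n))\<bar> \<le> real n * \<delta>"
      using Exps_nonneg
    proof eventually_elim
      case (elim x)
      have "0 \<le> ?w * x (Suc n)" using elim w_pos[OF kK] by (intro mult_nonneg_nonneg) auto
      then show ?case using Suc.prems by (intro Suc.IH) auto
    qed
  qed (intro Exps_comp_integrable antimono_borel tA_antimono tB_antimono tA_le_1 tB_le_1; assumption)+
  moreover have "(\<integral>x. tB w n (s - ?w * x (Suc n)) \<partial>Exps) = tB w (Suc n) s" by (rule tB_Suc[symmetric])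
  ultimately have "\<bar>tA (Th (Suc n)) s - tB w (Suc n) s\<bar> \<le> \<delta> + real n * \<delta>" by linarith
  then show ?case by (simp add: algebra_simps)
qed

text \<open>The sum must stay below \<open>l\<close> before it exceeds \<open>t\<close>; the
  distance \<open>t - l\<close> is reserved for the gaps.\<close>

definition qn :: "real \<Rightarrow> nat \<Rightarrow> real" where
  "qn l n = measure Exps {es. ws w (n - 1) es \<le> l \<and> t < ws w n es}"

text \<open>The error counts one \<open>\<delta>\<close> for the exit from valley
  \<open>n + 1\<close> and twice \<open>n * \<delta>\<close> for the two tails of the earlier
  sum.\<close>

lemma crossing_lower:
  assumes n: "n < K" and l: "l \<le> t"
  shows "qn l (Suc n) - real (2 * n + 1) * \<delta>
     \<le> measure_pmf.expectation (Th n) (\<lambda>i. if real i \<le> l then tA (tau (Suc n)) (t - real i) else 0)"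
proof -
  let ?w = "w (Suc n)"
  have kK: "Suc n \<in> {1..K}" using n by simp
  let ?e = "\<lambda>i. if real i \<le> l then ex (Suc n) (t - real i) else 0"
  have 1: "\<bar>measure_pmf.expectation (Th n) (\<lambda>i. if real i \<le> l then tA (tau (Suc n)) (t - real i) else 0) - measure_pmf.expectation (Th n) ?e\<bar> \<le> \<delta>"
  proof (rule expectation_diff_le[OF _ finite_Th])
    fix i
    show "\<bar>(if real i \<le> l then tA (tau (Suc n)) (t - real i) else 0) - ?e i\<bar> \<le> \<delta>"
      using tau_approx[OF kK, of "t - real i"] delta0 by auto
  qed
  have "?e = (\<lambda>i. measure Exps {x. real i \<le> l \<and> t - real i < ?w * x (Suc n)})"
    by (auto simp: ex_def fun_eq_iff)
  then have "measure_pmf.expectation (Th n) ?e = (\<integral>x. measure_pmf.prob (Th n) {i. real i \<le> l \<and> t - real i < ?w * x (Suc n)} \<partial>Exps)"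
  proof (simp only:, intro pmf_Exps_fubini[where Q = "\<lambda>i z. real i \<le> l \<and> t - real i < ?w * z"] finite_Th)
    fix i show "{x. real i \<le> l \<and> t - real i < ?w * x (Suc n)} \<in> sets Exps"
      using Exps_pred_lin(2)[of "t - real i" ?w "Suc n"] by (cases "real i \<le> l") auto
  qed
  also have "\<dots> = (\<integral>x. max 0 (tA (Th n) (t - ?w * x (Suc n)) - tA (Th n) l) \<partial>Exps)"
  proof (intro Bochner_Integration.integral_cong refl)
    fix x :: "nat \<Rightarrow> real"
    have "{i. real i \<le> l \<and> t - real i < ?w * x (Suc n)} = {i. real i \<le> l \<and> t - ?w * x (Suc n) < real i}" by auto
    then show "measure_pmf.prob (Th n) {i. real i \<le> l \<and> t - real i < ?w * x (Suc n)} = max 0 (tA (Th n) (t - ?w * x (Suc n)) - tA (Th n) l)"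
      by (simp only: tA_between)
  qed
  finally have 2: "measure_pmf.expectation (Th n) ?e = (\<integral>x. max 0 (tA (Th n) (t - ?w * x (Suc n)) - tA (Th n) l) \<partial>Exps)" .
  have 3: "\<bar>(\<integral>x. max 0 (tA (Th n) (t - ?w * x (Suc n)) - tA (Th n) l) \<partial>Exps) - (\<integral>x. max 0 (tB w n (t - ?w * x (Suc n)) - tB w n l) \<partial>Exps)\<bar> \<le> 2 * real n * \<delta>"
  proof (rule Exps_integral_diff_le)
    show "AE x in Exps. \<bar>max 0 (tA (Th n) (t - ?w * x (Suc n)) - tA (Th n) l) - max 0 (tB w n (t - ?w * x (Suc n)) - tB w n l)\<bar> \<le> 2 * real n * \<delta>"
      using Exps_nonneg
    proof eventually_elim
      case (elim x)
      have "0 \<le> ?w * x (Suc n)" using elim w_pos[OF kK] by (intro mult_nonneg_nonneg) auto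
      then have "\<bar>tA (Th n) (t - ?w * x (Suc n)) - tB w n (t - ?w * x (Suc n))\<bar> \<le> real n * \<delta>" using n by (intro kolmogorov) auto
      moreover have "\<bar>tA (Th n) l - tB w n l\<bar> \<le> real n * \<delta>" using n l by (intro kolmogorov) auto
      ultimately show ?case by linarith
    qed
    show "integrable Exps (\<lambda>x. max 0 (tA (Th n) (t - ?w * x (Suc n)) - tA (Th n) l))"
    proof (rule Exps_comp_integrable[where f = "\<lambda>r. max 0 (tA (Th n) r - tA (Th n) l)"])
      show "max 0 (tA (Th n) r - tA (Th n) l) \<le> 1" for r using tA_le_1[of "Th n" r] tA_le_1[of "Th n" l] by linarith
    qed (auto intro!: antimono_borel max.mono diff_mono tA_antimono)
    show "integrable Exps (\<lambda>x. max 0 (tB w n (t - ?w * x (Suc n)) - tB w n l))"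
    proof (rule Exps_comp_integrable[where f = "\<lambda>r. max 0 (tB w n r - tB w n l)"])
      show "max 0 (tB w n r - tB w n l) \<le> 1" for r using tB_le_1[of w n r] tB_le_1[of w n l] by linarith
    qed (auto intro!: antimono_borel max.mono diff_mono tB_antimono)
  qed
  have 4: "qn l (Suc n) = (\<integral>x. max 0 (tB w n (t - ?w * x (Suc n)) - tB w n l) \<partial>Exps)"
    unfolding qn_def using ws_cross_eq[of w n l t] by simp
  have "real (2 * n + 1) * \<delta> = 2 * real n * \<delta> + \<delta>" by (simp add: algebra_simps)
  then show ?thesis using 1 2 3 4 by linarith
qed

text \<open>If the valley times stay below \<open>l\<close>, the next exit carries them beyond
  \<open>t\<close>, and the gaps take at most \<open>t - l - 1\<close>, then at time
  \<open>T\<close> the walk has reached the bottom but not the exit. The gaps are independent of the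
  valley times, and Markov's inequality gives the second factor.\<close>

theorem visit_probability:
  assumes n: "n < K" and l: "0 \<le> l" "l < t" and gap: "measure_pmf.expectation (Gap n) real \<le> g"
    and that: "1 < t - l" "g \<le> t - l - 1"
  shows "(qn l (Suc n) - real (2 * n + 1) * \<delta>) * (1 - g / (t - l - 1))
      \<le> pr \<omega> T 0 (\<lambda>p. \<beta> (Suc n) \<in> set p \<and> (\<forall>z\<in>set p. z < dd (Suc n) + 1))"
proof -
  have b: "0 < \<beta> (Suc n)" "\<beta> (Suc n) \<le> dd (Suc n)" using n beta_ge beta_le by auto
  have Tc: "T < c" by (simp add: c_def)
  let ?A = "pmf_add (Th n) (Gap n)" and ?B = "tau (Suc n)"
  have "pr \<omega> T 0 (\<lambda>p. \<beta> (Suc n) \<in> set p \<and> (\<forall>z\<in>set p. z < dd (Suc n) + 1)) = sv \<omega> (dd (Suc n) + 1) T 0 - sv \<omega> (\<beta> (Suc n)) T 0"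
    using b by (intro pr_hit_below el) auto
  also have "sv \<omega> (dd (Suc n) + 1) T 0 = measure_pmf.prob (pmf_add ?A ?B) {k. T < k}"
    unfolding hit_survival[OF el Tc, symmetric] hit_dd[OF n] by (simp add: vimage_def Tc)
  also have "sv \<omega> (\<beta> (Suc n)) T 0 = measure_pmf.prob ?A {k. T < k}"
    unfolding hit_survival[OF el Tc, symmetric] hit_beta[OF n] by (simp add: vimage_def Tc)
  finally have pr: "pr \<omega> T 0 (\<lambda>p. \<beta> (Suc n) \<in> set p \<and> (\<forall>z\<in>set p. z < dd (Suc n) + 1))
     = measure_pmf.prob (pmf_add ?A ?B) {k. T < k} - measure_pmf.prob ?A {k. T < k}" .
  \<comment> \<open>The gap comes first, so that the favourable event \<open>?S\<close> is a product
    of an event about the gap and one about the valley times.\<close>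
  let ?p = "pair_pmf (Gap n) (pair_pmf (Th n) ?B)"
  let ?f = "\<lambda>(g, i, j). i + g + j"
  have A: "?A = map_pmf (\<lambda>(g, i, j). i + g) ?p"
  proof -
    have "map_pmf (\<lambda>(g, i, j). i + g) ?p = map_pmf (\<lambda>(g, i). i + g) (map_pmf (\<lambda>(g, ij). (g, fst ij)) ?p)"
      by (simp add: pmf.map_comp o_def case_prod_unfold)
    also have "map_pmf (\<lambda>(g, ij). (g, fst ij)) ?p = pair_pmf (Gap n) (Th n)"
      using pair_map_pmf2[of "Gap n" fst "pair_pmf (Th n) ?B"] by (simp add: map_fst_pair_pmf apsnd_def map_prod_def)
    also have "map_pmf (\<lambda>(g, i). i + g) (pair_pmf (Gap n) (Th n)) = pmf_add (Gap n) (Th n)"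
      by (simp add: pmf_add_def case_prod_unfold add.commute)
    finally show ?thesis by (simp add: pmf_add_commute)
  qed
  have AB: "pmf_add ?A ?B = map_pmf ?f ?p"
  proof -
    have "pmf_add ?A ?B = pmf_add (Gap n) (pmf_add (Th n) ?B)" by (metis pmf_add_assoc pmf_add_commute)
    also have "\<dots> = map_pmf ?f ?p"
      unfolding pmf_add_def using pair_map_pmf2[of "Gap n" "\<lambda>(i, j). i + j" "pair_pmf (Th n) ?B"]
      by (simp add: pmf.map_comp o_def case_prod_unfold apsnd_def map_prod_def ac_simps)
    finally show ?thesis .
  qed
  let ?E1 = "{(g, i, j). T < i + g + j}" and ?E2 = "{(g, i, j). T < i + g}"
  let ?S = "{g. real g \<le> t - l - 1} \<times> {(i, j). real i \<le> l \<and> t - real i < real j}"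
  have "measure_pmf.prob (pmf_add ?A ?B) {k. T < k} - measure_pmf.prob ?A {k. T < k} = measure_pmf.prob ?p ?E1 - measure_pmf.prob ?p ?E2"
    unfolding AB unfolding A by (simp add: vimage_def case_prod_unfold)
  also have "\<dots> = measure_pmf.prob ?p (?E1 - ?E2)"
    by (intro measure_pmf.finite_measure_Diff[symmetric]) auto
  also have "\<dots> \<ge> measure_pmf.prob ?p ?S"
  proof (intro measure_pmf.finite_measure_mono subsetI)
    fix x assume "x \<in> ?S"
    then obtain gg i j where x: "x = (gg, i, j)" "real gg \<le> t - l - 1" "real i \<le> l" "t - real i < real j" by auto
    \<comment> \<open>The subtracted 1 in \<open>t - l - 1\<close> compensates the rounding of
      \<open>t\<close> down to \<open>T\<close>.\<close>
    have "real (i + gg) < real T" using x T by simp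
    moreover have "real T < real (i + gg + j)" using x T by simp
    ultimately show "x \<in> ?E1 - ?E2" using x(1) by auto
  qed simp
  also have "measure_pmf.prob ?p ?S = measure_pmf.prob (Gap n) {g. real g \<le> t - l - 1} * measure_pmf.prob (pair_pmf (Th n) ?B) {(i, j). real i \<le> l \<and> t - real i < real j}"
    by (rule measure_pmf_prob_product)
       (auto intro: countable_subset[OF subset_UNIV])
  finally have low: "measure_pmf.prob (Gap n) {g. real g \<le> t - l - 1} * measure_pmf.prob (pair_pmf (Th n) ?B) {(i, j). real i \<le> l \<and> t - real i < real j}
     \<le> pr \<omega> T 0 (\<lambda>p. \<beta> (Suc n) \<in> set p \<and> (\<forall>z\<in>set p. z < dd (Suc n) + 1))" unfolding pr .
  have "measure_pmf.prob (pair_pmf (Th n) ?B) {(i, j). real i \<le> l \<and> t - real i < real j}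
     = measure_pmf.expectation (Th n) (\<lambda>i. if real i \<le> l then tA ?B (t - real i) else 0)"
  proof -
    have "pair_pmf (Th n) ?B = bind_pmf (Th n) (\<lambda>i. map_pmf (Pair i) ?B)"
      by (simp add: pair_pmf_def map_pmf_def)
    then show ?thesis
      by (simp only: prob_bind_pmf) (intro Bochner_Integration.integral_cong refl, auto simp: tA_def vimage_def)
  qed
  then have q: "qn l (Suc n) - real (2 * n + 1) * \<delta> \<le> measure_pmf.prob (pair_pmf (Th n) ?B) {(i, j). real i \<le> l \<and> t - real i < real j}"
    using crossing_lower[OF n, of l] l by simp
  have m: "1 - g / (t - l - 1) \<le> measure_pmf.prob (Gap n) {g. real g \<le> t - l - 1}"
  proof -
    have pos: "0 < t - l - 1" using that by simp
    have "measure_pmf.prob (Gap n) {g. t - l - 1 < real g} \<le> measure_pmf.prob (Gap n) {x \<in> space (Gap n). t - l - 1 \<le> real x}"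
      by (intro measure_pmf.finite_measure_mono) auto
    also have "\<dots> \<le> measure_pmf.expectation (Gap n) real / (t - l - 1)"
      using pos by (intro integral_Markov_inequality_measure[where A = "{}"] integrable_measure_pmf_finite finite_Gap) auto
    also have "\<dots> \<le> g / (t - l - 1)" using gap pos by (intro divide_right_mono) auto
    finally have "measure_pmf.prob (Gap n) {g. t - l - 1 < real g} \<le> g / (t - l - 1)" .
    moreover have "measure_pmf.prob (Gap n) {g. real g \<le> t - l - 1} = 1 - measure_pmf.prob (Gap n) {g. t - l - 1 < real g}"
      by (subst measure_pmf.prob_compl[symmetric]) (auto intro!: arg_cong[of _ _ "measure_pmf.prob (Gap n)"])
    ultimately show ?thesis by linarith
  qed
  show ?thesis
  proof (cases "0 \<le> qn l (Suc n) - real (2 * n + 1) * \<delta>")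
    case True
    have "(qn l (Suc n) - real (2 * n + 1) * \<delta>) * (1 - g / (t - l - 1))
      \<le> measure_pmf.prob (pair_pmf (Th n) ?B) {(i, j). real i \<le> l \<and> t - real i < real j} * measure_pmf.prob (Gap n) {g. real g \<le> t - l - 1}"
      using q m True that by (intro mult_mono) auto
    then show ?thesis using low by (simp add: mult.commute)
  next
    case False
    have "(qn l (Suc n) - real (2 * n + 1) * \<delta>) * (1 - g / (t - l - 1)) \<le> 0"
      using False that by (intro mult_nonpos_nonneg) (auto simp: divide_le_eq_1)
    also have "\<dots> \<le> pr \<omega> T 0 (\<lambda>p. \<beta> (Suc n) \<in> set p \<and> (\<forall>z\<in>set p. z < dd (Suc n) + 1))" by simp
    finally show ?thesis .
  qed
qed

end

subsection \<open>Deep valleys of a good environment\<close>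

text \<open>On the integers a nonempty set bounded below contains its infimum; thus \<open>e\<close>
  and \<open>d\<close>, and dually \<open>a\<close>, are attained.\<close>

lemma int_least:
  fixes X :: "int set"
  assumes "x0 \<in> X" "\<And>x. x \<in> X \<Longrightarrow> lo \<le> x"
  shows "Inf X \<in> X" "\<And>x. x \<in> X \<Longrightarrow> Inf X \<le> x"
proof -
  define n where "n = (LEAST n::nat. lo + int n \<in> X)"
  have ex: "lo + int (nat (x - lo)) \<in> X" if "x \<in> X" for x using that assms(2)[OF that] by simp
  have n: "lo + int n \<in> X" unfolding n_def by (rule LeastI[of _ "nat (x0 - lo)"]) (rule ex[OF assms(1)])
  have min: "lo + int n \<le> x" if "x \<in> X" for x
  proof -
    have "n \<le> nat (x - lo)" unfolding n_def by (rule Least_le) (rule ex[OF that])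
    then show ?thesis using assms(2)[OF that] by linarith
  qed
  have "Inf X = lo + int n" by (rule cInf_eq_minimum[OF n min])
  then show "Inf X \<in> X" "\<And>x. x \<in> X \<Longrightarrow> Inf X \<le> x" using n min by simp_all
qed

lemma int_greatest:
  fixes X :: "int set"
  assumes "x0 \<in> X" "\<And>x. x \<in> X \<Longrightarrow> x \<le> hi"
  shows "Sup X \<in> X" "\<And>x. x \<in> X \<Longrightarrow> x \<le> Sup X"
proof -
  define n where "n = (LEAST n::nat. hi - int n \<in> X)"
  have ex: "hi - int (nat (hi - x)) \<in> X" if "x \<in> X" for x using that assms(2)[OF that] by simp
  have n: "hi - int n \<in> X" unfolding n_def by (rule LeastI[of _ "nat (hi - x0)"]) (rule ex[OF assms(1)])
  have max: "x \<le> hi - int n" if "x \<in> X" for x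
  proof -
    have "n \<le> nat (hi - x)" unfolding n_def by (rule Least_le) (rule ex[OF that])
    then show ?thesis using assms(2)[OF that] by linarith
  qed
  have "Sup X = hi - int n" by (rule cSup_eq_maximum[OF n max])
  then show "Sup X \<in> X" "\<And>x. x \<in> X \<Longrightarrow> x \<le> Sup X" using n max by simp_all
qed

locale ladder =
  fixes \<omega> :: "int \<Rightarrow> real"
  assumes descend: "\<And>x. \<exists>y>x. V \<omega> y \<le> V \<omega> x"
    and rises: "\<And>x (y::nat). \<exists>m\<ge>x. \<exists>n>m. real y \<le> V \<omega> n - V \<omega> m"
begin

abbreviation "v \<equiv> V \<omega>"
abbreviation "el \<equiv> e \<omega>"

lemma e_Suc:
  shows e_less: "el i < el (Suc i)" and v_e_le: "v (el (Suc i)) \<le> v (el i)"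
    and e_Suc_le: "\<And>k. el i < k \<Longrightarrow> v k \<le> v (el i) \<Longrightarrow> el (Suc i) \<le> k"
proof -
  let ?X = "{k. el i < k \<and> v k \<le> v (el i)}"
  obtain y where y: "el i < y" "v y \<le> v (el i)" using descend by blast
  have y': "y \<in> ?X" using y by simp
  have b: "\<And>x. x \<in> ?X \<Longrightarrow> el i \<le> x" by simp
  have "Inf ?X \<in> ?X" using int_least(1)[OF y' b] by blast
  then show "el i < el (Suc i)" "v (el (Suc i)) \<le> v (el i)" by auto
  show "el (Suc i) \<le> k" if "el i < k" "v k \<le> v (el i)" for k
    using int_least(2)[OF y' b, of k] that by simp
qed

lemma e_mono: "i < j \<Longrightarrow> el i < el j"
  by (rule lift_Suc_mono_less[of el]) (use e_less in auto)

lemma e_mono_le: "i \<le> j \<Longrightarrow> el i \<le> el j"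
  using e_mono[of i j] by (cases "i = j") auto

lemma e_ge: "int i \<le> el i"
proof (induction i)
  case (Suc i)
  then show ?case using e_less[of i] by (simp del: e.simps(2))
qed simp

lemma v_excursion: "el i < k \<Longrightarrow> k < el (Suc i) \<Longrightarrow> v (el i) < v k"
  using e_Suc_le[of i k] by force

text \<open>Ladder points are weak descending records, so at any time the last one carries the
  minimum of the potential since 0.\<close>

lemma running_min: "0 \<le> m \<Longrightarrow> m < el (Suc i) \<Longrightarrow> v (el i) \<le> v m"
proof (induction i)
  case 0
  show ?case
  proof (cases "m = 0")
    case False
    then show ?thesis using v_excursion[of 0 m] 0 by (simp del: e.simps(2))
  qed simp
next
  case (Suc i)
  consider "m < el (Suc i)" | "m = el (Suc i)" | "el (Suc i) < m" by linarith
  then show ?case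
  proof cases
    case 1
    then show ?thesis using Suc.IH Suc.prems v_e_le[of i] by linarith
  next
    case 3
    then show ?thesis using v_excursion[of "Suc i" m] Suc.prems by linarith
  qed simp
qed

lemma excursion_cover:
  assumes "0 \<le> n"
  obtains i where "el i \<le> n" "n < el (Suc i)"
proof -
  define i where "i = (LEAST i. n < el (Suc i))"
  have "n < el (Suc (nat n))" using e_ge[of "Suc (nat n)"] assms by (simp del: e.simps)
  then have i: "n < el (Suc i)" unfolding i_def by (rule LeastI)
  have "el i \<le> n"
  proof (cases i)
    case (Suc j)
    then have "\<not> n < el (Suc j)" using not_less_Least[of j "\<lambda>i. n < el (Suc i)"] unfolding i_def by auto
    then show ?thesis using Suc by simp
  qed (use assms in simp)
  then show ?thesis using i that by blast
qed

lemma H_ge: "el i \<le> n \<Longrightarrow> n \<le> el (Suc i) \<Longrightarrow> v n - v (el i) \<le> H \<omega> i"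
  unfolding H_def by (intro Max_ge) (auto simp del: e.simps)

lemma H_attained:
  obtains c where "el i \<le> c" "c \<le> el (Suc i)" "v c - v (el i) = H \<omega> i"
proof -
  have "H \<omega> i \<in> (\<lambda>k. v k - v (el i)) ` {el i..el (Suc i)}"
    unfolding H_def using e_less[of i] by (intro Max_in) (auto simp del: e.simps)
  then show ?thesis using that by (auto simp del: e.simps)
qed

text \<open>The last record before \<open>n\<close> lies no higher than \<open>v m\<close>, so the
  excursion containing \<open>n\<close> is at least as high as the climb from \<open>m\<close> to
  \<open>n\<close>.\<close>

lemma rise_excursion:
  assumes "0 \<le> m" "m \<le> n" "y \<le> v n - v m"
  obtains i where "el i \<le> n" "n < el (Suc i)" "y \<le> H \<omega> i"
proof -
  obtain i where i: "el i \<le> n" "n < el (Suc i)" using excursion_cover[of n] assms by auto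
  have "v (el i) \<le> v m" using running_min[of m i] assms i by linarith
  moreover have "v n - v (el i) \<le> H \<omega> i" using H_ge[of i n] i by simp
  ultimately show ?thesis using that[OF i] assms(3) by linarith
qed

lemma deep_after: "\<exists>i>i0. y \<le> H \<omega> i"
proof -
  obtain yn :: nat where yn: "y \<le> real yn" using real_arch_simple by blast
  obtain m n where mn: "el (Suc i0) \<le> m" "m < n" "real yn \<le> v n - v m" using rises by blast
  have m0: "0 \<le> m" using mn(1) e_ge[of "Suc i0"] by linarith
  obtain i where i: "el i \<le> n" "n < el (Suc i)" "y \<le> H \<omega> i"
    using rise_excursion[of m n y] m0 mn yn by (metis less_imp_le order_trans)
  have "\<not> i \<le> i0" using e_mono_le[of "Suc i" "Suc i0"] i mn by auto
  then show ?thesis using i by (intro exI[of _ i]) (auto simp del: e.simps)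
qed

lemma sig_deep: "h t \<le> H \<omega> (sig \<omega> t j)"
proof (cases j)
  case 0
  obtain i where "h t \<le> H \<omega> i" using deep_after[of 0 "h t"] by blast
  then show ?thesis unfolding 0 sig.simps by (rule LeastI)
next
  case (Suc k)
  obtain i where "sig \<omega> t k < i \<and> h t \<le> H \<omega> i" using deep_after[of "sig \<omega> t k" "h t"] by blast
  then have "sig \<omega> t k < sig \<omega> t (Suc k) \<and> h t \<le> H \<omega> (sig \<omega> t (Suc k))" unfolding sig.simps by (rule LeastI)
  then show ?thesis using Suc by simp
qed

lemma sig_less: "sig \<omega> t k < sig \<omega> t (Suc k)"
proof -
  obtain i where "sig \<omega> t k < i \<and> h t \<le> H \<omega> i" using deep_after[of "sig \<omega> t k" "h t"] by blast
  then have "sig \<omega> t k < sig \<omega> t (Suc k) \<and> h t \<le> H \<omega> (sig \<omega> t (Suc k))" unfolding sig.simps by (rule LeastI)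
  then show ?thesis by blast
qed

lemma sig_mono: "i < j \<Longrightarrow> sig \<omega> t i < sig \<omega> t j"
  by (rule lift_Suc_mono_less[of "sig \<omega> t"]) (use sig_less in auto)

lemma sig_ge: "j \<le> sig \<omega> t j"
proof (induction j)
  case (Suc j)
  then show ?case using sig_less[of t j] by linarith
qed simp

lemma sig_enumerates:
  assumes "h t \<le> H \<omega> i"
  obtains j where "sig \<omega> t j = i"
proof -
  have s0: "sig \<omega> t 0 \<le> i" unfolding sig.simps by (rule Least_le) (rule assms)
  define j where "j = (GREATEST j. sig \<omega> t j \<le> i)"
  have bnd: "\<forall>y. sig \<omega> t y \<le> i \<longrightarrow> y \<le> i" using sig_ge order_trans by blast
  have j: "sig \<omega> t j \<le> i" unfolding j_def by (rule GreatestI_nat[of "\<lambda>j. sig \<omega> t j \<le> i" 0 i]) (use s0 bnd in auto)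
  have "\<not> sig \<omega> t j < i"
  proof
    assume "sig \<omega> t j < i"
    then have "sig \<omega> t (Suc j) \<le> i" unfolding sig.simps by (intro Least_le) (use assms in auto)
    then have "Suc j \<le> (GREATEST j. sig \<omega> t j \<le> i)" by (rule Greatest_le_nat[of "\<lambda>j. sig \<omega> t j \<le> i" "Suc j" i]) (use bnd in auto)
    then show False unfolding j_def[symmetric] by simp
  qed
  then show ?thesis using j that by (metis le_neq_implies_less)
qed

lemma b_mono: "1 \<le> j \<Longrightarrow> j < k \<Longrightarrow> b \<omega> t j < b \<omega> t k"
  unfolding b_def using sig_mono[of "j - 1" "k - 1" t] e_mono by (auto simp del: e.simps)

lemma b_nonneg: "0 \<le> b \<omega> t k"
  unfolding b_def using e_ge[of "sig \<omega> t (k - 1)"] by (auto simp del: e.simps)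

end

text \<open>Dominates sums of \<open>Asum\<close> over sites from which, looking back, every climb
  is below \<open>z\<close>; \<open>truncated_exponential_sum\<close> bounds its mean.\<close>

definition trunc_sum :: "(int \<Rightarrow> real) \<Rightarrow> real \<Rightarrow> int \<Rightarrow> real" where
  "trunc_sum \<omega> z N = (\<Sum>n\<in>{0..N}. \<Sum>m\<in>{0..n}. if V \<omega> n - V \<omega> m < z then exp (V \<omega> n - V \<omega> m) else 0)"

lemma trunc_sum_term_nonneg: "0 \<le> (\<Sum>m\<in>{0..n}. if V \<omega> n - V \<omega> m < z then exp (V \<omega> n - V \<omega> m) else 0)"
  by (intro sum_nonneg) auto

text \<open>\<open>L\<close> is of order \<open>ln t\<close> and \<open>N\<close> of order \<open>t powr \<kappa>\<close>. The threshold \<open>u = 3 / 4 * ln t\<close> lies strictly between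
  \<open>ln t / 2\<close>, so that two climbs of height \<open>u\<close> at distance \<open>O(L)\<close> are unlikely to occur in \<open>{0..N}\<close>, and \<open>h t\<close>.\<close>

locale good_env = ladder \<omega> for \<omega> +
  fixes \<kappa> t :: real and L N :: int and u :: real
  assumes s: "sellip \<omega>" and kappa: "0 < \<kappa>" "\<kappa> < 1" and L1: "1 \<le> L" and N0: "0 \<le> N"
    and lt: "0 < ln t" "u = 3 / 4 * ln t" "u \<le> h t" "ln 2 \<le> h t"
    and B1: "\<And>x. - L \<le> x \<Longrightarrow> x \<le> N + 4 * L \<Longrightarrow> V \<omega> (x + L) \<le> V \<omega> x - 3 * ln t"
    and B2: "\<And>i j k l. - L \<le> i \<Longrightarrow> i \<le> N \<Longrightarrow> i \<le> j \<Longrightarrow> j \<le> k \<Longrightarrow> k \<le> l \<Longrightarrow> l \<le> i + 5 * L \<Longrightarrow>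
        u \<le> V \<omega> j - V \<omega> i \<Longrightarrow> u \<le> V \<omega> l - V \<omega> k \<Longrightarrow> False"
    and B4: "\<And>i j. 0 \<le> i \<Longrightarrow> i \<le> N \<Longrightarrow> i \<le> j \<Longrightarrow> j \<le> i + 2 * L \<Longrightarrow> V \<omega> j - V \<omega> i \<le> (1 + \<kappa> / 2) * ln t"
    and B6: "\<And>i j. 0 \<le> i \<Longrightarrow> i \<le> L \<Longrightarrow> i \<le> j \<Longrightarrow> j \<le> i + L \<Longrightarrow> V \<omega> j - V \<omega> i < h t"
begin

lemma h_pos: "0 < h t"
  using lt(4) ln_gt_zero[of 2] by linarith

lemma D_le: "D \<kappa> t \<le> 3 * ln t" "0 < D \<kappa> t"
proof -
  have "(1 + \<kappa>) * ln t \<le> 3 * ln t" using lt(1) kappa by (intro mult_right_mono) auto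
  then show "D \<kappa> t \<le> 3 * ln t" by (simp add: D_def)
  show "0 < D \<kappa> t" unfolding D_def using lt(1) kappa by (intro mult_pos_pos) auto
qed

lemma e_next: "0 \<le> el i \<Longrightarrow> el i \<le> N + 4 * L \<Longrightarrow> el (Suc i) \<le> el i + L"
  using B1[of "el i"] lt(1) L1 by (intro e_Suc_le) auto

text \<open>A highest point of the excursion that starts at the \<open>k\<close>-th deep
  bottom.\<close>

definition cpk :: "nat \<Rightarrow> int" where
  "cpk k = (SOME c. b \<omega> t k \<le> c \<and> c < dbar \<omega> t k \<and> v c - v (b \<omega> t k) = H \<omega> (sig \<omega> t (k - 1)))"

lemma bot:
  assumes k: "1 \<le> k"
  shows b_eq: "b \<omega> t k = el (sig \<omega> t (k - 1))" and dbar_eq: "dbar \<omega> t k = el (Suc (sig \<omega> t (k - 1)))"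
    and b_dbar: "b \<omega> t k < dbar \<omega> t k" and v_dbar: "v (dbar \<omega> t k) \<le> v (b \<omega> t k)"
    and peak: "b \<omega> t k \<le> cpk k" "cpk k < dbar \<omega> t k" "v (cpk k) - v (b \<omega> t k) = H \<omega> (sig \<omega> t (k - 1))"
    and deep: "h t \<le> H \<omega> (sig \<omega> t (k - 1))"
proof -
  show 1: "b \<omega> t k = el (sig \<omega> t (k - 1))" using k by (simp add: b_def)
  show 2: "dbar \<omega> t k = el (Suc (sig \<omega> t (k - 1)))" by (simp add: dbar_def)
  show 3: "b \<omega> t k < dbar \<omega> t k" unfolding 1 2 by (rule e_less)
  show 4: "v (dbar \<omega> t k) \<le> v (b \<omega> t k)" unfolding 1 2 by (rule v_e_le)
  show 5: "h t \<le> H \<omega> (sig \<omega> t (k - 1))" by (rule sig_deep)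
  obtain c where c: "el (sig \<omega> t (k - 1)) \<le> c" "c \<le> el (Suc (sig \<omega> t (k - 1)))"
      "v c - v (el (sig \<omega> t (k - 1))) = H \<omega> (sig \<omega> t (k - 1))" by (rule H_attained)
  have "c \<noteq> dbar \<omega> t k" using c(3) 4 5 h_pos 1 by auto
  then have "b \<omega> t k \<le> c \<and> c < dbar \<omega> t k \<and> v c - v (b \<omega> t k) = H \<omega> (sig \<omega> t (k - 1))"
    using c 1 2 by simp
  then have "b \<omega> t k \<le> cpk k \<and> cpk k < dbar \<omega> t k \<and> v (cpk k) - v (b \<omega> t k) = H \<omega> (sig \<omega> t (k - 1))"
    unfolding cpk_def by (rule someI)
  then show "b \<omega> t k \<le> cpk k" "cpk k < dbar \<omega> t k" "v (cpk k) - v (b \<omega> t k) = H \<omega> (sig \<omega> t (k - 1))" by auto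
qed

text \<open>Within \<open>L\<close> steps the potential falls by \<open>3 * ln t\<close>, which is
  more than \<open>D \<kappa> t\<close>, so excursion, left wall and exit all lie within
  \<open>2 * L\<close> of the bottom. A deep bottom within distance \<open>L\<close> of the origin
  would contradict \<open>B6\<close>.\<close>

lemma geometry:
  assumes k: "1 \<le> k" and N: "b \<omega> t k \<le> N + 2 * L"
  shows dbar_le: "dbar \<omega> t k \<le> b \<omega> t k + L"
    and dd_ge: "dbar \<omega> t k \<le> d \<omega> \<kappa> t k" and dd_le: "d \<omega> \<kappa> t k \<le> b \<omega> t k + 2 * L"
    and aa_ge: "b \<omega> t k - L \<le> a \<omega> \<kappa> t k" and aa_le: "a \<omega> \<kappa> t k \<le> b \<omega> t k"
    and aa_v: "D \<kappa> t \<le> v (a \<omega> \<kappa> t k) - v (b \<omega> t k)"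
    and b_large: "L < b \<omega> t k"
proof -
  have b0: "0 \<le> b \<omega> t k" by (rule b_nonneg)
  show 1: "dbar \<omega> t k \<le> b \<omega> t k + L"
    using e_next[of "sig \<omega> t (k - 1)"] b0 N L1 unfolding b_eq[OF k] dbar_eq[OF k] by simp
  let ?X = "{j. dbar \<omega> t k \<le> j \<and> v j - v (dbar \<omega> t k) \<le> - D \<kappa> t}"
  have x0: "dbar \<omega> t k + L \<in> ?X"
    using B1[of "dbar \<omega> t k"] D_le L1 b_dbar[OF k] b0 1 N by auto
  have bd: "\<And>x. x \<in> ?X \<Longrightarrow> dbar \<omega> t k \<le> x" by simp
  have dX: "d \<omega> \<kappa> t k \<in> ?X" unfolding d_def using int_least(1)[OF x0 bd] by blast
  show "dbar \<omega> t k \<le> d \<omega> \<kappa> t k" using dX by simp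
  have "d \<omega> \<kappa> t k \<le> dbar \<omega> t k + L" unfolding d_def using int_least(2)[OF x0 bd x0] by blast
  then show "d \<omega> \<kappa> t k \<le> b \<omega> t k + 2 * L" using 1 by simp
  let ?Y = "{j. j \<le> b \<omega> t k \<and> v j - v (b \<omega> t k) \<ge> D \<kappa> t}"
  have y0: "b \<omega> t k - L \<in> ?Y" using B1[of "b \<omega> t k - L"] D_le L1 b0 N by auto
  have by0: "\<And>x. x \<in> ?Y \<Longrightarrow> x \<le> b \<omega> t k" by simp
  have aY: "a \<omega> \<kappa> t k \<in> ?Y" unfolding a_def using int_greatest(1)[OF y0 by0] by blast
  then show "a \<omega> \<kappa> t k \<le> b \<omega> t k" "D \<kappa> t \<le> v (a \<omega> \<kappa> t k) - v (b \<omega> t k)" by auto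
  show "b \<omega> t k - L \<le> a \<omega> \<kappa> t k" unfolding a_def using int_greatest(2)[OF y0 by0 y0] by blast
  show "L < b \<omega> t k"
  proof (rule ccontr)
    assume "\<not> L < b \<omega> t k"
    then have "v (cpk k) - v (b \<omega> t k) < h t" using b0 peak[OF k] 1 by (intro B6) auto
    then show False using peak[OF k] deep[OF k] by simp
  qed
qed

text \<open>Otherwise two climbs of height \<open>h t \<ge> u\<close> would occur within
  \<open>5 * L\<close>, which \<open>B2\<close> forbids.\<close>

lemma next_bottom:
  assumes k: "1 \<le> k" and N: "b \<omega> t k \<le> N"
  shows "d \<omega> \<kappa> t k < b \<omega> t (Suc k)"
proof (rule ccontr)
  assume neg: "\<not> d \<omega> \<kappa> t k < b \<omega> t (Suc k)"
  have N2: "b \<omega> t k \<le> N + 2 * L" using N L1 by simp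
  note g = geometry[OF k N2]
  have N3: "b \<omega> t (Suc k) \<le> N + 2 * L" using neg g N by linarith
  have k': "1 \<le> Suc k" by simp
  have "Suc (sig \<omega> t (k - 1)) \<le> sig \<omega> t k" using sig_less[of t "k - 1"] k by simp
  then have db: "dbar \<omega> t k \<le> b \<omega> t (Suc k)"
    unfolding dbar_eq[OF k] b_eq[OF k'] using e_mono_le by (simp del: e.simps)
  show False
  proof (rule B2[of "b \<omega> t k" "cpk k" "b \<omega> t (Suc k)" "cpk (Suc k)"])
    show "- L \<le> b \<omega> t k" using b_nonneg[of t k] L1 by linarith
    show "cpk k \<le> b \<omega> t (Suc k)" using peak[OF k] db by linarith
    show "cpk (Suc k) \<le> b \<omega> t k + 5 * L"
      using peak[OF k'] dbar_le[OF k' N3] g neg L1 by linarith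
    show "u \<le> v (cpk k) - v (b \<omega> t k)" using peak[OF k] deep[OF k] lt(3) by linarith
    show "u \<le> v (cpk (Suc k)) - v (b \<omega> t (Suc k))" using peak[OF k'] deep[OF k'] lt(3) by linarith
  qed (use N peak[OF k] peak[OF k'] in auto)
qed

text \<open>Every variation of more than \<open>u\<close> in the wrong direction produces, next to
  the main climb or by cutting it in two, a pair of disjoint climbs of height \<open>u\<close>
  within \<open>O(L)\<close>, against \<open>B2\<close>.\<close>

lemma valley_instance:
  assumes k: "1 \<le> k" and N: "b \<omega> t k \<le> N"
  shows "valley \<omega> (a \<omega> \<kappa> t k) (b \<omega> t k) (cpk k) (d \<omega> \<kappa> t k) (real_of_int (3 * L + 1)) u (h t) (D \<kappa> t) ((1 + \<kappa> / 2) * ln t)"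
proof -
  have N2: "b \<omega> t k \<le> N + 2 * L" using N L1 by simp
  note g = geometry[OF k N2]
  note p = peak[OF k] deep[OF k]
  have b0: "0 \<le> b \<omega> t k" by (rule b_nonneg)
  have hr: "u \<le> v (cpk k) - v (b \<omega> t k)" using p lt(3) by linarith
  show ?thesis
  proof
    show "sellip \<omega>" by (rule s)
    show "a \<omega> \<kappa> t k \<le> b \<omega> t k" "b \<omega> t k \<le> cpk k" "cpk k \<le> d \<omega> \<kappa> t k" using g p by linarith+
    show "real_of_int (d \<omega> \<kappa> t k - a \<omega> \<kappa> t k + 1) \<le> real_of_int (3 * L + 1)"
      using g unfolding of_int_le_iff by linarith
    show "0 \<le> u" using lt by simp
    show "h t \<le> v (cpk k) - v (b \<omega> t k)" "ln 2 \<le> h t" "D \<kappa> t \<le> v (a \<omega> \<kappa> t k) - v (b \<omega> t k)"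
      using p lt g by linarith+
    show "v z - v (b \<omega> t k) \<le> (1 + \<kappa> / 2) * ln t" if "b \<omega> t k \<le> z" "z \<le> d \<omega> \<kappa> t k" for z
      using that g N b0 by (intro B4) auto
    show "v z - v j \<le> u" if "b \<omega> t k \<le> z" "z \<le> j" "j \<le> cpk k" for z j
    proof (rule ccontr)
      \<comment> \<open>A drop during the climb cuts it in two: since the bottom is lowest and the
        peak highest, the parts before and after the drop both exceed \<open>u\<close>.\<close>
      assume neg: "\<not> v z - v j \<le> u"
      have vj: "v (b \<omega> t k) \<le> v j"
        using running_min[of j "sig \<omega> t (k - 1)"] that b0 p unfolding b_eq[OF k] dbar_eq[OF k] by linarith
      have vz: "v z \<le> v (cpk k)"
        using H_ge[of "sig \<omega> t (k - 1)" z] that p unfolding b_eq[OF k] dbar_eq[OF k] by linarith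
      show False by (rule B2[of "b \<omega> t k" z j "cpk k"]) (use neg vj vz that b0 N L1 p g in linarith)+
    qed
    show "v z - v j \<le> u" if "cpk k \<le> j" "j \<le> z" "z \<le> d \<omega> \<kappa> t k" for j z
    proof (rule ccontr)
      assume neg: "\<not> v z - v j \<le> u"
      show False by (rule B2[of "b \<omega> t k" "cpk k" j z]) (use neg that b0 N L1 p g hr in linarith)+
    qed
    show "v n - v m \<le> u" if "a \<omega> \<kappa> t k \<le> m" "m \<le> n" "n < b \<omega> t k" for m n
    proof (rule ccontr)
      assume neg: "\<not> v n - v m \<le> u"
      show False by (rule B2[of m n "b \<omega> t k" "cpk k"]) (use neg that b0 N L1 p g hr in linarith)+
    qed
  qed
qed

lemma W_eq:
  assumes k: "1 \<le> k" and N: "b \<omega> t k \<le> N"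
  shows "W \<omega> \<kappa> t k = 2 * (\<Sum>n\<in>{b \<omega> t k..d \<omega> \<kappa> t k}. Asum \<omega> (a \<omega> \<kappa> t k) n)"
proof -
  let ?A = "a \<omega> \<kappa> t k" and ?B = "b \<omega> t k" and ?D = "d \<omega> \<kappa> t k"
  have "(\<Sum>n\<in>{?B..?D}. Asum \<omega> ?A n) = (\<Sum>(n, m)\<in>Sigma {?B..?D} (\<lambda>n. {?A..n}). exp (V \<omega> n - V \<omega> m))"
    unfolding Asum_def by (rule sum.Sigma) auto
  also have "\<dots> = (\<Sum>(m, n)\<in>{(m, n). ?A \<le> m \<and> m \<le> n \<and> ?B \<le> n \<and> n \<le> ?D}. exp (V \<omega> n - V \<omega> m))"
    by (rule sum.reindex_bij_witness[where i = "\<lambda>(m, n). (n, m)" and j = "\<lambda>(m, n). (n, m)"]) auto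
  finally show ?thesis by (simp add: W_def)
qed

lemma W_ge:
  assumes k: "1 \<le> k" and N: "b \<omega> t k \<le> N"
  shows "2 * exp (H \<omega> (sig \<omega> t (k - 1))) \<le> W \<omega> \<kappa> t k"
proof -
  have N2: "b \<omega> t k \<le> N + 2 * L" using N L1 by simp
  note g = geometry[OF k N2]
  note p = peak[OF k]
  have "exp (H \<omega> (sig \<omega> t (k - 1))) \<le> Asum \<omega> (a \<omega> \<kappa> t k) (cpk k)"
    using Asum_ge[of "a \<omega> \<kappa> t k" "b \<omega> t k" "cpk k" \<omega>] g p by simp
  also have "\<dots> \<le> (\<Sum>n\<in>{b \<omega> t k..d \<omega> \<kappa> t k}. Asum \<omega> (a \<omega> \<kappa> t k) n)"
    using g p by (intro member_le_sum) (auto intro: Asum_nonneg)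
  finally show ?thesis by (simp add: W_eq[OF k N])
qed

text \<open>For \<open>m \<ge> 0\<close> all climbs ending in the valley are below \<open>z\<close>:
  up to the end of the excursion they are bounded by its height, afterwards by \<open>u\<close>. The
  left wall lies at a nonnegative site, so the sum over \<open>m\<close> may start at 0.\<close>

lemma W_le:
  assumes k: "1 \<le> k" and N: "b \<omega> t k \<le> N" and z: "H \<omega> (sig \<omega> t (k - 1)) < z" "u < z"
  shows "W \<omega> \<kappa> t k \<le> 2 * (\<Sum>n\<in>{b \<omega> t k..d \<omega> \<kappa> t k}. \<Sum>m\<in>{0..n}. if v n - v m < z then exp (v n - v m) else 0)"
proof -
  have N2: "b \<omega> t k \<le> N + 2 * L" using N L1 by simp
  note g = geometry[OF k N2]
  note p = peak[OF k]
  interpret vl: valley \<omega> "a \<omega> \<kappa> t k" "b \<omega> t k" "cpk k" "d \<omega> \<kappa> t k" "real_of_int (3 * L + 1)" u "h t" "D \<kappa> t" "(1 + \<kappa> / 2) * ln t"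
    by (rule valley_instance[OF k N])
  have lt: "v n - v m < z" if n: "b \<omega> t k \<le> n" "n \<le> d \<omega> \<kappa> t k" and m: "0 \<le> m" "m \<le> n" for n m
  proof (cases "n < dbar \<omega> t k")
    case True
    have "v (b \<omega> t k) \<le> v m" using running_min[of m "sig \<omega> t (k - 1)"] m True unfolding b_eq[OF k] dbar_eq[OF k] by linarith
    moreover have "v n - v (b \<omega> t k) \<le> H \<omega> (sig \<omega> t (k - 1))"
      using H_ge[of "sig \<omega> t (k - 1)" n] n True unfolding b_eq[OF k] dbar_eq[OF k] by linarith
    ultimately show ?thesis using z by linarith
  next
    case False
    show ?thesis
    proof (cases "cpk k \<le> m")
      case True
      then show ?thesis using vl.rise_r[of m n] n m z by linarith
    next
      case F2: False
      have "v (b \<omega> t k) \<le> v m" using running_min[of m "sig \<omega> t (k - 1)"] m F2 p unfolding b_eq[OF k] dbar_eq[OF k] by linarith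
      moreover have "v n - v (dbar \<omega> t k) \<le> u" using vl.rise_r[of "dbar \<omega> t k" n] n False p by linarith
      ultimately show ?thesis using z v_dbar[OF k] by linarith
    qed
  qed
  have "Asum \<omega> (a \<omega> \<kappa> t k) n \<le> (\<Sum>m\<in>{0..n}. if v n - v m < z then exp (v n - v m) else 0)"
    if n: "n \<in> {b \<omega> t k..d \<omega> \<kappa> t k}" for n
  proof -
    have "Asum \<omega> (a \<omega> \<kappa> t k) n \<le> (\<Sum>m\<in>{0..n}. exp (v n - v m))"
      unfolding Asum_def using g by (intro sum_mono2) auto
    also have "\<dots> = (\<Sum>m\<in>{0..n}. if v n - v m < z then exp (v n - v m) else 0)"
      using lt n by (intro sum.cong) auto
    finally show ?thesis .
  qed
  then have "(\<Sum>n\<in>{b \<omega> t k..d \<omega> \<kappa> t k}. Asum \<omega> (a \<omega> \<kappa> t k) n)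
     \<le> (\<Sum>n\<in>{b \<omega> t k..d \<omega> \<kappa> t k}. \<Sum>m\<in>{0..n}. if v n - v m < z then exp (v n - v m) else 0)"
    by (rule sum_mono)
  then show ?thesis by (simp add: W_eq[OF k N])
qed

text \<open>The intervals from bottom to exit are disjoint, so one double sum dominates all weights
  together.\<close>

lemma sum_W_le:
  assumes I: "I \<subseteq> {1..}" "finite I" and N: "\<And>k. k \<in> I \<Longrightarrow> b \<omega> t k \<le> N" "\<And>k. k \<in> I \<Longrightarrow> b \<omega> t k + 2 * L \<le> N'"
    and z: "\<And>k. k \<in> I \<Longrightarrow> H \<omega> (sig \<omega> t (k - 1)) < z" "u < z"
  shows "(\<Sum>k\<in>I. W \<omega> \<kappa> t k) \<le> 2 * trunc_sum \<omega> z N'"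
proof -
  let ?f = "\<lambda>n. \<Sum>m\<in>{0..n}. if v n - v m < z then exp (v n - v m) else 0"
  let ?J = "\<lambda>k. {b \<omega> t k..d \<omega> \<kappa> t k}"
  have disj: "?J j \<inter> ?J k = {}" if "j \<in> I" "k \<in> I" "j < k" for j k
  proof -
    have "d \<omega> \<kappa> t j < b \<omega> t (Suc j)" using that I N by (intro next_bottom) auto
    also have "b \<omega> t (Suc j) \<le> b \<omega> t k" using b_mono[of "Suc j" k t] that by (cases "Suc j = k") auto
    finally show ?thesis by auto
  qed
  have "(\<Sum>k\<in>I. W \<omega> \<kappa> t k) \<le> (\<Sum>k\<in>I. 2 * (\<Sum>n\<in>?J k. ?f n))"
    using I N z by (intro sum_mono W_le) auto
  also have "\<dots> = 2 * (\<Sum>k\<in>I. \<Sum>n\<in>?J k. ?f n)" by (simp add: sum_distrib_left)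
  also have "(\<Sum>k\<in>I. \<Sum>n\<in>?J k. ?f n) = (\<Sum>n\<in>(\<Union>k\<in>I. ?J k). ?f n)"
  proof (rule sum.UNION_disjoint[symmetric])
    show "\<forall>i\<in>I. \<forall>j\<in>I. i \<noteq> j \<longrightarrow> ?J i \<inter> ?J j = {}" using disj by (metis Int_commute linorder_neqE_nat)
  qed (use I in auto)
  also have "\<dots> \<le> trunc_sum \<omega> z N'"
    unfolding trunc_sum_def
  proof (rule sum_mono2)
    show "(\<Union>k\<in>I. ?J k) \<subseteq> {0..N'}"
    proof
      fix x assume "x \<in> (\<Union>k\<in>I. ?J k)"
      then obtain k where k: "k \<in> I" "x \<in> ?J k" by blast
      have "d \<omega> \<kappa> t k \<le> b \<omega> t k + 2 * L" using k I N(1)[of k] L1 by (intro dd_le) auto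
      then show "x \<in> {0..N'}" using k N(2)[of k] b_nonneg[of t k] by auto
    qed
  qed (auto intro: trunc_sum_term_nonneg)
  finally show ?thesis by simp
qed

lemma bottom_of_rise:
  assumes "0 \<le> m" "m \<le> n" "n \<le> N" "y \<le> v n - v m" "h t \<le> y"
  obtains k where "1 \<le> k" "b \<omega> t k \<le> n" "y \<le> H \<omega> (sig \<omega> t (k - 1))"
proof -
  obtain i where i: "el i \<le> n" "n < el (Suc i)" "y \<le> H \<omega> i" using rise_excursion assms by blast
  obtain j where j: "sig \<omega> t j = i" using sig_enumerates[of t i] i assms by (meson order_trans)
  show ?thesis by (rule that[of "Suc j"]) (use i j in \<open>auto simp: b_def simp del: e.simps\<close>)
qed

text \<open>The negative half-line enters \<open>Asum\<close> at a site \<open>x \<ge> 0\<close>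
  only through the product \<open>exp (v x) * Lam J\<close>.\<close>

definition Lam :: "int \<Rightarrow> real" where "Lam J = (\<Sum>m\<in>{- J..<0}. exp (- v m))"

text \<open>Outside the deep valleys the climbs are smaller than \<open>h t\<close>.\<close>

lemma Asum_off:
  assumes x: "0 \<le> x" and J: "0 \<le> J"
    and off: "\<And>k. 1 \<le> k \<Longrightarrow> b \<omega> t k \<le> x \<Longrightarrow> dbar \<omega> t k \<le> x"
  shows "Asum \<omega> (- J) x \<le> (\<Sum>m\<in>{0..x}. if v x - v m < h t then exp (v x - v m) else 0) + exp (v x) * Lam J"
proof -
  obtain i where i: "el i \<le> x" "x < el (Suc i)" using excursion_cover[OF x] by blast
  have nd: "H \<omega> i < h t"
  proof (rule ccontr)
    assume "\<not> H \<omega> i < h t"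
    then obtain j where j: "sig \<omega> t j = i" using sig_enumerates[of t i] by (meson not_less)
    then have "dbar \<omega> t (Suc j) \<le> x" using i by (intro off) (auto simp: b_def simp del: e.simps)
    then show False using i j by (simp add: dbar_def del: e.simps)
  qed
  have lt: "v x - v m < h t" if "m \<in> {0..x}" for m
    using running_min[of m i] H_ge[of i x] that i nd by auto
  have un: "{- J..x} = {- J..<0} \<union> {0..x}" using x J by auto
  have "Asum \<omega> (- J) x = (\<Sum>m\<in>{- J..<0}. exp (v x - v m)) + (\<Sum>m\<in>{0..x}. exp (v x - v m))"
    unfolding Asum_def un by (rule sum.union_disjoint) auto
  also have "(\<Sum>m\<in>{- J..<0}. exp (v x - v m)) = exp (v x) * Lam J"
    unfolding Lam_def sum_distrib_left by (intro sum.cong refl) (simp add: exp_add[symmetric])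
  also have "(\<Sum>m\<in>{0..x}. exp (v x - v m)) = (\<Sum>m\<in>{0..x}. if v x - v m < h t then exp (v x - v m) else 0)"
    using lt by (intro sum.cong) auto
  finally show ?thesis by simp
qed

definition Goff :: "int \<Rightarrow> int \<Rightarrow> real" where
  "Goff J x = 2 * ((\<Sum>m\<in>{0..x}. if v x - v m < h t then exp (v x - v m) else 0) + exp (v x) * Lam J)"

lemma Goff_nonneg: "0 \<le> Goff J x"
  unfolding Goff_def Lam_def by (intro mult_nonneg_nonneg add_nonneg_nonneg sum_nonneg) auto

text \<open>The capped walk cannot pass below \<open>- c\<close>, so it may be compared with the
  walk reflected there, whose mean passage time is explicit.\<close>

lemma expectation_hit_off:
  assumes xy: "0 \<le> x" "x \<le> y"
    and off: "\<And>z k. x \<le> z \<Longrightarrow> z < y \<Longrightarrow> 1 \<le> k \<Longrightarrow> b \<omega> t k \<le> z \<Longrightarrow> dbar \<omega> t k \<le> z"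
  shows "measure_pmf.expectation (hit \<omega> c x y) real \<le> (\<Sum>z\<in>{x..<y}. Goff (int c) z)"
proof -
  let ?lo = "- int c"
  define m where "m z = mean \<omega> ?lo y (max ?lo z)" for z
  have "measure_pmf.expectation (hit \<omega> c x y) real \<le> m x"
  proof (rule expectation_hit_le[where lo = ?lo])
    show "ellip \<omega>" by (rule sellip_imp_ellip[OF s])
    show "0 \<le> m z" for z unfolding m_def by (rule mean_ge_zero) simp
    fix z assume z: "?lo < z" "z < y"
    have "stp \<omega> m z = stp \<omega> (mean \<omega> ?lo y) z" using z by (simp add: stp_def m_def max_def)
    then show "1 + stp \<omega> m z \<le> m z" using mean_rec[OF s z] z by (simp add: m_def max_def)
  qed (use xy in auto)
  also have "m x = (\<Sum>z\<in>{x..<y}. 2 * Asum \<omega> ?lo z - 1)" using xy by (simp add: m_def mean_def max_def)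
  also have "\<dots> \<le> (\<Sum>z\<in>{x..<y}. Goff (int c) z)"
  proof (rule sum_mono)
    fix z assume z: "z \<in> {x..<y}"
    have "Asum \<omega> ?lo z \<le> (\<Sum>m\<in>{0..z}. if v z - v m < h t then exp (v z - v m) else 0) + exp (v z) * Lam (int c)"
      using z xy off by (intro Asum_off) auto
    then show "2 * Asum \<omega> ?lo z - 1 \<le> Goff (int c) z" by (simp add: Goff_def)
  qed
  finally show ?thesis .
qed

lemma sum_Goff: "(\<Sum>z\<in>{0..<y}. Goff J z) \<le> 2 * trunc_sum \<omega> (h t) N' + 2 * (\<Sum>x\<in>{0..N'}. exp (v x)) * Lam J" if "y \<le> N' + 1"
proof -
  have "(\<Sum>z\<in>{0..<y}. Goff J z) \<le> (\<Sum>z\<in>{0..N'}. Goff J z)"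
    using that by (intro sum_mono2) (auto intro: Goff_nonneg)
  also have "\<dots> = 2 * trunc_sum \<omega> (h t) N' + 2 * (\<Sum>x\<in>{0..N'}. exp (v x)) * Lam J"
    unfolding Goff_def trunc_sum_def by (simp add: sum.distrib sum_distrib_left sum_distrib_right distrib_left mult.assoc)
  finally show ?thesis .
qed

end

subsection \<open>Quenched estimates in a good environment\<close>

lemma tv_common_part:
  fixes M N :: "nat measure"
  assumes "prob_space M" "prob_space N" and sM: "sets M = UNIV" and sN: "sets N = UNIV"
    and I: "finite I" and p: "\<And>n. n \<in> I \<Longrightarrow> p n \<le> measure M {n}" "\<And>n. n \<in> I \<Longrightarrow> p n \<le> measure N {n}"
  shows "dTV M N \<le> 1 - (\<Sum>n\<in>I. p n)"
proof -
  interpret M: prob_space M by fact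
  interpret N: prob_space N by fact
  have low: "(\<Sum>n\<in>I \<inter> A. p n) \<le> measure Q A" if Q: "prob_space Q" "sets Q = UNIV" "\<And>n. n \<in> I \<Longrightarrow> p n \<le> measure Q {n}" for Q :: "nat measure" and A
  proof -
    interpret Q: prob_space Q by fact
    have "(\<Sum>n\<in>I \<inter> A. p n) \<le> (\<Sum>n\<in>I \<inter> A. measure Q {n})" using Q(3) by (intro sum_mono) auto
    also have "\<dots> = measure Q (I \<inter> A)" using I Q(2) by (intro Q.finite_measure_eq_sum_singleton[symmetric]) auto
    also have "\<dots> \<le> measure Q A" using Q(2) by (intro Q.finite_measure_mono) auto
    finally show ?thesis .
  qed
  have one: "measure Q A - measure R A \<le> 1 - (\<Sum>n\<in>I. p n)"
    if Q: "prob_space Q" "sets Q = UNIV" "\<And>n. n \<in> I \<Longrightarrow> p n \<le> measure Q {n}"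
      and R: "prob_space R" "sets R = UNIV" "\<And>n. n \<in> I \<Longrightarrow> p n \<le> measure R {n}" for Q R :: "nat measure" and A
  proof -
    interpret Q: prob_space Q by fact
    have sp: "space Q = UNIV" using Q(2) sets.top[of Q] sets.sets_into_space by (metis UNIV_I UNIV_eq_I subsetD)
    have "measure Q (- A) = 1 - measure Q A" using Q.prob_compl[of A] Q(2) sp by (simp add: Compl_eq_Diff_UNIV)
    moreover have "(\<Sum>n\<in>I \<inter> - A. p n) \<le> measure Q (- A)" by (rule low[OF Q])
    moreover have "(\<Sum>n\<in>I \<inter> A. p n) \<le> measure R A" by (rule low[OF R])
    moreover have "(\<Sum>n\<in>I. p n) = (\<Sum>n\<in>I \<inter> A. p n) + (\<Sum>n\<in>I \<inter> - A. p n)"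
      using I by (subst sum.union_disjoint[symmetric]) (auto intro!: sum.cong)
    ultimately show ?thesis by linarith
  qed
  show ?thesis unfolding dTV_def
  proof (rule cSUP_least)
    fix A
    show "\<bar>measure M A - measure N A\<bar> \<le> 1 - (\<Sum>n\<in>I. p n)"
      using one[OF assms(1) sM p(1) assms(2) sN p(2), of A] one[OF assms(2) sN p(2) assms(1) sM p(1), of A] by linarith
  qed simp
qed

lemma paths_hd: "p \<in> set_pmf (paths \<omega> n x) \<Longrightarrow> p ! 0 = x"
  by (cases n) (auto simp: set_bind_pmf)

context good_env
begin

text \<open>\<open>errv\<close> and \<open>errl\<close> are the bounds of
  \<open>exit_time_exponential\<close> and \<open>localization\<close> for a valley of at most
  \<open>3 * L + 1\<close> sites and time horizon \<open>t\<close>.\<close>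

definition errv :: real where
  "errv = (let L' = real_of_int (3 * L + 1) in
     L' * exp ((1 + \<kappa> / 2) * ln t - D \<kappa> t) + 2 * L'\<^sup>2 * exp (u - h t) * (2 + t * exp (- h t))
       + t * exp (- 2 * h t) * (2 * L'\<^sup>2 * exp u + 2 + L'))"

definition errl :: "real \<Rightarrow> real" where
  "errl c1 = (let L' = real_of_int (3 * L + 1) in
     L' * exp ((1 + \<kappa> / 2) * ln t - D \<kappa> t) + L' * (2 * L' * exp (u - h t) + 2 * exp (- c1)))"

lemma W_nonneg: "0 \<le> W \<omega> \<kappa> t k"
  unfolding W_def by (intro mult_nonneg_nonneg sum_nonneg) auto

text \<open>Later bottoms lie beyond the exit of valley \<open>n\<close>, so a path that visits its
  bottom without passing its exit has \<open>n\<close> as the largest index reached.\<close>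

lemma ell_eq:
  assumes n: "1 \<le> n" "b \<omega> t n \<le> N" and p: "p \<in> set_pmf (paths \<omega> (steps t) 0)"
    and hit: "b \<omega> t n \<in> set p" and below: "\<forall>z\<in>set p. z < d \<omega> \<kappa> t n + 1"
  shows "ell \<omega> t p = n"
proof -
  have len: "length p = Suc (steps t)" by (rule length_paths[OF p])
  have hd: "p ! 0 = 0" by (rule paths_hd[OF p])
  have b0: "0 < b \<omega> t n" using b_large[OF n(1)] n(2) L1 by simp
  obtain i where i: "i < length p" "p ! i = b \<omega> t n" using hit by (auto simp: in_set_conv_nth)
  \<comment> \<open>\<open>hit_by\<close> counts times from 1 on; the path starts at 0 and the
    bottom is positive, so the visit is not at time 0.\<close>
  have "i \<noteq> 0" using i hd b0 by (metis less_irrefl)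
  then have hb: "hit_by p t (b \<omega> t n)" unfolding hit_by_def using i len by (intro exI[of _ i]) auto
  show ?thesis unfolding ell_def
  proof (rule cSup_eq_maximum)
    show "n \<in> {n. n = 0 \<or> hit_by p t (b \<omega> t n)}" using hb by simp
    fix m assume m: "m \<in> {n. n = 0 \<or> hit_by p t (b \<omega> t n)}"
    show "m \<le> n"
    proof (rule ccontr)
      assume neg: "\<not> m \<le> n"
      then have "hit_by p t (b \<omega> t m)" using m by auto
      then obtain i where "i \<le> steps t" "p ! i = b \<omega> t m" unfolding hit_by_def by blast
      then have "b \<omega> t m \<in> set p" using len nth_mem[of i p] by simp
      then have "b \<omega> t m \<le> d \<omega> \<kappa> t n" using below by auto
      moreover have "b \<omega> t (Suc n) \<le> b \<omega> t m" using b_mono[of "Suc n" m t] neg by (cases "Suc n = m") auto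
      ultimately show False using next_bottom[OF n] by simp
    qed
  qed
qed

lemma ellE_measurable: "(\<lambda>es. ellE \<omega> \<kappa> t es + 1) \<in> measurable Exps (count_space UNIV)"
proof -
  have "(\<lambda>es. Sup {i. ws (W \<omega> \<kappa> t) i es \<le> t}) \<in> measurable Exps (count_space UNIV)"
    by (rule measurable_Sup_nat) measurable
  then have "ellE \<omega> \<kappa> t \<in> measurable Exps (count_space UNIV)"
    by (simp add: ellE_def[abs_def] ws_def[abs_def])
  then show ?thesis by (rule measurable_compose) simp
qed

text \<open>Valley \<open>K\<close> is so deep that it is not left by \<open>t\<close>; valley
  \<open>k0\<close> already has a mean of order \<open>t\<close> and smooths the partial sums;
  \<open>Lg\<close> holds the few other large valleys. The terms of \<open>zeta\<close> are, in
  order: leaving \<open>K\<close>, passing the lower threshold before \<open>k0\<close>, landing in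
  the window, replacing exit times by exponentials, and exceeding the time allotted to the
  gaps.\<close>

theorem quenched_core:
  assumes t1: "1 \<le> t"
    and K: "1 \<le> K" "b \<omega> t K \<le> N"
    and k0: "1 \<le> k0" "k0 \<le> K" and w0: "0 < w0" "w0 \<le> W \<omega> \<kappa> t k0" and w1: "0 < w1" "w1 \<le> W \<omega> \<kappa> t K"
    and early: "(\<Sum>k\<in>{1..<k0}. W \<omega> \<kappa> t k) \<le> E1"
    and Lg: "finite Lg" "real (card Lg) \<le> m" "(\<Sum>k\<in>{1..K} - Lg. W \<omega> \<kappa> t k) \<le> E2"
    and gap: "2 * trunc_sum \<omega> (h t) N + 2 * (\<Sum>x\<in>{0..N}. exp (v x)) * Lam (int (Suc (steps t))) \<le> g"
    and eps: "0 < \<epsilon>" "\<epsilon> < 1" "1 < \<epsilon> * t" "g \<le> \<epsilon> * t - 1"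
    and zeta: "t / w1 + E1 / ((1 - \<epsilon>) * t) + ((m + 1) * (\<epsilon> * t) + E2) / w0
        + 2 * (real K)\<^sup>2 * (errv + exp (- h t)) + g / (\<epsilon> * t - 1) \<le> \<zeta>"
  shows "dTV (law_ell \<omega> t) (law_ellE \<omega> \<kappa> t) \<le> \<zeta>"
    and "(\<And>k j. 1 \<le> k \<Longrightarrow> k \<le> K \<Longrightarrow> b \<omega> t k - L - 1 \<le> j \<Longrightarrow> j \<le> cpk k \<Longrightarrow> R - 1 \<le> \<bar>real_of_int (j - b \<omega> t k)\<bar> \<Longrightarrow> c1 \<le> v j - v (b \<omega> t k))
      \<Longrightarrow> 1 - \<zeta> - real K * errl c1 \<le> measure_pmf.prob (walk \<omega> (steps t)) {p. \<bar>real_of_int (p ! steps t - b \<omega> t (ell \<omega> t p))\<bar> \<le> R}"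
proof -
  let ?w = "W \<omega> \<kappa> t"
  define dl where "dl = errv + exp (- h t)"
  define l where "l = (1 - \<epsilon>) * t"
  define ga where "ga = g / (\<epsilon> * t - 1)"
  have tl: "t - l = \<epsilon> * t" by (simp add: l_def algebra_simps)
  have l0: "0 < l" "l < t" unfolding l_def using eps t1 by (auto simp: algebra_simps)
  have bk: "b \<omega> t k \<le> N" if "k \<in> {1..K}" for k
    using b_mono[of k K t] that K by (cases "k = K") auto
  have ellip: "ellip \<omega>" by (rule sellip_imp_ellip[OF s])
  have errv0: "0 \<le> errv" unfolding errv_def Let_def using L1 t1
    by (intro add_nonneg_nonneg mult_nonneg_nonneg) auto
  interpret pa: passage \<omega> t "b \<omega> t" "d \<omega> \<kappa> t" ?w K dl
  proof
    show "ellip \<omega>" by (rule ellip)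
    show "0 \<le> t" using t1 by simp
    show "0 < b \<omega> t 1" using b_large[of 1] bk[of 1] K L1 by simp
    show "b \<omega> t k \<le> d \<omega> \<kappa> t k" if "k \<in> {1..K}" for k
      using that bk[OF that] dd_ge[of k] b_dbar[of k] L1 by fastforce
    show "d \<omega> \<kappa> t k < b \<omega> t (Suc k)" if "k \<in> {1..<K}" for k
      using that bk[of k] by (intro next_bottom) auto
    have Wk: "2 * exp (h t) \<le> ?w k" if "k \<in> {1..K}" for k
    proof -
      have "2 * exp (h t) \<le> 2 * exp (H \<omega> (sig \<omega> t (k - 1)))" using deep[of k] that by simp
      also have "\<dots> \<le> ?w k" using that bk[OF that] by (intro W_ge) auto
      finally show ?thesis .
    qed
    show pos: "0 < ?w k" if "k \<in> {1..K}" for k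
    proof -
      have "0 < 2 * exp (h t)" by simp
      then show ?thesis using Wk[OF that] by (rule less_le_trans)
    qed
    show "0 \<le> dl" unfolding dl_def using errv0 by simp
    fix k n assume k: "k \<in> {1..K}" and n: "real n \<le> t"
    interpret vl: valley \<omega> "a \<omega> \<kappa> t k" "b \<omega> t k" "cpk k" "d \<omega> \<kappa> t k" "real_of_int (3 * L + 1)" u "h t" "D \<kappa> t" "(1 + \<kappa> / 2) * ln t"
      using k bk[OF k] by (intro valley_instance) auto
    have "vl.W0 = ?w k" unfolding vl.W0_def using k bk[OF k] by (intro W_eq[symmetric]) auto
    then have "\<bar>sv \<omega> (d \<omega> \<kappa> t k + 1) n (b \<omega> t k) - exp (- (real n / ?w k))\<bar> \<le> errv"
      using vl.exit_time_exponential[OF n] by (simp add: errv_def Let_def)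
    moreover have "1 / ?w k \<le> exp (- h t)"
    proof -
      have "1 / ?w k \<le> 1 / exp (h t)" using Wk[OF k] by (intro divide_left_mono) (auto intro!: mult_pos_pos pos[OF k] order_trans[OF _ Wk[OF k]])
      then show ?thesis by (simp add: exp_minus inverse_eq_divide)
    qed
    ultimately show "\<bar>sv \<omega> (d \<omega> \<kappa> t k + 1) n (b \<omega> t k) - exp (- (real n / ?w k))\<bar> + 1 / ?w k \<le> dl"
      unfolding dl_def by linarith
  qed
  have TT: "pa.T = steps t" by (simp add: pa.T_def steps_def)
  have cc: "pa.c = Suc (steps t)" by (simp add: pa.c_def TT)
  \<comment> \<open>The gap stretches are disjoint parts of the interval from 0 to the next bottom,
    so their costs add up to at most one sum of \<open>Goff\<close>.\<close>
  have Gap: "measure_pmf.expectation (pa.Gap n) real \<le> (\<Sum>z\<in>{0..<b \<omega> t (Suc n)}. Goff (int (Suc (steps t))) z)" if "n < K" for n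
    using that
  proof (induction n)
    case 0
    have "measure_pmf.expectation (pa.Gap 0) real \<le> (\<Sum>z\<in>{0..<b \<omega> t 1}. Goff (int pa.c) z)"
      unfolding pa.Gap.simps
    proof (rule expectation_hit_off)
      show "dbar \<omega> t k \<le> z" if "0 \<le> z" "z < b \<omega> t 1" "1 \<le> k" "b \<omega> t k \<le> z" for z k
        using that b_mono[of 1 k t] by (cases "k = 1") auto
    qed (simp_all add: b_nonneg)
    then show ?case by (simp add: cc)
  next
    case (Suc n)
    let ?D = "d \<omega> \<kappa> t (Suc n)" and ?B = "b \<omega> t (Suc n)" and ?B' = "b \<omega> t (Suc (Suc n))"
    have B: "?B \<le> N" using bk[of "Suc n"] Suc.prems by simp
    have N2: "?B \<le> N + 2 * L" using B L1 by simp
    have S1: "1 \<le> Suc n" by simp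
    have D: "?B \<le> ?D" "?D < ?B'" using dd_ge[OF S1 N2] b_dbar[OF S1] next_bottom[OF S1 B] by linarith+
    have "measure_pmf.expectation (hit \<omega> pa.c (?D + 1) ?B') real \<le> (\<Sum>z\<in>{?D + 1..<?B'}. Goff (int pa.c) z)"
    proof (rule expectation_hit_off)
      show "0 \<le> ?D + 1" using D b_nonneg[of t "Suc n"] by linarith
      show "?D + 1 \<le> ?B'" using D by simp
      fix z k assume z: "?D + 1 \<le> z" "z < ?B'" and k: "1 \<le> k" "b \<omega> t k \<le> z"
      have "k \<le> Suc n"
      proof (rule ccontr)
        assume "\<not> k \<le> Suc n"
        then have "?B' \<le> b \<omega> t k" using b_mono[of "Suc (Suc n)" k t] by (cases "Suc (Suc n) = k") auto
        then show False using z k by simp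
      qed
      show "dbar \<omega> t k \<le> z"
      proof (cases "k = Suc n")
        case True
        then show ?thesis using dd_ge[OF S1 N2] z by simp
      next
        case False
        then have kn: "k < Suc n" using \<open>k \<le> Suc n\<close> by simp
        have bN: "b \<omega> t k \<le> N" using bk[of k] k kn Suc.prems by simp
        have "dbar \<omega> t k \<le> d \<omega> \<kappa> t k" using bN L1 k by (intro dd_ge) auto
        also have "\<dots> < b \<omega> t (Suc k)" by (rule next_bottom[OF k(1) bN])
        also have "\<dots> \<le> ?B" using b_mono[of "Suc k" "Suc n" t] kn by (cases "Suc k = Suc n") auto
        finally show ?thesis using D z by linarith
      qed
    qed
    moreover have "measure_pmf.expectation (pa.Gap (Suc n)) real
       = measure_pmf.expectation (pa.Gap n) real + measure_pmf.expectation (hit \<omega> pa.c (?D + 1) ?B') real"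
      unfolding pa.Gap.simps by (intro expectation_pmf_add pa.finite_Gap finite_set_hit)
    moreover have "measure_pmf.expectation (pa.Gap n) real \<le> (\<Sum>z\<in>{0..<?B}. Goff (int pa.c) z)" using Suc by (simp add: cc)
    moreover have "(\<Sum>z\<in>{0..<?B}. Goff (int pa.c) z) + (\<Sum>z\<in>{?D + 1..<?B'}. Goff (int pa.c) z) \<le> (\<Sum>z\<in>{0..<?B'}. Goff (int pa.c) z)"
    proof -
      have "(\<Sum>z\<in>{0..<?B}. Goff (int pa.c) z) + (\<Sum>z\<in>{?D + 1..<?B'}. Goff (int pa.c) z) = (\<Sum>z\<in>{0..<?B} \<union> {?D + 1..<?B'}. Goff (int pa.c) z)"
        using D by (intro sum.union_disjoint[symmetric]) auto
      also have "\<dots> \<le> (\<Sum>z\<in>{0..<?B'}. Goff (int pa.c) z)"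
        using D b_nonneg[of t "Suc n"] by (intro sum_mono2 Goff_nonneg) auto
      finally show ?thesis .
    qed
    ultimately show ?case unfolding cc by linarith
  qed
  have Gapg: "measure_pmf.expectation (pa.Gap n) real \<le> g" if "n < K" for n
  proof -
    have "b \<omega> t (Suc n) \<le> N + 1" using bk[of "Suc n"] that by simp
    then show ?thesis using Gap[OF that] sum_Goff[of "b \<omega> t (Suc n)" N "int (Suc (steps t))"] gap by linarith
  qed
  have TS0: "0 \<le> trunc_sum \<omega> (h t) N" unfolding trunc_sum_def by (intro sum_nonneg) auto
  have Lam0: "0 \<le> Lam J" for J unfolding Lam_def by (intro sum_nonneg) auto
  have "0 \<le> 2 * (\<Sum>x\<in>{0..N}. exp (v x)) * Lam (int (Suc (steps t)))"
    by (intro mult_nonneg_nonneg sum_nonneg Lam0) auto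
  then have g0: "0 \<le> g" using TS0 gap by linarith
  have ga: "0 \<le> ga" "ga \<le> 1" unfolding ga_def using g0 eps by (auto simp: divide_le_eq_1)
  let ?q = "pa.qn l"
  have q0: "0 \<le> ?q n" for n by (simp add: pa.qn_def)
  \<comment> \<open>The common part of both laws. The error \<open>2 * K * dl\<close> covers
    \<open>(2 * n' + 1) * dl\<close> for all valleys at once, and the maximum with 0 handles indices
    where the estimate is void.\<close>
  define p where "p n = max 0 ((?q n - 2 * real K * dl) * (1 - ga))" for n
  have dl0: "0 \<le> dl" by (rule pa.delta0)
  let ?E = "\<lambda>n pth. b \<omega> t n \<in> set pth \<and> (\<forall>z\<in>set pth. z < d \<omega> \<kappa> t n + 1)"
  have pE: "p n \<le> pr \<omega> (steps t) 0 (?E n)" if n: "n \<in> {1..K}" for n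
  proof -
    obtain n' where n': "n = Suc n'" "n' < K" using n by (cases n) auto
    have "(?q n - real (2 * n' + 1) * dl) * (1 - ga) \<le> pr \<omega> (steps t) 0 (?E n)"
      using pa.visit_probability[OF n'(2), of l g] Gapg[OF n'(2)] l0 eps tl by (simp add: n' TT ga_def)
    moreover have "(?q n - 2 * real K * dl) * (1 - ga) \<le> (?q n - real (2 * n' + 1) * dl) * (1 - ga)"
    proof -
      have "real (2 * n' + 1) * dl \<le> 2 * real K * dl" using n' dl0 by (intro mult_right_mono) auto
      then show ?thesis using ga by (intro mult_right_mono) auto
    qed
    ultimately show ?thesis unfolding p_def by simp
  qed
  have pq: "p n \<le> ?q n" for n
  proof -
    have "(?q n - 2 * real K * dl) * (1 - ga) \<le> ?q n * (1 - ga)" using ga dl0 by (intro mult_right_mono) auto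
    also have "\<dots> \<le> ?q n" using ga q0[of n] by (intro mult_left_le) auto
    finally show ?thesis unfolding p_def using q0 by simp
  qed
  have wk0: "0 < ?w k0" "0 < ?w K" using w0 w1 by linarith+
  have sumq: "1 - t / ?w K - (\<Sum>k\<in>{1..<k0}. ?w k) / l - ((m + 1) * (t - l) + (\<Sum>k\<in>{1..K} - Lg. ?w k)) / ?w k0 \<le> (\<Sum>n\<in>{1..K}. ?q n)"
    unfolding pa.qn_def using k0 wk0 l0 Lg by (intro window_sum W_nonneg) auto
  have q1: "?q n \<le> 1" for n by (simp add: pa.qn_def)
  have m0: "0 \<le> m" using Lg(2) by (rule order_trans[rotated]) simp
  have sumE0: "0 \<le> (\<Sum>k\<in>{1..K} - Lg. ?w k)" by (intro sum_nonneg W_nonneg)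
  have "t / ?w K \<le> t / w1" using w1 t1 by (intro divide_left_mono) (auto intro: mult_pos_pos wk0)
  moreover have "(\<Sum>k\<in>{1..<k0}. ?w k) / l \<le> E1 / l" using early l0 by (intro divide_right_mono) auto
  moreover have "((m + 1) * (t - l) + (\<Sum>k\<in>{1..K} - Lg. ?w k)) / ?w k0 \<le> ((m + 1) * (\<epsilon> * t) + E2) / w0"
    using w0 Lg(3) m0 eps t1 sumE0 unfolding tl by (intro frac_le add_mono) (auto intro!: add_nonneg_nonneg mult_nonneg_nonneg)
  ultimately have sq: "1 - t / w1 - E1 / ((1 - \<epsilon>) * t) - ((m + 1) * (\<epsilon> * t) + E2) / w0 \<le> (\<Sum>n\<in>{1..K}. ?q n)"
    using sumq unfolding l_def[symmetric] by linarith
  \<comment> \<open>The straddling events are almost surely disjoint. This turns the factor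
    \<open>1 - ga\<close> into a loss of at most \<open>ga\<close> in total.\<close>
  have sum_le1: "(\<Sum>n\<in>{1..K}. ?q n) \<le> 1"
  proof -
    let ?G = "\<lambda>n. {es. ws ?w (n - 1) es \<le> l \<and> t < ws ?w n es}"
    have ms: "?G n \<in> sets Exps" for n by (rule sets_Exps_pred) measurable
    have ae: "AE es in Exps. es \<notin> ?G i \<or> es \<notin> ?G j" if "i < j" for i j
      using Exps_nonneg
    proof eventually_elim
      case (elim es)
      have "ws ?w i es \<le> ws ?w (j - 1) es" using elim that by (intro ws_mono W_nonneg) auto
      then show ?case using l0 by auto
    qed
    have "(\<Sum>n\<in>{1..K}. measure Exps (?G n)) = measure Exps (\<Union>n\<in>{1..K}. ?G n)"
    proof (rule measure_UNION_AE[symmetric])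
      show "pairwise (\<lambda>i j. AE es in Exps. es \<notin> ?G i \<or> es \<notin> ?G j) {1..K}"
        unfolding pairwise_def
      proof (intro ballI impI)
        fix i j :: nat assume "i \<noteq> j"
        then consider "i < j" | "j < i" by linarith
        then show "AE es in Exps. es \<notin> ?G i \<or> es \<notin> ?G j"
        proof cases
          case 1
          then show ?thesis by (rule ae)
        next
          case 2
          from ae[OF this] show ?thesis by eventually_elim blast
        qed
      qed
      show "?G i \<in> fmeasurable Exps" for i using ms by (simp only: Exps.fmeasurable_eq_sets)
    qed simp
    then show ?thesis by (simp add: pa.qn_def)
  qed
  have "(\<Sum>n\<in>{1..K}. ?q n) - 2 * (real K)\<^sup>2 * dl - ga \<le> (\<Sum>n\<in>{1..K}. p n)"
  proof -
    have "(\<Sum>n\<in>{1..K}. (?q n - 2 * real K * dl) * (1 - ga)) \<le> (\<Sum>n\<in>{1..K}. p n)"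
      unfolding p_def by (intro sum_mono) auto
    moreover have "(\<Sum>n\<in>{1..K}. (?q n - 2 * real K * dl) * (1 - ga)) = ((\<Sum>n\<in>{1..K}. ?q n) - 2 * (real K)\<^sup>2 * dl) * (1 - ga)"
      by (simp add: sum_distrib_right[symmetric] sum_subtractf power2_eq_square)
    moreover have "(\<Sum>n\<in>{1..K}. ?q n) * ga \<le> 1 * ga" using sum_le1 ga by (intro mult_right_mono) auto
    moreover have "0 \<le> 2 * (real K)\<^sup>2 * dl * ga" using dl0 ga by simp
    ultimately show ?thesis by (simp add: algebra_simps)
  qed
  then have sump: "1 - \<zeta> \<le> (\<Sum>n\<in>{1..K}. p n)" using sq zeta unfolding dl_def[symmetric] ga_def[symmetric] by linarith
  have Eell: "pr \<omega> (steps t) 0 (\<lambda>pth. ?E n pth \<and> Q pth) \<le> measure_pmf.prob (walk \<omega> (steps t)) {pth. ell \<omega> t pth = n \<and> Q pth}"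
    if n: "n \<in> {1..K}" for n Q
    unfolding walk_eq_paths
    by (intro measure_pmf.finite_measure_mono_AE) (use n bk[OF n] ell_eq in \<open>auto simp: AE_measure_pmf_iff\<close>)
  show "dTV (law_ell \<omega> t) (law_ellE \<omega> \<kappa> t) \<le> \<zeta>"
  proof -
    have "dTV (law_ell \<omega> t) (law_ellE \<omega> \<kappa> t) \<le> 1 - (\<Sum>n\<in>{1..K}. p n)"
    proof (rule tv_common_part)
      show "prob_space (law_ell \<omega> t)" unfolding law_ell_def by (rule prob_space_measure_pmf)
      show "prob_space (law_ellE \<omega> \<kappa> t)" unfolding law_ellE_def by (rule Exps.prob_space_distr[OF ellE_measurable])
      show "sets (law_ell \<omega> t) = UNIV" "sets (law_ellE \<omega> \<kappa> t) = UNIV" by (simp_all add: law_ell_def law_ellE_def)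
      fix n assume n: "n \<in> {1..K}"
      have "p n \<le> measure_pmf.prob (walk \<omega> (steps t)) {pth. ell \<omega> t pth = n}"
        using pE[OF n] Eell[OF n, of "\<lambda>_. True"] by simp
      then show "p n \<le> measure (law_ell \<omega> t) {n}" by (simp add: law_ell_def vimage_def)
      have "?q n \<le> measure Exps {es. ellE \<omega> \<kappa> t es + 1 = n}"
        unfolding pa.qn_def
      proof (rule Exps.finite_measure_mono_AE)
        show "AE es in Exps. es \<in> {es. ws ?w (n - 1) es \<le> l \<and> t < ws ?w n es} \<longrightarrow> es \<in> {es. ellE \<omega> \<kappa> t es + 1 = n}"
          using Exps_nonneg
        proof eventually_elim
          case (elim es)
          show ?case
          proof
            assume es: "es \<in> {es. ws ?w (n - 1) es \<le> l \<and> t < ws ?w n es}"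
            \<comment> \<open>The partial sum of order \<open>n - 1\<close> is still below
              \<open>t\<close> and that of order \<open>n\<close> is not: this is the shift by one
              between \<open>ell\<close> and \<open>ellE\<close>.\<close>
            have "Sup {i. ws ?w i es \<le> t} = n - 1"
            proof (rule cSup_eq_maximum)
              show "n - 1 \<in> {i. ws ?w i es \<le> t}" using es l0 by auto
              fix i assume i: "i \<in> {i. ws ?w i es \<le> t}"
              have "\<not> n \<le> i"
              proof
                assume "n \<le> i"
                then have "ws ?w n es \<le> ws ?w i es" using elim by (intro ws_mono W_nonneg)
                then show False using i es by auto
              qed
              then show "i \<le> n - 1" by simp
            qed
            then have "ellE \<omega> \<kappa> t es = n - 1" by (simp add: ellE_def ws_def)
            then show "es \<in> {es. ellE \<omega> \<kappa> t es + 1 = n}" using n by simp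
          qed
        qed
        show "{es. ellE \<omega> \<kappa> t es + 1 = n} \<in> sets Exps"
          using measurable_sets[OF ellE_measurable, of "{n}"] by (simp add: vimage_def)
      qed
      moreover have "measure (law_ellE \<omega> \<kappa> t) {n} = measure Exps {es. ellE \<omega> \<kappa> t es + 1 = n}"
        unfolding law_ellE_def by (subst measure_distr[OF ellE_measurable]) (auto simp: vimage_def)
      ultimately show "p n \<le> measure (law_ellE \<omega> \<kappa> t) {n}" using pq[of n] by linarith
    qed simp
    then show ?thesis using sump by linarith
  qed
  show "1 - \<zeta> - real K * errl c1 \<le> measure_pmf.prob (walk \<omega> (steps t)) {p. \<bar>real_of_int (p ! steps t - b \<omega> t (ell \<omega> t p))\<bar> \<le> R}"
    if far: "\<And>k j. 1 \<le> k \<Longrightarrow> k \<le> K \<Longrightarrow> b \<omega> t k - L - 1 \<le> j \<Longrightarrow> j \<le> cpk k \<Longrightarrow> R - 1 \<le> \<bar>real_of_int (j - b \<omega> t k)\<bar> \<Longrightarrow> c1 \<le> v j - v (b \<omega> t k)"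
  proof -
    let ?X = "walk \<omega> (steps t)"
    let ?good = "\<lambda>n pth. \<bar>real_of_int (last pth - b \<omega> t n)\<bar> \<le> R"
    have err0: "0 \<le> errl c1" unfolding errl_def Let_def using L1 by (intro add_nonneg_nonneg mult_nonneg_nonneg) auto
    have one: "p n - errl c1 \<le> measure_pmf.prob ?X {pth. ell \<omega> t pth = n \<and> ?good n pth}" if n: "n \<in> {1..K}" for n
    proof -
      interpret vl: valley \<omega> "a \<omega> \<kappa> t n" "b \<omega> t n" "cpk n" "d \<omega> \<kappa> t n" "real_of_int (3 * L + 1)" u "h t" "D \<kappa> t" "(1 + \<kappa> / 2) * ln t"
        using n bk[OF n] by (intro valley_instance) auto
      have n1: "1 \<le> n" "b \<omega> t n \<le> N + 2 * L" using n bk[OF n] L1 by auto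
      have "pr \<omega> (steps t) 0 (\<lambda>pth. b \<omega> t n \<in> set pth \<and> (\<forall>z\<in>set pth. z < d \<omega> \<kappa> t n + 1) \<and> \<not> \<bar>real_of_int (last pth - b \<omega> t n)\<bar> \<le> R) \<le> errl c1"
      proof (rule pr_hit_last_le[OF ellip err0, where f = "\<lambda>x. \<not> \<bar>real_of_int (x - b \<omega> t n)\<bar> \<le> R"])
        fix m
        show "pr \<omega> m (b \<omega> t n) (\<lambda>p. (\<forall>z\<in>set p. z < d \<omega> \<kappa> t n + 1) \<and> \<not> \<bar>real_of_int (last p - b \<omega> t n)\<bar> \<le> R) \<le> errl c1"
          unfolding errl_def Let_def
          by (rule vl.localization) (use far[of n] n aa_ge[OF n1] in auto)
      qed
      moreover have "pr \<omega> (steps t) 0 (?E n) \<le> pr \<omega> (steps t) 0 (\<lambda>pth. ?E n pth \<and> ?good n pth)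
          + pr \<omega> (steps t) 0 (\<lambda>pth. b \<omega> t n \<in> set pth \<and> (\<forall>z\<in>set pth. z < d \<omega> \<kappa> t n + 1) \<and> \<not> \<bar>real_of_int (last pth - b \<omega> t n)\<bar> \<le> R)"
        by (rule order_trans[OF measure_pmf.finite_measure_mono measure_Un_le]) auto
      ultimately show ?thesis using pE[OF n] Eell[OF n, of "?good n"] by linarith
    qed
    have "(\<Sum>n\<in>{1..K}. p n - errl c1) \<le> (\<Sum>n\<in>{1..K}. measure_pmf.prob ?X {pth. ell \<omega> t pth = n \<and> ?good n pth})"
      by (intro sum_mono one)
    also have "\<dots> = measure_pmf.prob ?X (\<Union>n\<in>{1..K}. {pth. ell \<omega> t pth = n \<and> ?good n pth})"
      by (intro measure_pmf.finite_measure_finite_Union[symmetric]) (auto simp: disjoint_family_on_def)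
    also have "\<dots> \<le> measure_pmf.prob ?X {p. \<bar>real_of_int (p ! steps t - b \<omega> t (ell \<omega> t p))\<bar> \<le> R}"
    proof (intro measure_pmf.finite_measure_mono_AE)
      show "AE pth in ?X. pth \<in> (\<Union>n\<in>{1..K}. {pth. ell \<omega> t pth = n \<and> ?good n pth}) \<longrightarrow> pth \<in> {p. \<bar>real_of_int (p ! steps t - b \<omega> t (ell \<omega> t p))\<bar> \<le> R}"
        unfolding walk_eq_paths AE_measure_pmf_iff
      proof
        fix pth assume pth: "pth \<in> set_pmf (paths \<omega> (steps t) 0)"
        have "last pth = pth ! steps t" using length_paths[OF pth] paths_nonempty[OF pth] by (simp add: last_conv_nth)
        then show "pth \<in> (\<Union>n\<in>{1..K}. {pth. ell \<omega> t pth = n \<and> ?good n pth}) \<longrightarrow> pth \<in> {p. \<bar>real_of_int (p ! steps t - b \<omega> t (ell \<omega> t p))\<bar> \<le> R}"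
          by auto
      qed
    qed simp
    finally show ?thesis using sump by (simp add: sum_subtractf)
  qed
qed

end

subsection \<open>Probabilities of bad environments\<close>

definition rise_count :: "(int \<Rightarrow> real) \<Rightarrow> real \<Rightarrow> int \<Rightarrow> nat \<Rightarrow> real" where
  "rise_count \<omega> y N n = (\<Sum>x\<in>{0..N}. if \<exists>j\<le>n. y \<le> inc \<omega> x (x + int j) then 1 else 0)"

context rwre_env
begin

lemma sets_P_pred: "Measurable.pred P Q \<Longrightarrow> {\<omega>. Q \<omega>} \<in> sets P"
  by (drule predE) simp

lemma union_bound:
  assumes I: "finite I" and E: "\<And>i. i \<in> I \<Longrightarrow> {\<omega>. E i \<omega>} \<in> sets P" "\<And>i. i \<in> I \<Longrightarrow> measure P {\<omega>. E i \<omega>} \<le> q"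
  shows "{\<omega>. \<exists>i\<in>I. E i \<omega>} \<in> sets P" "measure P {\<omega>. \<exists>i\<in>I. E i \<omega>} \<le> real (card I) * q"
proof -
  have eq: "{\<omega>. \<exists>i\<in>I. E i \<omega>} = (\<Union>i\<in>I. {\<omega>. E i \<omega>})" by auto
  show "{\<omega>. \<exists>i\<in>I. E i \<omega>} \<in> sets P" unfolding eq using I E(1) by (intro sets.finite_UN) auto
  have "measure P {\<omega>. \<exists>i\<in>I. E i \<omega>} \<le> (\<Sum>i\<in>I. measure P {\<omega>. E i \<omega>})"
    unfolding eq using I E(1) by (intro measure_UNION_le) auto
  also have "\<dots> \<le> real (card I) * q" using sum_bounded_above[of I "\<lambda>i. measure P {\<omega>. E i \<omega>}" q] E(2) by simp
  finally show "measure P {\<omega>. \<exists>i\<in>I. E i \<omega>} \<le> real (card I) * q" .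
qed

lemma inc_set: "{\<omega>. z \<le> inc \<omega> x y} \<in> sets P" "{\<omega>. inc \<omega> x y \<le> z} \<in> sets P"
  by (rule sets_P_pred, measurable)+

lemma bad_descent:
  assumes "0 \<le> n"
  shows "{\<omega>. \<exists>x\<in>{lo..hi}. - z \<le> inc \<omega> x (x + n)} \<in> sets P"
    "measure P {\<omega>. \<exists>x\<in>{lo..hi}. - z \<le> inc \<omega> x (x + n)} \<le> real (card {lo..hi}) * (exp (\<kappa> / 2 * z) * phi ^ nat n)"
proof -
  have m: "measure P {\<omega>. - z \<le> inc \<omega> x (x + n)} \<le> exp (\<kappa> / 2 * z) * phi ^ nat n" for x
    using measure_inc_ge[of "- z" x "nat n"] assms by simp
  show "{\<omega>. \<exists>x\<in>{lo..hi}. - z \<le> inc \<omega> x (x + n)} \<in> sets P"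
    "measure P {\<omega>. \<exists>x\<in>{lo..hi}. - z \<le> inc \<omega> x (x + n)} \<le> real (card {lo..hi}) * (exp (\<kappa> / 2 * z) * phi ^ nat n)"
    by (rule union_bound[OF finite_atLeastAtMost_int inc_set(1) m])+
qed

text \<open>The two climbs use disjoint sites, so their probabilities multiply. At height
  \<open>3 / 4 * ln t\<close> the square is \<open>t powr (- (3 / 2 * \<kappa>))\<close>, which
  beats the number of sites, of order \<open>t powr \<kappa>\<close>, and the logarithmic
  factors.\<close>

lemma bad_two_rises:
  "{\<omega>. \<exists>q\<in>{lo..hi} \<times> {0..n} \<times> {0..n} \<times> {0..n}. case q of (i, p, r, s) \<Rightarrow>
       z \<le> inc \<omega> i (i + p) \<and> z \<le> inc \<omega> (i + p + r) (i + p + r + s)} \<in> sets P"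
  "measure P {\<omega>. \<exists>q\<in>{lo..hi} \<times> {0..n} \<times> {0..n} \<times> {0..n}. case q of (i, p, r, s) \<Rightarrow>
       z \<le> inc \<omega> i (i + p) \<and> z \<le> inc \<omega> (i + p + r) (i + p + r + s)}
    \<le> real (card {lo..hi}) * real (card {0..n::int}) ^ 3 * exp (- (2 * \<kappa> * z))"
proof -
  let ?I = "{lo..hi} \<times> {0..n} \<times> {0..n} \<times> {0..n}"
  let ?E = "\<lambda>q \<omega>. case q of (i, p, r, s) \<Rightarrow> z \<le> inc \<omega> i (i + p) \<and> z \<le> inc \<omega> (i + p + r) (i + p + r + s)"
  have set: "{\<omega>. ?E q \<omega>} \<in> sets P" for q
    by (cases q) (auto intro!: sets_P_pred pred_intros_logic)
  have m: "measure P {\<omega>. ?E q \<omega>} \<le> exp (- (2 * \<kappa> * z))" if "q \<in> ?I" for q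
  proof -
    obtain i p r s where q: "q = (i, p, r, s)" by (cases q)
    have d: "{i<..i + p} \<inter> {i + p + r<..i + p + r + s} = {}" using that q by auto
    have "measure P {\<omega>. z \<le> inc \<omega> i (i + p) \<and> z \<le> inc \<omega> (i + p + r) (i + p + r + s)} \<le> exp (- (2 * \<kappa> * z)) * phi ^ card ({}::int set)"
    proof (rule chernoff[of "{i<..i + p} \<union> {i + p + r<..i + p + r + s}"])
      show "2 * \<kappa> * z \<le> \<kappa> * (\<Sum>i\<in>{i<..i + p} \<union> {i + p + r<..i + p + r + s}. xi (\<omega> i)) + \<kappa> / 2 * (\<Sum>i\<in>{}. xi (\<omega> i))"
        if "z \<le> inc \<omega> i (i + p) \<and> z \<le> inc \<omega> (i + p + r) (i + p + r + s)" for \<omega>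
      proof -
        have "(\<Sum>i\<in>{i<..i + p} \<union> {i + p + r<..i + p + r + s}. xi (\<omega> i)) = inc \<omega> i (i + p) + inc \<omega> (i + p + r) (i + p + r + s)"
          unfolding inc_def using d by (intro sum.union_disjoint) auto
        moreover have "\<kappa> * (z + z) \<le> \<kappa> * (inc \<omega> i (i + p) + inc \<omega> (i + p + r) (i + p + r + s))"
          using that kappa_pos by (intro mult_left_mono add_mono) auto
        ultimately show ?thesis by simp
      qed
    qed (auto intro!: pred_intros_logic)
    then show ?thesis by (simp add: q)
  qed
  have fin: "finite ?I" by simp
  show "{\<omega>. \<exists>q\<in>?I. ?E q \<omega>} \<in> sets P" by (rule union_bound(1)[OF fin set m])
  have "measure P {\<omega>. \<exists>q\<in>?I. ?E q \<omega>} \<le> real (card ?I) * exp (- (2 * \<kappa> * z))" by (rule union_bound(2)[OF fin set m])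
  also have "real (card ?I) = real (card {lo..hi}) * real (card {0..n::int}) ^ 3"
    by (simp add: card_cartesian_product power3_eq_cube)
  finally show "measure P {\<omega>. \<exists>q\<in>?I. ?E q \<omega>} \<le> real (card {lo..hi}) * real (card {0..n::int}) ^ 3 * exp (- (2 * \<kappa> * z))" .
qed

lemma bad_one_rise:
  "{\<omega>. \<exists>q\<in>{lo..hi} \<times> {0..n}. case q of (i, p) \<Rightarrow> z \<le> inc \<omega> i (i + p)} \<in> sets P"
  "measure P {\<omega>. \<exists>q\<in>{lo..hi} \<times> {0..n}. case q of (i, p) \<Rightarrow> z \<le> inc \<omega> i (i + p)}
    \<le> real (card {lo..hi}) * real (card {0..n::int}) * exp (- (\<kappa> * z))"
proof -
  let ?I = "{lo..hi} \<times> {0..n}"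
  let ?E = "\<lambda>q \<omega>. case q of (i, p) \<Rightarrow> z \<le> inc \<omega> i (i + p)"
  have set: "{\<omega>. ?E q \<omega>} \<in> sets P" for q by (cases q) (simp add: inc_set)
  have m: "measure P {\<omega>. ?E q \<omega>} \<le> exp (- (\<kappa> * z))" if "q \<in> ?I" for q
  proof -
    obtain i p where q: "q = (i, p)" by (cases q)
    have "measure P {\<omega>. z \<le> inc \<omega> i (i + p)} \<le> exp (- (\<kappa> * z)) * phi ^ card ({}::int set)"
      by (rule chernoff[of "{i<..i + p}"]) (use kappa_pos in \<open>auto simp: inc_def\<close>)
    then show ?thesis by (simp add: q)
  qed
  have fin: "finite ?I" by simp
  show "{\<omega>. \<exists>q\<in>?I. ?E q \<omega>} \<in> sets P" by (rule union_bound(1)[OF fin set m])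
  have "measure P {\<omega>. \<exists>q\<in>?I. ?E q \<omega>} \<le> real (card ?I) * exp (- (\<kappa> * z))" by (rule union_bound(2)[OF fin set m])
  then show "measure P {\<omega>. \<exists>q\<in>?I. ?E q \<omega>} \<le> real (card {lo..hi}) * real (card {0..n::int}) * exp (- (\<kappa> * z))"
    by (simp add: card_cartesian_product)
qed

lemma phi_power_le: "r \<le> real n \<Longrightarrow> phi ^ n \<le> phi powr r"
proof -
  assume "r \<le> real n"
  have "phi ^ n = phi powr real n" using phi_pos by (simp add: powr_realpow)
  also have "\<dots> \<le> phi powr r" using \<open>r \<le> real n\<close> phi_pos phi_less by (intro powr_mono') auto
  finally show ?thesis .
qed

text \<open>A climb of height \<open>z\<close> preceded by a stretch of length at least
  \<open>r\<close> that falls by at most \<open>y\<close>: weight \<open>\<kappa>\<close> on the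
  climb, \<open>\<kappa> / 2\<close> on the flat stretch.\<close>

lemma bad_flat_left:
  "{\<omega>. \<exists>q\<in>{lo..hi} \<times> {p. 0 \<le> p \<and> p \<le> n \<and> r \<le> real_of_int p} \<times> {0..n}. case q of (x, p, s) \<Rightarrow>
       - y \<le> inc \<omega> (x - p) x \<and> z \<le> inc \<omega> x (x + s)} \<in> sets P"
  "measure P {\<omega>. \<exists>q\<in>{lo..hi} \<times> {p. 0 \<le> p \<and> p \<le> n \<and> r \<le> real_of_int p} \<times> {0..n}. case q of (x, p, s) \<Rightarrow>
       - y \<le> inc \<omega> (x - p) x \<and> z \<le> inc \<omega> x (x + s)}
    \<le> real (card {lo..hi}) * real (card {0..n::int}) ^ 2 * (exp (\<kappa> / 2 * y - \<kappa> * z) * phi powr r)"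
proof -
  let ?Y = "{p. 0 \<le> p \<and> p \<le> n \<and> r \<le> real_of_int p}"
  let ?I = "{lo..hi} \<times> ?Y \<times> {0..n}"
  let ?E = "\<lambda>q \<omega>. case q of (x, p, s) \<Rightarrow> - y \<le> inc \<omega> (x - p) x \<and> z \<le> inc \<omega> x (x + s)"
  have Y: "?Y \<subseteq> {0..n}" by auto
  then have finY: "finite ?Y" by (rule finite_subset) simp
  have set: "{\<omega>. ?E q \<omega>} \<in> sets P" for q
    by (cases q) (auto intro!: sets_P_pred pred_intros_logic)
  have m: "measure P {\<omega>. ?E q \<omega>} \<le> exp (\<kappa> / 2 * y - \<kappa> * z) * phi powr r" if "q \<in> ?I" for q
  proof -
    obtain x p s where q: "q = (x, p, s)" by (cases q)
    have p: "0 \<le> p" "r \<le> real_of_int p" using that q by auto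
    have "measure P {\<omega>. - y \<le> inc \<omega> (x - p) x \<and> z \<le> inc \<omega> x (x + s)} \<le> exp (- (\<kappa> * z - \<kappa> / 2 * y)) * phi ^ card {x - p<..x}"
    proof (rule chernoff[of "{x<..x + s}"])
      show "\<kappa> * z - \<kappa> / 2 * y \<le> \<kappa> * (\<Sum>i\<in>{x<..x + s}. xi (\<omega> i)) + \<kappa> / 2 * (\<Sum>i\<in>{x - p<..x}. xi (\<omega> i))"
        if "- y \<le> inc \<omega> (x - p) x \<and> z \<le> inc \<omega> x (x + s)" for \<omega>
      proof -
        have "\<kappa> * z \<le> \<kappa> * inc \<omega> x (x + s)" using that kappa_pos by (intro mult_left_mono) auto
        moreover have "\<kappa> / 2 * (- y) \<le> \<kappa> / 2 * inc \<omega> (x - p) x" using that kappa_pos by (intro mult_left_mono) auto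
        ultimately show ?thesis unfolding inc_def by linarith
      qed
    qed (auto intro!: pred_intros_logic)
    also have "\<dots> \<le> exp (\<kappa> / 2 * y - \<kappa> * z) * phi powr r"
      using p by (intro mult_mono phi_power_le) (auto simp: phi_nonneg)
    finally show ?thesis by (simp add: q)
  qed
  have fin: "finite ?I" using finY by simp
  show "{\<omega>. \<exists>q\<in>?I. ?E q \<omega>} \<in> sets P" by (rule union_bound(1)[OF fin set m])
  have "measure P {\<omega>. \<exists>q\<in>?I. ?E q \<omega>} \<le> real (card ?I) * (exp (\<kappa> / 2 * y - \<kappa> * z) * phi powr r)" by (rule union_bound(2)[OF fin set m])
  also have "\<dots> \<le> (real (card {lo..hi}) * real (card {0..n::int}) ^ 2) * (exp (\<kappa> / 2 * y - \<kappa> * z) * phi powr r)"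
  proof (rule mult_right_mono)
    have "card ?Y \<le> card {0..n}" using Y by (intro card_mono) auto
    then have "card ?I \<le> card {lo..hi} * (card {0..n} * card {0..n})"
      by (simp only: card_cartesian_product) (intro mult_mono le_refl, auto)
    then have "real (card ?I) \<le> real (card {lo..hi} * (card {0..n} * card {0..n}))" by (rule of_nat_mono)
    then show "real (card ?I) \<le> real (card {lo..hi}) * real (card {0..n::int}) ^ 2" by (simp only: of_nat_mult power2_eq_square)
  qed simp
  finally show "measure P {\<omega>. \<exists>q\<in>?I. ?E q \<omega>} \<le> real (card {lo..hi}) * real (card {0..n::int}) ^ 2 * (exp (\<kappa> / 2 * y - \<kappa> * z) * phi powr r)" .
qed

text \<open>The climb from \<open>x\<close> reaches height \<open>z\<close> although its first
  \<open>p\<close> steps gained at most \<open>y\<close>. Weight \<open>\<kappa>\<close> on the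
  whole climb, lowered to \<open>\<kappa> / 2\<close> on its slow beginning, gives the same bound as
  on the left.\<close>

lemma bad_flat_right:
  "{\<omega>. \<exists>q\<in>{lo..hi} \<times> {p. 0 \<le> p \<and> p \<le> n \<and> r \<le> real_of_int p} \<times> {0..n}. case q of (x, p, s) \<Rightarrow>
       inc \<omega> x (x + p) \<le> y \<and> z \<le> inc \<omega> x (x + p + s)} \<in> sets P"
  "measure P {\<omega>. \<exists>q\<in>{lo..hi} \<times> {p. 0 \<le> p \<and> p \<le> n \<and> r \<le> real_of_int p} \<times> {0..n}. case q of (x, p, s) \<Rightarrow>
       inc \<omega> x (x + p) \<le> y \<and> z \<le> inc \<omega> x (x + p + s)}
    \<le> real (card {lo..hi}) * real (card {0..n::int}) ^ 2 * (exp (\<kappa> / 2 * y - \<kappa> * z) * phi powr r)"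
proof -
  let ?Y = "{p. 0 \<le> p \<and> p \<le> n \<and> r \<le> real_of_int p}"
  let ?I = "{lo..hi} \<times> ?Y \<times> {0..n}"
  let ?E = "\<lambda>q \<omega>. case q of (x, p, s) \<Rightarrow> inc \<omega> x (x + p) \<le> y \<and> z \<le> inc \<omega> x (x + p + s)"
  have Y: "?Y \<subseteq> {0..n}" by auto
  then have finY: "finite ?Y" by (rule finite_subset) simp
  have set: "{\<omega>. ?E q \<omega>} \<in> sets P" for q
    by (cases q) (auto intro!: sets_P_pred pred_intros_logic)
  have m: "measure P {\<omega>. ?E q \<omega>} \<le> exp (\<kappa> / 2 * y - \<kappa> * z) * phi powr r" if "q \<in> ?I" for q
  proof -
    obtain x p s where q: "q = (x, p, s)" by (cases q)
    have p: "0 \<le> p" "r \<le> real_of_int p" "0 \<le> s" using that q by auto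
    have "measure P {\<omega>. inc \<omega> x (x + p) \<le> y \<and> z \<le> inc \<omega> x (x + p + s)} \<le> exp (- (\<kappa> * z - \<kappa> / 2 * y)) * phi ^ card {x<..x + p}"
    proof (rule chernoff[of "{x + p<..x + p + s}"])
      show "\<kappa> * z - \<kappa> / 2 * y \<le> \<kappa> * (\<Sum>i\<in>{x + p<..x + p + s}. xi (\<omega> i)) + \<kappa> / 2 * (\<Sum>i\<in>{x<..x + p}. xi (\<omega> i))"
        if E: "inc \<omega> x (x + p) \<le> y \<and> z \<le> inc \<omega> x (x + p + s)" for \<omega>
      proof -
        have add: "inc \<omega> x (x + p + s) = inc \<omega> x (x + p) + inc \<omega> (x + p) (x + p + s)"
          using p by (intro inc_add[symmetric]) auto
        have "\<kappa> * z \<le> \<kappa> * inc \<omega> x (x + p + s)" using E kappa_pos by (intro mult_left_mono) auto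
        moreover have "\<kappa> / 2 * inc \<omega> x (x + p) \<le> \<kappa> / 2 * y" using E kappa_pos by (intro mult_left_mono) auto
        ultimately have "\<kappa> * z - \<kappa> / 2 * y \<le> \<kappa> * inc \<omega> (x + p) (x + p + s) + \<kappa> / 2 * inc \<omega> x (x + p)"
          unfolding add distrib_left by linarith
        then show ?thesis unfolding inc_def .
      qed
    qed (auto intro!: pred_intros_logic)
    also have "\<dots> \<le> exp (\<kappa> / 2 * y - \<kappa> * z) * phi powr r"
      using p by (intro mult_mono phi_power_le) (auto simp: phi_nonneg)
    finally show ?thesis by (simp add: q)
  qed
  have fin: "finite ?I" using finY by simp
  show "{\<omega>. \<exists>q\<in>?I. ?E q \<omega>} \<in> sets P" by (rule union_bound(1)[OF fin set m])
  have "measure P {\<omega>. \<exists>q\<in>?I. ?E q \<omega>} \<le> real (card ?I) * (exp (\<kappa> / 2 * y - \<kappa> * z) * phi powr r)" by (rule union_bound(2)[OF fin set m])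
  also have "\<dots> \<le> (real (card {lo..hi}) * real (card {0..n::int}) ^ 2) * (exp (\<kappa> / 2 * y - \<kappa> * z) * phi powr r)"
  proof (rule mult_right_mono)
    have "card ?Y \<le> card {0..n}" using Y by (intro card_mono) auto
    then have "card ?I \<le> card {lo..hi} * (card {0..n} * card {0..n})"
      by (simp only: card_cartesian_product) (intro mult_mono le_refl, auto)
    then have "real (card ?I) \<le> real (card {lo..hi} * (card {0..n} * card {0..n}))" by (rule of_nat_mono)
    then show "real (card ?I) \<le> real (card {lo..hi}) * real (card {0..n::int}) ^ 2" by (simp only: of_nat_mult power2_eq_square)
  qed simp
  finally show "measure P {\<omega>. \<exists>q\<in>?I. ?E q \<omega>} \<le> real (card {lo..hi}) * real (card {0..n::int}) ^ 2 * (exp (\<kappa> / 2 * y - \<kappa> * z) * phi powr r)" .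
qed

section \<open>Moment bounds for truncated sums and counts\<close>

lemma markov_P:
  assumes [measurable]: "f \<in> borel_measurable P" and f0: "\<And>\<omega>. 0 \<le> f \<omega>"
    and E: "(\<integral>\<^sup>+\<omega>. ennreal (f \<omega>) \<partial>P) \<le> ennreal e0" and "0 \<le> e0" "0 < x"
  shows "{\<omega>. x \<le> f \<omega>} \<in> sets P" "measure P {\<omega>. x \<le> f \<omega>} \<le> e0 / x"
proof -
  show S: "{\<omega>. x \<le> f \<omega>} \<in> sets P" by (rule sets_P_pred) measurable
  have "ennreal x * emeasure P {\<omega>. x \<le> f \<omega>} = (\<integral>\<^sup>+\<omega>. ennreal x * indicator {\<omega>. x \<le> f \<omega>} \<omega> \<partial>P)"
    using S by (simp add: nn_integral_cmult)
  also have "\<dots> \<le> (\<integral>\<^sup>+\<omega>. ennreal (f \<omega>) \<partial>P)"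
    by (intro nn_integral_mono) (auto simp: indicator_def intro: ennreal_leI)
  finally have "ennreal (x * measure P {\<omega>. x \<le> f \<omega>}) \<le> ennreal e0"
    using E assms by (simp add: P.emeasure_eq_measure ennreal_mult order_trans)
  then show "measure P {\<omega>. x \<le> f \<omega>} \<le> e0 / x" using assms by (simp add: ennreal_le_iff field_simps)
qed

text \<open>Ordering by the starting site gives, for each \<open>m\<close>, the sum treated in
  \<open>truncated_exponential_sum\<close>.\<close>

lemma trunc_sum_swap: "trunc_sum \<omega> z N = (\<Sum>m\<in>{0..N}. \<Sum>j\<le>nat (N - m). if inc \<omega> m (m + int j) < z then exp (inc \<omega> m (m + int j)) else 0)"
proof -
  let ?f = "\<lambda>n m. if V \<omega> n - V \<omega> m < z then exp (V \<omega> n - V \<omega> m) else (0::real)"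
  have "trunc_sum \<omega> z N = (\<Sum>(n, m)\<in>Sigma {0..N} (\<lambda>n. {0..n}). ?f n m)" unfolding trunc_sum_def by (rule sum.Sigma) auto
  also have "\<dots> = (\<Sum>(m, j)\<in>Sigma {0..N} (\<lambda>m. {..nat (N - m)}). ?f (m + int j) m)"
    by (rule sum.reindex_bij_witness[where i = "\<lambda>(m, j). (m + int j, m)" and j = "\<lambda>(n, m). (m, nat (n - m))"]) auto
  also have "\<dots> = (\<Sum>m\<in>{0..N}. \<Sum>j\<le>nat (N - m). ?f (m + int j) m)" by (rule sum.Sigma[symmetric]) auto
  finally show ?thesis by (simp add: V_diff cong: if_cong)
qed

lemma trunc_sum_measurable [measurable]: "(\<lambda>\<omega>. trunc_sum \<omega> z N) \<in> borel_measurable P"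
  unfolding trunc_sum_swap by measurable

lemma trunc_sum_nonneg: "0 \<le> trunc_sum \<omega> z N"
  unfolding trunc_sum_def by (intro sum_nonneg) auto

lemma ennreal_sum_if_exp:
  "ennreal (\<Sum>i\<in>I. if Q i then exp (g i) else 0) = (\<Sum>i\<in>I. if Q i then ennreal (exp (g i)) else 0)"
proof -
  have "(\<Sum>i\<in>I. ennreal (if Q i then exp (g i) else 0)) = ennreal (\<Sum>i\<in>I. if Q i then exp (g i) else 0)"
    by (rule sum_ennreal) auto
  moreover have "(\<Sum>i\<in>I. ennreal (if Q i then exp (g i) else 0)) = (\<Sum>i\<in>I. if Q i then ennreal (exp (g i)) else 0)"
    by (intro sum.cong) auto
  ultimately show ?thesis by simp
qed

lemma bad_trunc_sum:
  assumes "0 < x" "0 \<le> N"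
  shows "{\<omega>. x \<le> trunc_sum \<omega> z N} \<in> sets P" "measure P {\<omega>. x \<le> trunc_sum \<omega> z N} \<le> (real_of_int N + 1) * C3 * exp ((1 - \<kappa>) * z) / x"
proof -
  have "(\<integral>\<^sup>+\<omega>. ennreal (trunc_sum \<omega> z N) \<partial>P) = (\<Sum>m\<in>{0..N}. \<Sum>j\<le>nat (N - m). \<integral>\<^sup>+\<omega>. (if inc \<omega> m (m + int j) < z then ennreal (exp (inc \<omega> m (m + int j))) else 0) \<partial>P)"
  proof -
    have "ennreal (trunc_sum \<omega> z N) = (\<Sum>m\<in>{0..N}. \<Sum>j\<le>nat (N - m). (if inc \<omega> m (m + int j) < z then ennreal (exp (inc \<omega> m (m + int j))) else 0))" for \<omega>
    proof -
      have "ennreal (trunc_sum \<omega> z N) = (\<Sum>m\<in>{0..N}. ennreal (\<Sum>j\<le>nat (N - m). if inc \<omega> m (m + int j) < z then exp (inc \<omega> m (m + int j)) else 0))"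
        unfolding trunc_sum_swap by (intro sum_ennreal[symmetric] sum_nonneg) auto
      then show ?thesis by (simp only: ennreal_sum_if_exp)
    qed
    then show ?thesis by (simp add: nn_integral_sum)
  qed
  also have "\<dots> \<le> (\<Sum>m\<in>{0..N}. ennreal (C3 * exp ((1 - \<kappa>) * z)))"
    by (intro sum_mono truncated_exponential_sum)
  also have "\<dots> = ennreal ((real_of_int N + 1) * C3 * exp ((1 - \<kappa>) * z))"
  proof -
    have "(\<Sum>m\<in>{0..N}. ennreal (C3 * exp ((1 - \<kappa>) * z))) = ennreal (\<Sum>m\<in>{0..N}. C3 * exp ((1 - \<kappa>) * z))"
      using C3_pos by (intro sum_ennreal) auto
    also have "(\<Sum>m\<in>{0..N}. C3 * exp ((1 - \<kappa>) * z)) = (real_of_int N + 1) * C3 * exp ((1 - \<kappa>) * z)"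
      using assms by (simp add: algebra_simps)
    finally show ?thesis .
  qed
  finally have E: "(\<integral>\<^sup>+\<omega>. ennreal (trunc_sum \<omega> z N) \<partial>P) \<le> ennreal ((real_of_int N + 1) * C3 * exp ((1 - \<kappa>) * z))" .
  show "{\<omega>. x \<le> trunc_sum \<omega> z N} \<in> sets P" "measure P {\<omega>. x \<le> trunc_sum \<omega> z N} \<le> (real_of_int N + 1) * C3 * exp ((1 - \<kappa>) * z) / x"
    using C3_pos assms by (intro markov_P[OF trunc_sum_measurable trunc_sum_nonneg E]; simp)+
qed

lemma bad_rise_count:
  assumes "0 < x" "0 \<le> N"
  shows "{\<omega>. x \<le> rise_count \<omega> y N n} \<in> sets P" "measure P {\<omega>. x \<le> rise_count \<omega> y N n} \<le> (real_of_int N + 1) * exp (- (\<kappa> * y)) / x"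
proof -
  have m: "(\<lambda>\<omega>. rise_count \<omega> y N n) \<in> borel_measurable P" unfolding rise_count_def by measurable
  have "(\<integral>\<^sup>+\<omega>. ennreal (rise_count \<omega> y N n) \<partial>P) = (\<integral>\<^sup>+\<omega>. (\<Sum>x\<in>{0..N}. indicator {\<omega>. \<exists>j\<le>n. y \<le> inc \<omega> x (x + int j)} \<omega>) \<partial>P)"
  proof (rule nn_integral_cong)
    fix \<omega>
    have "ennreal (rise_count \<omega> y N n) = (\<Sum>x\<in>{0..N}. ennreal (if \<exists>j\<le>n. y \<le> inc \<omega> x (x + int j) then 1 else 0))"
      unfolding rise_count_def by (intro sum_ennreal[symmetric]) auto
    also have "\<dots> = (\<Sum>x\<in>{0..N}. indicator {\<omega>. \<exists>j\<le>n. y \<le> inc \<omega> x (x + int j)} \<omega>)"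
      by (intro sum.cong refl) (simp add: indicator_def)
    finally show "ennreal (rise_count \<omega> y N n) = (\<Sum>x\<in>{0..N}. indicator {\<omega>. \<exists>j\<le>n. y \<le> inc \<omega> x (x + int j)} \<omega>)" .
  qed
  also have "\<dots> = (\<Sum>x\<in>{0..N}. emeasure P {\<omega>. \<exists>j\<le>n. y \<le> inc \<omega> x (x + int j)})"
  proof -
    have s: "{\<omega>. \<exists>j\<le>n. y \<le> inc \<omega> x (x + int j)} \<in> sets P" for x by (rule sets_P_pred) measurable
    then show ?thesis by (subst nn_integral_sum) auto
  qed
  also have "\<dots> \<le> (\<Sum>x\<in>{0..N}. ennreal (exp (- (\<kappa> * y))))"
    by (intro sum_mono) (simp add: P.emeasure_eq_measure maximal_inequality ennreal_leI)
  also have "\<dots> = ennreal ((real_of_int N + 1) * exp (- (\<kappa> * y)))"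
  proof -
    have "(\<Sum>x\<in>{0..N}. ennreal (exp (- (\<kappa> * y)))) = ennreal (\<Sum>x\<in>{0..N}. exp (- (\<kappa> * y)))" by (intro sum_ennreal) auto
    also have "(\<Sum>x\<in>{0..N}. exp (- (\<kappa> * y))) = (real_of_int N + 1) * exp (- (\<kappa> * y))" using assms by simp
    finally show ?thesis .
  qed
  finally have E: "(\<integral>\<^sup>+\<omega>. ennreal (rise_count \<omega> y N n) \<partial>P) \<le> ennreal ((real_of_int N + 1) * exp (- (\<kappa> * y)))" .
  have nn: "0 \<le> rise_count \<omega> y N n" for \<omega> unfolding rise_count_def by (intro sum_nonneg) auto
  show "{\<omega>. x \<le> rise_count \<omega> y N n} \<in> sets P" "measure P {\<omega>. x \<le> rise_count \<omega> y N n} \<le> (real_of_int N + 1) * exp (- (\<kappa> * y)) / x"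
    using assms by (intro markov_P[OF m nn E]; simp)+
qed

text \<open>Fractional moments: a sum of exponentials is large only if one term beats the geometric profile \<open>phi powr (k / \<kappa>)\<close>.\<close>

lemma bad_exp_sum:
  assumes X: "0 < X" and S: "\<And>k \<omega>. k < n \<Longrightarrow> f k \<omega> = inc \<omega> (s k) (s k + int k)"
  shows "{\<omega>. X \<le> (\<Sum>k<n. exp (f k \<omega>))} \<in> sets P"
    "measure P {\<omega>. X \<le> (\<Sum>k<n. exp (f k \<omega>))} \<le> X powr (- (\<kappa> / 2)) * ((1 / (1 - phi powr (1 / \<kappa>))) powr (\<kappa> / 2) / (1 - sqrt phi))"
proof -
  have fm: "(\<lambda>\<omega>. \<Sum>k<n. exp (f k \<omega>)) = (\<lambda>\<omega>. \<Sum>k<n. exp (inc \<omega> (s k) (s k + int k)))"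
    using S by (intro ext sum.cong) auto
  have [measurable]: "(\<lambda>\<omega>. \<Sum>k<n. exp (f k \<omega>)) \<in> borel_measurable P" unfolding fm by measurable
  show set: "{\<omega>. X \<le> (\<Sum>k<n. exp (f k \<omega>))} \<in> sets P" by (rule sets_P_pred) measurable
  \<comment> \<open>With this ratio the union bound at step \<open>k\<close> is
    \<open>(1 / sqrt phi) ^ k * phi ^ k\<close>, so its terms decay like
    \<open>sqrt phi ^ k\<close>.\<close>
  define r where "r = phi powr (1 / \<kappa>)"
  have r: "0 < r" "r < 1"
    unfolding r_def using phi_pos phi_less kappa_pos powr_less_mono2[of "1 / \<kappa>" phi 1] by auto
  define Y where "Y = X * (1 - r)"
  have Y: "0 < Y" using X r by (simp add: Y_def)
  let ?E = "\<lambda>k \<omega>. ln (Y * r ^ k) \<le> inc \<omega> (s k) (s k + int k)"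
  have sub: "{\<omega>. X \<le> (\<Sum>k<n. exp (f k \<omega>))} \<subseteq> (\<Union>k\<in>{..<n}. {\<omega>. ?E k \<omega>})"
  proof
    fix \<omega> assume w: "\<omega> \<in> {\<omega>. X \<le> (\<Sum>k<n. exp (f k \<omega>))}"
    show "\<omega> \<in> (\<Union>k\<in>{..<n}. {\<omega>. ?E k \<omega>})"
    proof (rule ccontr)
      assume neg: "\<omega> \<notin> (\<Union>k\<in>{..<n}. {\<omega>. ?E k \<omega>})"
      have lt: "exp (f k \<omega>) < Y * r ^ k" if "k < n" for k
      proof -
        have "\<not> ?E k \<omega>" using neg that by auto
        then have "f k \<omega> < ln (Y * r ^ k)" using S[OF that] by (simp add: not_le)
        then have "exp (f k \<omega>) < exp (ln (Y * r ^ k))" by simp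
        then show ?thesis using Y r by simp
      qed
      have n0: "n \<noteq> 0"
      proof
        assume "n = 0"
        with w X show False by simp
      qed
      have "(\<Sum>k<n. exp (f k \<omega>)) < (\<Sum>k<n. Y * r ^ k)" using lt n0 by (intro sum_strict_mono) auto
      also have "\<dots> = Y * (\<Sum>k<n. r ^ id k)" by (simp add: sum_distrib_left)
      also have "\<dots> \<le> Y * (1 / (1 - r))" using Y r by (intro mult_left_mono geometric_sum_inj_le) auto
      also have "\<dots> = X" using r by (simp add: Y_def)
      finally show False using w by simp
    qed
  qed
  have one: "measure P {\<omega>. ?E k \<omega>} \<le> Y powr (- (\<kappa> / 2)) * sqrt phi ^ k" for k
  proof -
    have "measure P {\<omega>. ?E k \<omega>} \<le> exp (- (\<kappa> / 2 * ln (Y * r ^ k))) * phi ^ k" by (rule measure_inc_ge)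
    also have "exp (- (\<kappa> / 2 * ln (Y * r ^ k))) = Y powr (- (\<kappa> / 2)) * (r powr (- (\<kappa> / 2))) ^ k"
      using Y r by (simp add: powr_def ln_mult ln_realpow exp_of_nat_mult[symmetric] exp_add[symmetric] algebra_simps)
    also have "r powr (- (\<kappa> / 2)) = 1 / sqrt phi"
      unfolding r_def powr_powr using kappa_pos phi_pos by (simp add: powr_minus powr_half_sqrt[symmetric] inverse_eq_divide)
    also have "Y powr (- (\<kappa> / 2)) * (1 / sqrt phi) ^ k * phi ^ k = Y powr (- (\<kappa> / 2)) * sqrt phi ^ k"
    proof -
      have "(1 / sqrt phi) ^ k * phi ^ k = (1 / sqrt phi * phi) ^ k" by (simp add: power_mult_distrib[symmetric])
      also have "1 / sqrt phi * phi = sqrt phi" using phi_pos by (simp add: real_div_sqrt)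
      finally show ?thesis by simp
    qed
    finally show ?thesis .
  qed
  have "measure P {\<omega>. X \<le> (\<Sum>k<n. exp (f k \<omega>))} \<le> measure P (\<Union>k\<in>{..<n}. {\<omega>. ?E k \<omega>})"
    by (intro P.finite_measure_mono sub sets.finite_UN inc_set) auto
  also have "\<dots> \<le> (\<Sum>k<n. measure P {\<omega>. ?E k \<omega>})" by (intro measure_UNION_le inc_set) auto
  also have "\<dots> \<le> (\<Sum>k<n. Y powr (- (\<kappa> / 2)) * sqrt phi ^ id k)" using one by (intro sum_mono) auto
  also have "\<dots> = Y powr (- (\<kappa> / 2)) * (\<Sum>k<n. sqrt phi ^ id k)" by (simp add: sum_distrib_left)
  also have "\<dots> \<le> Y powr (- (\<kappa> / 2)) * (1 / (1 - sqrt phi))"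
    using phi_pos phi_less by (intro mult_left_mono geometric_sum_inj_le) auto
  also have "Y powr (- (\<kappa> / 2)) = X powr (- (\<kappa> / 2)) * (1 / (1 - r)) powr (\<kappa> / 2)"
  proof -
    define q where "q = 1 - r"
    have q: "0 < q" using r by (simp add: q_def)
    have "Y powr (- (\<kappa> / 2)) = X powr (- (\<kappa> / 2)) * q powr (- (\<kappa> / 2))" using X q by (simp add: Y_def q_def[symmetric] powr_mult)
    also have "q powr (- (\<kappa> / 2)) = (1 / q) powr (\<kappa> / 2)" using q by (simp add: powr_minus powr_divide inverse_eq_divide)
    finally show ?thesis by (simp add: q_def)
  qed
  finally show "measure P {\<omega>. X \<le> (\<Sum>k<n. exp (f k \<omega>))} \<le> X powr (- (\<kappa> / 2)) * ((1 / (1 - phi powr (1 / \<kappa>))) powr (\<kappa> / 2) / (1 - sqrt phi))"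
    by (simp add: r_def)
qed

end

lemma rise_count_card: "rise_count \<omega> y N n = real (card {x \<in> {0..N}. \<exists>j\<le>n. y \<le> inc \<omega> x (x + int j)})"
proof -
  have "{0..N} \<inter> {x. \<exists>j\<le>n. y \<le> inc \<omega> x (x + int j)} = {x \<in> {0..N}. \<exists>j\<le>n. y \<le> inc \<omega> x (x + int j)}" by blast
  then show ?thesis unfolding rise_count_def by (simp add: sum.If_cases)
qed

text \<open>Distinct deep bottoms are distinct sites from which the potential climbs by
  \<open>y\<close> within \<open>L\<close> steps.\<close>

lemma (in good_env) count_bottoms:
  assumes I: "\<And>k. k \<in> I \<Longrightarrow> 1 \<le> k \<and> b \<omega> t k \<le> N1 \<and> y \<le> H \<omega> (sig \<omega> t (k - 1))" and N1: "N1 \<le> N"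
  shows "real (card I) \<le> rise_count \<omega> y N1 (nat L)"
proof -
  let ?X = "{x \<in> {0..N1}. \<exists>j\<le>nat L. y \<le> inc \<omega> x (x + int j)}"
  have fin: "finite ?X" by (rule finite_subset[of _ "{0..N1}"]) auto
  have "b \<omega> t ` I \<subseteq> ?X"
  proof
    fix x assume "x \<in> b \<omega> t ` I"
    then obtain k where k: "k \<in> I" "x = b \<omega> t k" by blast
    have k1: "1 \<le> k" "b \<omega> t k \<le> N + 2 * L" using I[OF k(1)] N1 L1 by auto
    have c: "cpk k \<le> b \<omega> t k + L" using peak[OF k1(1)] dbar_le[OF k1] by linarith
    have "y \<le> inc \<omega> (b \<omega> t k) (b \<omega> t k + int (nat (cpk k - b \<omega> t k)))"
      using peak[OF k1(1)] I[OF k(1)] V_diff[of "b \<omega> t k" "cpk k" \<omega>] by simp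
    moreover have "nat (cpk k - b \<omega> t k) \<le> nat L" using c by simp
    ultimately show "x \<in> ?X" using k I[OF k(1)] b_nonneg[of t k] by auto
  qed
  moreover have "inj_on (b \<omega> t) I"
  proof (rule inj_onI)
    fix i j assume "i \<in> I" "j \<in> I" "b \<omega> t i = b \<omega> t j"
    then show "i = j" using b_mono[of i j t] b_mono[of j i t] I by (metis less_irrefl linorder_neqE_nat)
  qed
  ultimately have "card I \<le> card ?X" using fin card_inj_on_le[of "b \<omega> t" I ?X] by simp
  then show ?thesis by (simp add: rise_count_card)
qed

text \<open>\<open>errv\<close> with \<open>u\<close> inserted and the valley length replaced by a
  real bound \<open>l\<close>, so that it is an explicit function of \<open>t\<close>.\<close>

definition errf :: "real \<Rightarrow> real \<Rightarrow> real \<Rightarrow> real" where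
  "errf \<kappa> l t = l * exp ((1 + \<kappa> / 2) * ln t - D \<kappa> t) + 2 * l\<^sup>2 * exp (3 / 4 * ln t - h t) * (2 + t * exp (- h t))
       + t * exp (- 2 * h t) * (2 * l\<^sup>2 * exp (3 / 4 * ln t) + 2 + l)"

definition errlf :: "real \<Rightarrow> real \<Rightarrow> real \<Rightarrow> real \<Rightarrow> real" where
  "errlf \<kappa> l c1 t = l * exp ((1 + \<kappa> / 2) * ln t - D \<kappa> t) + l * (2 * l * exp (3 / 4 * ln t - h t) + 2 * exp (- c1))"

text \<open>The deterministic core: off sixteen bad events both estimates hold. \<open>RB\<close>
  provides the last valley, with mean at least \<open>2 * B' * t\<close>, and \<open>RE\<close> an
  early one within \<open>Ne\<close>, with mean at least \<open>2 * et * t\<close>;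
  \<open>\<theta>\<close> separates the at most \<open>m\<close> large valleys from small ones of
  negligible total weight.\<close>

theorem good_conclusion:
  fixes \<omega> :: "int \<Rightarrow> real" and \<kappa> t :: real and L N Ne :: int
  assumes s: "sellip \<omega>" and descend: "\<And>x. \<exists>y>x. inc \<omega> x y \<le> 0"
    and rises: "\<And>x (y::nat). \<exists>m\<ge>x. \<exists>n>m. real y \<le> inc \<omega> m n"
    and kappa: "0 < \<kappa>" "\<kappa> < 1" and L1: "1 \<le> L" and Ne: "0 \<le> Ne" "Ne \<le> N"
    and t: "1 \<le> t" "0 < ln t" "3 / 4 * ln t \<le> h t" "ln 2 \<le> h t"
    and pars: "0 < B'" "0 < et" "et \<le> B'" "0 < \<theta>" "h t \<le> ln (et * t)" "3 / 4 * ln t < ln (\<theta> * t)"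
    and nB1: "\<not> (\<exists>x\<in>{- L..N + 4 * L}. - (3 * ln t) \<le> inc \<omega> x (x + L))"
    and nB2: "\<not> (\<exists>q\<in>{- L..N} \<times> {0..5 * L} \<times> {0..5 * L} \<times> {0..5 * L}. case q of (i, p, r, s) \<Rightarrow>
       3 / 4 * ln t \<le> inc \<omega> i (i + p) \<and> 3 / 4 * ln t \<le> inc \<omega> (i + p + r) (i + p + r + s))"
    and nB4: "\<not> (\<exists>q\<in>{0..N} \<times> {0..2 * L}. case q of (i, p) \<Rightarrow> (1 + \<kappa> / 2) * ln t \<le> inc \<omega> i (i + p))"
    and nB6: "\<not> (\<exists>q\<in>{0..L} \<times> {0..L}. case q of (i, p) \<Rightarrow> h t \<le> inc \<omega> i (i + p))"
    and nFL: "\<not> (\<exists>q\<in>{0..N} \<times> {p. 0 \<le> p \<and> p \<le> L + 1 \<and> R - 1 \<le> real_of_int p} \<times> {0..L + 1}. case q of (x, p, s) \<Rightarrow>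
       - c1 \<le> inc \<omega> (x - p) x \<and> h t \<le> inc \<omega> x (x + s))"
    and nFR: "\<not> (\<exists>q\<in>{0..N} \<times> {p. 0 \<le> p \<and> p \<le> L + 1 \<and> R - 1 \<le> real_of_int p} \<times> {0..L + 1}. case q of (x, p, s) \<Rightarrow>
       inc \<omega> x (x + p) \<le> c1 \<and> h t \<le> inc \<omega> x (x + p + s))"
    and RB: "\<exists>k<nat (N - L). rise \<omega> (0 + int k) (ln (B' * t)) (nat L)"
    and RE: "\<exists>k<nat (Ne - L). rise \<omega> (0 + int k) (ln (et * t)) (nat L)"
    and nCE: "\<not> 1 \<le> rise_count \<omega> (ln t) Ne (nat L)" and nTE: "\<not> \<epsilon>0 * t \<le> trunc_sum \<omega> (ln t) (Ne + 2 * L)"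
    and nTT: "\<not> \<epsilon>0 * et * t \<le> trunc_sum \<omega> (ln (\<theta> * t)) (N + 2 * L)" and nCT: "\<not> m \<le> rise_count \<omega> (ln (\<theta> * t)) N (nat L)"
    and nTH: "\<not> g / 4 \<le> trunc_sum \<omega> (h t) N"
    and nY: "\<not> sqrt g / 2 \<le> (\<Sum>k<nat (N + 1). exp (inc \<omega> 0 (0 + int k)))"
    and nLam: "\<not> sqrt g / 2 \<le> (\<Sum>k<Suc (Suc (steps t)). exp (inc \<omega> (- int k) (- int k + int k)))"
    and nCH: "\<not> (ln t)\<^sup>2 \<le> rise_count \<omega> (h t) N (nat L)"
    and eps: "0 < \<epsilon>" "\<epsilon> \<le> 1 / 2" "2 \<le> \<epsilon> * t" "0 < g" "g \<le> \<epsilon> * t / 2"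
    and l: "real_of_int (3 * L + 1) \<le> l"
    and zeta: "1 / (2 * B') + 4 * \<epsilon>0 + (m + 1) * \<epsilon> / (2 * et) + \<epsilon>0 + 2 * (ln t) ^ 4 * (errf \<kappa> l t + exp (- h t)) + 2 * g / (\<epsilon> * t) \<le> \<zeta>"
    and e0: "0 < \<epsilon>0"
  shows "dTV (law_ell \<omega> t) (law_ellE \<omega> \<kappa> t) \<le> \<zeta>"
    and "1 - \<zeta> - (ln t)\<^sup>2 * errlf \<kappa> l c1 t \<le> measure_pmf.prob (walk \<omega> (steps t)) {p. \<bar>real_of_int (p ! steps t - b \<omega> t (ell \<omega> t p))\<bar> \<le> R}"
proof -
  let ?u = "3 / 4 * ln t"
  interpret good_env \<omega> \<kappa> t L N ?u
  proof
    show "\<exists>y>x. V \<omega> y \<le> V \<omega> x" for x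
    proof -
      obtain y where "y > x" "inc \<omega> x y \<le> 0" using descend by blast
      then show ?thesis using V_diff[of x y \<omega>] by (intro exI[of _ y]) auto
    qed
    show "\<exists>m\<ge>x. \<exists>n>m. real y \<le> V \<omega> n - V \<omega> m" for x y
    proof -
      obtain m n where "m \<ge> x" "n > m" "real y \<le> inc \<omega> m n" using rises by blast
      then show ?thesis using V_diff[of m n \<omega>] by (intro exI[of _ m] conjI exI[of _ n]) auto
    qed
    show "V \<omega> (x + L) \<le> V \<omega> x - 3 * ln t" if "- L \<le> x" "x \<le> N + 4 * L" for x
    proof -
      have "\<not> - (3 * ln t) \<le> inc \<omega> x (x + L)" using nB1 that by auto
      then show ?thesis using V_diff[of x "x + L" \<omega>] L1 by simp
    qed
    show False if "- L \<le> i" "i \<le> N" "i \<le> j" "j \<le> k" "k \<le> q" "q \<le> i + 5 * L" "?u \<le> V \<omega> j - V \<omega> i" "?u \<le> V \<omega> q - V \<omega> k" for i j k q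
    proof -
      have "(i, j - i, k - j, q - k) \<in> {- L..N} \<times> {0..5 * L} \<times> {0..5 * L} \<times> {0..5 * L}" using that by auto
      with nB2 have "\<not> (?u \<le> inc \<omega> i (i + (j - i)) \<and> ?u \<le> inc \<omega> (i + (j - i) + (k - j)) (i + (j - i) + (k - j) + (q - k)))" by fastforce
      then show False using that V_diff[of i j \<omega>] V_diff[of k q \<omega>] by simp
    qed
    show "V \<omega> j - V \<omega> i \<le> (1 + \<kappa> / 2) * ln t" if "0 \<le> i" "i \<le> N" "i \<le> j" "j \<le> i + 2 * L" for i j
    proof -
      have "(i, j - i) \<in> {0..N} \<times> {0..2 * L}" using that by auto
      with nB4 have "\<not> (1 + \<kappa> / 2) * ln t \<le> inc \<omega> i (i + (j - i))" by fastforce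
      then show ?thesis using that V_diff[of i j \<omega>] by simp
    qed
    show "V \<omega> j - V \<omega> i < h t" if "0 \<le> i" "i \<le> L" "i \<le> j" "j \<le> i + L" for i j
    proof -
      have "(i, j - i) \<in> {0..L} \<times> {0..L}" using that by auto
      with nB6 have "\<not> h t \<le> inc \<omega> i (i + (j - i))" by fastforce
      then show ?thesis using that V_diff[of i j \<omega>] by simp
    qed
  qed (use s kappa L1 Ne t in \<open>simp_all\<close>)
  have t0: "0 < t" using t by simp
  have rise_bottom: "\<exists>k. 1 \<le> k \<and> b \<omega> t k \<le> N1 \<and> ln (x * t) \<le> H \<omega> (sig \<omega> t (k - 1))"
    if R: "\<exists>k<nat (N1 - L). rise \<omega> (0 + int k) (ln (x * t)) (nat L)" and N1: "N1 \<le> N" and hx: "h t \<le> ln (x * t)" for x N1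
  proof -
    obtain k j where k: "k < nat (N1 - L)" "1 \<le> j" "j \<le> nat L" "ln (x * t) \<le> inc \<omega> (int k) (int k + int j)"
      using R by (auto simp: rise_def)
    have "ln (x * t) \<le> v (int k + int j) - v (int k)" using k V_diff[of "int k" "int k + int j" \<omega>] by simp
    moreover have "int k + int j \<le> N1" using k L1 by linarith
    ultimately obtain kk where "1 \<le> kk" "b \<omega> t kk \<le> int k + int j" "ln (x * t) \<le> H \<omega> (sig \<omega> t (kk - 1))"
      using bottom_of_rise[of "int k" "int k + int j" "ln (x * t)"] hx N1 by auto
    then show ?thesis using \<open>int k + int j \<le> N1\<close> by (intro exI[of _ kk]) auto
  qed
  have hB: "h t \<le> ln (B' * t)"
  proof -
    have "ln (et * t) \<le> ln (B' * t)" using pars t0 by (subst ln_le_cancel_iff) auto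
    then show ?thesis using pars by linarith
  qed
  obtain K where K: "1 \<le> K" "b \<omega> t K \<le> N" "ln (B' * t) \<le> H \<omega> (sig \<omega> t (K - 1))"
    using rise_bottom[OF RB order_refl hB] by blast
  obtain k1 where k1: "1 \<le> k1" "b \<omega> t k1 \<le> Ne" "ln (et * t) \<le> H \<omega> (sig \<omega> t (k1 - 1))"
    using rise_bottom[OF RE Ne(2) pars(5)] by blast
  \<comment> \<open>The minimum ensures \<open>k0 \<le> K\<close>; if \<open>K\<close> comes first,
    it is deep enough itself because \<open>et \<le> B'\<close>.\<close>
  define k0 where "k0 = min k1 K"
  have k0: "1 \<le> k0" "k0 \<le> K" using k1 K by (auto simp: k0_def)
  have k0b: "b \<omega> t k0 \<le> Ne"
  proof (cases "k1 \<le> K")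
    case False
    then show ?thesis using b_mono[of K k1 t] K k1 by (simp add: k0_def)
  qed (use k1 in \<open>simp add: k0_def\<close>)
  have k0H: "ln (et * t) \<le> H \<omega> (sig \<omega> t (k0 - 1))"
  proof (cases "k1 \<le> K")
    case False
    have "ln (et * t) \<le> ln (B' * t)" using pars t0 by (subst ln_le_cancel_iff) auto
    then show ?thesis using False K by (simp add: k0_def min_def)
  qed (use k1 in \<open>simp add: k0_def\<close>)
  have bk: "b \<omega> t k \<le> N" if "k \<in> {1..K}" for k
    using b_mono[of k K t] that K by (cases "k = K") auto
  have Wlow: "2 * (x * t) \<le> W \<omega> \<kappa> t k" if "k \<in> {1..K}" "ln (x * t) \<le> H \<omega> (sig \<omega> t (k - 1))" "0 < x" for x k
  proof -
    have "x * t = exp (ln (x * t))" using that t0 by simp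
    also have "\<dots> \<le> exp (H \<omega> (sig \<omega> t (k - 1)))" using that by simp
    finally show ?thesis using W_ge[of k] bk[OF that(1)] that by simp
  qed
  have K2: "real K \<le> (ln t)\<^sup>2"
  proof -
    have "real (card {1..K}) \<le> rise_count \<omega> (h t) N (nat L)"
      by (rule count_bottoms) (use bk deep in auto)
    then show ?thesis using nCH by simp
  qed
  have early: "(\<Sum>k\<in>{1..<k0}. W \<omega> \<kappa> t k) \<le> 2 * \<epsilon>0 * t"
  proof -
    have be: "b \<omega> t k \<le> Ne" if "k \<in> {1..<k0}" for k using b_mono[of k k0 t] that k0b by auto
    have He: "H \<omega> (sig \<omega> t (k - 1)) < ln t" if k: "k \<in> {1..<k0}" for k
    proof (rule ccontr)
      assume "\<not> H \<omega> (sig \<omega> t (k - 1)) < ln t"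
      then have "real (card {k}) \<le> rise_count \<omega> (ln t) Ne (nat L)"
        using k be[OF k] Ne by (intro count_bottoms) auto
      then show False using nCE by simp
    qed
    have "(\<Sum>k\<in>{1..<k0}. W \<omega> \<kappa> t k) \<le> 2 * trunc_sum \<omega> (ln t) (Ne + 2 * L)"
    proof (rule sum_W_le)
      fix k assume k: "k \<in> {1..<k0}"
      show "b \<omega> t k \<le> N" "b \<omega> t k + 2 * L \<le> Ne + 2 * L" using be[OF k] Ne by auto
    qed (use He t in auto)
    then show ?thesis using nTE by simp
  qed
  define Lg where "Lg = {k \<in> {1..K}. ln (\<theta> * t) \<le> H \<omega> (sig \<omega> t (k - 1))}"
  have Lgc: "real (card Lg) \<le> m"
  proof -
    have "real (card Lg) \<le> rise_count \<omega> (ln (\<theta> * t)) N (nat L)"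
      by (rule count_bottoms) (use bk in \<open>auto simp: Lg_def\<close>)
    then show ?thesis using nCT by simp
  qed
  have small: "(\<Sum>k\<in>{1..K} - Lg. W \<omega> \<kappa> t k) \<le> 2 * (\<epsilon>0 * et * t)"
  proof -
    have "(\<Sum>k\<in>{1..K} - Lg. W \<omega> \<kappa> t k) \<le> 2 * trunc_sum \<omega> (ln (\<theta> * t)) (N + 2 * L)"
      using pars bk by (intro sum_W_le) (auto simp: Lg_def)
    then show ?thesis using nTT by simp
  qed
  have m0: "0 \<le> m" using Lgc by (rule order_trans[rotated]) simp
  have gap: "2 * trunc_sum \<omega> (h t) N + 2 * (\<Sum>x\<in>{0..N}. exp (v x)) * Lam (int (Suc (steps t))) \<le> g"
  proof -
    have Y: "(\<Sum>x\<in>{0..N}. exp (v x)) \<le> sqrt g / 2"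
    proof -
      have "(\<Sum>x\<in>{0..N}. exp (v x)) = (\<Sum>k<nat (N + 1). exp (inc \<omega> 0 (0 + int k)))"
        by (rule sum.reindex_bij_witness[where i = int and j = nat]) (auto simp: V_inc)
      then show ?thesis using nY by simp
    qed
    have La: "Lam (int (Suc (steps t))) \<le> sqrt g / 2"
    proof -
      have "Lam (int (Suc (steps t))) = (\<Sum>k\<in>{1..Suc (steps t)}. exp (inc \<omega> (- int k) (- int k + int k)))"
        unfolding Lam_def
        by (rule sum.reindex_bij_witness[where i = "\<lambda>k. - int k" and j = "\<lambda>m. nat (- m)"]) (auto simp: V_inc)
      also have "\<dots> \<le> (\<Sum>k<Suc (Suc (steps t)). exp (inc \<omega> (- int k) (- int k + int k)))"
        by (rule sum_mono2) auto
      finally show ?thesis using nLam by simp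
    qed
    \<comment> \<open>Each side of the origin is allotted \<open>sqrt g / 2\<close>, so the product
      fits into a quarter of \<open>g\<close>.\<close>
    have "(\<Sum>x\<in>{0..N}. exp (v x)) * Lam (int (Suc (steps t))) \<le> (sqrt g / 2) * (sqrt g / 2)"
      using eps by (intro mult_mono Y La) (auto simp: Lam_def intro!: sum_nonneg)
    also have "\<dots> = g / 4" using eps by simp
    finally show ?thesis using nTH by simp
  qed
  have l1: "1 \<le> l" using l L1 by linarith
  have L'0: "0 \<le> real_of_int (3 * L + 1)" using L1 by simp
  have errv: "errv \<le> errf \<kappa> l t"
    unfolding errv_def errf_def Let_def
    using l L'0 t0 by (intro add_mono mult_mono power_mono order_refl) (auto intro!: add_nonneg_nonneg mult_nonneg_nonneg)
  have errl: "errl c1 \<le> errlf \<kappa> l c1 t"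
    unfolding errl_def errlf_def Let_def
    using l L'0 t0 by (intro add_mono mult_mono power_mono order_refl) (auto intro!: add_nonneg_nonneg mult_nonneg_nonneg)
  have errv0: "0 \<le> errf \<kappa> l t" "0 \<le> errlf \<kappa> l c1 t" unfolding errf_def errlf_def using l1 t0
    by (auto intro!: add_nonneg_nonneg mult_nonneg_nonneg)
  have gle: "g \<le> \<epsilon> * t - 1" using eps by linarith
  have z: "t / (2 * (B' * t)) + (2 * \<epsilon>0 * t) / ((1 - \<epsilon>) * t) + ((m + 1) * (\<epsilon> * t) + 2 * (\<epsilon>0 * et * t)) / (2 * (et * t))
      + 2 * (real K)\<^sup>2 * (errv + exp (- h t)) + g / (\<epsilon> * t - 1) \<le> \<zeta>"
  proof -
    have 1: "t / (2 * (B' * t)) = 1 / (2 * B')" using t0 pars by (simp add: field_simps)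
    have 2: "(2 * \<epsilon>0 * t) / ((1 - \<epsilon>) * t) \<le> 4 * \<epsilon>0"
    proof -
      have "(2 * \<epsilon>0 * t) / ((1 - \<epsilon>) * t) = 2 * \<epsilon>0 / (1 - \<epsilon>)" using t0 by simp
      also have "\<dots> \<le> 2 * \<epsilon>0 / (1 / 2)" using eps e0 by (intro divide_left_mono) auto
      finally show ?thesis by simp
    qed
    have 3: "((m + 1) * (\<epsilon> * t) + 2 * (\<epsilon>0 * et * t)) / (2 * (et * t)) = (m + 1) * \<epsilon> / (2 * et) + \<epsilon>0"
      using t0 pars by (simp add: field_simps)
    have 4: "2 * (real K)\<^sup>2 * (errv + exp (- h t)) \<le> 2 * (ln t) ^ 4 * (errf \<kappa> l t + exp (- h t))"
    proof -
      have "(real K)\<^sup>2 \<le> ((ln t)\<^sup>2)\<^sup>2" using K2 by (intro power_mono) auto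
      also have "\<dots> = (ln t) ^ 4" by (simp add: power_mult[symmetric])
      finally have K4: "(real K)\<^sup>2 \<le> (ln t) ^ 4" .
      have "2 * (real K)\<^sup>2 * (errv + exp (- h t)) \<le> 2 * (real K)\<^sup>2 * (errf \<kappa> l t + exp (- h t))"
        using errv by (intro mult_left_mono) auto
      also have "\<dots> \<le> 2 * (ln t) ^ 4 * (errf \<kappa> l t + exp (- h t))"
        using K4 errv0 by (intro mult_right_mono) auto
      finally show ?thesis .
    qed
    have 5: "g / (\<epsilon> * t - 1) \<le> 2 * g / (\<epsilon> * t)"
    proof -
      have "g / (\<epsilon> * t - 1) \<le> g / (\<epsilon> * t / 2)" using eps by (intro divide_left_mono) auto
      then show ?thesis by (simp add: mult.commute)
    qed
    show ?thesis using zeta 1 2 3 4 5 by linarith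
  qed
  have prem: "1 \<le> t" "0 < 2 * (et * t)" "0 < 2 * (B' * t)" "\<epsilon> < 1" "1 < \<epsilon> * t" using t pars t0 eps by auto
  have w0: "2 * (et * t) \<le> W \<omega> \<kappa> t k0" using k0 k0H pars by (intro Wlow) auto
  have w1: "2 * (B' * t) \<le> W \<omega> \<kappa> t K" using K pars by (intro Wlow) auto
  have finLg: "finite Lg" by (simp add: Lg_def)
  show "dTV (law_ell \<omega> t) (law_ellE \<omega> \<kappa> t) \<le> \<zeta>"
    by (rule quenched_core(1)[OF prem(1) K(1,2) k0 prem(2) w0 prem(3) w1 early finLg Lgc small gap eps(1) prem(4,5) gle z])
  have "1 - \<zeta> - real K * errl c1 \<le> measure_pmf.prob (walk \<omega> (steps t)) {p. \<bar>real_of_int (p ! steps t - b \<omega> t (ell \<omega> t p))\<bar> \<le> R}"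
  proof (rule quenched_core(2)[OF prem(1) K(1,2) k0 prem(2) w0 prem(3) w1 early finLg Lgc small gap eps(1) prem(4,5) gle z])
    fix k j assume k: "1 \<le> k" "k \<le> K" and j: "b \<omega> t k - L - 1 \<le> j" "j \<le> cpk k" "R - 1 \<le> \<bar>real_of_int (j - b \<omega> t k)\<bar>"
    let ?x = "b \<omega> t k"
    have bN: "?x \<le> N" "0 \<le> ?x" "?x \<le> N + 2 * L" using bk[of k] k b_nonneg[of t k] L1 by auto
    note p = peak[OF k(1)]
    have dl: "dbar \<omega> t k \<le> ?x + L" by (rule dbar_le[OF k(1) bN(3)])
    have hp: "h t \<le> inc \<omega> ?x (cpk k)" using p deep[OF k(1)] V_diff[of ?x "cpk k" \<omega>] by simp
    show "c1 \<le> v j - v ?x"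
    proof (cases "j \<le> ?x")
      case True
      have "(?x, ?x - j, cpk k - ?x) \<in> {0..N} \<times> {p. 0 \<le> p \<and> p \<le> L + 1 \<and> R - 1 \<le> real_of_int p} \<times> {0..L + 1}"
        using True j bN p dl by auto
      with nFL have "\<not> (- c1 \<le> inc \<omega> (?x - (?x - j)) ?x \<and> h t \<le> inc \<omega> ?x (?x + (cpk k - ?x)))" by fastforce
      then show ?thesis using hp V_diff[of j ?x \<omega>] True by simp
    next
      case False
      have "(?x, j - ?x, cpk k - j) \<in> {0..N} \<times> {p. 0 \<le> p \<and> p \<le> L + 1 \<and> R - 1 \<le> real_of_int p} \<times> {0..L + 1}"
        using False j bN p dl by auto
      with nFR have "\<not> (inc \<omega> ?x (?x + (j - ?x)) \<le> c1 \<and> h t \<le> inc \<omega> ?x (?x + (j - ?x) + (cpk k - j)))" by fastforce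
      then show ?thesis using hp V_diff[of ?x j \<omega>] False by simp
    qed
  qed
  moreover have "real K * errl c1 \<le> (ln t)\<^sup>2 * errlf \<kappa> l c1 t"
  proof -
    have "real K * errl c1 \<le> real K * errlf \<kappa> l c1 t" using errl by (intro mult_left_mono) auto
    also have "\<dots> \<le> (ln t)\<^sup>2 * errlf \<kappa> l c1 t" using K2 errv0 by (intro mult_right_mono) auto
    finally show ?thesis .
  qed
  ultimately show "1 - \<zeta> - (ln t)\<^sup>2 * errlf \<kappa> l c1 t \<le> measure_pmf.prob (walk \<omega> (steps t)) {p. \<bar>real_of_int (p ! steps t - b \<omega> t (ell \<omega> t p))\<bar> \<le> R}"
    by linarith
qed

subsection \<open>Choice of scales\<close>

definition window_len :: "real \<Rightarrow> real \<Rightarrow> int" where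
  "window_len C t = \<lceil>C * ln t\<rceil>"

text \<open>The extra window leaves about \<open>A * t powr \<kappa>\<close> starting sites whose
  climbs, no longer than the window, end inside the range.\<close>

definition range_len :: "real \<Rightarrow> real \<Rightarrow> real \<Rightarrow> real \<Rightarrow> int" where
  "range_len \<kappa> A C t = \<lceil>A * t powr \<kappa>\<rceil> + window_len C t"

lemma window_range_bounds:
  assumes "0 < t" "1 \<le> ln t" "0 < A" "0 < C"
  shows "1 \<le> window_len C t" "C * ln t \<le> real_of_int (window_len C t)" "real_of_int (window_len C t) \<le> C * ln t + 1"
    "1 \<le> range_len \<kappa> A C t" "real_of_int (range_len \<kappa> A C t) \<le> A * t powr \<kappa> + C * ln t + 2"
    "A * t powr \<kappa> \<le> real (nat (range_len \<kappa> A C t - window_len C t))" "0 < nat (range_len \<kappa> A C t - window_len C t)"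
proof -
  have "0 < ln t" using assms by linarith
  then have 0: "0 < C * ln t" "0 < A * t powr \<kappa>" using assms by simp_all
  show 1: "1 \<le> window_len C t" unfolding window_len_def using 0 by (simp add: less_ceiling_iff int_one_le_iff_zero_less)
  show "C * ln t \<le> real_of_int (window_len C t)" unfolding window_len_def by simp
  show l: "real_of_int (window_len C t) \<le> C * ln t + 1" unfolding window_len_def by linarith
  show "1 \<le> range_len \<kappa> A C t" unfolding range_len_def using 0 1 by (simp add: add_increasing)
  show "real_of_int (range_len \<kappa> A C t) \<le> A * t powr \<kappa> + C * ln t + 2" unfolding range_len_def using l by simp linarith
  have c: "0 < \<lceil>A * t powr \<kappa>\<rceil>" using 0 by (simp add: less_ceiling_iff)
  show "0 < nat (range_len \<kappa> A C t - window_len C t)" unfolding range_len_def using c by simp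
  show "A * t powr \<kappa> \<le> real (nat (range_len \<kappa> A C t - window_len C t))" unfolding range_len_def using c by simp
qed

lemma card_interval: "x \<le> y + 1 \<Longrightarrow> real (card {x..y::int}) = real_of_int y - real_of_int x + 1"
  by simp

lemma exp_h: "0 < t \<Longrightarrow> 0 < ln t \<Longrightarrow> exp (p * h t) = t powr p * ln t powr (- p)"
  by (simp add: h_def powr_def exp_add[symmetric] algebra_simps)

lemma exp_quarter:
  assumes t: "0 < t" "0 < ln t"
  shows "exp (3 / 4 * ln t - h t) = t powr (- (1 / 4)) * ln t"
proof -
  have "exp (3 / 4 * ln t - h t) = exp (3 / 4 * ln t) * exp (- 1 * h t)" by (simp add: exp_add[symmetric])
  also have "\<dots> = (t powr (3 / 4) * t powr (- 1)) * ln t" using exp_h[OF t, of "- 1"] t by (simp add: powr_def)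
  also have "t powr (3 / 4) * t powr (- 1) = t powr (3 / 4 + - 1)" by (rule powr_add[symmetric])
  finally show ?thesis by simp
qed

lemma exp_ln_mult: "0 < (x::real) \<Longrightarrow> 0 < t \<Longrightarrow> exp (p * ln (x * t)) = x powr p * t powr p"
  using powr_mult[of x t p] by (simp add: powr_def[of "x * t"])

lemma eventually_large: "\<forall>\<^sub>F t in at_top. 0 < t \<and> 1 \<le> ln (t::real)"
proof -
  have "\<forall>\<^sub>F t in at_top. 1 \<le> ln (t::real)" "\<forall>\<^sub>F t in at_top. 0 < (t::real)" by real_asymp+
  then show ?thesis by eventually_elim simp
qed

section \<open>Limits of the bounds for bad events\<close>

context
  fixes A C k q r g :: real
  assumes pos: "0 < A" "0 < C" "0 < k"
begin

lemma lim_descent: "((\<lambda>t. (A * t powr k + C * ln t + 2 + 5 * (C * ln t + 1) + 1) * t powr (- (3 / 2 * k + 1))) \<longlongrightarrow> 0) at_top"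
  using pos by real_asymp

lemma lim_two_rises: "((\<lambda>t. (A * t powr k + C * ln t + 2 + (C * ln t + 1) + 1) * (5 * (C * ln t + 1) + 1) ^ 3 * t powr (- (3 / 2 * k))) \<longlongrightarrow> 0) at_top"
  using pos by real_asymp

lemma lim_one_rise: "k < q \<Longrightarrow> ((\<lambda>t. (A * t powr k + C * ln t + 2 + 1) * (2 * (C * ln t + 1) + 1) * t powr (- q)) \<longlongrightarrow> 0) at_top"
  using pos by real_asymp

lemma lim_initial: "((\<lambda>t. (C * ln t + 2) * (C * ln t + 2) * (t powr (- k) * ln t powr k)) \<longlongrightarrow> 0) at_top"
  using pos by real_asymp

lemma lim_flat: "0 < q \<Longrightarrow> ((\<lambda>t. (A * t powr k + C * ln t + 2 + 1) * (C * ln t + 3) ^ 2 * (t powr (- k) * ln t powr k * (t powr (- q) * r))) \<longlongrightarrow> 0) at_top"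
  using pos by real_asymp

text \<open>The one positive limit: at height \<open>ln t\<close> plus a constant, the expected
  number of climbs in the range stays of order \<open>A\<close>. This is why the constants must be
  tuned later.\<close>

lemma lim_density: "((\<lambda>t. (A * t powr k + C * ln t + 2 + 2 * (C * ln t + 1) + 1) * t powr (- k)) \<longlongrightarrow> A) at_top"
  using pos by real_asymp

text \<open>The surplus logarithm comes from the double logarithm in \<open>h\<close>: for the
  truncated sum \<open>q = 1 - \<kappa>\<close>, for comparing the number of deep valleys with
  \<open>(ln t)\<^sup>2\<close> it is \<open>2 - \<kappa>\<close>.\<close>

lemma lim_log: "0 < q \<Longrightarrow> ((\<lambda>t. (A * t powr k + C * ln t + 2 + 1) * (t powr (- k) * ln t powr (- q))) \<longlongrightarrow> 0) at_top"
  using pos by real_asymp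

lemma lim_sqrt: "0 < g \<Longrightarrow> ((\<lambda>t. (sqrt (g * t) / 2) powr (- k)) \<longlongrightarrow> 0) at_top"
  using pos by real_asymp

lemma lim_window: "0 < g \<Longrightarrow> \<forall>\<^sub>F t in at_top. C * (ln (g * t) + 1) \<le> 2 * C * ln t"
  using pos by real_asymp

end

lemma eventually_params:
  assumes "0 < x"
  shows "\<forall>\<^sub>F t in at_top. 3 / 4 * ln t \<le> h t \<and> ln 2 \<le> h t \<and> h t \<le> ln (x * t) \<and> 3 / 4 * ln t < ln (x * t) \<and> 2 \<le> x * t \<and> 0 < ln (x * t)"
proof -
  have "\<forall>\<^sub>F t::real in at_top. 3 / 4 * ln t \<le> ln t - ln (ln t)" "\<forall>\<^sub>F t::real in at_top. ln 2 \<le> ln t - ln (ln t)" by real_asymp+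
  moreover have "\<forall>\<^sub>F t in at_top. ln t - ln (ln t) \<le> ln (x * t)" "\<forall>\<^sub>F t in at_top. 3 / 4 * ln t < ln (x * t)"
    "\<forall>\<^sub>F t in at_top. 2 \<le> x * t" "\<forall>\<^sub>F t in at_top. 0 < ln (x * t)" using assms by real_asymp+
  ultimately show ?thesis unfolding h_def by eventually_elim simp
qed

text \<open>The wall difference contributes \<open>t powr (- (\<kappa> / 2))\<close> and the gap
  between \<open>u\<close> and \<open>h t\<close> contributes \<open>t powr (- (1 / 4))\<close>,
  both up to logarithms.\<close>

lemma errf_tendsto:
  assumes C: "0 < C" and k: "0 < \<kappa>"
  shows "((\<lambda>t. 2 * (ln t) ^ 4 * (errf \<kappa> (C * ln t + 4) t + exp (- h t))) \<longlongrightarrow> 0) at_top"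
proof -
  let ?F = "\<lambda>t. 2 * ((ln t) ^ 4 * (C * ln t + 4) * t powr (- (\<kappa> / 2))) + 4 * ((ln t) ^ 5 * (C * ln t + 4)\<^sup>2 * (2 + ln t) * t powr (- (1 / 4)))
    + (4 * ((ln t) ^ 6 * (C * ln t + 4)\<^sup>2 * t powr (- (1 / 4))) + 2 * ((ln t) ^ 6 * (C * ln t + 6) * t powr (- 1))) + 2 * (ln t ^ 5 * t powr (- 1))"
  have 1: "((\<lambda>t. (ln t) ^ 4 * (C * ln t + 4) * t powr (- (\<kappa> / 2))) \<longlongrightarrow> 0) at_top"
    "((\<lambda>t. (ln t) ^ 5 * (C * ln t + 4)\<^sup>2 * (2 + ln t) * t powr (- (1 / 4))) \<longlongrightarrow> 0) at_top"
    "((\<lambda>t. (ln t) ^ 6 * (C * ln t + 4)\<^sup>2 * t powr (- (1 / 4))) \<longlongrightarrow> 0) at_top"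
    "((\<lambda>t. (ln t) ^ 6 * (C * ln t + 6) * t powr (- 1)) \<longlongrightarrow> 0) at_top" "((\<lambda>t::real. (ln t) ^ 5 * t powr (- 1)) \<longlongrightarrow> 0) at_top"
    using C k by real_asymp+
  have lim: "(?F \<longlongrightarrow> 2 * 0 + 4 * 0 + (4 * 0 + 2 * 0) + 2 * 0) at_top" by (intro tendsto_add tendsto_mult_left 1)
  have "\<forall>\<^sub>F t in at_top. ?F t = 2 * (ln t) ^ 4 * (errf \<kappa> (C * ln t + 4) t + exp (- h t))"
    using eventually_large
  proof eventually_elim
    case (elim t)
    then have t: "0 < t" "0 < ln t" by linarith+
    define y where "y = ln t"
    define z where "z = C * y + 4"
    have e1: "exp ((1 + \<kappa> / 2) * ln t - D \<kappa> t) = t powr (- (\<kappa> / 2))" using t by (simp add: D_def powr_def algebra_simps)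
    have e3: "exp (- h t) = y * t powr (- 1)" using exp_h[OF t, of "- 1"] t by (simp add: y_def)
    have e2: "exp (3 / 4 * ln t - h t) = t powr (- (1 / 4)) * y" using exp_quarter[OF t] by (simp add: y_def)
    have e4: "t * exp (- h t) = y" unfolding e3 using t by (simp add: powr_minus)
    have e5: "t * exp (- 2 * h t) = y\<^sup>2 * t powr (- 1)"
    proof -
      have "t * exp (- 2 * h t) = (t * exp (- h t)) * exp (- h t)" by (simp add: exp_add[symmetric])
      then show ?thesis unfolding e4 e3 using t by (simp add: power2_eq_square)
    qed
    have e6: "t powr (- (1 / 4)) = t powr (- 1) * exp (3 / 4 * ln t)" using t by (simp add: powr_def exp_add[symmetric])
    have "errf \<kappa> z t + exp (- h t) = z * t powr (- (\<kappa> / 2)) + 2 * z\<^sup>2 * (t powr (- (1 / 4)) * y) * (2 + y)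
        + (2 * (y\<^sup>2 * z\<^sup>2 * t powr (- (1 / 4))) + y\<^sup>2 * (2 + z) * t powr (- 1)) + y * t powr (- 1)"
      unfolding errf_def e1 e2 e4 e5 e6 e3 using t by (simp add: algebra_simps)
    then show ?case unfolding y_def[symmetric] z_def[symmetric]
      by (simp add: z_def algebra_simps power2_eq_square eval_nat_numeral)
  qed
  from tendsto_cong[OF this] lim show ?thesis by simp
qed

lemma errlf_tendsto:
  assumes C: "0 < C" and k: "0 < \<kappa>" "0 < q"
  shows "((\<lambda>t. (ln t)\<^sup>2 * errlf \<kappa> (C * ln t + 4) (q * ln t) t) \<longlongrightarrow> 0) at_top"
proof -
  let ?F = "\<lambda>t. (ln t) ^ 2 * (C * ln t + 4) * t powr (- (\<kappa> / 2)) + (2 * ((ln t) ^ 3 * (C * ln t + 4)\<^sup>2 * t powr (- (1 / 4)))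
    + 2 * ((ln t) ^ 2 * (C * ln t + 4) * t powr (- q)))"
  have 1: "((\<lambda>t. (ln t) ^ 2 * (C * ln t + 4) * t powr (- (\<kappa> / 2))) \<longlongrightarrow> 0) at_top"
    "((\<lambda>t. (ln t) ^ 3 * (C * ln t + 4)\<^sup>2 * t powr (- (1 / 4))) \<longlongrightarrow> 0) at_top"
    "((\<lambda>t. (ln t) ^ 2 * (C * ln t + 4) * t powr (- q)) \<longlongrightarrow> 0) at_top"
    using C k by real_asymp+
  have lim: "(?F \<longlongrightarrow> 0 + (2 * 0 + 2 * 0)) at_top" by (intro tendsto_add tendsto_mult_left 1)
  have "\<forall>\<^sub>F t in at_top. ?F t = (ln t)\<^sup>2 * errlf \<kappa> (C * ln t + 4) (q * ln t) t"
    using eventually_large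
  proof eventually_elim
    case (elim t)
    then have t: "0 < t" "0 < ln t" by linarith+
    have e1: "exp ((1 + \<kappa> / 2) * ln t - D \<kappa> t) = t powr (- (\<kappa> / 2))" using t by (simp add: D_def powr_def algebra_simps)
    note e2 = exp_quarter[OF t]
    have e4: "exp (- (q * ln t)) = t powr (- q)" using t by (simp add: powr_def)
    show ?case unfolding errlf_def e1 e2 e4 by (simp add: algebra_simps power2_eq_square eval_nat_numeral)
  qed
  from tendsto_cong[OF this] lim show ?thesis by simp
qed

lemma ln_ge_1_imp: "0 < t \<Longrightarrow> 1 \<le> ln t \<Longrightarrow> 1 < (t::real)"
  using ln_gt_zero_iff[of t] by linarith

section \<open>Each bad event becomes rare\<close>

context rwre_env
begin

definition small :: "(int \<Rightarrow> real) set \<Rightarrow> real \<Rightarrow> bool" where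
  "small S x \<longleftrightarrow> S \<in> sets P \<and> measure P S \<le> x"

lemma eventually_small:
  assumes lim: "(f \<longlongrightarrow> l) at_top" "l < x" and le: "\<And>t. 0 < t \<Longrightarrow> 1 \<le> ln t \<Longrightarrow> small (S t) (f t)"
  shows "\<forall>\<^sub>F t::real in at_top. small (S t) x"
  using eventually_large order_tendstoD(2)[OF lim] by eventually_elim (use le in \<open>fastforce simp: small_def\<close>)

context
  fixes x A C :: real
  assumes x: "0 < x" and A: "0 < A" and C: "0 < C"
begin

text \<open>The window must be long enough for \<open>phi\<close> to the window length to beat
  \<open>exp (3 / 2 * \<kappa> * ln t)\<close> and the number of sites; the condition on
  \<open>C\<close> leaves a spare power of \<open>t\<close>.\<close>

lemma eventually_descent_small:
  assumes "3 * \<kappa> + 1 \<le> C * (- ln phi)"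
  shows "\<forall>\<^sub>F t in at_top. small {\<omega>. \<exists>y\<in>{- window_len C t..range_len \<kappa> A C t + 4 * window_len C t}. - (3 * ln t) \<le> inc \<omega> y (y + window_len C t)} x"
proof (rule eventually_small[OF lim_descent[OF A C kappa_pos] x])
  fix t :: real assume t: "0 < t" "1 \<le> ln t"
  note n = window_range_bounds(1-3)[OF t A C] window_range_bounds(4-7)[OF t A C, of \<kappa>]
  have p: "phi ^ nat (window_len C t) \<le> phi powr (C * ln t)" by (rule phi_power_le) (use n in simp)
  also have "\<dots> = exp (- (C * (- ln phi)) * ln t)" using phi_pos by (simp add: powr_def mult.commute mult.left_commute)
  also have "\<dots> \<le> exp (- (3 * \<kappa> + 1) * ln t)" using assms t by (simp only: exp_le_cancel_iff) (intro mult_right_mono, linarith+)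
  finally have q: "phi ^ nat (window_len C t) \<le> exp (- (3 * \<kappa> + 1) * ln t)" .
  have "exp (\<kappa> / 2 * (3 * ln t)) * phi ^ nat (window_len C t) \<le> exp (\<kappa> / 2 * (3 * ln t)) * exp (- (3 * \<kappa> + 1) * ln t)"
    using q by (intro mult_left_mono) auto
  also have "\<dots> = t powr (- (3 / 2 * \<kappa> + 1))" using t by (simp add: powr_def exp_add[symmetric] algebra_simps)
  finally have q2: "exp (\<kappa> / 2 * (3 * ln t)) * phi ^ nat (window_len C t) \<le> t powr (- (3 / 2 * \<kappa> + 1))" .
  have c: "real (card {- window_len C t..range_len \<kappa> A C t + 4 * window_len C t}) \<le> A * t powr \<kappa> + C * ln t + 2 + 5 * (C * ln t + 1) + 1"
    using n by (subst card_interval) auto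
  show "small {\<omega>. \<exists>y\<in>{- window_len C t..range_len \<kappa> A C t + 4 * window_len C t}. - (3 * ln t) \<le> inc \<omega> y (y + window_len C t)}
      ((A * t powr \<kappa> + C * ln t + 2 + 5 * (C * ln t + 1) + 1) * t powr (- (3 / 2 * \<kappa> + 1)))"
    unfolding small_def
  proof
    have L0: "0 \<le> window_len C t" using n by simp
    show "{\<omega>. \<exists>y\<in>{- window_len C t..range_len \<kappa> A C t + 4 * window_len C t}. - (3 * ln t) \<le> inc \<omega> y (y + window_len C t)} \<in> sets P" by (rule bad_descent[OF L0])
    show "measure P {\<omega>. \<exists>y\<in>{- window_len C t..range_len \<kappa> A C t + 4 * window_len C t}. - (3 * ln t) \<le> inc \<omega> y (y + window_len C t)}
      \<le> (A * t powr \<kappa> + C * ln t + 2 + 5 * (C * ln t + 1) + 1) * t powr (- (3 / 2 * \<kappa> + 1))"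
      by (rule order_trans[OF bad_descent(2)[OF L0] mult_mono[OF c q2]]) (use order_trans[OF _ c] phi_pos in auto)
  qed
qed

lemma eventually_two_rises_small:
  "\<forall>\<^sub>F t in at_top. small {\<omega>. \<exists>q\<in>{- window_len C t..range_len \<kappa> A C t} \<times> {0..5 * window_len C t} \<times> {0..5 * window_len C t} \<times> {0..5 * window_len C t}. case q of (i, p, r, s) \<Rightarrow>
       3 / 4 * ln t \<le> inc \<omega> i (i + p) \<and> 3 / 4 * ln t \<le> inc \<omega> (i + p + r) (i + p + r + s)} x"
proof (rule eventually_small[OF lim_two_rises[OF A C kappa_pos] x], unfold small_def, rule conjI[OF bad_two_rises(1) order_trans[OF bad_two_rises(2)]])
  fix t :: real assume t: "0 < t" "1 \<le> ln t"
  note n = window_range_bounds(1-3)[OF t A C] window_range_bounds(4-7)[OF t A C, of \<kappa>]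
  have e: "exp (- (2 * \<kappa> * (3 / 4 * ln t))) = t powr (- (3 / 2 * \<kappa>))" using t by (simp add: powr_def)
  have c: "real (card {- window_len C t..range_len \<kappa> A C t}) \<le> A * t powr \<kappa> + C * ln t + 2 + (C * ln t + 1) + 1"
    "real (card {0..5 * window_len C t}) \<le> 5 * (C * ln t + 1) + 1"
    using n by (subst card_interval; simp)+
  show "real (card {- window_len C t..range_len \<kappa> A C t}) * real (card {0..5 * window_len C t}) ^ 3 * exp (- (2 * \<kappa> * (3 / 4 * ln t)))
    \<le> (A * t powr \<kappa> + C * ln t + 2 + (C * ln t + 1) + 1) * (5 * (C * ln t + 1) + 1) ^ 3 * t powr (- (3 / 2 * \<kappa>))"
    unfolding e by (intro mult_mono power_mono c) (use order_trans[OF _ c(1)] order_trans[OF _ c(2)] in auto)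
qed

lemma eventually_one_rise_small:
  "\<forall>\<^sub>F t in at_top. small {\<omega>. \<exists>q\<in>{0..range_len \<kappa> A C t} \<times> {0..2 * window_len C t}. case q of (i, p) \<Rightarrow> (1 + \<kappa> / 2) * ln t \<le> inc \<omega> i (i + p)} x"
proof (rule eventually_small[OF lim_one_rise[OF A C kappa_pos, of "\<kappa> * (1 + \<kappa> / 2)"] x], use kappa_pos in simp,
    unfold small_def, rule conjI[OF bad_one_rise(1) order_trans[OF bad_one_rise(2)]])
  fix t :: real assume t: "0 < t" "1 \<le> ln t"
  note n = window_range_bounds(1-3)[OF t A C] window_range_bounds(4-7)[OF t A C, of \<kappa>]
  have e: "exp (- (\<kappa> * ((1 + \<kappa> / 2) * ln t))) = t powr (- (\<kappa> * (1 + \<kappa> / 2)))" using t by (simp add: powr_def)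
  have c: "real (card {0..range_len \<kappa> A C t}) \<le> A * t powr \<kappa> + C * ln t + 2 + 1"
    "real (card {0..2 * window_len C t}) \<le> 2 * (C * ln t + 1) + 1"
    using n by (subst card_interval; simp)+
  show "real (card {0..range_len \<kappa> A C t}) * real (card {0..2 * window_len C t}) * exp (- (\<kappa> * ((1 + \<kappa> / 2) * ln t)))
    \<le> (A * t powr \<kappa> + C * ln t + 2 + 1) * (2 * (C * ln t + 1) + 1) * t powr (- (\<kappa> * (1 + \<kappa> / 2)))"
    unfolding e by (intro mult_mono c) (use order_trans[OF _ c(1)] order_trans[OF _ c(2)] in auto)
qed

lemma eventually_initial_small:
  "\<forall>\<^sub>F t in at_top. small {\<omega>. \<exists>q\<in>{0..window_len C t} \<times> {0..window_len C t}. case q of (i, p) \<Rightarrow> h t \<le> inc \<omega> i (i + p)} x"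
proof (rule eventually_small[OF lim_initial[OF A C kappa_pos] x], unfold small_def, rule conjI[OF bad_one_rise(1) order_trans[OF bad_one_rise(2)]])
  fix t :: real assume t: "0 < t" "1 \<le> ln t"
  note n = window_range_bounds(1-3)[OF t A C] window_range_bounds(4-7)[OF t A C, of \<kappa>]
  have e: "exp (- (\<kappa> * h t)) = t powr (- \<kappa>) * ln t powr \<kappa>" using exp_h[of t "- \<kappa>"] ln_ge_1_imp[OF t] by simp
  have c: "real (card {0..window_len C t}) \<le> C * ln t + 2"
    using n by (subst card_interval; simp)+
  show "real (card {0..window_len C t}) * real (card {0..window_len C t}) * exp (- (\<kappa> * h t)) \<le> (C * ln t + 2) * (C * ln t + 2) * (t powr (- \<kappa>) * ln t powr \<kappa>)"
    unfolding e by (intro mult_mono c) (use order_trans[OF _ c(1)] in auto)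
qed

text \<open>The tolerance \<open>\<eta> * (- ln phi) / \<kappa> * ln t\<close> costs half of the
  exponent that a flat stretch of length \<open>\<eta> * ln t - 1\<close> gains, so a negative power
  of \<open>t\<close> survives; the 1 in the length is the factor \<open>1 / phi\<close>.\<close>

lemma flat_bound:
  assumes t: "0 < t" "1 \<le> ln t" and eta: "0 < \<eta>"
  shows "real (card {0..range_len \<kappa> A C t}) * real (card {0..window_len C t + 1}) ^ 2 * (exp (\<kappa> / 2 * (\<eta> * (- ln phi) / \<kappa> * ln t) - \<kappa> * h t) * phi powr (\<eta> * ln t - 1))
    \<le> (A * t powr \<kappa> + C * ln t + 2 + 1) * (C * ln t + 3) ^ 2 * (t powr (- \<kappa>) * ln t powr \<kappa> * (t powr (- (\<eta> * (- ln phi) / 2)) * (1 / phi)))"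
proof -
  note n = window_range_bounds(1-3)[OF t A C] window_range_bounds(4-7)[OF t A C, of \<kappa>]
  have e: "exp (\<kappa> / 2 * (\<eta> * (- ln phi) / \<kappa> * ln t) - \<kappa> * h t) * phi powr (\<eta> * ln t - 1) = t powr (- \<kappa>) * ln t powr \<kappa> * (t powr (- (\<eta> * (- ln phi) / 2)) * (1 / phi))"
  proof -
    have 1: "exp (\<kappa> / 2 * (\<eta> * (- ln phi) / \<kappa> * ln t) - \<kappa> * h t) = exp (\<eta> * (- ln phi) / 2 * ln t) * exp (- \<kappa> * h t)"
      using kappa_pos by (simp add: exp_add[symmetric])
    have 2: "phi powr (\<eta> * ln t - 1) = exp (\<eta> * ln phi * ln t) * (1 / phi)"
      using phi_pos powr_diff[of phi "\<eta> * ln t" 1] by (simp add: powr_def[of phi "\<eta> * ln t"] mult.commute mult.left_commute)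
    have 3: "exp (\<eta> * (- ln phi) / 2 * ln t) * exp (\<eta> * ln phi * ln t) = t powr (- (\<eta> * (- ln phi) / 2))"
      using t by (simp add: powr_def exp_add[symmetric] field_simps)
    have 4: "exp (- \<kappa> * h t) = t powr (- \<kappa>) * ln t powr \<kappa>" using exp_h[of t "- \<kappa>"] ln_ge_1_imp[OF t] by simp
    show ?thesis unfolding 1 2 4 3[symmetric] by (simp only: ac_simps)
  qed
  have c: "real (card {0..range_len \<kappa> A C t}) \<le> A * t powr \<kappa> + C * ln t + 2 + 1" "real (card {0..window_len C t + 1}) \<le> C * ln t + 3"
    using n by (subst card_interval; simp)+
  show ?thesis unfolding e using phi_pos by (intro mult_mono power_mono c) (use order_trans[OF _ c(1)] order_trans[OF _ c(2)] in auto)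
qed

lemma eventually_flat_small:
  assumes eta: "0 < \<eta>"
  shows "\<forall>\<^sub>F t in at_top. small {\<omega>. \<exists>q\<in>{0..range_len \<kappa> A C t} \<times> {p. 0 \<le> p \<and> p \<le> window_len C t + 1 \<and> \<eta> * ln t - 1 \<le> real_of_int p} \<times> {0..window_len C t + 1}. case q of (x, p, s) \<Rightarrow>
       - (\<eta> * (- ln phi) / \<kappa> * ln t) \<le> inc \<omega> (x - p) x \<and> h t \<le> inc \<omega> x (x + s)} x"
    and "\<forall>\<^sub>F t in at_top. small {\<omega>. \<exists>q\<in>{0..range_len \<kappa> A C t} \<times> {p. 0 \<le> p \<and> p \<le> window_len C t + 1 \<and> \<eta> * ln t - 1 \<le> real_of_int p} \<times> {0..window_len C t + 1}. case q of (x, p, s) \<Rightarrow>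
       inc \<omega> x (x + p) \<le> \<eta> * (- ln phi) / \<kappa> * ln t \<and> h t \<le> inc \<omega> x (x + p + s)} x"
proof -
  have "ln phi < 0" using phi_pos phi_less by simp
  then have q: "0 < \<eta> * (- ln phi) / 2" using eta mult_pos_neg[of \<eta> "ln phi"] by simp
  note ev = eventually_small[OF lim_flat[OF A C kappa_pos q, of "1 / phi"] x]
  show "\<forall>\<^sub>F t in at_top. small {\<omega>. \<exists>q\<in>{0..range_len \<kappa> A C t} \<times> {p. 0 \<le> p \<and> p \<le> window_len C t + 1 \<and> \<eta> * ln t - 1 \<le> real_of_int p} \<times> {0..window_len C t + 1}. case q of (x, p, s) \<Rightarrow>
       - (\<eta> * (- ln phi) / \<kappa> * ln t) \<le> inc \<omega> (x - p) x \<and> h t \<le> inc \<omega> x (x + s)} x"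
    by (rule ev, unfold small_def, rule conjI[OF bad_flat_left(1) order_trans[OF bad_flat_left(2)]]) (rule flat_bound[OF _ _ eta])
  show "\<forall>\<^sub>F t in at_top. small {\<omega>. \<exists>q\<in>{0..range_len \<kappa> A C t} \<times> {p. 0 \<le> p \<and> p \<le> window_len C t + 1 \<and> \<eta> * ln t - 1 \<le> real_of_int p} \<times> {0..window_len C t + 1}. case q of (x, p, s) \<Rightarrow>
       inc \<omega> x (x + p) \<le> \<eta> * (- ln phi) / \<kappa> * ln t \<and> h t \<le> inc \<omega> x (x + p + s)} x"
    by (rule ev, unfold small_def, rule conjI[OF bad_flat_right(1) order_trans[OF bad_flat_right(2)]]) (rule flat_bound[OF _ _ eta])
qed

text \<open>The range offers at least \<open>A * t powr \<kappa>\<close> starting sites, each with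
  probability at least \<open>c * (z * t) powr (- \<kappa>)\<close>; the powers of \<open>t\<close>
  cancel and the second moment bound becomes a constant.\<close>

lemma eventually_no_rise_small:
  assumes low: "\<And>y n z. 0 < y \<Longrightarrow> C2 * (y + 1) \<le> real n \<Longrightarrow> c * exp (- (\<kappa> * y)) \<le> measure P {\<omega>. rise \<omega> z y n}"
    and c: "0 < c" "0 < C2" "2 * C2 \<le> C" and z: "0 < z" "4 / (1 - phi) * z powr \<kappa> / (A * c) \<le> x"
  shows "\<forall>\<^sub>F t in at_top. small {\<omega>. \<forall>k<nat (range_len \<kappa> A C t - window_len C t). \<not> rise \<omega> (0 + int k) (ln (z * t)) (nat (window_len C t))} x"
  using eventually_large eventually_params[OF z(1)] lim_window[OF A c(2) kappa_pos z(1)]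
proof eventually_elim
  case (elim t)
  then have t: "0 < t" "1 \<le> ln t" by auto
  note n = window_range_bounds(1-3)[OF t A C] window_range_bounds(4-7)[OF t A C, of \<kappa>]
  have e: "exp (- (\<kappa> * ln (z * t))) = 1 / (z powr \<kappa> * t powr \<kappa>)"
    using exp_ln_mult[OF z(1) t(1), of "- \<kappa>"] z t by (simp add: powr_minus inverse_eq_divide)
  have "2 * C2 * ln t \<le> C * ln t" using c ln_ge_1_imp[OF t] by (intro mult_right_mono) auto
  then have "C2 * (ln (z * t) + 1) \<le> real (nat (window_len C t))" using elim n by simp
  then have q: "c * exp (- (\<kappa> * ln (z * t))) \<le> measure P {\<omega>. rise \<omega> (0 + int k) (ln (z * t)) (nat (window_len C t))}" for k
    using elim by (intro low) auto
  let ?N = "nat (range_len \<kappa> A C t - window_len C t)"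
  have phi1: "0 < 4 / (1 - phi)" using phi_less by simp
  have "measure P {\<omega>. \<forall>k<?N. \<not> rise \<omega> (0 + int k) (ln (z * t)) (nat (window_len C t))} \<le> (4 / (1 - phi)) / (real ?N * (c * exp (- (\<kappa> * ln (z * t)))))"
    by (rule no_rise_prob) (use q c n in auto)
  also have "\<dots> \<le> (4 / (1 - phi)) / (A * t powr \<kappa> * (c * exp (- (\<kappa> * ln (z * t)))))"
    using n c A t phi1 by (intro divide_left_mono mult_right_mono mult_pos_pos) auto
  also have "\<dots> = 4 / (1 - phi) * z powr \<kappa> / (A * c)" unfolding e using A t z c by (simp add: field_simps)
  finally show ?case unfolding small_def using z by (auto intro!: sets_P_pred)
qed

lemma eventually_count_small:
  assumes "0 < z" "A * z powr (- \<kappa>) / m < x" "0 < m"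
  shows "\<forall>\<^sub>F t in at_top. small {\<omega>. m \<le> rise_count \<omega> (ln (z * t)) (range_len \<kappa> A C t) (nat (window_len C t))} x"
proof -
  have lim: "((\<lambda>t. (A * t powr \<kappa> + C * ln t + 2 + 2 * (C * ln t + 1) + 1) * t powr (- \<kappa>) * (z powr (- \<kappa>) / m)) \<longlongrightarrow> A * (z powr (- \<kappa>) / m)) at_top"
    by (intro tendsto_mult_right lim_density[OF A C kappa_pos])
  show ?thesis
  proof (rule eventually_small[OF lim])
    show "A * (z powr (- \<kappa>) / m) < x" using assms by simp
    fix t :: real assume t: "0 < t" "1 \<le> ln t"
    note n = window_range_bounds(1-3)[OF t A C] window_range_bounds(4-7)[OF t A C, of \<kappa>]
    have N0: "0 \<le> range_len \<kappa> A C t" using n by simp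
    have e: "exp (- (\<kappa> * ln (z * t))) = z powr (- \<kappa>) * t powr (- \<kappa>)" using exp_ln_mult[OF assms(1) t(1), of "- \<kappa>"] by simp
    have Cl: "0 < C * ln t" using C t by (intro mult_pos_pos) linarith+
    have "(real_of_int (range_len \<kappa> A C t) + 1) * exp (- (\<kappa> * ln (z * t))) / m = (real_of_int (range_len \<kappa> A C t) + 1) * (t powr (- \<kappa>) * (z powr (- \<kappa>) / m))"
      unfolding e by simp
    also have "\<dots> \<le> (A * t powr \<kappa> + C * ln t + 2 + 2 * (C * ln t + 1) + 1) * (t powr (- \<kappa>) * (z powr (- \<kappa>) / m))"
      using n Cl assms by (intro mult_right_mono) (simp_all add: divide_nonneg_pos)
    finally show "small {\<omega>. m \<le> rise_count \<omega> (ln (z * t)) (range_len \<kappa> A C t) (nat (window_len C t))}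
        ((A * t powr \<kappa> + C * ln t + 2 + 2 * (C * ln t + 1) + 1) * t powr (- \<kappa>) * (z powr (- \<kappa>) / m))"
      unfolding small_def using bad_rise_count[OF assms(3) N0, of "ln (z * t)" "nat (window_len C t)"] by (auto simp: mult.assoc intro: order_trans)
  qed
qed

lemma eventually_trunc_sum_small:
  assumes "0 < z" "A * C3 * z powr (1 - \<kappa>) / m < x" "0 < m"
  shows "\<forall>\<^sub>F t in at_top. small {\<omega>. m * t \<le> trunc_sum \<omega> (ln (z * t)) (range_len \<kappa> A C t + 2 * window_len C t)} x"
proof -
  let ?c = "C3 * z powr (1 - \<kappa>) / m"
  have lim: "((\<lambda>t. (A * t powr \<kappa> + C * ln t + 2 + 2 * (C * ln t + 1) + 1) * t powr (- \<kappa>) * ?c) \<longlongrightarrow> A * ?c) at_top"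
    by (intro tendsto_mult_right lim_density[OF A C kappa_pos])
  show ?thesis
  proof (rule eventually_small[OF lim])
    show "A * ?c < x" using assms by simp
    fix t :: real assume t: "0 < t" "1 \<le> ln t"
    note n = window_range_bounds(1-3)[OF t A C] window_range_bounds(4-7)[OF t A C, of \<kappa>]
    have N0: "0 \<le> range_len \<kappa> A C t + 2 * window_len C t" and mt: "0 < m * t" using n assms t by simp_all
    have e: "exp ((1 - \<kappa>) * ln (z * t)) = z powr (1 - \<kappa>) * (t * t powr (- \<kappa>))"
      using exp_ln_mult[OF assms(1) t(1), of "1 - \<kappa>"] t powr_add[of t 1 "- \<kappa>"] by simp
    have "(real_of_int (range_len \<kappa> A C t + 2 * window_len C t) + 1) * C3 * exp ((1 - \<kappa>) * ln (z * t)) / (m * t)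
        = (real_of_int (range_len \<kappa> A C t + 2 * window_len C t) + 1) * (t powr (- \<kappa>) * ?c)"
      unfolding e using t assms by (simp add: field_simps)
    also have "\<dots> \<le> (A * t powr \<kappa> + C * ln t + 2 + 2 * (C * ln t + 1) + 1) * (t powr (- \<kappa>) * ?c)"
      using n C3_pos assms by (intro mult_right_mono) (simp_all add: divide_nonneg_pos)
    finally show "small {\<omega>. m * t \<le> trunc_sum \<omega> (ln (z * t)) (range_len \<kappa> A C t + 2 * window_len C t)}
        ((A * t powr \<kappa> + C * ln t + 2 + 2 * (C * ln t + 1) + 1) * t powr (- \<kappa>) * ?c)"
      unfolding small_def using bad_trunc_sum[OF mt N0, of "ln (z * t)"] by (auto simp: mult.assoc intro: order_trans)
  qed
qed

lemma eventually_trunc_sum_h_small: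
  assumes "0 < m"
  shows "\<forall>\<^sub>F t in at_top. small {\<omega>. m * t \<le> trunc_sum \<omega> (h t) (range_len \<kappa> A C t)} x"
proof -
  let ?c = "C3 / m"
  have k1: "0 < 1 - \<kappa>" using kappa_less by simp
  have lim: "((\<lambda>t. (A * t powr \<kappa> + C * ln t + 2 + 1) * (t powr (- \<kappa>) * ln t powr (- (1 - \<kappa>))) * ?c) \<longlongrightarrow> 0 * ?c) at_top"
    by (intro tendsto_mult_right lim_log[OF A C kappa_pos k1])
  show ?thesis
  proof (rule eventually_small[OF lim])
    show "0 * ?c < x" using x by simp
    fix t :: real assume t: "0 < t" "1 \<le> ln t"
    note n = window_range_bounds(1-3)[OF t A C] window_range_bounds(4-7)[OF t A C, of \<kappa>]
    have N0: "0 \<le> range_len \<kappa> A C t" and mt: "0 < m * t" using n assms t by simp_all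
    have e: "exp ((1 - \<kappa>) * h t) = t * t powr (- \<kappa>) * ln t powr (- (1 - \<kappa>))"
      using exp_h[of t "1 - \<kappa>"] ln_ge_1_imp[OF t] powr_add[of t 1 "- \<kappa>"] by simp
    have "(real_of_int (range_len \<kappa> A C t) + 1) * C3 * exp ((1 - \<kappa>) * h t) / (m * t)
        = (real_of_int (range_len \<kappa> A C t) + 1) * ((t powr (- \<kappa>) * ln t powr (- (1 - \<kappa>))) * ?c)"
      unfolding e using t assms by (simp add: field_simps)
    also have "\<dots> \<le> (A * t powr \<kappa> + C * ln t + 2 + 1) * ((t powr (- \<kappa>) * ln t powr (- (1 - \<kappa>))) * ?c)"
      using n C3_pos assms by (intro mult_right_mono) (simp_all add: divide_nonneg_pos)
    finally show "small {\<omega>. m * t \<le> trunc_sum \<omega> (h t) (range_len \<kappa> A C t)}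
        ((A * t powr \<kappa> + C * ln t + 2 + 1) * (t powr (- \<kappa>) * ln t powr (- (1 - \<kappa>))) * ?c)"
      unfolding small_def using bad_trunc_sum[OF mt N0, of "h t"] by (auto simp: mult.assoc intro: order_trans)
  qed
qed

lemma eventually_count_h_small:
  "\<forall>\<^sub>F t in at_top. small {\<omega>. (ln t)\<^sup>2 \<le> rise_count \<omega> (h t) (range_len \<kappa> A C t) (nat (window_len C t))} x"
proof (rule eventually_small[OF lim_log[OF A C kappa_pos, of "2 - \<kappa>"] x])
  show "0 < 2 - \<kappa>" using kappa_less by simp
  fix t :: real assume t: "0 < t" "1 \<le> ln t"
  note n = window_range_bounds(1-3)[OF t A C] window_range_bounds(4-7)[OF t A C, of \<kappa>]
  have lt: "0 < ln t" using t by linarith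
  have N0: "0 \<le> range_len \<kappa> A C t" and mt: "0 < (ln t)\<^sup>2" using n lt by simp_all
  have e: "exp (- (\<kappa> * h t)) / (ln t)\<^sup>2 = t powr (- \<kappa>) * ln t powr (- (2 - \<kappa>))"
    using exp_h[OF t(1) lt, of "- \<kappa>"] powr_diff[of "ln t" \<kappa> 2] lt by simp
  have "(real_of_int (range_len \<kappa> A C t) + 1) * exp (- (\<kappa> * h t)) / (ln t)\<^sup>2 = (real_of_int (range_len \<kappa> A C t) + 1) * (t powr (- \<kappa>) * ln t powr (- (2 - \<kappa>)))"
    unfolding e[symmetric] by simp
  also have "\<dots> \<le> (A * t powr \<kappa> + C * ln t + 2 + 1) * (t powr (- \<kappa>) * ln t powr (- (2 - \<kappa>)))"
    using n by (intro mult_right_mono) simp_all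
  finally show "small {\<omega>. (ln t)\<^sup>2 \<le> rise_count \<omega> (h t) (range_len \<kappa> A C t) (nat (window_len C t))}
      ((A * t powr \<kappa> + C * ln t + 2 + 1) * (t powr (- \<kappa>) * ln t powr (- (2 - \<kappa>))))"
    unfolding small_def using bad_rise_count[OF mt N0, of "h t" "nat (window_len C t)"] by (auto intro: order_trans)
qed

text \<open>The bound of \<open>bad_exp_sum\<close> does not depend on the number of terms, so the
  sums are tight, while the threshold grows.\<close>

lemma eventually_exp_sum_small:
  assumes "0 < g"
  shows "\<forall>\<^sub>F t in at_top. small {\<omega>. sqrt (g * t) / 2 \<le> (\<Sum>k<n t. exp (inc \<omega> (s k) (s k + int k)))} x"
proof -
  let ?c = "(1 / (1 - phi powr (1 / \<kappa>))) powr (\<kappa> / 2) / (1 - sqrt phi)"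
  have lim: "((\<lambda>t. (sqrt (g * t) / 2) powr (- (\<kappa> / 2)) * ?c) \<longlongrightarrow> 0 * ?c) at_top"
    using kappa_pos assms by (intro tendsto_mult_right lim_sqrt[of A C]) (use A C in auto)
  show ?thesis
  proof (rule eventually_small[OF lim])
    fix t :: real assume t: "0 < t" "1 \<le> ln t"
    have p: "0 < sqrt (g * t) / 2" using t assms by simp
    show "small {\<omega>. sqrt (g * t) / 2 \<le> (\<Sum>k<n t. exp (inc \<omega> (s k) (s k + int k)))} ((sqrt (g * t) / 2) powr (- (\<kappa> / 2)) * ?c)"
      unfolding small_def by (rule conjI; rule bad_exp_sum[OF p refl])
  qed (use x in simp)
qed

end

end

section \<open>Choice of constants and conclusion\<close>

context rwre_env
begin

lemma AE_sellip: "AE \<omega> in P. sellip \<omega>"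
  unfolding sellip_def AE_all_countable Penv_def
  by (intro allI AE_PiM_component prob_mu unit_mu) auto

lemma small_disj: "small {\<omega>. Q \<omega>} y \<Longrightarrow> small {\<omega>. R \<omega>} z \<Longrightarrow> small {\<omega>. Q \<omega> \<or> R \<omega>} (y + z)"
proof -
  assume a: "small {\<omega>. Q \<omega>} y" "small {\<omega>. R \<omega>} z"
  have "{\<omega>. Q \<omega> \<or> R \<omega>} = {\<omega>. Q \<omega>} \<union> {\<omega>. R \<omega>}" by blast
  then show ?thesis using a measure_Un_le[of "{\<omega>. Q \<omega>}" P "{\<omega>. R \<omega>}"] by (auto simp: small_def)
qed

text \<open>\<open>R\<close> is wanted at every point of a measurable set, so the exceptional null
  set is removed together with the bad event.\<close>

lemma small_complement:
  assumes B: "small {\<omega>. B \<omega>} y" and Q: "AE \<omega> in P. Q \<omega>" and R: "\<And>\<omega>. Q \<omega> \<Longrightarrow> \<not> B \<omega> \<Longrightarrow> R \<omega>"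
  shows "\<exists>G\<in>sets P. 1 - y \<le> measure P G \<and> (\<forall>\<omega>\<in>G. R \<omega>)"
proof -
  obtain N where N: "{\<omega> \<in> space P. \<not> Q \<omega>} \<subseteq> N" "emeasure P N = 0" "N \<in> sets P" using AE_E[OF Q] by blast
  have Bs: "{\<omega>. B \<omega>} \<in> sets P" "measure P {\<omega>. B \<omega>} \<le> y" using B by (auto simp: small_def)
  have N0: "measure P N = 0" using N by (simp add: measure_def)
  have U: "{\<omega>. B \<omega>} \<union> N \<in> sets P" using Bs N by auto
  have "measure P ({\<omega>. B \<omega>} \<union> N) \<le> y" using measure_Un_le[OF Bs(1) N(3)] Bs N0 by simp
  then have "1 - y \<le> measure P (space P - ({\<omega>. B \<omega>} \<union> N))" using P.prob_compl[OF U] by simp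
  moreover have "R \<omega>" if "\<omega> \<in> space P - ({\<omega>. B \<omega>} \<union> N)" for \<omega> using that N R by auto
  ultimately show ?thesis using sets.compl_sets[OF U] by (intro bexI[of _ "space P - ({\<omega>. B \<omega>} \<union> N)"]) auto
qed

text \<open>Each of the sixteen bad events receives probability \<open>x\<close>. The terms of
  \<open>zeta\<close> total less than \<open>9 * x\<close>, and localization costs another
  \<open>x\<close>.\<close>

lemma eventually_good:
  assumes x: "0 < x" "x \<le> 1" and eta: "0 < \<eta>"
  shows "\<forall>\<^sub>F t in at_top. \<exists>G\<in>sets P. 1 - 16 * x \<le> measure P G \<and> (\<forall>\<omega>\<in>G. dTV (law_ell \<omega> t) (law_ellE \<omega> \<kappa> t) \<le> 9 * x \<and>
     1 - 10 * x \<le> measure_pmf.prob (walk \<omega> (steps t)) {p. \<bar>real_of_int (p ! steps t - b \<omega> t (ell \<omega> t p))\<bar> \<le> \<eta> * ln t})"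
proof -
  obtain c C2 where c: "0 < c" "0 < C2" and low: "\<And>y n z. 0 < y \<Longrightarrow> C2 * (y + 1) \<le> real n \<Longrightarrow> c * exp (- (\<kappa> * y)) \<le> measure P {\<omega>. rise \<omega> z y n}"
    using rise_prob_lower by blast
  define K5 where "K5 = 4 / (1 - phi)"
  have K5: "0 < K5" using phi_less by (simp add: K5_def)
  define lam where "lam = - ln phi"
  have lam: "0 < lam" using phi_pos phi_less by (simp add: lam_def)
  define C where "C = 2 * C2 + (3 * \<kappa> + 1) / lam"
  have "0 \<le> (3 * \<kappa> + 1) / lam" using kappa_pos lam by simp
  then have C: "0 < C" "2 * C2 \<le> C" using c by (auto simp: C_def)
  have "C * lam = 2 * C2 * lam + (3 * \<kappa> + 1)" using lam by (simp add: C_def field_simps)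
  then have Clam: "3 * \<kappa> + 1 \<le> C * (- ln phi)" using mult_pos_pos[OF c(2) lam] unfolding lam_def[symmetric] by linarith
  \<comment> \<open>Makes the chance to leave the last valley by time \<open>t\<close>, bounded by
    \<open>1 / (2 * B)\<close>, equal to \<open>x / 2\<close>.\<close>
  define B where "B = 1 / x"
  have B: "0 < B" using x by (simp add: B_def)
  \<comment> \<open>The range in which a climb to \<open>ln (B * t)\<close> is missed with
    probability at most \<open>x\<close>.\<close>
  define A where "A = K5 * B powr \<kappa> / (c * x)"
  have A: "0 < A" using K5 B c x by (simp add: A_def)
  \<comment> \<open>A range so short that it probably contains no climb of height
    \<open>ln t\<close> and that its valleys have total weight \<open>O(x * t)\<close>.\<close>
  define al where "al = min A (min (x / 4) (x\<^sup>2 / (2 * C3)))"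
  have al: "0 < al" "al \<le> A" "al \<le> x / 4" "al \<le> x\<^sup>2 / (2 * C3)" using A x C3_pos by (auto simp: al_def)
  \<comment> \<open>So low that even the short range contains a climb to \<open>ln (et * t)\<close>
    with probability at least \<open>1 - x\<close>.\<close>
  define et where "et = (x * al * c / K5) powr (1 / \<kappa>)"
  have et: "0 < et" using al x c K5 by (simp add: et_def)
  have etk: "et powr \<kappa> = x * al * c / K5" using al x c K5 kappa_pos by (simp add: et_def powr_powr)
  have etB: "et \<le> B"
  proof (rule ccontr)
    assume "\<not> et \<le> B"
    then have "B powr \<kappa> < et powr \<kappa>" using B kappa_pos by (intro powr_less_mono2) auto
    also have "\<dots> \<le> x * A * c / K5" unfolding etk using al x c K5 by (intro divide_right_mono mult_right_mono mult_left_mono) auto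
    also have "\<dots> = B powr \<kappa>" unfolding A_def using x c K5 by simp
    finally show False by simp
  qed
  \<comment> \<open>Valleys below height \<open>ln (\<theta> * t)\<close> together weigh
    \<open>O(x * et * t)\<close>, small against the early valley; this uses
    \<open>\<kappa> < 1\<close>.\<close>
  define \<theta> where "\<theta> = (x\<^sup>2 * et / (2 * A * C3)) powr (1 / (1 - \<kappa>))"
  have th: "0 < \<theta>" "\<theta> powr (1 - \<kappa>) = x\<^sup>2 * et / (2 * A * C3)"
    using x et A C3_pos kappa_less by (simp_all add: \<theta>_def powr_powr)
  \<comment> \<open>Markov's inequality for the number of climbs to
    \<open>ln (\<theta> * t)\<close>, whose mean tends to
    \<open>A * \<theta> powr (- \<kappa>)\<close>.\<close>
  define m where "m = 2 * A * \<theta> powr (- \<kappa>) / x"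
  have m: "0 < m" using A th x by (simp add: m_def)
  \<comment> \<open>The window is narrow enough for landing in it, at any of \<open>m + 1\<close>
    indices, to cost at most \<open>x\<close>; then \<open>\<gamma>\<close> makes the gaps small
    against this window.\<close>
  define \<epsilon> where "\<epsilon> = min (1 / 2) (2 * et * x / (m + 1))"
  have eps: "0 < \<epsilon>" "\<epsilon> \<le> 1 / 2" "\<epsilon> \<le> 2 * et * x / (m + 1)" using et x m by (auto simp: \<epsilon>_def)
  define \<gamma> where "\<gamma> = \<epsilon> * x / 4"
  have gam: "0 < \<gamma>" using eps x by (simp add: \<gamma>_def)
  note ctx = x(1) A C(1) and ctxe = x(1) al(1) C(1)
  have rB: "4 / (1 - phi) * B powr \<kappa> / (A * c) \<le> x" unfolding K5_def[symmetric] A_def using K5 B c x by simp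
  have rE: "4 / (1 - phi) * et powr \<kappa> / (al * c) \<le> x" unfolding K5_def[symmetric] etk using K5 al c x by simp
  have E7: "\<forall>\<^sub>F t in at_top. small {\<omega>. \<forall>k<nat (range_len \<kappa> A C t - window_len C t). \<not> rise \<omega> (0 + int k) (ln (B * t)) (nat (window_len C t))} x"
    by (rule eventually_no_rise_small[OF ctx _ c C(2) B rB]) (rule low)
  have E8: "\<forall>\<^sub>F t in at_top. small {\<omega>. \<forall>k<nat (range_len \<kappa> al C t - window_len C t). \<not> rise \<omega> (0 + int k) (ln (et * t)) (nat (window_len C t))} x"
    by (rule eventually_no_rise_small[OF ctxe _ c C(2) et rE]) (rule low)
  have E9: "\<forall>\<^sub>F t in at_top. small {\<omega>. 1 \<le> rise_count \<omega> (ln t) (range_len \<kappa> al C t) (nat (window_len C t))} x"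
    using eventually_count_small[OF ctxe, of 1 1] al x by simp
  have "al * C3 / x < x"
  proof -
    have "al * C3 / x \<le> x\<^sup>2 / (2 * C3) * C3 / x" using al x C3_pos by (intro divide_right_mono mult_right_mono) auto
    also have "\<dots> = x / 2" using x C3_pos by (simp add: power2_eq_square)
    finally show ?thesis using x by linarith
  qed
  then have E10: "\<forall>\<^sub>F t in at_top. small {\<omega>. x * t \<le> trunc_sum \<omega> (ln t) (range_len \<kappa> al C t + 2 * window_len C t)} x"
    using eventually_trunc_sum_small[OF ctxe, of 1 x] x by simp
  have "A * C3 * \<theta> powr (1 - \<kappa>) / (x * et) < x"
    unfolding th using A C3_pos x et by (simp add: power2_eq_square)
  then have E11: "\<forall>\<^sub>F t in at_top. small {\<omega>. x * et * t \<le> trunc_sum \<omega> (ln (\<theta> * t)) (range_len \<kappa> A C t + 2 * window_len C t)} x"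
    using eventually_trunc_sum_small[OF ctx th(1), of "x * et"] x et by simp
  have "A * \<theta> powr (- \<kappa>) / m < x" unfolding m_def using A th x by simp
  then have E12: "\<forall>\<^sub>F t in at_top. small {\<omega>. m \<le> rise_count \<omega> (ln (\<theta> * t)) (range_len \<kappa> A C t) (nat (window_len C t))} x"
    using eventually_count_small[OF ctx th(1)] m by simp
  have E13: "\<forall>\<^sub>F t in at_top. small {\<omega>. \<gamma> * t / 4 \<le> trunc_sum \<omega> (h t) (range_len \<kappa> A C t)} x"
    using eventually_trunc_sum_h_small[OF ctx, of "\<gamma> / 4"] gam by simp
  have q: "0 < \<eta> * (- ln phi) / \<kappa>" using eta lam kappa_pos unfolding lam_def by (intro divide_pos_pos mult_pos_pos) auto
  have C3pos: "0 < 3 * C" using C by simp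
  note F1 = order_tendstoD(2)[OF errf_tendsto[OF C3pos kappa_pos] x(1)]
  note F2 = order_tendstoD(2)[OF errlf_tendsto[OF C3pos kappa_pos q] x(1)]
  note Y = eventually_exp_sum_small[OF ctx gam, of "\<lambda>_. 0" "\<lambda>t. nat (range_len \<kappa> A C t + 1)"]
  note La = eventually_exp_sum_small[OF ctx gam, of "\<lambda>k. - int k" "\<lambda>t. Suc (Suc (steps t))"]
  show ?thesis
    using eventually_descent_small[OF ctx Clam] eventually_two_rises_small[OF ctx] eventually_one_rise_small[OF ctx] eventually_initial_small[OF ctx] eventually_flat_small(1)[OF ctx eta] eventually_flat_small(2)[OF ctx eta]
      E7 E8 E9 E10 E11 E12 E13 Y La eventually_count_h_small[OF ctx]
      eventually_large eventually_params[OF et] eventually_params[OF th(1)] eventually_params[OF eps(1)] F1 F2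
  proof eventually_elim
    case (elim t)
    note S = small_disj[OF elim(1) small_disj[OF elim(2) small_disj[OF elim(3) small_disj[OF elim(4) small_disj[OF elim(5) small_disj[OF elim(6)
      small_disj[OF elim(7) small_disj[OF elim(8) small_disj[OF elim(9) small_disj[OF elim(10) small_disj[OF elim(11) small_disj[OF elim(12)
      small_disj[OF elim(13) small_disj[OF elim(14) small_disj[OF elim(15) elim(16)]]]]]]]]]]]]]]]
    have t: "0 < t" "1 \<le> ln t" "1 \<le> t" "0 < ln t" using elim(17) ln_ge_1_imp[of t] by auto
    have L: "1 \<le> window_len C t" "real_of_int (window_len C t) \<le> C * ln t + 1" using window_range_bounds(1,3)[OF t(1,2) A C(1)] by auto
    have Ne: "0 \<le> range_len \<kappa> al C t" "range_len \<kappa> al C t \<le> range_len \<kappa> A C t"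
      using window_range_bounds(4)[OF t(1,2) al(1) C(1), of \<kappa>] al(2) by (auto simp: range_len_def intro!: ceiling_mono mult_right_mono)
    have l: "real_of_int (3 * window_len C t + 1) \<le> 3 * C * ln t + 4" using L by simp
    have me: "(m + 1) * \<epsilon> / (2 * et) \<le> x"
    proof -
      have "(m + 1) * \<epsilon> / (2 * et) \<le> (m + 1) * (2 * et * x / (m + 1)) / (2 * et)" using eps m et by (intro divide_right_mono mult_left_mono) auto
      also have "\<dots> = x" using m et by simp
      finally show ?thesis .
    qed
    have zeta: "1 / (2 * B) + 4 * x + (m + 1) * \<epsilon> / (2 * et) + x + 2 * (ln t) ^ 4 * (errf \<kappa> (3 * C * ln t + 4) t + exp (- h t)) + 2 * (\<gamma> * t) / (\<epsilon> * t) \<le> 9 * x"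
    proof -
      have "1 / (2 * B) = x / 2" "2 * (\<gamma> * t) / (\<epsilon> * t) = x / 2" using x eps t by (simp_all add: B_def \<gamma>_def)
      then show ?thesis using me elim(21) x by linarith
    qed
    have g: "\<gamma> * t \<le> \<epsilon> * t / 2"
    proof -
      have "\<epsilon> * x \<le> \<epsilon> * 2" using eps x by (intro mult_left_mono) auto
      then have "\<gamma> \<le> \<epsilon> / 2" by (simp add: \<gamma>_def)
      then have "\<gamma> * t \<le> \<epsilon> / 2 * t" using t by (intro mult_right_mono) auto
      then show ?thesis by simp
    qed
    have g0: "0 < \<gamma> * t" using gam t by simp
    have ae: "AE \<omega> in P. sellip \<omega> \<and> (\<forall>x. \<exists>y>x. inc \<omega> x y \<le> 0) \<and> (\<forall>x. \<forall>y::nat. \<exists>m\<ge>x. \<exists>n>m. real y \<le> inc \<omega> m n)"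
      using AE_sellip AE_descend AE_rise by eventually_elim blast
    have "\<exists>G\<in>sets P. 1 - (x + (x + (x + (x + (x + (x + (x + (x + (x + (x + (x + (x + (x + (x + (x + x))))))))))))))) \<le> measure P G \<and> (\<forall>\<omega>\<in>G. dTV (law_ell \<omega> t) (law_ellE \<omega> \<kappa> t) \<le> 9 * x \<and>
     1 - 10 * x \<le> measure_pmf.prob (walk \<omega> (steps t)) {p. \<bar>real_of_int (p ! steps t - b \<omega> t (ell \<omega> t p))\<bar> \<le> \<eta> * ln t})"
    proof (rule small_complement[OF S ae], goal_cases)
      case (1 \<omega>)
      have env: "sellip \<omega>" "\<And>x. \<exists>y>x. inc \<omega> x y \<le> 0" "\<And>x (y::nat). \<exists>m\<ge>x. \<exists>n>m. real y \<le> inc \<omega> m n" using 1(1) by blast+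
      from 1(2)[unfolded de_Morgan_disj] show ?case
      proof (elim conjE, goal_cases)
        case n: 1
        have RB: "\<exists>k<nat (range_len \<kappa> A C t - window_len C t). rise \<omega> (0 + int k) (ln (B * t)) (nat (window_len C t))" using n(7) by blast
        have RE: "\<exists>k<nat (range_len \<kappa> al C t - window_len C t). rise \<omega> (0 + int k) (ln (et * t)) (nat (window_len C t))" using n(8) by blast
        have pp: "3 / 4 * ln t \<le> h t" "ln 2 \<le> h t" "h t \<le> ln (et * t)" "3 / 4 * ln t < ln (\<theta> * t)" "2 \<le> \<epsilon> * t"
          using elim(18-20) by auto
        note G = good_conclusion[OF env kappa_pos kappa_less L(1) Ne t(3,4) pp(1,2) B et etB th(1) pp(3,4) n(1-6) RB RE n(9-16)
          eps(1,2) pp(5) g0 g l zeta x(1)]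
        show ?case using G(1) G(2) elim(22) by linarith
      qed
    qed
    then show ?case by (simp add: algebra_simps)
  qed
qed

text \<open>The integrand may fail to be measurable, and \<open>nn_integral\<close> is then a lower
  integral; so the lower bound is taken through the measurable sets \<open>G\<close>.\<close>

lemma tendsto_one:
  fixes f :: "real \<Rightarrow> (int \<Rightarrow> real) \<Rightarrow> ennreal"
  assumes le: "\<And>t \<omega>. f t \<omega> \<le> 1"
    and good: "\<And>x. 0 < x \<Longrightarrow> x \<le> 1 \<Longrightarrow> \<forall>\<^sub>F t in at_top. \<exists>G\<in>sets P. 1 - 16 * x \<le> measure P G \<and> (\<forall>\<omega>\<in>G. ennreal (1 - 10 * x) \<le> f t \<omega>)"
  shows "((\<lambda>t. \<integral>\<^sup>+\<omega>. f t \<omega> \<partial>P) \<longlongrightarrow> 1) at_top"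
proof (rule order_tendstoI)
  fix a :: ennreal assume "1 < a"
  have "(\<integral>\<^sup>+\<omega>. f t \<omega> \<partial>P) \<le> (\<integral>\<^sup>+\<omega>. 1 \<partial>P)" for t by (intro nn_integral_mono le)
  then have "(\<integral>\<^sup>+\<omega>. f t \<omega> \<partial>P) \<le> 1" for t using P.emeasure_space_1 by simp
  then show "\<forall>\<^sub>F t in at_top. (\<integral>\<^sup>+\<omega>. f t \<omega> \<partial>P) < a" using \<open>1 < a\<close> by (intro always_eventually) (meson le_less_trans)
next
  fix a :: ennreal assume a: "a < 1"
  then obtain r where r: "a = ennreal r" "0 \<le> r" "r < 1"
    by (cases a) (auto simp: ennreal_less_one_iff)
  \<comment> \<open>Twice 26: the loss \<open>10 * x + 16 * x\<close> is then half of
    \<open>1 - r\<close>.\<close>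
  define x where "x = (1 - r) / 52"
  have x: "0 < x" "x \<le> 1 / 52" using r by (auto simp: x_def)
  have ge: "r < (1 - 10 * x) * (1 - 16 * x)"
  proof -
    have "52 * x = 1 - r" by (simp add: x_def)
    then have "r < 1 - 26 * x" using r(3) by linarith
    also have "\<dots> \<le> 1 - 26 * x + 160 * x\<^sup>2" by simp
    also have "\<dots> = (1 - 10 * x) * (1 - 16 * x)" by (simp add: algebra_simps power2_eq_square)
    finally show ?thesis .
  qed
  show "\<forall>\<^sub>F t in at_top. a < (\<integral>\<^sup>+\<omega>. f t \<omega> \<partial>P)"
    using good[of x]
  proof (rule eventually_mono)
    fix t assume "\<exists>G\<in>sets P. 1 - 16 * x \<le> measure P G \<and> (\<forall>\<omega>\<in>G. ennreal (1 - 10 * x) \<le> f t \<omega>)"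
    then obtain G where G: "G \<in> sets P" "1 - 16 * x \<le> measure P G" "\<And>\<omega>. \<omega> \<in> G \<Longrightarrow> ennreal (1 - 10 * x) \<le> f t \<omega>" by blast
    have "a < ennreal ((1 - 10 * x) * (1 - 16 * x))" using r ge by (simp add: ennreal_less_iff)
    also have "\<dots> = ennreal (1 - 10 * x) * ennreal (1 - 16 * x)" using x by (intro ennreal_mult) auto
    also have "\<dots> \<le> ennreal (1 - 10 * x) * emeasure P G"
      using G by (intro mult_left_mono) (auto simp: P.emeasure_eq_measure intro!: ennreal_leI)
    also have "\<dots> = (\<integral>\<^sup>+\<omega>. ennreal (1 - 10 * x) * indicator G \<omega> \<partial>P)" using G by (simp add: nn_integral_cmult_indicator)
    also have "\<dots> \<le> (\<integral>\<^sup>+\<omega>. f t \<omega> \<partial>P)" using G by (intro nn_integral_mono) (auto simp: indicator_def)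
    finally show "a < (\<integral>\<^sup>+\<omega>. f t \<omega> \<partial>P)" .
  qed (use x in auto)
qed

end

theorem theorem2:
  fixes \<mu> :: "real measure" and \<kappa> :: real
  assumes "prob_space \<mu>" and "sets \<mu> = sets borel"
    and "AE x in \<mu>. 0 < x \<and> x < 1"
    and "0 < \<kappa>" and "\<kappa> < 1"
    and "integrable \<mu> (\<lambda>x. ((1 - x) / x) powr \<kappa>)"
    and "(\<integral>x. ((1 - x) / x) powr \<kappa> \<partial>\<mu>) = 1"
    and "integrable \<mu> (\<lambda>x. ((1 - x) / x) powr \<kappa> * max 0 (ln ((1 - x) / x)))"
    and "\<not> (\<exists>c l. 0 < l \<and> (AE x in \<mu>. \<exists>k::int. ln ((1 - x) / x) = c + l * of_int k))"
  shows "(\<forall>\<eta>>0. ((\<lambda>t. \<integral>\<^sup>+\<omega>. ennreal (measure_pmf.prob (walk \<omega> (steps t))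
              {p. \<bar>real_of_int (p ! steps t - b \<omega> t (ell \<omega> t p))\<bar> \<le> \<eta> * ln t}) \<partial>Penv \<mu>)
            \<longlongrightarrow> 1) at_top)
       \<and> (\<forall>\<delta>>0. ((\<lambda>t. \<integral>\<^sup>+\<omega>. indicator {\<omega>. dTV (law_ell \<omega> t) (law_ellE \<omega> \<kappa> t) \<le> \<delta>} \<omega> \<partial>Penv \<mu>)
            \<longlongrightarrow> 1) at_top)"
proof -
  interpret rwre_env \<mu> \<kappa> using assms by (rule rwre_env.intro)
  show ?thesis
  proof (intro conjI allI impI)
    fix \<eta> :: real assume eta: "0 < \<eta>"
    show "((\<lambda>t. \<integral>\<^sup>+\<omega>. ennreal (measure_pmf.prob (walk \<omega> (steps t))
              {p. \<bar>real_of_int (p ! steps t - b \<omega> t (ell \<omega> t p))\<bar> \<le> \<eta> * ln t}) \<partial>P) \<longlongrightarrow> 1) at_top"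
    proof (rule tendsto_one)
      fix x :: real assume x: "0 < x" "x \<le> 1"
      show "\<forall>\<^sub>F t in at_top. \<exists>G\<in>sets P. 1 - 16 * x \<le> measure P G \<and> (\<forall>\<omega>\<in>G. ennreal (1 - 10 * x) \<le> ennreal (measure_pmf.prob (walk \<omega> (steps t))
              {p. \<bar>real_of_int (p ! steps t - b \<omega> t (ell \<omega> t p))\<bar> \<le> \<eta> * ln t}))"
        using eventually_good[OF x eta] by (rule eventually_mono) (meson ennreal_leI)
    qed simp
  next
    fix \<delta> :: real assume d: "0 < \<delta>"
    show "((\<lambda>t. \<integral>\<^sup>+\<omega>. indicator {\<omega>. dTV (law_ell \<omega> t) (law_ellE \<omega> \<kappa> t) \<le> \<delta>} \<omega> \<partial>P) \<longlongrightarrow> 1) at_top"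
    proof (rule tendsto_one)
      fix x :: real assume x: "0 < x" "x \<le> 1"
      \<comment> \<open>\<open>eventually_good\<close> yields the distance bound
        \<open>9 * y\<close>, which has to stay below \<open>\<delta>\<close>.\<close>
      define y where "y = min x (\<delta> / 9)"
      have y: "0 < y" "y \<le> 1" "y \<le> x" "9 * y \<le> \<delta>" using x d by (auto simp: y_def)
      show "\<forall>\<^sub>F t in at_top. \<exists>G\<in>sets P. 1 - 16 * x \<le> measure P G \<and> (\<forall>\<omega>\<in>G. ennreal (1 - 10 * x) \<le> indicator {\<omega>. dTV (law_ell \<omega> t) (law_ellE \<omega> \<kappa> t) \<le> \<delta>} \<omega>)"
        using eventually_good[OF y(1,2) zero_less_one]
      proof (rule eventually_mono)
        fix t
        assume "\<exists>G\<in>sets P. 1 - 16 * y \<le> measure P G \<and> (\<forall>\<omega>\<in>G. dTV (law_ell \<omega> t) (law_ellE \<omega> \<kappa> t) \<le> 9 * y \<and>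
          1 - 10 * y \<le> measure_pmf.prob (walk \<omega> (steps t)) {p. \<bar>real_of_int (p ! steps t - b \<omega> t (ell \<omega> t p))\<bar> \<le> 1 * ln t})"
        then obtain G where G: "G \<in> sets P" "1 - 16 * y \<le> measure P G" "\<And>\<omega>. \<omega> \<in> G \<Longrightarrow> dTV (law_ell \<omega> t) (law_ellE \<omega> \<kappa> t) \<le> 9 * y" by blast
        have "ennreal (1 - 10 * x) \<le> indicator {\<omega>. dTV (law_ell \<omega> t) (law_ellE \<omega> \<kappa> t) \<le> \<delta>} \<omega>" if "\<omega> \<in> G" for \<omega>
          using G(3)[OF that] y x by (simp add: indicator_def)
        moreover have "1 - 16 * x \<le> measure P G" using G y by linarith
        ultimately show "\<exists>G\<in>sets P. 1 - 16 * x \<le> measure P G \<and> (\<forall>\<omega>\<in>G. ennreal (1 - 10 * x) \<le> indicator {\<omega>. dTV (law_ell \<omega> t) (law_ellE \<omega> \<kappa> t) \<le> \<delta>} \<omega>)"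
          using G(1) by blast
      qed
    qed (simp add: indicator_def)
  qed
qed

end
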